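(* There is a constant $M$ such that for all integers $p,q$ with $q\ne0$ and $\max(|p|,|q|)>M$, $$\left|\zeta_2(5)-\frac pq\right|_2>\frac1{\max(|p|,|q|)^{20}}.$$
   Context: $|\cdot|_2$ is the standard $2$-adic absolute value. $\zeta_2(5)\in\mathbf{Q}_2$ is the $2$-adic zeta value: writing $\zeta^*(s)=(1-2^{-s})\zeta(s)$, the values $\zeta^*(1+2m)$ for negative integers $m$ are rational, and $\zeta_2(5)=\lim\zeta^*(1+2m)$ as $m$ runs through negative integers converging $2$-adically to $2$ (the $2$-adic interpolation of Kubota–Leopoldt). Equivalently, $\zeta_2(5)$ is the unique $2$-adic number for which $\frac{\zeta_2(5)}2+\sum_{n\ge1}\bigl(\sum_{d\mid n,\,2\nmid d}d^{-5}\bigr)q^n$ is the $q$-expansion of an overconvergent $2$-adic modular form of level $\Gamma_0(2)$ and weight $-4$. *)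

theory Defs
  imports "HOL-Complex_Analysis.Complex_Analysis"
begin

section \<open>The 2-adic absolute value on the rationals\<close>

definition abs2 :: "rat \<Rightarrow> real" where
  "abs2 r = (if r = 0 then 0 else
     2 powi (int (multiplicity 2 (snd (quotient_of r))) - int (multiplicity 2 (fst (quotient_of r)))))"

lemma prime_elem_2_int: "prime_elem (2::int)"
  by (simp add: prime_imp_prime_elem)

lemma abs2_frac:
  assumes "a \<noteq> 0" "b \<noteq> 0"
  shows "abs2 (of_int a / of_int b) = 2 powi (int (multiplicity 2 b) - int (multiplicity 2 a))"
proof -
  define r :: rat where "r = of_int a / of_int b"
  obtain c d where cd: "quotient_of r = (c, d)" by (cases "quotient_of r")
  have d: "d > 0" using quotient_of_denom_pos[OF cd] .
  have r0: "r \<noteq> 0" using assms by (simp add: r_def)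
  have eq: "r = of_int c / of_int d" using quotient_of_div[OF cd] .
  have c: "c \<noteq> 0" using r0 eq by auto
  have "(of_int (a * d) :: rat) = of_int (c * b)"
    using eq d assms by (simp add: r_def field_simps)
  hence "a * d = c * b" by (simp only: of_int_eq_iff)
  hence "multiplicity 2 (a * d) = multiplicity 2 (c * b)" by simp
  hence "multiplicity 2 a + multiplicity 2 d = multiplicity 2 c + multiplicity 2 b"
    using prime_elem_multiplicity_mult_distrib[OF prime_elem_2_int] assms c d by simp
  hence "int (multiplicity 2 d) - int (multiplicity 2 c) = int (multiplicity 2 b) - int (multiplicity 2 a)"
    by linarith
  thus ?thesis using r0 by (simp add: abs2_def cd flip: r_def)
qed

lemma rat_fracE:
  fixes r :: rat
  obtains a b where "r = of_int a / of_int b" "b \<noteq> 0"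
proof -
  obtain c d where cd: "quotient_of r = (c, d)" by (cases "quotient_of r")
  show ?thesis using that[of c d] quotient_of_div[OF cd] quotient_of_denom_pos[OF cd] by simp
qed

lemma abs2_0 [simp]: "abs2 0 = 0"
  by (simp add: abs2_def)

lemma abs2_pos: "r \<noteq> 0 \<Longrightarrow> abs2 r > 0"
  by (simp add: abs2_def)

lemma abs2_nonneg [simp]: "abs2 r \<ge> 0"
  using abs2_pos[of r] by (cases "r = 0") auto

lemma abs2_eq_0_iff [simp]: "abs2 r = 0 \<longleftrightarrow> r = 0"
  using abs2_pos[of r] by (cases "r = 0") auto

lemma abs2_1 [simp]: "abs2 1 = 1"
  by (simp add: abs2_def)

lemma abs2_2: "abs2 2 = 1 / 2"
  using abs2_frac[of 2 1] by (simp add: power_int_minus)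

lemma abs2_mult: "abs2 (r * s) = abs2 r * abs2 s"
proof (cases "r = 0 \<or> s = 0")
  case False
  obtain a b where r: "r = of_int a / of_int b" "b \<noteq> 0" by (rule rat_fracE)
  obtain c d where s: "s = of_int c / of_int d" "d \<noteq> 0" by (rule rat_fracE)
  have ac: "a \<noteq> 0" "c \<noteq> 0" using False r s by auto
  have rs: "r * s = of_int (a * c) / of_int (b * d)" using r s by simp
  show ?thesis
    unfolding rs unfolding r(1) s(1)
    using ac r(2) s(2)
    by (simp add: abs2_frac prime_elem_multiplicity_mult_distrib[OF prime_elem_2_int] add_diff_add
        flip: power_int_add del: of_int_mult)
qed auto

lemma abs2_minus [simp]: "abs2 (- r) = abs2 r"
proof -
  have "abs2 (-1) = 1" using abs2_frac[of "-1" 1] by (simp add: not_dvd_imp_multiplicity_0)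
  thus ?thesis using abs2_mult[of "-1" r] by simp
qed

lemma abs2_minus_commute: "abs2 (r - s) = abs2 (s - r)"
  using abs2_minus[of "r - s"] by simp

lemma abs2_inverse: "abs2 (inverse r) = inverse (abs2 r)"
proof (cases "r = 0")
  case False
  hence "abs2 r * abs2 (inverse r) = 1" by (simp flip: abs2_mult)
  thus ?thesis by (metis inverse_unique)
qed auto

lemma abs2_ultra: "abs2 (r + s) \<le> max (abs2 r) (abs2 s)"
proof (cases "r = 0 \<or> s = 0 \<or> r + s = 0")
  case True
  thus ?thesis by (auto simp: le_max_iff_disj)
next
  case False
  obtain a b where r: "r = of_int a / of_int b" "b \<noteq> 0" by (rule rat_fracE)
  obtain c d where s: "s = of_int c / of_int d" "d \<noteq> 0" by (rule rat_fracE)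
  have r': "r = of_int (a * d) / of_int (b * d)" using r s by simp
  have s': "s = of_int (c * b) / of_int (b * d)" using r s by simp
  have rs: "r + s = of_int (a * d + c * b) / of_int (b * d)"
    unfolding r' s' by (simp add: add_divide_distrib)
  have nz: "a * d \<noteq> 0" "c * b \<noteq> 0" "b * d \<noteq> 0" "a * d + c * b \<noteq> 0"
    using False r(2) s(2) r' s' rs by (auto simp del: of_int_mult of_int_add)
  define k where "k = min (multiplicity 2 (a * d)) (multiplicity 2 (c * b))"
  have "2 ^ k dvd a * d + c * b"
    by (intro dvd_add multiplicity_dvd') (auto simp: k_def)
  hence k: "k \<le> multiplicity 2 (a * d + c * b)"
    using nz by (intro multiplicity_geI) auto
  have e: "abs2 r = 2 powi (int (multiplicity 2 (b * d)) - int (multiplicity 2 (a * d)))"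
    "abs2 s = 2 powi (int (multiplicity 2 (b * d)) - int (multiplicity 2 (c * b)))"
    "abs2 (r + s) = 2 powi (int (multiplicity 2 (b * d)) - int (multiplicity 2 (a * d + c * b)))"
    unfolding rs unfolding r' s' using nz by (intro abs2_frac; simp)+
  show ?thesis
    unfolding e le_max_iff_disj using k
    by (auto simp: k_def min_def split: if_splits intro!: power_int_increasing)
qed

lemma abs2_ultra_less: "abs2 r < e \<Longrightarrow> abs2 s < e \<Longrightarrow> abs2 (r + s) < e"
  using abs2_ultra[of r s] by auto

lemma abs2_triangle: "abs2 (r + s) \<le> abs2 r + abs2 s"
  using abs2_ultra[of r s] abs2_nonneg[of r] abs2_nonneg[of s] by linarith

lemma abs2_triangle3: "\<bar>abs2 r - abs2 s\<bar> \<le> abs2 (r - s)"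
  using abs2_triangle[of "r - s" s] abs2_triangle[of "s - r" r] abs2_minus_commute[of r s]
  by simp


section \<open>The field of 2-adic numbers as the completion of the rationals\<close>

definition cauchy2 :: "(nat \<Rightarrow> rat) \<Rightarrow> bool" where
  "cauchy2 X \<longleftrightarrow> (\<forall>e>0. \<exists>N. \<forall>m\<ge>N. \<forall>n\<ge>N. abs2 (X m - X n) < e)"

definition null2 :: "(nat \<Rightarrow> rat) \<Rightarrow> bool" where
  "null2 X \<longleftrightarrow> (\<forall>e>0. \<exists>N. \<forall>n\<ge>N. abs2 (X n) < e)"

lemma null2_iff_tendsto: "null2 X \<longleftrightarrow> (\<lambda>n. abs2 (X n)) \<longlonglongrightarrow> 0"
  by (simp add: null2_def LIMSEQ_iff)

lemma null2_const [simp]: "null2 (\<lambda>_. c) \<longleftrightarrow> c = 0"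
  by (simp add: null2_iff_tendsto LIMSEQ_const_iff)

lemma null2_eventually_0: "(\<And>n. n \<ge> N \<Longrightarrow> X n = 0) \<Longrightarrow> null2 X"
  unfolding null2_def by (metis abs2_0)

lemma null2_minus: "null2 X \<Longrightarrow> null2 (\<lambda>n. - X n)"
  by (simp add: null2_def)

lemma null2_add:
  assumes "null2 X" "null2 Y"
  shows "null2 (\<lambda>n. X n + Y n)"
  unfolding null2_def
proof (intro allI impI)
  fix e :: real assume "e > 0"
  then obtain M N where "\<forall>n\<ge>M. abs2 (X n) < e" "\<forall>n\<ge>N. abs2 (Y n) < e"
    using assms unfolding null2_def by metis
  hence "\<forall>n\<ge>max M N. abs2 (X n + Y n) < e" by (auto intro: abs2_ultra_less)
  thus "\<exists>N. \<forall>n\<ge>N. abs2 (X n + Y n) < e" ..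
qed

lemma cauchy2_const [simp]: "cauchy2 (\<lambda>_. c)"
  by (simp add: cauchy2_def)

lemma cauchy2_minus: "cauchy2 X \<Longrightarrow> cauchy2 (\<lambda>n. - X n)"
  by (simp add: cauchy2_def abs2_minus_commute)

lemma cauchy2_add:
  assumes "cauchy2 X" "cauchy2 Y"
  shows "cauchy2 (\<lambda>n. X n + Y n)"
  unfolding cauchy2_def
proof (intro allI impI)
  fix e :: real assume "e > 0"
  then obtain M N where MN: "\<forall>m\<ge>M. \<forall>n\<ge>M. abs2 (X m - X n) < e" "\<forall>m\<ge>N. \<forall>n\<ge>N. abs2 (Y m - Y n) < e"
    using assms unfolding cauchy2_def by metis
  have "abs2 ((X m + Y m) - (X n + Y n)) < e" if "m \<ge> max M N" "n \<ge> max M N" for m n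
    using abs2_ultra_less[of "X m - X n" e "Y m - Y n"] MN that by (simp add: add_diff_add)
  thus "\<exists>N. \<forall>m\<ge>N. \<forall>n\<ge>N. abs2 ((X m + Y m) - (X n + Y n)) < e" by blast
qed

lemma cauchy2_imp_convergent:
  assumes "cauchy2 X"
  shows "convergent (\<lambda>n. abs2 (X n))"
proof -
  have "Cauchy (\<lambda>n. abs2 (X n))"
    unfolding Cauchy_def dist_real_def
    using assms unfolding cauchy2_def by (meson abs2_triangle3 le_less_trans)
  thus ?thesis by (simp add: Cauchy_convergent_iff)
qed

lemma cauchy2_bounded:
  assumes "cauchy2 X"
  obtains B where "B > 0" "\<And>n. abs2 (X n) \<le> B"
proof -
  have "Bseq (\<lambda>n. abs2 (X n))"
    using cauchy2_imp_convergent[OF assms] by (rule convergent_imp_Bseq)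
  thus ?thesis using that by (auto simp: Bseq_def)
qed

lemma null2_mult_bounded:
  assumes "null2 X" "cauchy2 Y"
  shows "null2 (\<lambda>n. X n * Y n)"
proof -
  have "convergent (\<lambda>n. abs2 (Y n))" using assms by (intro cauchy2_imp_convergent)
  then obtain l where "(\<lambda>n. abs2 (Y n)) \<longlonglongrightarrow> l" by (auto simp: convergent_def)
  from tendsto_mult[OF assms(1)[unfolded null2_iff_tendsto] this] show ?thesis
    by (simp add: null2_iff_tendsto abs2_mult)
qed

lemma cauchy2_mult:
  assumes X: "cauchy2 X" and Y: "cauchy2 Y"
  shows "cauchy2 (\<lambda>n. X n * Y n)"
  unfolding cauchy2_def
proof (intro allI impI)
  fix e :: real assume e: "e > 0"
  obtain A where A: "A > 0" "\<And>n. abs2 (X n) \<le> A" using cauchy2_bounded[OF X] by metis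
  obtain B where B: "B > 0" "\<And>n. abs2 (Y n) \<le> B" using cauchy2_bounded[OF Y] by metis
  have "e / A > 0" "e / B > 0" using A B e by auto
  then obtain M N where MN: "\<forall>m\<ge>M. \<forall>n\<ge>M. abs2 (X m - X n) < e / B"
    "\<forall>m\<ge>N. \<forall>n\<ge>N. abs2 (Y m - Y n) < e / A"
    using assms unfolding cauchy2_def by metis
  have "abs2 (X m * Y m - X n * Y n) < e" if mn: "m \<ge> max M N" "n \<ge> max M N" for m n
  proof -
    have "abs2 (X m) * abs2 (Y m - Y n) \<le> A * abs2 (Y m - Y n)"
      using A by (intro mult_right_mono) auto
    also have "\<dots> < A * (e / A)" using MN mn A by (intro mult_strict_left_mono) auto
    finally have 1: "abs2 (X m * (Y m - Y n)) < e" using A by (simp add: abs2_mult)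
    have "abs2 (X m - X n) * abs2 (Y n) \<le> abs2 (X m - X n) * B"
      using B by (intro mult_left_mono) auto
    also have "\<dots> < e / B * B" using MN mn B by (intro mult_strict_right_mono) auto
    finally have 2: "abs2 ((X m - X n) * Y n) < e" using B by (simp add: abs2_mult)
    show ?thesis using abs2_ultra_less[OF 1 2] by (simp add: algebra_simps)
  qed
  thus "\<exists>N. \<forall>m\<ge>N. \<forall>n\<ge>N. abs2 (X m * Y m - X n * Y n) < e" by blast
qed

lemma cauchy2_not_null2:
  assumes "cauchy2 X" "\<not> null2 X"
  obtains c N where "c > 0" "\<And>n. n \<ge> N \<Longrightarrow> abs2 (X n) \<ge> c"
proof -
  obtain c where c: "c > 0" "\<forall>N. \<exists>n\<ge>N. abs2 (X n) \<ge> c"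
    using assms(2) unfolding null2_def by (meson linorder_not_less)
  obtain N where N: "\<forall>m\<ge>N. \<forall>n\<ge>N. abs2 (X m - X n) < c"
    using assms(1) c(1) unfolding cauchy2_def by metis
  obtain m where m: "m \<ge> N" "abs2 (X m) \<ge> c" using c(2) by blast
  have "abs2 (X n) \<ge> c" if "n \<ge> N" for n
    using abs2_ultra[of "X m - X n" "X n"] N m that by (force simp: max_def split: if_splits)
  thus ?thesis using that c(1) by blast
qed

lemma cauchy2_inverse:
  assumes X: "cauchy2 X" and nz: "\<not> null2 X"
  shows "cauchy2 (\<lambda>n. inverse (X n))"
  unfolding cauchy2_def
proof (intro allI impI)
  fix e :: real assume e: "e > 0"
  obtain c M where c: "c > 0" "\<And>n. n \<ge> M \<Longrightarrow> abs2 (X n) \<ge> c"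
    using cauchy2_not_null2[OF X nz] by blast
  have "e * (c * c) > 0" using c e by simp
  then obtain N where N: "\<forall>m\<ge>N. \<forall>n\<ge>N. abs2 (X m - X n) < e * (c * c)"
    using X unfolding cauchy2_def by metis
  have "abs2 (inverse (X m) - inverse (X n)) < e" if mn: "m \<ge> max M N" "n \<ge> max M N" for m n
  proof -
    have ge: "abs2 (X m) \<ge> c" "abs2 (X n) \<ge> c" using c(2) mn by auto
    hence "X m \<noteq> 0" "X n \<noteq> 0" using c(1) by auto
    hence "inverse (X m) - inverse (X n) = (X n - X m) * inverse (X m * X n)"
      by (simp add: field_simps)
    hence "abs2 (inverse (X m) - inverse (X n)) = abs2 (X n - X m) / (abs2 (X m) * abs2 (X n))"
      by (simp only: abs2_mult abs2_inverse divide_inverse)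
    also have "\<dots> \<le> abs2 (X n - X m) / (c * c)"
      using ge c(1) by (intro divide_left_mono mult_mono mult_pos_pos) auto
    also have "\<dots> < e" using N mn c(1) by (simp add: divide_less_eq)
    finally show ?thesis .
  qed
  thus "\<exists>N. \<forall>m\<ge>N. \<forall>n\<ge>N. abs2 (inverse (X m) - inverse (X n)) < e" by blast
qed

definition padic2_rel :: "(nat \<Rightarrow> rat) \<Rightarrow> (nat \<Rightarrow> rat) \<Rightarrow> bool" where
  "padic2_rel X Y \<longleftrightarrow> cauchy2 X \<and> cauchy2 Y \<and> null2 (\<lambda>n. X n - Y n)"

lemma padic2_rel_refl: "cauchy2 X \<Longrightarrow> padic2_rel X X"
  by (simp add: padic2_rel_def)

lemma padic2_rel_eqI: "cauchy2 X \<Longrightarrow> X = Y \<Longrightarrow> padic2_rel X Y"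
  by (simp add: padic2_rel_def)

lemma part_equivp_padic2_rel: "part_equivp padic2_rel"
proof (rule part_equivpI)
  show "\<exists>X. padic2_rel X X" using padic2_rel_refl[of "\<lambda>_. 0"] by auto
  show "symp padic2_rel"
    by (simp add: symp_def padic2_rel_def null2_def abs2_minus_commute)
  show "transp padic2_rel"
    unfolding transp_def padic2_rel_def
    using null2_add by fastforce
qed

lemma null2_cong:
  assumes "padic2_rel X Y"
  shows "null2 X \<longleftrightarrow> null2 Y"
proof -
  have d: "null2 (\<lambda>n. X n - Y n)" using assms by (simp add: padic2_rel_def)
  show ?thesis
    using null2_add[OF d, of Y] null2_add[OF null2_minus[OF d], of X] by auto
qed

quotient_type padic2 = "nat \<Rightarrow> rat" / partial: padic2_rel
  by (rule part_equivp_padic2_rel)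

instantiation padic2 :: field
begin

lift_definition zero_padic2 :: padic2 is "\<lambda>_. 0"
  by (rule padic2_rel_refl) simp

lift_definition one_padic2 :: padic2 is "\<lambda>_. 1"
  by (rule padic2_rel_refl) simp

lift_definition plus_padic2 :: "padic2 \<Rightarrow> padic2 \<Rightarrow> padic2" is "\<lambda>X Y n. X n + Y n"
  unfolding padic2_rel_def add_diff_add by (auto intro: cauchy2_add null2_add)

lift_definition uminus_padic2 :: "padic2 \<Rightarrow> padic2" is "\<lambda>X n. - X n"
  by (auto simp: padic2_rel_def null2_def abs2_minus_commute intro: cauchy2_minus)

lift_definition times_padic2 :: "padic2 \<Rightarrow> padic2 \<Rightarrow> padic2" is "\<lambda>X Y n. X n * Y n"
proof -
  fix X X' Y Y' assume "padic2_rel X X'" "padic2_rel Y Y'"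
  hence c: "cauchy2 X" "cauchy2 X'" "cauchy2 Y" "cauchy2 Y'"
    and n: "null2 (\<lambda>n. X n - X' n)" "null2 (\<lambda>n. Y n - Y' n)"
    by (auto simp: padic2_rel_def)
  have "null2 (\<lambda>n. (X n - X' n) * Y n + (Y n - Y' n) * X' n)"
    using c n by (intro null2_add null2_mult_bounded)
  hence "null2 (\<lambda>n. X n * Y n - X' n * Y' n)" by (simp add: algebra_simps)
  thus "padic2_rel (\<lambda>n. X n * Y n) (\<lambda>n. X' n * Y' n)"
    using c by (simp add: padic2_rel_def cauchy2_mult)
qed

lift_definition inverse_padic2 :: "padic2 \<Rightarrow> padic2"
  is "\<lambda>X. if null2 X then (\<lambda>_. 0) else (\<lambda>n. inverse (X n))"
proof -
  fix X Y assume XY: "padic2_rel X Y"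
  hence c: "cauchy2 X" "cauchy2 Y" and n: "null2 (\<lambda>n. X n - Y n)"
    by (auto simp: padic2_rel_def)
  show "padic2_rel (if null2 X then (\<lambda>_. 0) else (\<lambda>n. inverse (X n)))
          (if null2 Y then (\<lambda>_. 0) else (\<lambda>n. inverse (Y n)))"
  proof (cases "null2 X")
    case True
    thus ?thesis using null2_cong[OF XY] by (simp add: padic2_rel_refl)
  next
    case False
    hence nz: "\<not> null2 X" "\<not> null2 Y" using null2_cong[OF XY] by auto
    obtain a M where a: "a > 0" "\<And>n. n \<ge> M \<Longrightarrow> abs2 (X n) \<ge> a"
      using cauchy2_not_null2[OF c(1) nz(1)] by blast
    obtain b N where b: "b > 0" "\<And>n. n \<ge> N \<Longrightarrow> abs2 (Y n) \<ge> b"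
      using cauchy2_not_null2[OF c(2) nz(2)] by blast
    have "cauchy2 (\<lambda>n. - (inverse (X n) * inverse (Y n)))"
      using c nz by (intro cauchy2_mult cauchy2_minus cauchy2_inverse)
    from null2_mult_bounded[OF n this]
    have 1: "null2 (\<lambda>n. (X n - Y n) * - (inverse (X n) * inverse (Y n)))" .
    have 2: "null2 (\<lambda>n. (inverse (X n) - inverse (Y n)) - (X n - Y n) * - (inverse (X n) * inverse (Y n)))"
    proof (rule null2_eventually_0)
      fix n assume "n \<ge> max M N"
      hence "X n \<noteq> 0" "Y n \<noteq> 0" using a(1) b(1) a(2)[of n] b(2)[of n] by auto
      thus "inverse (X n) - inverse (Y n) - (X n - Y n) * - (inverse (X n) * inverse (Y n)) = 0"
        by (simp add: field_simps)
    qed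
    from null2_add[OF 2 1] have "null2 (\<lambda>n. inverse (X n) - inverse (Y n))" by simp
    thus ?thesis using nz c by (simp add: padic2_rel_def cauchy2_inverse)
  qed
qed

definition "x - y = x + - y" for x y :: padic2

definition "x div y = x * inverse y" for x y :: padic2

instance
proof
  fix a b c :: padic2
  show "a + b = b + a"
    by transfer (rule padic2_rel_eqI; auto simp: padic2_rel_def intro!: cauchy2_add)
  show "(a + b) + c = a + (b + c)"
    by transfer (rule padic2_rel_eqI; auto simp: padic2_rel_def intro!: cauchy2_add)
  show "0 + a = a"
    by transfer (rule padic2_rel_eqI; auto simp: padic2_rel_def)
  show "- a + a = 0"
    by transfer (rule padic2_rel_eqI; auto simp: padic2_rel_def)
  show "a - b = a + - b"
    by (rule minus_padic2_def)
  show "(a * b) * c = a * (b * c)"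
    by transfer (rule padic2_rel_eqI; auto simp: padic2_rel_def mult.assoc intro!: cauchy2_mult)
  show "a * b = b * a"
    by transfer (rule padic2_rel_eqI; auto simp: padic2_rel_def mult.commute intro!: cauchy2_mult)
  show "1 * a = a"
    by transfer (rule padic2_rel_eqI; auto simp: padic2_rel_def)
  show "(a + b) * c = a * c + b * c"
    by transfer (rule padic2_rel_eqI;
        auto simp: padic2_rel_def distrib_right intro!: cauchy2_add cauchy2_mult)
  show "(0::padic2) \<noteq> 1"
    by transfer (simp add: padic2_rel_def)
  show "a \<noteq> 0 \<Longrightarrow> inverse a * a = 1"
  proof (transfer, goal_cases)
    case (1 X)
    hence X: "cauchy2 X" "\<not> null2 X" by (auto simp: padic2_rel_def)
    obtain c N where c: "c > 0" "\<And>n. n \<ge> N \<Longrightarrow> abs2 (X n) \<ge> c"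
      using cauchy2_not_null2[OF X] by blast
    have "null2 (\<lambda>n. inverse (X n) * X n - 1)"
    proof (rule null2_eventually_0)
      fix n assume "n \<ge> N"
      hence "X n \<noteq> 0" using c(1) c(2)[of n] by auto
      thus "inverse (X n) * X n - 1 = 0" by simp
    qed
    thus ?case using X by (simp add: padic2_rel_def cauchy2_mult cauchy2_inverse)
  qed
  show "a div b = a * inverse b"
    by (rule divide_padic2_def)
  show "inverse (0::padic2) = 0"
    by transfer (simp add: padic2_rel_def)
qed

end

lemma of_nat_padic2_transfer: "pcr_padic2 (\<lambda>_. of_nat k) (of_nat k)"
proof (induction k)
  case 0
  show ?case using zero_padic2.transfer by simp
next
  case (Suc k)
  have "pcr_padic2 (\<lambda>n. 1 + of_nat k) (1 + of_nat k)"
    using plus_padic2.transfer one_padic2.transfer Suc unfolding rel_fun_def by blast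
  thus ?case by simp
qed

instance padic2 :: field_char_0
proof
  show "inj (of_nat :: nat \<Rightarrow> padic2)"
  proof (rule injI)
    fix a b assume eq: "(of_nat a :: padic2) = of_nat b"
    have "padic2_rel (\<lambda>_. of_nat a) (\<lambda>_. of_nat b)"
      using padic2.rel_eq_transfer of_nat_padic2_transfer[of a] of_nat_padic2_transfer[of b] eq
      unfolding rel_fun_def by blast
    thus "a = b" by (simp add: padic2_rel_def)
  qed
qed


text \<open>
  The standard 2-adic absolute value, normalised by $|2|_2 = 1/2$, extended by continuity. The
  library's \<^const>\<open>norm\<close> is not available, as it is restricted to real vector spaces.
\<close>

lift_definition norm2 :: "padic2 \<Rightarrow> real" is "\<lambda>X. lim (\<lambda>n. abs2 (X n))"
proof -
  fix X Y assume "padic2_rel X Y"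
  hence c: "cauchy2 X" "cauchy2 Y" and n: "null2 (\<lambda>n. X n - Y n)"
    by (auto simp: padic2_rel_def)
  obtain l where l: "(\<lambda>n. abs2 (X n)) \<longlonglongrightarrow> l"
    using cauchy2_imp_convergent[OF c(1)] by (auto simp: convergent_def)
  have "(\<lambda>n. abs2 (X n) - abs2 (Y n)) \<longlonglongrightarrow> 0"
    using n unfolding null2_iff_tendsto
    by (rule Lim_null_comparison[rotated]) (simp add: abs2_triangle3)
  from tendsto_diff[OF l this] have "(\<lambda>n. abs2 (Y n)) \<longlonglongrightarrow> l" by simp
  with l show "lim (\<lambda>n. abs2 (X n)) = lim (\<lambda>n. abs2 (Y n))" by (simp add: limI)
qed

lemma cauchy2_LIMSEQ:
  assumes "cauchy2 X"
  shows "(\<lambda>n. abs2 (X n)) \<longlonglongrightarrow> lim (\<lambda>n. abs2 (X n))"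
  using cauchy2_imp_convergent[OF assms] by (simp add: convergent_LIMSEQ_iff)

lemma norm2_eq_0_iff [simp]: "norm2 (x :: padic2) = 0 \<longleftrightarrow> x = 0"
proof (transfer, goal_cases)
  case (1 X)
  hence X: "cauchy2 X" by (simp add: padic2_rel_def)
  have "lim (\<lambda>n. abs2 (X n)) = 0 \<longleftrightarrow> null2 X"
    unfolding null2_iff_tendsto using cauchy2_LIMSEQ[OF X] LIMSEQ_unique by metis
  thus ?case using X by (simp add: padic2_rel_def)
qed

lemma norm2_nonneg: "norm2 (x :: padic2) \<ge> 0"
proof (transfer, goal_cases)
  case (1 X)
  hence X: "cauchy2 X" by (simp add: padic2_rel_def)
  show ?case using cauchy2_LIMSEQ[OF X] by (rule LIMSEQ_le_const) auto
qed

lemma norm2_minus [simp]: "norm2 (- x :: padic2) = norm2 x"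
  by transfer simp

lemma norm2_mult: "norm2 (x * y :: padic2) = norm2 x * norm2 y"
proof (transfer, goal_cases)
  case (1 X Y)
  hence "cauchy2 X" "cauchy2 Y" by (auto simp: padic2_rel_def)
  from tendsto_mult[OF this[THEN cauchy2_LIMSEQ]] show ?case
    by (simp add: abs2_mult limI)
qed

lemma norm2_ultra: "norm2 (x + y :: padic2) \<le> max (norm2 x) (norm2 y)"
proof (transfer, goal_cases)
  case (1 X Y)
  hence c: "cauchy2 X" "cauchy2 Y" by (auto simp: padic2_rel_def)
  show ?case
    using cauchy2_LIMSEQ[OF cauchy2_add[OF c]] tendsto_max[OF c[THEN cauchy2_LIMSEQ]]
    by (rule LIMSEQ_le) (auto intro: abs2_ultra)
qed

instantiation padic2 :: metric_space
begin

definition dist_padic2 :: "padic2 \<Rightarrow> padic2 \<Rightarrow> real"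
  where "dist_padic2 x y = norm2 (x - y)"

definition uniformity_padic2 :: "(padic2 \<times> padic2) filter"
  where "uniformity_padic2 = (INF e\<in>{0 <..}. principal {(x, y). dist x y < e})"

definition open_padic2 :: "padic2 set \<Rightarrow> bool"
  where "open_padic2 U \<longleftrightarrow> (\<forall>x\<in>U. eventually (\<lambda>(x', y). x' = x \<longrightarrow> y \<in> U) uniformity)"

instance
proof
  fix x y z :: padic2
  show "uniformity = (INF e\<in>{0 <..}. principal {(x, y :: padic2). dist x y < e})"
    by (rule uniformity_padic2_def)
  show "open U \<longleftrightarrow> (\<forall>x\<in>U. eventually (\<lambda>(x', y). x' = x \<longrightarrow> y \<in> U) uniformity)" for U :: "padic2 set"
    by (rule open_padic2_def)
  show "dist x y = 0 \<longleftrightarrow> x = y"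
    by (simp add: dist_padic2_def)
  have "norm2 (x - y) \<le> max (norm2 (x - z)) (norm2 (y - z))"
    using norm2_ultra[of "x - z" "- (y - z)"] unfolding norm2_minus by simp
  thus "dist x y \<le> dist x z + dist y z"
    using norm2_nonneg[of "x - z"] norm2_nonneg[of "y - z"]
    by (simp add: dist_padic2_def)
qed

end

lemma norm2_of_nat: "norm2 (of_nat k :: padic2) = abs2 (of_nat k)"
proof -
  have "rel_fun pcr_padic2 (=) (\<lambda>X. lim (\<lambda>n. abs2 (X n))) (norm2 :: padic2 \<Rightarrow> real)"
    by (rule norm2.transfer)
  from rel_funD[OF this, OF of_nat_padic2_transfer[of k]] show ?thesis by simp
qed

lemma norm2_of_int: "norm2 (of_int k :: padic2) = abs2 (of_int k)"
  by (cases k rule: int_cases2) (simp_all add: norm2_of_nat)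

lemma norm2_of_rat: "norm2 (of_rat r :: padic2) = abs2 r"
proof -
  obtain a b where r: "r = of_int a / of_int b" "b \<noteq> 0" by (rule rat_fracE)
  have "norm2 (of_rat r * of_int b :: padic2) = norm2 (of_int a :: padic2)"
    using r by (simp add: of_rat_divide)
  hence "norm2 (of_rat r :: padic2) * abs2 (of_int b) = abs2 (r * of_int b)"
    using r by (simp add: norm2_mult norm2_of_int)
  thus ?thesis using r(2) by (simp add: abs2_mult)
qed


section \<open>The 2-adic zeta value\<close>

text \<open>
  The Riemann zeta function, as the analytic continuation of the Dirichlet series. The value
  at the pole \<open>1\<close> is left unspecified.
\<close>

definition riemann_zeta :: "complex \<Rightarrow> complex" where
  "riemann_zeta = (SOME f. f holomorphic_on - {1} \<and>
     (\<forall>s. Re s > 1 \<longrightarrow> (\<lambda>n. of_nat (Suc n) powr (- s)) sums f s))"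

definition zeta_star :: "complex \<Rightarrow> complex" where
  "zeta_star s = (1 - 2 powr (- s)) * riemann_zeta s"

text \<open>
  For negative \<open>m\<close> the value of \<^const>\<open>zeta_star\<close> at \<open>1 + 2 m\<close> is rational; the following is that
  value as a rational number, so that it can be mapped to the 2-adic numbers.
\<close>

definition zeta_star_rat :: "int \<Rightarrow> rat" where
  "zeta_star_rat m = (THE r. of_rat r = zeta_star (of_int (1 + 2 * m)))"

definition neg_ints_to_2 :: "int filter" where
  "neg_ints_to_2 = inf (filtercomap (of_int :: int \<Rightarrow> padic2) (nhds 2)) (principal {m. m < 0})"

lemma eventually_neg_ints_to_2:
  "eventually P neg_ints_to_2 \<longleftrightarrow> (\<exists>e>0. \<forall>m<0. abs2 (of_int (m - 2)) < e \<longrightarrow> P m)"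
proof -
  have d: "dist (of_int m) (2 :: padic2) = abs2 (of_int (m - 2))" for m
    using norm2_of_int[of "m - 2"] by (simp add: dist_padic2_def)
  have "eventually P neg_ints_to_2 \<longleftrightarrow>
      (\<exists>Q. (\<exists>e>0. \<forall>x. dist x (2 :: padic2) < e \<longrightarrow> Q x) \<and> (\<forall>m. Q (of_int m) \<longrightarrow> m < 0 \<longrightarrow> P m))"
    unfolding neg_ints_to_2_def eventually_inf_principal eventually_filtercomap
      eventually_nhds_metric by simp
  also have "\<dots> \<longleftrightarrow> (\<exists>e>0. \<forall>m<0. dist (of_int m) (2 :: padic2) < e \<longrightarrow> P m)"
  proof
    assume "\<exists>e>0. \<forall>m<0. dist (of_int m) (2 :: padic2) < e \<longrightarrow> P m"
    then obtain e where "e > 0" "\<forall>m<0. dist (of_int m) (2 :: padic2) < e \<longrightarrow> P m" by blast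
    thus "\<exists>Q. (\<exists>e>0. \<forall>x. dist x (2 :: padic2) < e \<longrightarrow> Q x) \<and> (\<forall>m. Q (of_int m) \<longrightarrow> m < 0 \<longrightarrow> P m)"
      by (intro exI[of _ "\<lambda>x. dist x 2 < e"]) auto
  qed blast
  finally show ?thesis by (simp only: d)
qed

lemma neg_ints_to_2_neq_bot: "neg_ints_to_2 \<noteq> bot"
proof
  assume "neg_ints_to_2 = bot"
  then obtain e :: real where e: "e > 0" "\<And>m. m < 0 \<Longrightarrow> \<not> abs2 (of_int (m - 2)) < e"
    using eventually_neg_ints_to_2[of "\<lambda>_. False"] by auto
  obtain n where n: "(1 / 2 :: real) ^ n < e"
    using real_arch_pow_inv[OF e(1), of "1/2"] by auto
  have "abs2 (2 ^ k) = (1 / 2) ^ k" for k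
    by (induction k) (simp_all add: abs2_mult abs2_2)
  moreover have "(of_int (2 - 2 ^ (n + 2) - 2) :: rat) = - (2 ^ (n + 2))" by simp
  ultimately have "abs2 (of_int (2 - 2 ^ (n + 2) - 2)) = (1 / 2) ^ (n + 2)"
    by (simp only: abs2_minus)
  also have "\<dots> \<le> (1 / 2 :: real) ^ n" by (rule power_decreasing) auto
  finally have *: "abs2 (of_int (2 - 2 ^ (n + 2) - 2)) < e" using n by simp
  have "(2 :: int) ^ (n + 2) \<ge> 2 ^ 2" by (rule power_increasing) auto
  moreover have "(2 :: int) ^ 2 = 4" by simp
  ultimately have "(2 :: int) - 2 ^ (n + 2) < 0" by linarith
  from e(2)[OF this] * show False by blast
qed

definition zeta_2_5 :: padic2 where
  "zeta_2_5 = Lim neg_ints_to_2 (\<lambda>m. of_rat (zeta_star_rat m))"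

end

theory Submission
  imports Defs "HOL-Number_Theory.Prime_Powers" "HOL-Real_Asymp.Real_Asymp"
begin

text \<open>
  For \<open>k \<ge> 1\<close> let \<open>nu = 10 k\<close>, \<open>M = 9 k\<close> and \<open>R w = w * (r w)^4\<close>, where \<open>r\<close> is the rational function
  with simple poles at the integers \<open>j\<close>, \<open>|j| \<le> nu\<close>, zeros at the half-integers in \<open>(-M, M)\<close>, and residues
  that are integers. The averages \<open>4^(-N) * (\<Sum>t<2^N. R (t + 1/2))\<close> converge 2-adically to half of a linear form
  \<open>S = rho0 - 384 * rho3 * zeta_2_5\<close>: the partial fractions of \<open>R\<close> reduce them to averages of \<open>(2 t + 1)^(-3)\<close>,
  and these are identified with the zeta value by congruences, since the values of zeta at negative odd
  integers are, by Euler-Maclaurin summation, second-order coefficients of sums of odd powers. Written with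
  binomial coefficients, the same averages show that \<open>|S|\<close> is an explicit power of 2, about \<open>2^(-304 k)\<close>.

  The denominators of \<open>rho0\<close> and \<open>rho3\<close> divide the sixth power of \<open>lcm(1..20 k)\<close>. A prime \<open>q > 2 k\<close> occurs with
  one power less, because the residues cancel in pairs under an involution of the poles in a residue class
  modulo \<open>q\<close>, and with five powers less if \<open>q\<close> divides an integer in \<open>(18 k, 20 k]\<close>. By the prime number theorem
  (Newman's proof, applied to the Dirichlet series of \<open>psi n / n - 1\<close>) the common denominator is at most
  \<open>exp (79.9 k)\<close>, and one gets integers \<open>P, Q\<close> of size \<open>exp (199 k)\<close> with \<open>|P - Q * zeta_2_5|\<close> about \<open>2^(-304 k)\<close>,
  where \<open>304 * ln 2 > 210\<close>. Given \<open>p / q\<close> of height \<open>H\<close>, choose \<open>k\<close> near \<open>ln H / 11\<close>: if \<open>P q - Q p \<noteq> 0\<close>, its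
  2-adic absolute value, at least the inverse of its size, dominates; if it vanishes, then
  \<open>|zeta_2_5 - p / q| \<ge> |P - Q * zeta_2_5|\<close>, which is bounded below as well.
\<close>

section \<open>Sums of fourth powers of binomial coefficients\<close>

text \<open>The shape \<open>w * r^4\<close> isolates one zeta value. Because of the factor
  \<open>4^(-N)\<close> the averages see second-order coefficients in \<open>2^N\<close>, so a pole
  of order \<open>i\<close> contributes the average of \<open>(t + 1/2)^(-i)\<close> and boundary
  terms that are second derivatives. \<open>R\<close> is odd, so the coefficients of even order sum
  to 0; \<open>R\<close> decays at least like \<open>w^(-3)\<close>, so those of order 1 do as well;
  only order 3 survives. As the zeros of \<open>r\<close> become zeros of order 4, the second
  derivative of \<open>R\<close> vanishes there, which brings \<open>rho0\<close> into a form
  symmetric enough for the cancellation modulo \<open>q\<close>.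

  Exponents tending 2-adically to -3 are unbounded integers, so the congruences for power sums have
  to be uniform in the exponent. Nonvanishing of the linear forms, the other usual obstacle, comes
  from an exact absolute value: an odd factor survives every halving of the binomial sums.

  The gap between \<open>304 * ln 2\<close>, about 210.7, and 199 leaves \<open>exp (11 k)\<close>
  for \<open>H\<close>. With \<open>H\<close> near \<open>exp (11 k)\<close> the two cases lead to
  the exponents \<open>1 + 199 / 11\<close> and \<open>304 * ln 2 / 11\<close>, both below
  20.\<close>

fun digit_sum2 :: "nat => nat" where
 "digit_sum2 n = (if n = 0 then 0 else n mod 2 + digit_sum2 (n div 2))"

declare digit_sum2.simps [simp del]

lemma digit_sum2_0 [simp]: "digit_sum2 0 = 0"
 by (simp add: digit_sum2.simps)

lemma digit_sum2_double: "digit_sum2 (2 * n) = digit_sum2 n"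
 by (cases "n = 0") (simp_all add: digit_sum2.simps[of "2 * n"])

lemma digit_sum2_Suc_double: "digit_sum2 (2 * n + 1) = Suc (digit_sum2 n)"
 by (simp add: digit_sum2.simps[of "Suc (2 * n)"])

lemma digit_sum2_Suc_le: "digit_sum2 (Suc n) \<le> Suc (digit_sum2 n)"
proof (induction n rule: less_induct)
 case (less n)
 show ?case
 proof (cases "even n")
  case True
  then obtain k where "n = 2 * k" by (elim evenE)
  thus ?thesis using digit_sum2_Suc_double[of k] by (simp add: digit_sum2_double)
 next
  case False
  then obtain k where k: "n = 2 * k + 1" by (elim oddE)
  have "digit_sum2 (Suc n) = digit_sum2 (Suc k)"
   using digit_sum2_double[of "Suc k"] k by simp
  thus ?thesis using less.IH[of k] k digit_sum2_Suc_double[of k] by simp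
 qed
qed

lemma power_digit_sum2_le: "2 ^ digit_sum2 n \<le> n + 1"
proof (induction n rule: less_induct)
 case (less n)
 show ?case
 proof (cases "even n")
  case True
  then obtain k where k: "n = 2 * k" by (elim evenE)
  show ?thesis
  proof (cases "k = 0")
   case False
   hence "2 ^ digit_sum2 k \<le> k + 1" using less.IH[of k] k by simp
   thus ?thesis using k by (simp add: digit_sum2_double)
  qed (use k in simp)
 next
  case False
  then obtain k where k: "n = 2 * k + 1" by (elim oddE)
  have "2 ^ digit_sum2 k \<le> k + 1" using less.IH[of k] k by simp
  thus ?thesis using k digit_sum2_Suc_double[of k] by simp
 qed
qed

text \<open>Legendre's formula for the prime 2: the valuation of \<open>n!\<close> is
  \<open>n\<close> minus the binary digit sum. It is written with an odd cofactor so that it can be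
  carried over to the rationals. The induction rests on \<open>(2 k)! = 2^k k!\<close> times an odd
  double factorial.\<close>

lemma fact_2adic: "\<exists>z::int. odd z \<and> 2 ^ digit_sum2 n * fact n = 2 ^ n * z"
proof (induction n rule: less_induct)
 case (less n)
 have dbl: "\<exists>z::int. odd z \<and> fact (2 * k) = 2 ^ k * fact k * z" for k
 proof (induction k)
  case (Suc k)
  then obtain z :: int where z: "odd z" "fact (2 * k) = 2 ^ k * fact k * z" by blast
  have "(fact (2 * Suc k) :: int) = (2 * int k + 2) * ((2 * int k + 1) * fact (2 * k))"
   by (simp add: algebra_simps)
  also have "... = 2 ^ Suc k * fact (Suc k) * ((2 * int k + 1) * z)"
   unfolding z(2) by (simp add: algebra_simps)
  finally show ?case using z(1) by (intro exI[of _ "(2 * int k + 1) * z"]) simp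
 qed (auto intro: exI[of _ 1])
 show ?case
 proof (cases "n = 0")
  case False
  define k where "k = n div 2"
  have "k < n" using False by (simp add: k_def)
  from less.IH[OF this] obtain z :: int where z: "odd z" "2 ^ digit_sum2 k * fact k = 2 ^ k * z"
   by blast
  obtain y :: int where y: "odd y" "fact (2 * k) = 2 ^ k * fact k * y" using dbl by blast
  show ?thesis
  proof (cases "even n")
   case True
   hence n: "n = 2 * k" by (simp add: k_def)
   have "2 ^ digit_sum2 n * (fact n :: int) = 2 ^ k * y * (2 ^ digit_sum2 k * fact k)"
    unfolding n y(2) digit_sum2_double by (simp add: algebra_simps)
   also have "... = 2 ^ n * (y * z)" unfolding z(2) n mult_2 power_add by simp
   finally show ?thesis using y z by (intro exI[of _ "y * z"]) simp
  next
   case False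
   hence n: "n = 2 * k + 1" by (simp add: k_def odd_two_times_div_two_succ)
   have "2 ^ digit_sum2 n * (fact n :: int) = 2 * 2 ^ k * y * (2 * int k + 1) * (2 ^ digit_sum2 k * fact k)"
    unfolding n digit_sum2_Suc_double using y(2) by (simp add: algebra_simps)
   also have "... = 2 ^ n * (y * (2 * int k + 1) * z)"
    unfolding z(2) n mult_2 power_add by simp
   finally show ?thesis using y z by (intro exI[of _ "y * (2 * int k + 1) * z"]) simp
  qed
 qed (auto intro: exI[of _ 1])
qed

section \<open>Parity splittings of integer polynomials and binomial coefficients\<close>

lemma poly_cong_mod:
 fixes e :: "int poly"
 shows "m dvd a - b ==> m dvd poly e a - poly e b"
proof (induction e)
 case (pCons c p)
 have "poly (pCons c p) a - poly (pCons c p) b = (a - b) * poly p a + b * (poly p a - poly p b)"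
  by (simp add: algebra_simps)
 thus ?case using pCons by (metis dvd_add dvd_mult dvd_mult2)
qed simp

lemma poly_even_odd_split:
 fixes q :: "int poly"
 shows "\<exists>A B. \<forall>x. poly q x = poly A (x\<^sup>2) + x * poly B (x\<^sup>2)"
proof (induction q)
 case 0
 show ?case by (intro exI[of _ 0]) simp
next
 case (pCons a q)
 then obtain A B where "\<forall>x. poly q x = poly A (x\<^sup>2) + x * poly B (x\<^sup>2)" by blast
 thus ?case
  by (intro exI[of _ "pCons a B"] exI[of _ A]) (simp add: algebra_simps power2_eq_square)
qed

text \<open>\<open>(2 s + 1)^2 = 1 + 4 s + 4 s^2\<close>, so every odd power of \<open>s\<close>
  that appears carries a factor 4.\<close>

lemma poly_odd_square_split:
 fixes e :: "int poly"
 shows "\<exists>E0 E1. \<forall>s. poly e ((2 * s + 1)\<^sup>2) = poly E0 (s\<^sup>2) + 4 * s * poly E1 (s\<^sup>2)"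
proof (induction e)
 case 0
 show ?case by (intro exI[of _ 0]) simp
next
 case (pCons a e)
 then obtain E0 E1 where E: "\<forall>s. poly e ((2 * s + 1)\<^sup>2) = poly E0 (s\<^sup>2) + 4 * s * poly E1 (s\<^sup>2)" by blast
 have "poly (pCons a e) ((2 * s + 1)\<^sup>2) = poly ([:a:] + [:1, 4:] * E0 + [:0, 16:] * E1) (s\<^sup>2)
   + 4 * s * poly (E0 + [:1, 4:] * E1) (s\<^sup>2)" for s
  using E[rule_format, of s] by (simp add: algebra_simps power2_eq_square)
 thus ?case by blast
qed

lemma sum_lessThan_double:
 fixes f :: "nat => 'a::comm_monoid_add"
 shows "(\<Sum>x<2 * n. f x) = (\<Sum>b<n. f (2 * b) + f (2 * b + 1))"
 by (induction n) (simp_all add: algebra_simps)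

text \<open>The shifts \<open>n - 1 - 2 i\<close> are symmetric about 0, so reversing the index in
  one of the two factors replaces \<open>s + shift\<close> by \<open>s - shift\<close>. This makes
  the square a polynomial in \<open>s^2\<close>.\<close>

lemma prod_symmetric_square:
 fixes s c :: int
 shows "(\<Prod>i<n. s + (int n - 1 - 2 * int i))\<^sup>2 = (\<Prod>i<n. s\<^sup>2 - (int n - 1 - 2 * int i)\<^sup>2)"
proof -
 have "(\<Prod>i<n. s + (int n - 1 - 2 * int i)) = (\<Prod>i<n. s + (int n - 1 - 2 * int (n - Suc i)))"
  by (rule prod.nat_diff_reindex[symmetric])
 also have "... = (\<Prod>i<n. s - (int n - 1 - 2 * int i))"
  by (intro prod.cong refl) (auto simp: of_nat_diff)
 finally have "(\<Prod>i<n. s + (int n - 1 - 2 * int i))\<^sup>2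
   = (\<Prod>i<n. s + (int n - 1 - 2 * int i)) * (\<Prod>i<n. s - (int n - 1 - 2 * int i))"
  by (simp add: power2_eq_square)
 also have "... = (\<Prod>i<n. s\<^sup>2 - (int n - 1 - 2 * int i)\<^sup>2)"
  unfolding prod.distrib[symmetric] by (intro prod.cong) (auto simp: power2_eq_square algebra_simps)
 finally show ?thesis .
qed

lemma choose_Suc_int: "int (Suc k) * int (n choose Suc k) = (int n - int k) * int (n choose k)"
proof (cases "k \<le> n")
 case True
 have "Suc k * (n choose Suc k) = (n - k) * (n choose k)"
  by (simp only: binomial_absorption binomial_absorb_comp)
 hence "int (Suc k * (n choose Suc k)) = int ((n - k) * (n choose k))" by simp
 thus ?thesis using True by (simp only: of_nat_mult of_nat_diff)
qed (simp add: binomial_eq_0)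

text \<open>Numerator and denominator of \<open>C(2 b, 2 k)\<close> split into even and odd factors.
  The even ones make up \<open>C(b, k)\<close>, the odd ones the two products. Halving both
  arguments thus costs only a polynomial in \<open>b\<close> and a 2-adic unit.\<close>

lemma choose_double_double:
 "int (2 * b choose (2 * k)) * (\<Prod>i<k. 2 * int i + 1) = int (b choose k) * (\<Prod>i<k. 2 * int b - 1 - 2 * int i)"
proof (induction k)
 case (Suc k)
 define P Q where "P = (\<Prod>i<k. 2 * int i + 1)" and "Q = (\<Prod>i<k. 2 * int b - 1 - 2 * int i)"
 have 1: "int (Suc (Suc (2 * k))) * int (2 * b choose Suc (Suc (2 * k)))
   = (2 * int b - 2 * int k - 1) * int (2 * b choose Suc (2 * k))"
  using choose_Suc_int[of "Suc (2 * k)" "2 * b"] by (simp add: algebra_simps)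
 have 2: "int (Suc (2 * k)) * int (2 * b choose Suc (2 * k)) = (2 * int b - 2 * int k) * int (2 * b choose (2 * k))"
  using choose_Suc_int[of "2 * k" "2 * b"] by simp
 have 3: "int (Suc k) * int (b choose Suc k) = (int b - int k) * int (b choose k)"
  by (rule choose_Suc_int)
 have IH: "int (2 * b choose (2 * k)) * P = int (b choose k) * Q" using Suc.IH by (simp add: P_def Q_def)
 define c2 c1 c0 d1 d0 where "c2 = int (2 * b choose Suc (Suc (2 * k)))" and "c1 = int (2 * b choose Suc (2 * k))"
  and "c0 = int (2 * b choose (2 * k))" and "d1 = int (b choose Suc k)" and "d0 = int (b choose k)"
 have "(2 * int k + 2) * c2 = (2 * int b - 2 * int k - 1) * c1" "(2 * int k + 1) * c1 = (2 * int b - 2 * int k) * c0"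
  "(int k + 1) * d1 = (int b - int k) * d0" "c0 * P = d0 * Q"
  using 1 2 3 IH by (simp_all add: c2_def c1_def c0_def d1_def d0_def algebra_simps)
 hence "(2 * (int k + 1)) * (c2 * (P * (2 * int k + 1))) = (2 * (int k + 1)) * (d1 * (Q * (2 * int b - 1 - 2 * int k)))"
  by algebra
 hence "c2 * (P * (2 * int k + 1)) = d1 * (Q * (2 * int b - 1 - 2 * int k))"
  by (subst (asm) mult_cancel_left) auto
 thus ?case by (simp add: c2_def d1_def P_def Q_def)
qed simp

lemma choose_Suc_double:
 "int (2 * b + 1 choose (2 * k)) * (\<Prod>i<k. 2 * int i + 1) = int (b choose k) * (\<Prod>i<k. 2 * int b + 1 - 2 * int i)"
proof -
 have 0: "int (2 * b + 1 choose (2 * k)) * (2 * int b + 1 - 2 * int k) = (2 * int b + 1) * int (2 * b choose (2 * k))"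
 proof (cases "k \<le> b")
  case True
  have "(2 * b + 1 choose (2 * k)) * (2 * b + 1 - 2 * k) = (2 * b + 1) * (2 * b choose (2 * k))"
   using binomial_absorb_comp[of "2 * b + 1" "2 * k"] by (simp add: mult.commute)
  hence "int ((2 * b + 1 choose (2 * k)) * (2 * b + 1 - 2 * k)) = int ((2 * b + 1) * (2 * b choose (2 * k)))"
   by simp
  moreover have "int (2 * b + 1 - 2 * k) = 2 * int b + 1 - 2 * int k" using True by simp
  ultimately show ?thesis by (simp only: of_nat_mult) simp
 qed (simp add: binomial_eq_0)
 have tel: "(2 * int b + 1 - 2 * int k) * (\<Prod>i<k. 2 * int b + 1 - 2 * int i)
   = (2 * int b + 1) * (\<Prod>i<k. 2 * int b - 1 - 2 * int i)"
 proof (induction k)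
  case (Suc k)
  have "(2 * int b + 1 - 2 * int (Suc k)) * (\<Prod>i<Suc k. 2 * int b + 1 - 2 * int i)
   = (2 * int b - 1 - 2 * int k) * ((2 * int b + 1 - 2 * int k) * (\<Prod>i<k. 2 * int b + 1 - 2 * int i))"
   by (simp add: algebra_simps)
  also have "... = (2 * int b + 1) * (\<Prod>i<Suc k. 2 * int b - 1 - 2 * int i)"
   unfolding Suc by (simp add: algebra_simps)
  finally show ?case .
 qed simp
 have nz: "2 * int b + 1 - 2 * int k \<noteq> 0" by presburger
 have "(2 * int b + 1 - 2 * int k) * (int (2 * b + 1 choose (2 * k)) * (\<Prod>i<k. 2 * int i + 1))
   = (2 * int b + 1 - 2 * int k) * (int (b choose k) * (\<Prod>i<k. 2 * int b + 1 - 2 * int i))"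
  using 0 tel choose_double_double[of b k] by algebra
 thus ?thesis using nz by (subst (asm) mult_cancel_left) auto
qed

text \<open>Put \<open>tau = 2 x + 1 - m\<close>. As a polynomial, \<open>C(x, m)\<close> is
  invariant up to sign under \<open>x -> m - 1 - x\<close>, that is \<open>tau -> - tau\<close>, so
  the summand is an odd polynomial in \<open>tau\<close>. The parameter \<open>e\<close> absorbs the
  polynomial factors created by each halving of \<open>m\<close>.\<close>

definition binom4_sum :: "nat => nat => int poly => int" where
 "binom4_sum N m e = (\<Sum>x<2 ^ N. int (x choose m) ^ 4 * (2 * int x + 1 - int m) * poly e ((2 * int x + 1 - int m)\<^sup>2))"

text \<open>The terms \<open>x = 2 b\<close> and \<open>x = 2 b + 1\<close> are mirror images under
  \<open>s -> - s\<close> with \<open>s = 2 b + 1 - k\<close>, so together they are twice the odd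
  part of one polynomial in \<open>s\<close>. That odd part is itself even: \<open>2 s + 1\<close>
  contributes 2, the argument of \<open>e\<close> and the fourth power of \<open>U\<close>
  contribute 4 each. Hence the factor 4, and only the contribution of \<open>2 s\<close> decides the
  parity of \<open>e'\<close>.\<close>

lemma binom4_sum_even:
 fixes e :: "int poly"
 shows "\<exists>e'. (\<Prod>i<k. 2 * int i + 1) ^ 4 * binom4_sum (Suc N) (2 * k) e = 4 * binom4_sum N k e' \<and>
  (odd (poly e 1) \<longrightarrow> odd (poly e' (of_bool (even k))))"
proof -
 define P where "P = (\<Prod>i<k. 2 * int i + 1)"
 define U where "U s = (\<Prod>i<k. s + int k - 2 * int i)" for s :: int
 obtain E0 E1 where E: "\<And>s. poly e ((2 * s + 1)\<^sup>2) = poly E0 (s\<^sup>2) + 4 * s * poly E1 (s\<^sup>2)"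
  using poly_odd_square_split by blast
 have "U s = poly (\<Prod>i<k. [:int k - 2 * int i, 1:]) s" for s
  by (simp add: U_def poly_prod algebra_simps)
 then obtain A B where U: "\<And>s. U s = poly A (s\<^sup>2) + s * poly B (s\<^sup>2)"
  using poly_even_odd_split by metis
 define X :: "int poly" where "X = [:0, 1:]"
 \<comment> \<open>\<open>(A + s B)^4 = P0 + 4 s P1\<close>, with all polynomials evaluated at
   \<open>s^2\<close>: it is the exponent 4 that makes the odd part divisible by 4.\<close>
 define P0 where "P0 = A ^ 4 + 6 * X * A\<^sup>2 * B\<^sup>2 + X\<^sup>2 * B ^ 4"
 define P1 where "P1 = A * B * (A\<^sup>2 + X * B\<^sup>2)"
 define e' where "e' = (E0 * P0 + 16 * X * E1 * P1) + 2 * (E0 * P1 + E1 * P0)"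
 have key: "(2 * s - 1) * poly e ((2 * s - 1)\<^sup>2) * U (- s) ^ 4 + (2 * s + 1) * poly e ((2 * s + 1)\<^sup>2) * U s ^ 4
   = 4 * s * poly e' (s\<^sup>2)" for s
 proof -
  have m: "poly e ((2 * s - 1)\<^sup>2) = poly E0 (s\<^sup>2) - 4 * s * poly E1 (s\<^sup>2)"
   using E[of "- s"] by (simp add: power2_eq_square algebra_simps)
  have um: "U (- s) = poly A (s\<^sup>2) - s * poly B (s\<^sup>2)" using U[of "- s"] by simp
  define a b c d where "a = poly A (s\<^sup>2)" and "b = poly B (s\<^sup>2)" and "c = poly E0 (s\<^sup>2)" and "d = poly E1 (s\<^sup>2)"
  have e': "poly e' (s\<^sup>2) = (c * (a ^ 4 + 6 * s\<^sup>2 * a\<^sup>2 * b\<^sup>2 + (s\<^sup>2)\<^sup>2 * b ^ 4) + 16 * s\<^sup>2 * d * (a * b * (a\<^sup>2 + s\<^sup>2 * b\<^sup>2)))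
    + 2 * (c * (a * b * (a\<^sup>2 + s\<^sup>2 * b\<^sup>2)) + d * (a ^ 4 + 6 * s\<^sup>2 * a\<^sup>2 * b\<^sup>2 + (s\<^sup>2)\<^sup>2 * b ^ 4))"
   by (simp add: e'_def P0_def P1_def X_def a_def b_def c_def d_def algebra_simps)
  show ?thesis unfolding m um E[of s] U[of s] e' unfolding a_def[symmetric] b_def[symmetric] c_def[symmetric] d_def[symmetric]
   by algebra
 qed
 have Um: "U (- s) ^ 4 = (\<Prod>i<k. s + int k - 2 - 2 * int i) ^ 4" for s
 proof -
  have "(\<Prod>i<k. s + int k - 2 - 2 * int i) = (\<Prod>i<k. s + int k - 2 - 2 * int (k - Suc i))"
   by (rule prod.nat_diff_reindex[symmetric])
  also have "... = (\<Prod>i<k. (-1) * (- s + int k - 2 * int i))"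
   by (intro prod.cong refl) (auto simp: of_nat_diff)
  also have "... = (-1) ^ k * U (- s)" unfolding U_def by (simp only: prod.distrib) simp
  finally show ?thesis by (simp add: power_mult_distrib flip: power_mult)
 qed
 let ?L = "\<lambda>b. (int (2 * b choose (2 * k)) * P) ^ 4 * (2 * int (2 * b) + 1 - 2 * int k) * poly e ((2 * int (2 * b) + 1 - 2 * int k)\<^sup>2)
   + (int (2 * b + 1 choose (2 * k)) * P) ^ 4 * (2 * int (2 * b + 1) + 1 - 2 * int k) * poly e ((2 * int (2 * b + 1) + 1 - 2 * int k)\<^sup>2)"
 have "P ^ 4 * binom4_sum (Suc N) (2 * k) e = (\<Sum>b<2 ^ N.
   ?L b)"
  unfolding binom4_sum_def power_Suc sum_lessThan_double sum_distrib_left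
  by (intro sum.cong refl) (simp add: algebra_simps)
 also have "... = (\<Sum>b<2 ^ N. 4 * (int (b choose k) ^ 4 * (2 * int b + 1 - int k) * poly e' ((2 * int b + 1 - int k)\<^sup>2)))"
 proof (intro sum.cong refl)
  fix b :: nat
  define s where "s = 2 * int b + 1 - int k"
  have 1: "(int (2 * b choose (2 * k)) * P) ^ 4 = int (b choose k) ^ 4 * U (- s) ^ 4"
   unfolding Um P_def choose_double_double s_def by (simp add: power_mult_distrib algebra_simps)
  have 2: "(int (2 * b + 1 choose (2 * k)) * P) ^ 4 = int (b choose k) ^ 4 * U s ^ 4"
   unfolding U_def P_def choose_Suc_double s_def by (simp add: power_mult_distrib algebra_simps)
  have 3: "2 * int (2 * b) + 1 - 2 * int k = 2 * s - 1" "2 * int (2 * b + 1) + 1 - 2 * int k = 2 * s + 1"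
   by (simp_all add: s_def)
  have "int (b choose k) ^ 4 * U (- s) ^ 4 * (2 * s - 1) * poly e ((2 * s - 1)\<^sup>2)
   + int (b choose k) ^ 4 * U s ^ 4 * (2 * s + 1) * poly e ((2 * s + 1)\<^sup>2)
   = int (b choose k) ^ 4 * ((2 * s - 1) * poly e ((2 * s - 1)\<^sup>2) * U (- s) ^ 4 + (2 * s + 1) * poly e ((2 * s + 1)\<^sup>2) * U s ^ 4)"
   by (simp add: algebra_simps)
  thus "?L b
   = 4 * (int (b choose k) ^ 4 * (2 * int b + 1 - int k) * poly e' ((2 * int b + 1 - int k)\<^sup>2))"
   unfolding 1 2 3 key s_def[symmetric] by simp
 qed
 also have "... = 4 * binom4_sum N k e'" by (simp add: binom4_sum_def sum_distrib_left)
 finally have main: "P ^ 4 * binom4_sum (Suc N) (2 * k) e = 4 * binom4_sum N k e'" .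
 have par: "odd (poly e' (of_bool (even k)))" if odd: "odd (poly e 1)"
 proof -
  define s :: int where "s = of_bool (even k)"
  have s2: "s\<^sup>2 = s" by (simp add: s_def)
  have "2 dvd (2 * s + 1)\<^sup>2 - 1" by (simp add: power2_eq_square algebra_simps)
  from poly_cong_mod[OF this, of e] odd have "odd (poly e ((2 * s + 1)\<^sup>2))" by simp
  hence E0: "odd (poly E0 s)" using E[of s] by (simp add: s2)
  have "odd (U s)" unfolding U_def by (rule ccontr) (auto simp: even_prod_iff s_def)
  hence "odd (poly A s + s * poly B s)" using U[of s] by (simp add: s2)
  \<comment> \<open>Modulo 2, \<open>P0\<close> is \<open>A^4 + s^2 B^4\<close>, which has the
    parity of \<open>A + s B\<close>.\<close>
  hence "odd (poly P0 s)" by (auto simp: P0_def X_def)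
  thus ?thesis using E0 unfolding s_def[symmetric] e'_def by simp
 qed
 from main[unfolded P_def] par show ?thesis by blast
qed

text \<open>For odd \<open>m\<close> the two parities of \<open>x\<close> play different roles:
  \<open>x = 2 b + 1\<close> leads back to \<open>C(b, k)\<close>, whereas \<open>x = 2 b\<close>
  produces \<open>(b - k) C(b, k) = (k + 1) C(b, k + 1)\<close>. The latter comes with
  \<open>2^4\<close> from this factor and another 2 from \<open>tau\<close>, so that 2-adically it
  only perturbs the former.\<close>

lemma binom4_sum_odd:
 fixes e :: "int poly"
 shows "\<exists>e1 e2. ((2 * int k + 1) * (\<Prod>i<k. 2 * int i + 1)) ^ 4 * binom4_sum (Suc N) (2 * k + 1) e
    = 2 * binom4_sum N k e1 + 32 * (int k + 1) ^ 4 * binom4_sum N (Suc k) e2 \<and>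
  (odd (poly e 0) \<longrightarrow> odd (poly e1 (of_bool (even k))))"
proof -
 define P where "P = (\<Prod>i<k. 2 * int i + 1)"
 define e1 where "e1 = pcompose e [:0, 4:] * (\<Prod>i<Suc k. [:- (int k - 2 * int i)\<^sup>2, 1:])\<^sup>2"
 define e2 where "e2 = pcompose e [:0, 4:] * (\<Prod>i<k. [:- (int k - 1 - 2 * int i)\<^sup>2, 1:])\<^sup>2"
 have e1: "poly e1 (s\<^sup>2) = poly e (4 * s\<^sup>2) * (\<Prod>i<Suc k. s + (int k - 2 * int i)) ^ 4" for s
 proof -
  have "(\<Prod>i<Suc k. s + (int k - 2 * int i)) ^ 4 = ((\<Prod>i<Suc k. s + (int (Suc k) - 1 - 2 * int i))\<^sup>2)\<^sup>2"
   by (simp flip: power_mult)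
  also have "... = (\<Prod>i<Suc k. s\<^sup>2 - (int k - 2 * int i)\<^sup>2)\<^sup>2"
   unfolding prod_symmetric_square by simp
  finally show ?thesis unfolding e1_def by (simp add: poly_pcompose poly_prod mult.commute del: prod.lessThan_Suc)
 qed
 have e2: "poly e2 (s\<^sup>2) = poly e (4 * s\<^sup>2) * (\<Prod>i<k. s + (int k - 1 - 2 * int i)) ^ 4" for s
 proof -
  have "(\<Prod>i<k. s + (int k - 1 - 2 * int i)) ^ 4 = ((\<Prod>i<k. s + (int k - 1 - 2 * int i))\<^sup>2)\<^sup>2"
   by (simp flip: power_mult)
  also have "... = (\<Prod>i<k. s\<^sup>2 - (int k - 1 - 2 * int i)\<^sup>2)\<^sup>2"
   unfolding prod_symmetric_square by simp
  finally show ?thesis unfolding e2_def by (simp add: poly_pcompose poly_prod mult.commute)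
 qed
 define Q where "Q = (2 * int k + 1) * P"
 let ?L = "\<lambda>b. (Q * int (2 * b choose (2 * k + 1))) ^ 4 * (2 * (2 * int b - int k)) * poly e (4 * (2 * int b - int k)\<^sup>2)
   + (Q * int (2 * b + 1 choose (2 * k + 1))) ^ 4 * (2 * (2 * int b + 1 - int k)) * poly e (4 * (2 * int b + 1 - int k)\<^sup>2)"
  and ?R = "\<lambda>b. 32 * (int k + 1) ^ 4 * (int (b choose Suc k) ^ 4 * (2 * int b + 1 - int (Suc k)) * poly e2 ((2 * int b + 1 - int (Suc k))\<^sup>2))
   + 2 * (int (b choose k) ^ 4 * (2 * int b + 1 - int k) * poly e1 ((2 * int b + 1 - int k)\<^sup>2))"
 have "Q ^ 4 * binom4_sum (Suc N) (2 * k + 1) e = (\<Sum>b<2 ^ N.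
   ?L b)"
  unfolding binom4_sum_def power_Suc[of 2] sum_lessThan_double sum_distrib_left
 proof (intro sum.cong refl)
  fix b :: nat
  have w: "2 * int (2 * b) + 1 - int (2 * k + 1) = 2 * (2 * int b - int k)"
   "2 * int (2 * b + 1) + 1 - int (2 * k + 1) = 2 * (2 * int b + 1 - int k)" by simp_all
  have f: "(2 * x)\<^sup>2 = 4 * x\<^sup>2" for x :: int by (simp add: power2_eq_square)
  show "Q ^ 4 * (int (2 * b choose (2 * k + 1)) ^ 4 * (2 * int (2 * b) + 1 - int (2 * k + 1)) * poly e ((2 * int (2 * b) + 1 - int (2 * k + 1))\<^sup>2)
    + int (2 * b + 1 choose (2 * k + 1)) ^ 4 * (2 * int (2 * b + 1) + 1 - int (2 * k + 1)) * poly e ((2 * int (2 * b + 1) + 1 - int (2 * k + 1))\<^sup>2))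
   = ?L b"
   unfolding w f by (simp only: power_mult_distrib distrib_left mult_ac)
 qed
 also have "... = (\<Sum>b<2 ^ N. ?R b)"
 proof (intro sum.cong refl)
  fix b :: nat
  have c1: "(2 * int k + 1) * int (2 * b + 1 choose (2 * k + 1)) = (2 * int b + 1) * int (2 * b choose (2 * k))"
  proof -
   have "int (Suc (2 * k)) * int (Suc (2 * b) choose Suc (2 * k)) = int (Suc (2 * b)) * int (2 * b choose (2 * k))"
    by (metis Suc_times_binomial of_nat_mult)
   thus ?thesis by (simp del: binomial_Suc_Suc add: add.commute)
  qed
  have c2: "(2 * int k + 1) * int (2 * b choose (2 * k + 1)) = (2 * int b - 2 * int k) * int (2 * b choose (2 * k))"
   "(int k + 1) * int (b choose Suc k) = (int b - int k) * int (b choose k)"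
   using choose_Suc_int[of "2 * k" "2 * b"] choose_Suc_int[of k b] by (simp_all add: algebra_simps)
  have c3: "int (2 * b choose (2 * k)) * P = int (b choose k) * (\<Prod>i<k. 2 * int b - 1 - 2 * int i)"
   unfolding P_def by (rule choose_double_double)
  have "Q * int (2 * b + 1 choose (2 * k + 1)) = int (b choose k) * (\<Prod>i<Suc k. 2 * int b + 1 - 2 * int i)"
   unfolding Q_def prod.lessThan_Suc_shift using c1 c3 by (simp add: algebra_simps) algebra
  also have "(\<Prod>i<Suc k. 2 * int b + 1 - 2 * int i) = (\<Prod>i<Suc k. (2 * int b + 1 - int k) + (int k - 2 * int i))"
   by (intro prod.cong refl) simp
  finally have 1: "Q * int (2 * b + 1 choose (2 * k + 1)) = int (b choose k) * (\<Prod>i<Suc k. (2 * int b + 1 - int k) + (int k - 2 * int i))" .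
  have "Q * int (2 * b choose (2 * k + 1)) = 2 * ((int k + 1) * int (b choose Suc k)) * (\<Prod>i<k. 2 * int b - 1 - 2 * int i)"
   unfolding Q_def using c2 c3 by algebra
  also have "(\<Prod>i<k. 2 * int b - 1 - 2 * int i) = (\<Prod>i<k. (2 * int b + 1 - int (Suc k)) + (int k - 1 - 2 * int i))"
   by (intro prod.cong refl) simp
  finally have 2: "Q * int (2 * b choose (2 * k + 1)) = 2 * ((int k + 1) * int (b choose Suc k)) * (\<Prod>i<k. (2 * int b + 1 - int (Suc k)) + (int k - 1 - 2 * int i))" .
  show "?L b
   = ?R b"
  proof -
   have w: "2 * int b + 1 - int (Suc k) = 2 * int b - int k" by simp
   have "(2 * (c * d) * p) ^ 4 * (2 * x) * q + (g * r) ^ 4 * (2 * t) * u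
    = 32 * c ^ 4 * (d ^ 4 * x * (q * p ^ 4)) + 2 * (g ^ 4 * t * (u * r ^ 4))" for c d p x q g r t u :: int
    by (simp add: power_mult_distrib)
   thus ?thesis unfolding 1 2 e1 e2 w .
  qed
 qed
 also have "... = 2 * binom4_sum N k e1 + 32 * (int k + 1) ^ 4 * binom4_sum N (Suc k) e2"
  by (simp add: binom4_sum_def sum_distrib_left sum.distrib)
 finally have main: "Q ^ 4 * binom4_sum (Suc N) (2 * k + 1) e = 2 * binom4_sum N k e1 + 32 * (int k + 1) ^ 4 * binom4_sum N (Suc k) e2" .
 have par: "odd (poly e1 (of_bool (even k)))" if odd: "odd (poly e 0)"
 proof -
  define s :: int where "s = of_bool (even k)"
  have s2: "s\<^sup>2 = s" by (simp add: s_def)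
  have "2 dvd 4 * s\<^sup>2 - 0" by simp
  from poly_cong_mod[OF this, of e] odd have "odd (poly e (4 * s\<^sup>2))" by simp
  moreover have "odd (\<Prod>i<Suc k. s + (int k - 2 * int i))"
   by (rule ccontr) (auto simp: even_prod_iff s_def simp del: prod.lessThan_Suc)
  ultimately have "odd (poly e1 (s\<^sup>2))" unfolding e1 by simp
  thus ?thesis unfolding s2 by (simp add: s_def)
 qed
 from main[unfolded Q_def P_def] par show ?thesis by blast
qed

lemma odd_mult_eq_power2:
 fixes a b c :: int
 assumes "odd a" "a * b = 2 ^ n * c"
 obtains z where "b = 2 ^ n * z" "odd c \<longleftrightarrow> odd z"
proof -
 have "coprime (2 ^ n) a" using assms(1) by simp
 moreover have "2 ^ n dvd a * b" using assms(2) by simp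
 ultimately have "2 ^ n dvd b" using coprime_dvd_mult_right_iff by blast
 then obtain z where z: "b = 2 ^ n * z" by blast
 hence "2 ^ n * (a * z) = 2 ^ n * c" using assms(2) by (simp add: algebra_simps)
 hence "a * z = c" by simp
 thus ?thesis using that[OF z] assms(1) by auto
qed

text \<open>Each step halves \<open>m\<close> and lowers \<open>N\<close>. An even \<open>m\<close>
  keeps its digit sum and yields a factor 4; an odd \<open>m\<close> yields only 2 in its main term,
  and the missing 2 is the binary digit it loses. For \<open>m < 2^N\<close> the recursion ends at
  \<open>m = 0\<close>, \<open>N = 0\<close>, where the sum is \<open>poly e 1\<close>; the parity
  condition on \<open>e\<close> is handed down along the way.\<close>

theorem binom4_sum_valuation:
 "\<exists>z. 2 ^ digit_sum2 m * binom4_sum N m e = 2 ^ (2 * N) * z \<and>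
    (m < 2 ^ N \<longrightarrow> odd (poly e (of_bool (even m))) \<longrightarrow> odd z)"
proof (induction N arbitrary: m e)
 case 0
 show ?case by (cases "m = 0") (simp_all add: binom4_sum_def)
next
 case (Suc N)
 show ?case
 proof (cases "even m")
  case True
  then obtain k where m: "m = 2 * k" by (elim evenE)
  define P where "P = (\<Prod>i<k. 2 * int i + 1)"
  have "odd (P ^ 4)" by (auto simp: P_def even_prod_iff)
  obtain e' where e': "P ^ 4 * binom4_sum (Suc N) (2 * k) e = 4 * binom4_sum N k e'"
   "odd (poly e 1) ==> odd (poly e' (of_bool (even k)))"
   unfolding P_def using binom4_sum_even by blast
  obtain z where z: "2 ^ digit_sum2 k * binom4_sum N k e' = 2 ^ (2 * N) * z"
   "k < 2 ^ N ==> odd (poly e' (of_bool (even k))) ==> odd z"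
   using Suc.IH by blast
  have "P ^ 4 * (2 ^ digit_sum2 m * binom4_sum (Suc N) m e) = 4 * (2 ^ digit_sum2 k * binom4_sum N k e')"
   using e'(1) unfolding m digit_sum2_double by (simp add: algebra_simps)
  also have "... = 2 ^ (2 * Suc N) * z" unfolding z by simp
  finally obtain y where y: "2 ^ digit_sum2 m * binom4_sum (Suc N) m e = 2 ^ (2 * Suc N) * y" "odd z \<longleftrightarrow> odd y"
   by (rule odd_mult_eq_power2[OF \<open>odd (P ^ 4)\<close>])
  show ?thesis using y z(2) e'(2) m by (intro exI[of _ y]) auto
 next
  case False
  then obtain k where m: "m = 2 * k + 1" by (elim oddE)
  define Q where "Q = (2 * int k + 1) * (\<Prod>i<k. 2 * int i + 1)"
  have "odd (Q ^ 4)" by (auto simp: Q_def even_prod_iff)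
  obtain e1 e2 where e: "Q ^ 4 * binom4_sum (Suc N) (2 * k + 1) e
    = 2 * binom4_sum N k e1 + 32 * (int k + 1) ^ 4 * binom4_sum N (Suc k) e2"
   "odd (poly e 0) ==> odd (poly e1 (of_bool (even k)))"
   unfolding Q_def using binom4_sum_odd by blast
  obtain z where z: "2 ^ digit_sum2 k * binom4_sum N k e1 = 2 ^ (2 * N) * z"
   "k < 2 ^ N ==> odd (poly e1 (of_bool (even k))) ==> odd z"
   using Suc.IH by blast
  obtain y where y: "2 ^ digit_sum2 (Suc k) * binom4_sum N (Suc k) e2 = 2 ^ (2 * N) * y"
   using Suc.IH by blast
  \<comment> \<open>Passing from \<open>k\<close> to \<open>k + 1\<close> may raise the digit sum by
    one, but not more; the factor 32 has room for this.\<close>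
  define d where "d = Suc (digit_sum2 k) - digit_sum2 (Suc k)"
  have d: "Suc (digit_sum2 k) = d + digit_sum2 (Suc k)"
   using digit_sum2_Suc_le[of k] by (simp add: d_def)
  have "Q ^ 4 * (2 ^ digit_sum2 m * binom4_sum (Suc N) m e)
    = 2 ^ Suc (digit_sum2 k) * (Q ^ 4 * binom4_sum (Suc N) (2 * k + 1) e)"
   unfolding m digit_sum2_Suc_double by (simp add: algebra_simps)
  also have "... = 4 * (2 ^ digit_sum2 k * binom4_sum N k e1)
    + 32 * (int k + 1) ^ 4 * (2 ^ Suc (digit_sum2 k) * binom4_sum N (Suc k) e2)"
   unfolding e(1) by (simp add: algebra_simps)
  also have "2 ^ Suc (digit_sum2 k) * binom4_sum N (Suc k) e2 = 2 ^ d * (2 ^ digit_sum2 (Suc k) * binom4_sum N (Suc k) e2)"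
   unfolding d by (simp add: power_add)
  also have "4 * (2 ^ digit_sum2 k * binom4_sum N k e1) + 32 * (int k + 1) ^ 4 * (2 ^ d * (2 ^ digit_sum2 (Suc k) * binom4_sum N (Suc k) e2))
   = 2 ^ (2 * Suc N) * (z + 2 * (4 * (int k + 1) ^ 4 * 2 ^ d * y))"
   unfolding z y by (simp add: algebra_simps)
  finally obtain x where x: "2 ^ digit_sum2 m * binom4_sum (Suc N) m e = 2 ^ (2 * Suc N) * x"
   "odd (z + 2 * (4 * (int k + 1) ^ 4 * 2 ^ d * y)) \<longleftrightarrow> odd x"
   by (rule odd_mult_eq_power2[OF \<open>odd (Q ^ 4)\<close>])
  show ?thesis using x z(2) e(2) m by (intro exI[of _ x]) auto
 qed
qed

section \<open>The zeta function by Euler-Maclaurin summation\<close>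

text \<open>Weierstrass test with locally uniform majorants, for the Hurwitz series as well as for
  the Dirichlet series in the prime number theorem.\<close>

lemma holomorphic_series:
 fixes f :: "nat => complex => complex"
 assumes "open S" and hol: "\<And>n. f n holomorphic_on S"
  and bound: "\<And>x. x \<in> S ==> \<exists>d>0. \<exists>h. summable h \<and> (\<forall>\<^sub>F n in sequentially. \<forall>y\<in>ball x d \<inter> S. norm (f n y) \<le> h n)"
 shows "\<exists>g. g holomorphic_on S \<and> (\<forall>x\<in>S. (\<lambda>n. f n x) sums g x)"
proof -
 have 1: "f n field_differentiable at x" if "x \<in> S" for n x
  using hol[of n] that assms(1) by (simp add: holomorphic_on_imp_differentiable_at)
 have 2: "\<exists>d h. 0 < d \<and> summable h \<and> range h \<subseteq> \<real>\<^sub>\<ge>\<^sub>0 \<and> (\<forall>\<^sub>F n in sequentially. \<forall>y\<in>ball x d \<inter> S. cmod (f n y) \<le> cmod (h n))"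
  if x: "x \<in> S" for x
 proof -
  obtain d h where d: "d > 0" "summable h" "\<forall>\<^sub>F n in sequentially. \<forall>y\<in>ball x d \<inter> S. norm (f n y) \<le> h n"
   using bound[OF x] by blast
  have ev: "\<forall>\<^sub>F n in sequentially. h n \<ge> 0"
   using d(3)
  proof eventually_elim
   case (elim n)
   thus ?case using x d(1) norm_ge_zero[of "f n x"] by (meson IntI centre_in_ball order_trans)
  qed
  have ev2: "\<forall>\<^sub>F n in sequentially. norm (max 0 (h n)) \<le> h n"
   using ev by eventually_elim auto
  have "summable (\<lambda>n. max 0 (h n))"
   by (rule summable_comparison_test_ev[OF ev2 d(2)])
  hence "summable (\<lambda>n. complex_of_real (max 0 (h n)))" by (simp only: summable_complex_of_real)
  moreover have "range (\<lambda>n. complex_of_real (max 0 (h n))) \<subseteq> \<real>\<^sub>\<ge>\<^sub>0"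
   by (auto simp: nonneg_Reals_of_real_iff)
  moreover have "\<forall>\<^sub>F n in sequentially. \<forall>y\<in>ball x d \<inter> S. cmod (f n y) \<le> cmod (complex_of_real (max 0 (h n)))"
   using d(3) by eventually_elim force
  ultimately show ?thesis using d(1) by blast
 qed
 from series_differentiable_comparison_complex[OF assms(1) 1 2] obtain g where
  "\<forall>x\<in>S. (\<lambda>n. f n x) sums g x \<and> g field_differentiable at x" by blast
 thus ?thesis using field_differentiable_at_within
  by (intro exI[of _ g]) (auto simp: holomorphic_on_def)
qed

text \<open>\<open>em_s\<close> are the Taylor coefficients of \<open>sinh (x/2) / (x/2)\<close> in \<open>x^2\<close>, and \<open>em_b\<close> those of its inverse, which is
the operator of the midpoint Euler-Maclaurin formula.\<close>

definition em_s :: "nat => rat" where "em_s l = 1 / (4 ^ l * fact (2 * l + 1))"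

definition em_b :: "nat => rat" where "em_b n = fps_nth (inverse (Abs_fps em_s)) n"

lemma em_conv: "(\<Sum>i\<le>m. em_b i * em_s (m - i)) = of_bool (m = 0)"
proof -
 have "fps_nth (Abs_fps em_s) 0 \<noteq> 0" by (simp add: em_s_def)
 hence "inverse (Abs_fps em_s) * Abs_fps em_s = 1" by (rule inverse_mult_eq_1)
 from arg_cong[OF this, of "\<lambda>f. fps_nth f m"] show ?thesis
  by (simp add: fps_mult_nth em_b_def atLeast0AtMost)
qed

lemma sum_triangle_lessThan:
 fixes g :: "nat => nat => 'a::comm_monoid_add"
 shows "(\<Sum>i<n. \<Sum>l<n - i. g i l) = (\<Sum>m<n. \<Sum>i\<le>m. g i (m - i))"
proof -
 have "(\<Sum>i<n. \<Sum>l<n - i. g i l) = (\<Sum>(i, l)\<in>(SIGMA i:{..<n}. {..<n - i}). g i l)"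
  by (rule sum.Sigma) auto
 also have "(SIGMA i:{..<n}. {..<n - i}) = {(i, j). i + j < n}" by auto
 also have "(\<Sum>(i, l)\<in>{(i, j). i + j < n}. g i l) = (\<Sum>m<n. \<Sum>i\<le>m. g i (m - i))"
  by (rule sum.triangle_reindex)
 finally show ?thesis .
qed

text \<open>The operator with coefficients \<open>em_b\<close> inverts the central difference with
  coefficients \<open>em_s\<close>. Truncating by total order \<open>i + l < N\<close> makes the
  cancellation exact.\<close>

lemma sum_em_conv:
 fixes H :: "nat => 'a::field_char_0"
 assumes "N > 0"
 shows "(\<Sum>i<N. of_rat (em_b i) * (\<Sum>l<N - i. of_rat (em_s l) * H (i + l))) = H 0"
proof -
 have "(\<Sum>i<N. of_rat (em_b i) * (\<Sum>l<N - i. of_rat (em_s l) * H (i + l)))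
   = (\<Sum>i<N. \<Sum>l<N - i. of_rat (em_b i * em_s l) * H (i + l))"
  by (simp add: sum_distrib_left of_rat_mult mult.assoc)
 also have "... = (\<Sum>m<N. \<Sum>i\<le>m. of_rat (em_b i * em_s (m - i)) * H (i + (m - i)))"
  by (rule sum_triangle_lessThan)
 also have "... = (\<Sum>m<N. of_rat (\<Sum>i\<le>m. em_b i * em_s (m - i)) * H m)"
  by (simp add: of_rat_sum sum_distrib_right)
 also have "... = (\<Sum>m<N. if m = 0 then H 0 else 0)"
  by (intro sum.cong refl) (simp add: em_conv)
 also have "... = H 0" using assms by simp
 finally show ?thesis .
qed

lemma of_rat_fact: "(of_rat (fact n) :: 'a::field_char_0) = fact n"
 by (metis of_nat_fact of_rat_of_nat_eq)

text \<open>Even orders cancel between the expansions at \<open>x + 1/2\<close> and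
  \<open>x - 1/2\<close>; an odd order \<open>2 l + 1\<close> leaves
  \<open>2 (1/2)^(2 l + 1) / (2 l + 1)!\<close>, which is \<open>em_s l\<close>.\<close>

lemma sum_half_powers:
 fixes g :: "nat => 'a::field_char_0"
 shows "(\<Sum>k\<le>2 * M. g k * ((1 / 2) ^ k - (- 1 / 2) ^ k) / fact k) = (\<Sum>l<M. of_rat (em_s l) * g (2 * l + 1))"
proof (induction M)
 case (Suc M)
 have 1: "((1 / 2) ^ (2 * M + 1) - (- 1 / 2) ^ (2 * M + 1) :: 'a) = 1 / 4 ^ M"
  by (simp add: power_mult power2_eq_square power_divide)
 have 2: "((1 / 2) ^ (2 * M + 2) - (- 1 / 2) ^ (2 * M + 2) :: 'a) = 0"
  by (simp add: power_mult power2_eq_square)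
 have 3: "(of_rat (em_s M) :: 'a) = (1 / 4 ^ M) / fact (2 * M + 1)"
  by (simp add: em_s_def of_rat_divide of_rat_mult of_rat_power of_rat_add of_rat_fact)
 have "(\<Sum>k\<le>2 * Suc M. g k * ((1 / 2) ^ k - (- 1 / 2) ^ k) / fact k)
   = (\<Sum>k\<le>2 * M. g k * ((1 / 2) ^ k - (- 1 / 2) ^ k) / fact k)
   + g (2 * M + 1) * ((1 / 2) ^ (2 * M + 1) - (- 1 / 2) ^ (2 * M + 1)) / fact (2 * M + 1)
   + g (2 * M + 2) * ((1 / 2) ^ (2 * M + 2) - (- 1 / 2) ^ (2 * M + 2)) / fact (2 * M + 2)"
  by simp
 thus ?case unfolding 1 2 Suc 3[symmetric] by (simp add: 3)
qed simp

text \<open>The factor in the \<open>k\<close>-th derivative of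
  \<open>z powr (1 - s) / (1 - s)\<close>. For \<open>k = 0\<close> it carries the pole at
  \<open>s = 1\<close>, for \<open>k = 1\<close> it is 1.\<close>

definition em_d :: "nat => complex => complex" where
 "em_d k s = (\<Prod>i<k. 1 - s - of_nat i) / (1 - s)"

text \<open>An approximate discrete antiderivative of \<open>z powr (- s)\<close>: the truncated
  inverse of the central difference, applied to the antiderivative
  \<open>z powr (1 - s) / (1 - s)\<close>.\<close>

definition em_G :: "nat => complex => complex => complex" where
 "em_G N s z = (\<Sum>i<N. of_rat (em_b i) * (em_d (2 * i) s * z powr (1 - s - of_nat (2 * i))))"

lemma em_d_Suc: "em_d (Suc k) s = em_d k s * (1 - s - of_nat k)"
 by (simp add: em_d_def)

text \<open>For each \<open>i\<close> the Taylor expansion is cut off at order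
  \<open>2 (N - i)\<close>, so all remainders involve the same derivative, of order
  \<open>2 N + 1\<close>, while \<open>sum_em_conv\<close> reduces the main terms to
  \<open>x powr (- s)\<close>. The bound is taken at \<open>x / 2\<close>, below which the segment
  from \<open>x - 1/2\<close> to \<open>x + 1/2\<close> does not reach when
  \<open>x >= 1\<close>.\<close>

lemma em_G_diff_bound:
 assumes x: "x \<ge> 1" and s: "s \<noteq> 1" and N: "N > 0" and pos: "Re s + 2 * real N \<ge> 0"
 shows "norm (of_real x powr (- s) - (em_G N s (of_real (x + 1/2)) - em_G N s (of_real (x - 1/2))))
   \<le> 2 * (\<Sum>i<N. norm (of_rat (em_b i) :: complex)) * (norm (em_d (2 * N + 1) s) * (x / 2) powr (- (Re s + 2 * real N)))"
proof -
 define B where "B = norm (em_d (2 * N + 1) s) * (x / 2) powr (- (Re s + 2 * real N))"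
 define S where "S = closed_segment (complex_of_real (x - 1/2)) (of_real (x + 1/2))"
 have S: "\<exists>t. z = of_real t \<and> t \<ge> x / 2" if "z \<in> S" for z
 proof -
  from that obtain u where u: "0 \<le> u" "u \<le> 1"
   "z = (1 - u) *\<^sub>R of_real (x - 1/2) + u *\<^sub>R of_real (x + 1/2)"
   unfolding S_def in_segment by blast
  have "z = of_real ((1 - u) * (x - 1/2) + u * (x + 1/2))"
   unfolding u(3) scaleR_conv_of_real by (simp only: of_real_add of_real_mult)
  also have "(1 - u) * (x - 1/2) + u * (x + 1/2) = x - 1/2 + u" by (simp add: field_simps)
  finally have "z = of_real (x - 1/2 + u)" .
  thus ?thesis using x u by (intro exI[of _ "x - 1/2 + u"]) auto
 qed
 define f where "f k z = em_d k s * z powr (1 - s - of_nat k)" for k z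
 have deriv: "(f k has_field_derivative f (Suc k) z) (at z within T)" if "z \<in> S" for k z T
 proof -
  obtain t where t: "z = of_real t" "t \<ge> x / 2" using S \<open>z \<in> S\<close> by blast
  have "z \<notin> \<real>\<^sub>\<le>\<^sub>0" using t x by (auto simp: complex_nonpos_Reals_iff)
  hence "((\<lambda>z. em_d k s * z powr (1 - s - of_nat k)) has_field_derivative
    em_d k s * ((1 - s - of_nat k) * z powr (1 - s - of_nat k - 1))) (at z within T)"
   by (intro DERIV_cmult has_field_derivative_at_within[OF has_field_derivative_powr])
  thus ?thesis unfolding f_def[abs_def] em_d_Suc by (simp add: algebra_simps)
 qed
 have fB: "norm (f (2 * N + 1) z) \<le> B" if "z \<in> S" for z
 proof -
  obtain t where t: "z = of_real t" "t \<ge> x / 2" using S \<open>z \<in> S\<close> by blast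
  have "norm (z powr (1 - s - of_nat (2 * N + 1))) = t powr (- (Re s + 2 * real N))"
   using t x by (subst norm_powr_real_powr) (auto simp: algebra_simps)
  also have "... \<le> (x / 2) powr (- (Re s + 2 * real N))"
   using t x pos by (intro powr_mono2') auto
  finally show ?thesis unfolding f_def B_def norm_mult by (intro mult_left_mono) auto
 qed
 have B0: "B \<ge> 0" by (simp add: B_def)
 define H where "H m = f (2 * m + 1) (of_real x)" for m
 have tm: "norm (f (2 * i) (of_real (x + 1/2)) - f (2 * i) (of_real (x - 1/2)) - (\<Sum>l<N - i. of_rat (em_s l) * H (i + l))) \<le> 2 * B"
  if i: "i < N" for i
 proof -
  define n where "n = 2 * (N - i)"
  let ?P = "\<lambda>c :: complex. \<Sum>k\<le>n. f (2 * i + k) (of_real x) * c ^ k / fact k" and ?E = "\<Sum>l<N - i. of_rat (em_s l) * H (i + l)"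
  have n: "2 * i + Suc n = 2 * N + 1" using i by (simp add: n_def)
  have T: "norm (f (2 * i) z - ?P (z - of_real x)) \<le> B"
   if z: "z \<in> S" "norm (z - of_real x) \<le> 1" for z
  proof -
   have "norm (f (2 * i + 0) z - ?P (z - of_real x))
     \<le> B * norm (z - of_real x) ^ Suc n / fact n"
   proof (rule complex_Taylor[where f = "\<lambda>k. f (2 * i + k)" and S = S])
    show "convex S" by (simp add: S_def)
    show "(f (2 * i + k) has_field_derivative f (2 * i + Suc k) z) (at z within S)" if "z \<in> S" for k z
     using deriv[OF that, of "2 * i + k" S] by simp
    show "norm (f (2 * i + Suc n) z) \<le> B" if "z \<in> S" for z
     unfolding n using fB[OF that] by simp
    have "complex_of_real x = midpoint (of_real (x - 1/2)) (of_real (x + 1/2))"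
     by (simp add: midpoint_def scaleR_conv_of_real field_simps)
    thus "complex_of_real x \<in> S" unfolding S_def by (metis midpoint_in_closed_segment)
   qed (use z in auto)
   also have "... \<le> B * 1 / 1"
    using z(2) B0 by (intro frac_le mult_left_mono power_le_one norm_ge_zero mult_nonneg_nonneg fact_ge_1) simp_all
   finally show ?thesis by simp
  qed
  have zS: "of_real (x + 1/2) \<in> S" "of_real (x - 1/2) \<in> S" by (simp_all add: S_def)
  have d: "complex_of_real (x + 1/2) - of_real x = 1/2" "complex_of_real (x - 1/2) - of_real x = -1/2" by simp_all
  have "?P (1/2) - ?P (-1/2)
    = (\<Sum>k\<le>n. f (2 * i + k) (of_real x) * ((1/2) ^ k - (-1/2) ^ k) / fact k)"
   by (simp only: sum_subtractf[symmetric] diff_divide_distrib right_diff_distrib)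
  also have "... = (\<Sum>l<N - i. of_rat (em_s l) * f (2 * i + (2 * l + 1)) (of_real x))"
   unfolding n_def by (rule sum_half_powers)
  also have "... = ?E"
   by (simp add: H_def algebra_simps)
  finally have e: "?E =
    ?P (1/2) - ?P (-1/2)" ..
  have b1: "norm (f (2 * i) (of_real (x + 1/2)) - ?P (1/2)) \<le> B"
   using T[OF zS(1)] unfolding d by simp
  have b2: "norm (f (2 * i) (of_real (x - 1/2)) - ?P (-1/2)) \<le> B"
   using T[OF zS(2)] unfolding d by simp
  have "norm ((f (2 * i) (of_real (x + 1/2)) - ?P (1/2))
    - (f (2 * i) (of_real (x - 1/2)) - ?P (-1/2))) \<le> B + B"
   by (rule order_trans[OF norm_triangle_ineq4 add_mono[OF b1 b2]])
  thus ?thesis unfolding e by (simp add: algebra_simps)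
 qed
 have G: "em_G N s z = (\<Sum>i<N. of_rat (em_b i) * f (2 * i) z)" for z by (simp add: em_G_def f_def)
 have H0: "H 0 = of_real x powr (- s)" using s by (simp add: H_def f_def em_d_def)
 have "norm (of_real x powr (- s) - (em_G N s (of_real (x + 1/2)) - em_G N s (of_real (x - 1/2))))
   = norm (\<Sum>i<N. of_rat (em_b i) * (f (2 * i) (of_real (x + 1/2)) - f (2 * i) (of_real (x - 1/2)) - (\<Sum>l<N - i. of_rat (em_s l) * H (i + l))))"
 proof -
  have "(\<Sum>i<N. of_rat (em_b i) * (f (2 * i) (of_real (x + 1/2)) - f (2 * i) (of_real (x - 1/2)) - (\<Sum>l<N - i. of_rat (em_s l) * H (i + l))))
   = em_G N s (of_real (x + 1/2)) - em_G N s (of_real (x - 1/2)) - H 0"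
   unfolding sum_em_conv[OF N, of H, symmetric] G by (simp only: right_diff_distrib sum_subtractf)
  thus ?thesis unfolding H0[symmetric] by (metis norm_minus_commute)
 qed
 also have "... \<le> (\<Sum>i<N. norm (of_rat (em_b i) :: complex) * (2 * B))"
  by (rule sum_norm_le, unfold norm_mult, intro mult_left_mono tm) auto
 also have "... = 2 * (\<Sum>i<N. norm (of_rat (em_b i) :: complex)) * B"
  by (simp add: sum_distrib_right[symmetric])
 finally show ?thesis by (simp add: B_def)
qed


section \<open>Analytic continuation of the series with terms
  \<open>(n + c) powr (- s)\<close>\<close>

lemma em_d_bound:
 assumes "s \<noteq> 1"
 shows "norm (em_d (Suc k) s) \<le> (1 + norm s + real k) ^ k"
proof -
 have "em_d (Suc k) s = (\<Prod>i<k. 1 - s - of_nat (Suc i))"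
  using assms by (simp add: em_d_def prod.lessThan_Suc_shift del: prod.lessThan_Suc)
 hence "norm (em_d (Suc k) s) = (\<Prod>i<k. norm (s + of_nat i))"
  by (simp add: prod_norm norm_minus_commute[of "_ - s"] flip: norm_minus_cancel[of "s + _"])
 also have "... \<le> (\<Prod>i<k. 1 + norm s + real k)"
 proof (intro prod_mono conjI)
  fix i assume "i \<in> {..<k}"
  have "norm (s + of_nat i) \<le> norm s + real i" by (metis norm_of_nat norm_triangle_ineq)
  thus "norm (s + of_nat i) \<le> 1 + norm s + real k" using \<open>i \<in> {..<k}\<close> by auto
 qed auto
 finally show ?thesis by simp
qed

lemma holomorphic_em_G:
 assumes "x > 0"
 shows "(\<lambda>s. em_G N s (of_real x)) holomorphic_on - {1}"
 unfolding em_G_def em_d_def using assms by (intro holomorphic_intros) auto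

text \<open>Subtracting the differences of \<open>em_G\<close> from the terms makes the series
  converge for \<open>Re s > 1 - 2 N\<close>, and these differences telescope to the single value at
  \<open>c - 1/2\<close>. At \<open>s = - e\<close> the corrected terms vanish identically: a
  derivative of order \<open>2 N + 1\<close> annihilates a polynomial of degree
  \<open>e + 1\<close>.\<close>

lemma hurwitz_partial_continuation:
 fixes c :: real
 assumes c: "c \<ge> 1" and N: "N > 0"
 defines "D \<equiv> {s. Re s > 1 - 2 * real N} - {1}"
 shows "\<exists>F. F holomorphic_on D \<and> (\<forall>s. Re s > 1 \<longrightarrow> (\<lambda>n. of_real (real n + c) powr (- s)) sums F s) \<and>
  (\<forall>e. e + 1 < 2 * N \<longrightarrow> F (- of_nat e) = - em_G N (- of_nat e) (of_real (c - 1/2)))"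
proof -
 define T where "T n s = complex_of_real (real n + c) powr (- s) -
   (em_G N s (of_real (real n + c + 1/2)) - em_G N s (of_real (real n + c - 1/2)))" for n s
 define A where "A = (\<Sum>i<N. norm (of_rat (em_b i) :: complex))"
 have A0: "A \<ge> 0" by (simp add: A_def sum_nonneg)
 have Tb: "norm (T n s) \<le> 2 * A * (norm (em_d (2 * N + 1) s) * ((real n + c) / 2) powr (- (Re s + 2 * real N)))"
  if "s \<noteq> 1" "Re s + 2 * real N \<ge> 0" for n s
  unfolding T_def A_def using em_G_diff_bound[of "real n + c" s N] that c N by simp
 have opD: "open D" unfolding D_def by (intro open_Diff open_halfspace_Re_gt) auto
 have "\<exists>g. g holomorphic_on D \<and> (\<forall>s\<in>D. (\<lambda>n. T n s) sums g s)"
 proof (rule holomorphic_series[OF opD])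
  show "T n holomorphic_on D" for n
  proof -
   have "T n holomorphic_on - {1}" unfolding T_def[abs_def] using c
    by (intro holomorphic_intros holomorphic_em_G) auto
   thus ?thesis by (rule holomorphic_on_subset) (auto simp: D_def)
  qed
 next
  fix s0 assume s0: "s0 \<in> D"
  define \<delta> where "\<delta> = (Re s0 + 2 * real N - 1) / 2"
  have \<delta>: "\<delta> > 0" using s0 by (simp add: D_def \<delta>_def)
  define d where "d = min \<delta> 1"
  define K where "K = (1 + (norm s0 + 1) + real (2 * N)) ^ (2 * N)"
  define h where "h n = 2 * A * (K * ((1 / 2) powr (- (1 + \<delta>)) * real n powr (- (1 + \<delta>))))" for n :: nat
  have "summable h" unfolding h_def using \<delta> by (intro summable_mult) (simp add: summable_real_powr_iff)
  moreover have "\<forall>\<^sub>F n in sequentially. \<forall>y\<in>ball s0 d \<inter> D. norm (T n y) \<le> h n"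
   using eventually_ge_at_top[of 2]
  proof eventually_elim
   case (elim n)
   show ?case
   proof
    fix y assume y: "y \<in> ball s0 d \<inter> D"
    have dy: "norm (s0 - y) < d" using y by (simp add: dist_norm)
    have "Re s0 - Re y \<le> norm (s0 - y)" using complex_Re_le_cmod[of "s0 - y"] by simp
    hence re: "Re y + 2 * real N \<ge> 1 + \<delta>"
    proof -
     have "d \<le> \<delta>" by (simp add: d_def)
     moreover have "2 * \<delta> = Re s0 + 2 * real N - 1"
      unfolding \<delta>_def by (subst times_divide_eq_right, rule nonzero_mult_div_cancel_left) simp
     ultimately show ?thesis using dy \<open>Re s0 - Re y \<le> norm (s0 - y)\<close> by linarith
    qed

    have "norm y \<le> norm s0 + norm (s0 - y)" using norm_triangle_ineq4[of s0 "s0 - y"] by simp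
    hence ny: "norm y \<le> norm s0 + 1" using dy by (simp add: d_def)
    have y1: "y \<noteq> 1" using y by (simp add: D_def)
    have "norm (em_d (2 * N + 1) y) \<le> (1 + norm y + real (2 * N)) ^ (2 * N)"
     using em_d_bound[OF y1, of "2 * N"] by simp
    also have "... \<le> K" unfolding K_def using ny by (intro power_mono) auto
    finally have Kb: "norm (em_d (2 * N + 1) y) \<le> K" .
    have "((real n + c) / 2) powr (- (Re y + 2 * real N)) \<le> (real n / 2) powr (- (Re y + 2 * real N))"
     using elim c re \<delta> by (intro powr_mono2') auto
    also have "... \<le> (real n / 2) powr (- (1 + \<delta>))"
     using elim re by (intro powr_mono) auto
    also have "... = (1 / 2) powr (- (1 + \<delta>)) * real n powr (- (1 + \<delta>))"
     by (subst powr_mult[symmetric]) auto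
    finally have pb: "((real n + c) / 2) powr (- (Re y + 2 * real N)) \<le> (1 / 2) powr (- (1 + \<delta>)) * real n powr (- (1 + \<delta>))" .
    have "norm (T n y) \<le> 2 * A * (norm (em_d (2 * N + 1) y) * ((real n + c) / 2) powr (- (Re y + 2 * real N)))"
     using Tb[OF y1] re \<delta> by simp
    also have "... \<le> h n" unfolding h_def using A0 Kb pb order_trans[OF norm_ge_zero Kb]
     by (intro mult_left_mono mult_mono) auto
    finally show "norm (T n y) \<le> h n" .
   qed
  qed
  ultimately show "\<exists>d>0. \<exists>h. summable h \<and> (\<forall>\<^sub>F n in sequentially. \<forall>y\<in>ball s0 d \<inter> D. norm (T n y) \<le> h n)"
   using \<delta> by (intro exI[of _ d] conjI exI[of _ h]) (auto simp: d_def)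
 qed
 then obtain g where g: "g holomorphic_on D" "\<And>s. s \<in> D ==> (\<lambda>n. T n s) sums g s" by blast
 define F where "F s = g s - em_G N s (of_real (c - 1/2))" for s
 have "F holomorphic_on D" unfolding F_def[abs_def]
  by (intro holomorphic_intros g holomorphic_on_subset[OF holomorphic_em_G]) (use c in \<open>auto simp: D_def\<close>)
 moreover have "(\<lambda>n. of_real (real n + c) powr (- s)) sums F s" if s: "Re s > 1" for s
 proof -
  have sD: "s \<in> D" using s by (auto simp: D_def)
  have lim: "(\<lambda>n. em_G N s (of_real (real n + c - 1/2))) \<longlonglongrightarrow> 0"
   unfolding em_G_def
  proof (rule tendsto_null_sum, rule tendsto_mult_right_zero, rule tendsto_mult_right_zero)
   fix i :: nat
   have "((\<lambda>n. (real n + (c - 1/2)) powr (1 - Re s - 2 * real i)) \<longlongrightarrow> 0) sequentially"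
    by (rule tendsto_neg_powr)
      (use s in \<open>auto intro!: filterlim_tendsto_add_at_top[OF _ filterlim_real_sequentially] filterlim_at_top_add_at_top simp: add.commute[of _ "c - 1/2"]\<close>)
   moreover have "norm (complex_of_real (real n + c - 1/2) powr (1 - s - of_nat (2 * i))) = (real n + (c - 1/2)) powr (1 - Re s - 2 * real i)" for n
    using c by (subst norm_powr_real_powr) (auto simp: algebra_simps)
   ultimately show "(\<lambda>n. complex_of_real (real n + c - 1/2) powr (1 - s - of_nat (2 * i))) \<longlonglongrightarrow> 0"
    by (subst tendsto_norm_zero_iff[symmetric]) simp
  qed
  have "(\<lambda>n. em_G N s (of_real (real (Suc n) + c - 1/2)) - em_G N s (of_real (real n + c - 1/2))) sums (0 - em_G N s (of_real (real 0 + c - 1/2)))"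
   by (rule telescope_sums[OF lim])
  from sums_add[OF g(2)[OF sD] this] show ?thesis unfolding T_def F_def by (simp add: algebra_simps)
 qed
 moreover have "F (- of_nat e) = - em_G N (- of_nat e) (of_real (c - 1/2))" if e: "e + 1 < 2 * N" for e
 proof -
  have "real e + 1 < 2 * real N" using e by linarith
  hence sD: "- of_nat e \<in> D" by (auto simp: D_def complex_eq_iff)
  have "em_d (2 * N + 1) (- of_nat e) = 0"
   using e unfolding em_d_def by (auto intro!: bexI[of _ "e + 1"])
  moreover have "- of_nat e \<noteq> (1 :: complex)" by (auto simp: complex_eq_iff)
  moreover have "Re (- of_nat e) + 2 * real N \<ge> 0" using e by simp
  ultimately have "norm (T n (- of_nat e)) \<le> 0" for n
   using Tb[of "- of_nat e" n] by (simp only: norm_zero mult_zero_left mult_zero_right not_False_eq_True simp_thms)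
  hence "(\<lambda>n. T n (- of_nat e)) sums 0" by simp
  with g(2)[OF sD] have "g (- of_nat e) = 0" by (simp add: sums_iff)
  thus ?thesis by (simp add: F_def)
 qed
 ultimately show ?thesis by blast
qed

lemma connected_punctured_halfplane: "connected ({s. Re s > a} - {1})"
 by (intro connected_open_delete open_halfspace_Re_gt convex_connected convex_halfspace_Re_gt) simp

text \<open>The half-planes for growing \<open>N\<close> exhaust the punctured plane, and by the
  identity theorem the partial continuations agree where several are defined; \<open>n s\<close>
  selects the least admissible \<open>N\<close>.\<close>

theorem hurwitz_continuation:
 fixes c :: real
 assumes c: "c \<ge> 1"
 shows "\<exists>f. f holomorphic_on - {1} \<and> (\<forall>s. Re s > 1 \<longrightarrow> (\<lambda>n. of_real (real n + c) powr (- s)) sums f s) \<and>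
  (\<forall>e N. e + 1 < 2 * N \<longrightarrow> f (- of_nat e) = - em_G N (- of_nat e) (of_real (c - 1/2)))"
proof -
 define D where "D N = {s. Re s > 1 - 2 * real N} - {1}" for N
 have "\<forall>N. \<exists>F. N > 0 \<longrightarrow> F holomorphic_on D N \<and> (\<forall>s. Re s > 1 \<longrightarrow> (\<lambda>n. of_real (real n + c) powr (- s)) sums F s) \<and>
  (\<forall>e. e + 1 < 2 * N \<longrightarrow> F (- of_nat e) = - em_G N (- of_nat e) (of_real (c - 1/2)))"
  using hurwitz_partial_continuation[OF c] unfolding D_def by blast
 then obtain F where F: "\<And>N. N > 0 ==> F N holomorphic_on D N"
  "\<And>N s. N > 0 ==> Re s > 1 ==> (\<lambda>n. of_real (real n + c) powr (- s)) sums F N s"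
  "\<And>N e. N > 0 ==> e + 1 < 2 * N ==> F N (- of_nat e) = - em_G N (- of_nat e) (of_real (c - 1/2))"
  by metis
 have opD: "open (D N)" for N unfolding D_def by (intro open_Diff open_halfspace_Re_gt) auto
 have agree: "F N s = F M s" if "N > 0" "N \<le> M" "s \<in> D N" for N M s
 proof (rule analytic_continuation_open[of "{s. Re s > 1}" "D N" "F N" "F M"])
  show "open {s. Re s > 1}" by (rule open_halfspace_Re_gt)
  show "{s. Re s > 1} \<noteq> {}" by (auto intro: exI[of _ 2])
  show "connected (D N)" unfolding D_def by (rule connected_punctured_halfplane)
  show "{s. Re s > 1} \<subseteq> D N" using that by (auto simp: D_def)
  have "D N \<subseteq> D M" using that by (auto simp: D_def)
  thus "F M holomorphic_on D N" using F(1)[of M] that by (meson holomorphic_on_subset less_le_trans)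
  show "F N z = F M z" if "z \<in> {s. Re s > 1}" for z
   using F(2)[of N z] F(2)[of M z] that \<open>N > 0\<close> \<open>N \<le> M\<close> by (auto simp: sums_iff)
 qed (use F opD that in auto)
 define n where "n s = (LEAST N. N > 0 \<and> s \<in> D N)" for s
 define f where "f s = F (n s) s" for s
 have f: "f s = F N s" if "N > 0" "s \<in> D N" for N s
 proof -
  have "n s > 0 \<and> s \<in> D (n s)" unfolding n_def by (rule LeastI[of "\<lambda>N. N > 0 \<and> s \<in> D N" N]) (use that in auto)
  moreover have "n s \<le> N" unfolding n_def by (rule Least_le) (use that in auto)
  ultimately show ?thesis using agree[of "n s" N s] by (simp add: f_def)
 qed
 have "f holomorphic_on (\<Union>N\<in>{0<..}. D N)"
 proof (rule holomorphic_on_UN_open)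
  fix N :: nat assume "N \<in> {0<..}"
  thus "f holomorphic_on D N" using F(1)[of N] f[of N] by (subst holomorphic_cong[of _ "D N" f "F N"]) auto
 qed (rule opD)
 moreover have "- {1} \<subseteq> (\<Union>N\<in>{0<..}. D N)"
 proof
  fix s :: complex assume s: "s \<in> - {1}"
  obtain N :: nat where "real N > 1 - Re s" using reals_Archimedean2 by blast
  hence "s \<in> D (Suc N)" using s by (auto simp: D_def)
  thus "s \<in> (\<Union>N\<in>{0<..}. D N)" by auto
 qed
 ultimately have "f holomorphic_on - {1}" by (rule holomorphic_on_subset)
 moreover have "(\<lambda>n. of_real (real n + c) powr (- s)) sums f s" if "Re s > 1" for s
 proof -
  have "s \<noteq> 1" using that by auto
  thus ?thesis using F(2)[of 1 s] f[of 1 s] that by (simp add: D_def)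
 qed
 moreover have "f (- of_nat e) = - em_G N (- of_nat e) (of_real (c - 1/2))" if "e + 1 < 2 * N" for e N
 proof -
  have "real e + 1 < 2 * real N" using that by linarith
  hence "- of_nat e \<in> D N" by (auto simp: D_def complex_eq_iff)
  thus ?thesis using f[of N "- of_nat e"] F(3)[of N e] that by auto
 qed
 ultimately show ?thesis by blast
qed

section \<open>The 2-adic zeta value as a limit of power sums\<close>

text \<open>The \<open>k\<close>-th derivative of \<open>x^(e + 1) / (e + 1)\<close>, the rational
  counterpart of \<open>em_d\<close> at \<open>s = - e\<close>.\<close>

definition em_f :: "nat => nat => rat => rat" where
 "em_f e k x = (if k \<le> e + 1 then fact e / fact (e + 1 - k) * x ^ (e + 1 - k) else 0)"

text \<open>For a polynomial the Euler-Maclaurin expansion is finite and exact. The result is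
  \<open>B(x + 1/2) / (e + 1)\<close>, where \<open>B\<close> is the Bernoulli polynomial of degree
  \<open>e + 1\<close>.\<close>

definition em_poly :: "nat => rat => rat" where
 "em_poly e x = (\<Sum>i\<le>(e + 1) div 2. em_b i * em_f e (2 * i) x)"

lemma em_f_Taylor:
 assumes "j \<le> e + 1"
 shows "em_f e j (x + h) = (\<Sum>k\<le>e + 1 - j. em_f e (j + k) x * h ^ k / fact k)"
proof -
 define m where "m = e + 1 - j"
 have "em_f e j (x + h) = fact e / fact m * (x + h) ^ m" using assms by (simp add: em_f_def m_def)
 also have "(x + h) ^ m = (\<Sum>k\<le>m. of_nat (m choose k) * h ^ k * x ^ (m - k))"
  using binomial_ring[of h x m] by (simp add: add.commute)
 also have "fact e / fact m * ... = (\<Sum>k\<le>m. em_f e (j + k) x * h ^ k / fact k)"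
  unfolding sum_distrib_left
 proof (intro sum.cong refl)
  fix k assume "k \<in> {..m}"
  hence k: "k \<le> m" by simp
  have "em_f e (j + k) x = fact e / fact (m - k) * x ^ (m - k)"
   using k assms by (simp add: em_f_def m_def)
  moreover have "(of_nat (m choose k) :: rat) = fact m / (fact k * fact (m - k))"
   using k by (rule binomial_fact)
  ultimately show "fact e / fact m * (of_nat (m choose k) * h ^ k * x ^ (m - k)) = em_f e (j + k) x * h ^ k / fact k"
   by (simp add: mult_ac)
 qed
 finally show ?thesis by (simp add: m_def)
qed

lemma em_poly_diff:
 assumes "odd e"
 shows "em_poly e (x + 1/2) - em_poly e (x - 1/2) = x ^ e"
proof -
 define N where "N = (e + 1) div 2"
 have e: "e + 1 = 2 * N" using assms by (simp add: N_def)
 have N: "N > 0" using e by simp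
 define H where "H m = em_f e (2 * m + 1) x" for m
 have 1: "em_f e (2 * i) (x + 1/2) - em_f e (2 * i) (x - 1/2) = (\<Sum>l<N - i. of_rat (em_s l) * H (i + l))"
  if "i \<le> N" for i
 proof -
  have i: "2 * i \<le> e + 1" "e + 1 - 2 * i = 2 * (N - i)" using that e by simp_all
  have "em_f e (2 * i) (x + 1/2) - em_f e (2 * i) (x + (- 1/2))
    = (\<Sum>k\<le>2 * (N - i). em_f e (2 * i + k) x * (1/2) ^ k / fact k) - (\<Sum>k\<le>2 * (N - i). em_f e (2 * i + k) x * (-1/2) ^ k / fact k)"
   unfolding em_f_Taylor[OF i(1)] i(2) ..
  also have "... = (\<Sum>k\<le>2 * (N - i). em_f e (2 * i + k) x * ((1/2) ^ k - (-1/2) ^ k) / fact k)"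
   by (simp only: sum_subtractf[symmetric] diff_divide_distrib right_diff_distrib)
  also have "... = (\<Sum>l<N - i. of_rat (em_s l) * em_f e (2 * i + (2 * l + 1)) x)"
   by (rule sum_half_powers)
  also have "... = (\<Sum>l<N - i. of_rat (em_s l) * H (i + l))" by (simp add: H_def algebra_simps)
  finally show ?thesis by simp
 qed
 have "em_poly e (x + 1/2) - em_poly e (x - 1/2) = (\<Sum>i\<le>N. of_rat (em_b i) * (\<Sum>l<N - i. of_rat (em_s l) * H (i + l)))"
  unfolding em_poly_def N_def[symmetric] sum_subtractf[symmetric] right_diff_distrib[symmetric]
  by (intro sum.cong refl) (subst 1, auto)
 also have "{..N} = insert N {..<N}" by auto
 also have "(\<Sum>i\<in>insert N {..<N}. of_rat (em_b i) * (\<Sum>l<N - i. of_rat (em_s l) * H (i + l)))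
   = (\<Sum>i<N. of_rat (em_b i) * (\<Sum>l<N - i. of_rat (em_s l) * H (i + l)))" by simp
 also have "... = H 0" by (rule sum_em_conv[OF N])
 finally show ?thesis by (simp add: H_def em_f_def)
qed

definition odd_power_sum :: "nat => nat => int" where
 "odd_power_sum e n = (\<Sum>t<n. (2 * int t + 1) ^ e)"

text \<open>For odd \<open>e\<close>, \<open>zcoeff e\<close> is the coefficient of \<open>n^2\<close> in the polynomial \<open>odd_power_sum e n\<close>.\<close>

definition zcoeff :: "nat => rat" where
 "zcoeff e = 2 ^ e * em_b ((e - 1) div 2) * fact e / 2"

lemma odd_power_sum_em_poly:
 assumes "odd e"
 shows "of_int (odd_power_sum e n) = 2 ^ e * (em_poly e (of_nat n) - em_poly e 0)"
proof (induction n)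
 case (Suc n)
 have "em_poly e (of_nat (Suc n)) - em_poly e (of_nat n) = (of_nat n + 1/2) ^ e"
  using em_poly_diff[OF assms, of "of_nat n + 1/2"] by (simp add: add.commute)
 moreover have "(2 * of_nat n + 1 :: rat) ^ e = 2 ^ e * (of_nat n + 1/2) ^ e"
  by (simp add: power_mult_distrib[symmetric] algebra_simps)
 ultimately show ?case using Suc by (simp add: odd_power_sum_def algebra_simps)
qed (simp add: odd_power_sum_def)

lemma abs2_power: "abs2 (x ^ n) = abs2 x ^ n"
 by (induction n) (simp_all add: abs2_mult)

lemma abs2_divide: "abs2 (x / y) = abs2 x / abs2 y"
 by (simp add: divide_inverse abs2_mult abs2_inverse)

lemma abs2_of_int_le: "abs2 (of_int k) \<le> 1"
proof (cases "k = 0")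
 case False
 have "abs2 (of_int k / of_int 1) = 2 powi (int (multiplicity 2 (1::int)) - int (multiplicity 2 k))"
  by (rule abs2_frac) (use False in auto)
 also have "... \<le> 2 powi 0" by (intro power_int_increasing) auto
 finally show ?thesis by simp
qed simp

lemma abs2_of_int_odd: "odd k ==> abs2 (of_int k) = 1"
 using abs2_frac[of k 1] by (cases "k = 0") (auto simp: not_dvd_imp_multiplicity_0)

lemma abs2_two_power: "abs2 (2 ^ k) = (1/2) ^ k"
 by (simp add: abs2_power abs2_2)

lemma abs2_sum_le: "(\<And>i. i \<in> A ==> abs2 (f i) \<le> B) ==> B \<ge> 0 ==> abs2 (\<Sum>i\<in>A. f i) \<le> B"
proof (induction A rule: infinite_finite_induct)
 case (insert x A)
 thus ?case using abs2_ultra[of "f x" "sum f A"] order_trans[OF _ max.boundedI] by (smt (verit) insertCI sum.insert insert.hyps)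
qed simp_all

lemma abs2_diff_le: "abs2 (x - z) \<le> max (abs2 (x - y)) (abs2 (y - z))"
 using abs2_ultra[of "x - y" "y - z"] by simp

text \<open>For odd \<open>e\<close> the polynomial \<open>em_poly e n\<close> has only even powers
  of \<open>n\<close>, and its constant term drops out. Division by \<open>n^2 = 4^N\<close> leaves
  the coefficient of \<open>n^2\<close> and terms divisible by \<open>n\<close>, which are small
  2-adically. The constant \<open>C\<close> depends on \<open>e\<close> through the coefficients
  \<open>em_b\<close>.\<close>

lemma zcoeff_limit:
 assumes "odd e"
 shows "\<exists>C. \<forall>N. abs2 (of_int (odd_power_sum e (2 ^ N)) / 4 ^ N - zcoeff e) \<le> C * (1/2) ^ N"
proof -
 define M where "M = (e - 1) div 2"
 have e: "e = 2 * M + 1" using assms by (simp add: M_def)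
 define c where "c i = 2 ^ e * em_b i * (fact e / fact (e + 1 - 2 * i))" for i
 have main: "of_int (odd_power_sum e (2 ^ N)) / 4 ^ N - zcoeff e = (\<Sum>i<M. c i * (2 ^ N) ^ (e - 1 - 2 * i))" for N
 proof -
  define x :: rat where "x = 2 ^ N"
  have x: "x \<noteq> 0" by (simp add: x_def)
  have x2: "x\<^sup>2 = 4 ^ N" unfolding x_def power2_eq_square power_mult_distrib[symmetric] by simp
  have f0: "em_f e (2 * i) 0 = 0" if "i \<le> M" for i using that by (simp add: em_f_def e)
  have "em_poly e x - em_poly e 0 = (\<Sum>i\<le>Suc M. em_b i * (em_f e (2 * i) x - em_f e (2 * i) 0))"
   by (simp add: em_poly_def e sum_subtractf right_diff_distrib)
  also have "... = (\<Sum>i\<le>M. em_b i * em_f e (2 * i) x) + em_b (Suc M) * (em_f e (2 * Suc M) x - em_f e (2 * Suc M) 0)"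
   by (simp add: f0)
  also have "em_f e (2 * Suc M) x - em_f e (2 * Suc M) 0 = 0" by (simp add: em_f_def e)
  finally have d: "em_poly e x - em_poly e 0 = (\<Sum>i\<le>M. em_b i * em_f e (2 * i) x)" by simp
  have "of_int (odd_power_sum e (2 ^ N)) = 2 ^ e * (em_poly e x - em_poly e 0)"
   using odd_power_sum_em_poly[OF assms, of "2 ^ N"] by (simp add: x_def)
  also have "... = (\<Sum>i\<le>M. c i * x ^ (e - 1 - 2 * i)) * x\<^sup>2"
   unfolding d sum_distrib_left sum_distrib_right
  proof (intro sum.cong refl)
   fix i assume "i \<in> {..M}"
   hence "e + 1 - 2 * i = (e - 1 - 2 * i) + 2" by (simp add: e)
   thus "2 ^ e * (em_b i * em_f e (2 * i) x) = c i * x ^ (e - 1 - 2 * i) * x\<^sup>2"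
    using \<open>i \<in> {..M}\<close> by (simp add: c_def em_f_def e power_add power2_eq_square del: fact_Suc)
  qed
  finally have "of_int (odd_power_sum e (2 ^ N)) / 4 ^ N = (\<Sum>i\<le>M. c i * x ^ (e - 1 - 2 * i))"
   using x x2 by simp
  also have "{..M} = insert M {..<M}" by auto
  also have "(\<Sum>i\<in>insert M {..<M}. c i * x ^ (e - 1 - 2 * i)) = zcoeff e + (\<Sum>i<M. c i * x ^ (e - 1 - 2 * i))"
   by (simp add: c_def zcoeff_def e)
  finally show ?thesis by (simp add: x_def)
 qed
 define C where "C = (\<Sum>i<M. abs2 (c i))"
 have "abs2 (of_int (odd_power_sum e (2 ^ N)) / 4 ^ N - zcoeff e) \<le> C * (1/2) ^ N" for N
  unfolding main
 proof (rule abs2_sum_le)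
  fix i assume i: "i \<in> {..<M}"
  have "abs2 ((2 ^ N) ^ (e - 1 - 2 * i)) = ((1/2) ^ N) ^ (e - 1 - 2 * i)"
   by (simp add: abs2_power abs2_2)
  also have "... \<le> ((1/2) ^ N) ^ 1"
   using i by (intro power_decreasing) (auto simp: e intro: power_le_one)
  finally have "abs2 (c i * (2 ^ N) ^ (e - 1 - 2 * i)) \<le> abs2 (c i) * (1/2) ^ N"
   by (simp add: abs2_mult mult_left_mono)
  also have "... \<le> C * (1/2) ^ N"
   unfolding C_def using i by (intro mult_right_mono member_le_sum) auto
  finally show "abs2 (c i * (2 ^ N) ^ (e - 1 - 2 * i)) \<le> C * (1/2) ^ N" .
 qed (simp add: C_def sum_nonneg)
 thus ?thesis by blast
qed

text \<open>The case \<open>m = 0\<close> of the binomial sums, where the binomial coefficient is 1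
  and the digit sum is 0.\<close>

lemma odd_power_sum_dvd:
 assumes "odd e"
 shows "2 ^ (2 * N) dvd odd_power_sum e (2 ^ N)"
proof -
 obtain j where j: "e = 2 * j + 1" using assms by (elim oddE)
 have "binom4_sum N 0 (monom 1 j) = odd_power_sum e (2 ^ N)"
  unfolding binom4_sum_def odd_power_sum_def j
  by (intro sum.cong refl) (simp add: poly_monom power_mult)
 thus ?thesis using binom4_sum_valuation[of 0 N "monom 1 j"] by auto
qed

section \<open>Congruences for sums of odd powers, uniform in the exponent\<close>

lemma power_Taylor3:
 fixes v z :: int
 shows "\<exists>w. (v + z) ^ (e + 2) = v ^ (e + 2) + int (e + 2) * z * v ^ (e + 1) + int (e + 2 choose 2) * z\<^sup>2 * v ^ e + z ^ 3 * w"
proof (induction e)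
 case 0
 have "(0 + 2 choose 2) = (1::nat)" by (simp only: add_0 binomial_n_n)
 thus ?case by (intro exI[of _ 0]) (simp add: power2_eq_square algebra_simps del: binomial_Suc_Suc)
next
 case (Suc e)
 then obtain w where w: "(v + z) ^ (e + 2) = v ^ (e + 2) + int (e + 2) * z * v ^ (e + 1) + int (e + 2 choose 2) * z\<^sup>2 * v ^ e + z ^ 3 * w"
  by blast
 have c: "int (Suc e + 2 choose 2) = int (e + 2 choose 2) + int (e + 2)"
  by (simp add: numeral_2_eq_2)
 have "(v + z) ^ (Suc e + 2) = (v + z) * (v + z) ^ (e + 2)" by simp
 also have "... = v ^ (Suc e + 2) + int (Suc e + 2) * z * v ^ (Suc e + 1) + int (Suc e + 2 choose 2) * z\<^sup>2 * v ^ Suc e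
   + z ^ 3 * (int (e + 2 choose 2) * v ^ e + (v + z) * w)"
  unfolding w c by (simp add: algebra_simps power2_eq_square power3_eq_cube)
 finally show ?case by blast
qed

lemma sum_reflect_odd:
 fixes g :: "int => 'a::comm_monoid_add"
 shows "(\<Sum>t<n. g (2 * int t + 1)) = (\<Sum>t<n. g (2 * int n - (2 * int t + 1)))"
proof -
 have "(\<Sum>t<n. g (2 * int t + 1)) = (\<Sum>t<n. g (2 * int (n - Suc t) + 1))"
  by (rule sum.nat_diff_reindex[symmetric])
 also have "... = (\<Sum>t<n. g (2 * int n - (2 * int t + 1)))"
  by (intro sum.cong refl arg_cong[of _ _ g]) auto
 finally show ?thesis .
qed

text \<open>With \<open>y = 2 n\<close>, reflecting \<open>u\<close> to \<open>y - u\<close> and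
  \<open>2 y - u\<close> turns the difference into a sum of second differences
  \<open>v^e - 2 (v + y)^e + (v + 2 y)^e\<close> at \<open>v = - u\<close>, because \<open>e\<close>
  is odd. Constant and linear terms in \<open>y\<close> cancel; the quadratic term is a multiple of
  \<open>y^2\<close> times a sum of powers with the odd exponent \<open>e - 2\<close>, itself
  divisible by \<open>4^N\<close>; the rest is divisible by \<open>y^3\<close>. The modulus is the
  same for all \<open>e\<close>.\<close>

lemma odd_power_sum_double:
 assumes "odd e" "e \<ge> 3"
 shows "2 ^ (3 * N) dvd odd_power_sum e (2 * 2 ^ N) - 4 * odd_power_sum e (2 ^ N)"
proof -
 obtain d where d: "e = d + 2" using that[of "e - 2"] assms(2) by simp
 have od: "odd d" using assms d by simp
 define n where "n = (2::nat) ^ N"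
 define y where "y = 2 * int n"
 let ?D = "\<lambda>t. (2 * int t + 1) ^ e + (2 * y - (2 * int t + 1)) ^ e - 2 * (2 * int t + 1) ^ e - 2 * (y - (2 * int t + 1)) ^ e"
  and ?c = "- (2 * int (d + 2 choose 2) * y\<^sup>2)"
 have y: "y = 2 ^ Suc N" by (simp add: y_def n_def)
 have "odd_power_sum e (2 * n) = (\<Sum>t<n. (2 * int t + 1) ^ e) + (\<Sum>t<n. (2 * int (n + t) + 1) ^ e)"
  unfolding odd_power_sum_def mult_2 by (simp add: sum.nat_group[symmetric] lessThan_atLeast0 sum.atLeastLessThan_concat[of 0 n "n + n", symmetric] sum.shift_bounds_nat_ivl[of _ 0 n n, simplified] add.commute)
 also have "(\<Sum>t<n. (2 * int (n + t) + 1) ^ e) = (\<Sum>t<n. (y + (2 * int t + 1)) ^ e)"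
  by (intro sum.cong refl) (simp add: y_def algebra_simps)
 also have "... = (\<Sum>t<n. (y + (2 * int n - (2 * int t + 1))) ^ e)"
  by (rule sum_reflect_odd[of "\<lambda>u. (y + u) ^ e"])
 finally have 1: "odd_power_sum e (2 * n) = (\<Sum>t<n. (2 * int t + 1) ^ e + (2 * y - (2 * int t + 1)) ^ e)"
  by (simp add: sum.distrib y_def algebra_simps)
 have 2: "odd_power_sum e n = (\<Sum>t<n. (y - (2 * int t + 1)) ^ e)"
  unfolding odd_power_sum_def y_def by (rule sum_reflect_odd)
 have "\<exists>W. \<forall>t. ?D t
   = ?c * (2 * int t + 1) ^ d + y ^ 3 * W t"
 proof (intro choice allI)
  fix t
  define v where "v = - (2 * int t + 1)"
  have ve: "(2 * int t + 1) ^ e = - (v ^ e)" unfolding v_def power_minus_odd[OF assms(1)] by simp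
  have vd: "(2 * int t + 1) ^ d = - (v ^ d)" unfolding v_def power_minus_odd[OF od] by simp
  obtain w1 where w1: "(v + 2 * y) ^ (d + 2) = v ^ (d + 2) + int (d + 2) * (2 * y) * v ^ (d + 1) + int (d + 2 choose 2) * (2 * y)\<^sup>2 * v ^ d + (2 * y) ^ 3 * w1"
   using power_Taylor3 by blast
  obtain w2 where w2: "(v + y) ^ (d + 2) = v ^ (d + 2) + int (d + 2) * y * v ^ (d + 1) + int (d + 2 choose 2) * y\<^sup>2 * v ^ d + y ^ 3 * w2"
   using power_Taylor3 by blast
  have "2 * y - (2 * int t + 1) = v + 2 * y" "y - (2 * int t + 1) = v + y" by (simp_all add: v_def)
  hence "?D t
   = v ^ e + (v + 2 * y) ^ (d + 2) - 2 * (v + y) ^ (d + 2)" using ve unfolding d by (simp only:)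
  also have "... = ?c * (2 * int t + 1) ^ d + y ^ 3 * (8 * w1 - 2 * w2)"
   unfolding w1 w2 vd d by (simp add: algebra_simps power2_eq_square power3_eq_cube)
  finally show "\<exists>W. ?D t
   = ?c * (2 * int t + 1) ^ d + y ^ 3 * W" by blast
 qed
 then obtain W where W: "\<And>t. ?D t
   = ?c * (2 * int t + 1) ^ d + y ^ 3 * W t" by blast
 have "odd_power_sum e (2 * n) - 4 * odd_power_sum e n = odd_power_sum e (2 * n) - 2 * (\<Sum>t<n. (2 * int t + 1) ^ e) - 2 * (\<Sum>t<n. (y - (2 * int t + 1)) ^ e)"
  using 2 by (simp add: odd_power_sum_def)
 also have "... = (\<Sum>t<n. ?D t)"
  unfolding 1 by (simp add: sum_subtractf sum.distrib flip: sum_distrib_left)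
 also have "... = ?c * odd_power_sum d n + y ^ 3 * (\<Sum>t<n. W t)"
  unfolding W by (simp add: sum.distrib sum_subtractf sum_distrib_left odd_power_sum_def sum_negf)
 also have "2 ^ (3 * N) dvd ..."
 proof (rule dvd_add)
  have "2 ^ (2 * N) dvd odd_power_sum d n" unfolding n_def by (rule odd_power_sum_dvd[OF od])
  moreover have "2 ^ N dvd ?c" by (simp add: y power2_eq_square)
  ultimately have "2 ^ N * 2 ^ (2 * N) dvd ?c * odd_power_sum d n"
   by (intro mult_dvd_mono)
  thus "2 ^ (3 * N) dvd ?c * odd_power_sum d n" by (simp flip: power_add)
  have "y ^ 3 = 2 ^ (3 * N) * 8" unfolding y by (simp add: power_mult_distrib power_mult[symmetric] mult.commute)
  thus "2 ^ (3 * N) dvd y ^ 3 * (\<Sum>t<n. W t)" by simp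
 qed
 finally show ?thesis by (simp add: n_def)
qed

definition osum :: "nat => nat => rat" where
 "osum e N = of_int (odd_power_sum e (2 ^ N)) / 4 ^ N"

text \<open>The normalised sum for the exponent -3, to which exponents \<open>e\<close> tend
  2-adically.\<close>

definition osum_neg3 :: "nat => rat" where
 "osum_neg3 N = (\<Sum>t<2 ^ N. 1 / (2 * of_nat t + 1) ^ 3) / 4 ^ N"

lemma osum_step:
 assumes "odd e" "e \<ge> 3"
 shows "abs2 (osum e (Suc N) - osum e N) \<le> 4 * (1/2) ^ N"
proof -
 obtain k where k: "odd_power_sum e (2 * 2 ^ N) - 4 * odd_power_sum e (2 ^ N) = 2 ^ (3 * N) * k"
  using odd_power_sum_double[OF assms, of N] by (elim dvdE)
 have "osum e (Suc N) - osum e N = of_int (odd_power_sum e (2 * 2 ^ N) - 4 * odd_power_sum e (2 ^ N)) / 4 ^ Suc N"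
  by (simp add: osum_def field_simps)
 also have "... = 2 ^ (3 * N) * of_int k / 2 ^ (2 * Suc N)" unfolding k by (simp add: power_mult)
 finally have "abs2 (osum e (Suc N) - osum e N) = (1/2) ^ (3 * N) * abs2 (of_int k) / (1/2) ^ (2 * Suc N)"
  by (simp only: abs2_mult abs2_divide abs2_two_power)
 also have "... \<le> (1/2) ^ (3 * N) * 1 / (1/2) ^ (2 * Suc N)"
  by (intro divide_right_mono mult_left_mono abs2_of_int_le) auto
 also have "... = 4 * (1/2) ^ N"
 proof -
  have "(1/2 :: real) ^ (3 * N) = (1/2) ^ (2 * N) * (1/2) ^ N" by (simp flip: power_add)
  thus ?thesis by (simp add: power2_eq_square)
 qed
 finally show ?thesis .
qed

text \<open>In an ultrametric the bound for single steps persists for any number of steps.\<close>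

lemma abs2_telescope:
 assumes "\<And>N. abs2 (f (Suc N) - f N) \<le> C * (1/2) ^ N" "C \<ge> 0" "M \<ge> N"
 shows "abs2 (f M - f N) \<le> C * (1/2) ^ N"
 using \<open>M \<ge> N\<close>
proof (induction M rule: dec_induct)
 case (step M)
 have "abs2 (f (Suc M) - f N) \<le> max (abs2 (f (Suc M) - f M)) (abs2 (f M - f N))" by (rule abs2_diff_le)
 moreover have "abs2 (f (Suc M) - f M) \<le> C * (1/2) ^ N"
  by (rule order_trans[OF assms(1)]) (intro mult_left_mono power_decreasing, use step assms in auto)
 ultimately show ?case using step.IH by simp
qed (use assms in simp)

text \<open>The constant 4 is uniform in \<open>e\<close>, unlike the one in
  \<open>zcoeff_limit\<close>. That lemma supplies only the fact of convergence, the rate comes from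
  the telescoped steps: a larger error at \<open>N\<close> would have to persist for all later
  \<open>M\<close>.\<close>

lemma zcoeff_approx:
 assumes "odd e" "e \<ge> 3"
 shows "abs2 (zcoeff e - osum e N) \<le> 4 * (1/2) ^ N"
proof (rule ccontr)
 assume neg: "\<not> ?thesis"
 obtain C where C: "\<And>N. abs2 (osum e N - zcoeff e) \<le> C * (1/2) ^ N"
  using zcoeff_limit[OF assms(1)] unfolding osum_def by blast
 have C0: "C \<ge> 0" using order_trans[OF abs2_nonneg C[of 0]] by simp
 define D where "D = abs2 (zcoeff e - osum e N)"
 have D: "D > 0" "D > 4 * (1/2) ^ N" using neg le_less_trans[of 0 "4 * (1/2) ^ N :: real" D] by (auto simp: D_def)
 have "(\<lambda>M. C * (1/2) ^ M) \<longlonglongrightarrow> C * 0" by (intro tendsto_mult tendsto_const LIMSEQ_realpow_zero) auto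
 hence "\<forall>\<^sub>F M in sequentially. C * (1/2) ^ M < D" using D(1) by (intro order_tendstoD(2)) auto
 then obtain M0 where "\<forall>M\<ge>M0. C * (1/2) ^ M < D" unfolding eventually_sequentially by blast
 then obtain M where M: "M \<ge> N" "C * (1/2) ^ M < D" using that[of "max M0 N"] by simp
 have "D \<le> max (abs2 (zcoeff e - osum e M)) (abs2 (osum e M - osum e N))" unfolding D_def by (rule abs2_diff_le)
 moreover have "abs2 (zcoeff e - osum e M) < D" using C[of M] M(2) by (simp add: abs2_minus_commute)
 moreover have "abs2 (osum e M - osum e N) \<le> 4 * (1/2) ^ N"
  by (rule abs2_telescope[OF osum_step[OF assms]]) (use M in auto)
 ultimately show False using D(2) by linarith
qed

text \<open>\<open>u^(2^(g+1)) - 1\<close> factors as a difference of squares, which adds a factor 2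
  at every step. This allows inverses of odd integers to be traded for large positive
  powers.\<close>

lemma odd_power_two_power:
 fixes u :: int
 assumes "odd u"
 shows "2 ^ g dvd u ^ (2 ^ g * k) - 1"
proof -
 have "2 ^ g dvd u ^ (2 ^ g) - 1"
 proof (induction g)
  case (Suc g)
  have "u ^ (2 ^ Suc g) - 1 = (u ^ (2 ^ g) - 1) * (u ^ (2 ^ g) + 1)"
   by (simp add: power_mult power2_eq_square algebra_simps flip: power_add)
  moreover have "2 dvd u ^ (2 ^ g) + 1" using assms by simp
  ultimately show ?case using mult_dvd_mono[OF Suc] by (metis mult.commute power_Suc)
 qed (use assms in simp)
 moreover have "u ^ (2 ^ g) - 1 dvd (u ^ (2 ^ g)) ^ k - 1"
  using power_diff_1_eq[of "u ^ (2 ^ g)" k] by simp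
 ultimately show ?thesis by (metis dvd_trans power_mult)
qed

text \<open>When \<open>2^g\<close> divides \<open>e + 3\<close>, the powers \<open>u^e\<close> and
  \<open>u^(-3)\<close> of an odd \<open>u\<close> agree modulo \<open>2^g\<close>; the
  normalisation costs the factor \<open>4^N\<close>.\<close>

lemma osum_neg3_approx:
 assumes "e + 3 = 2 ^ g * k"
 shows "abs2 (osum e N - osum_neg3 N) \<le> 4 ^ N * (1/2) ^ g"
proof -
 have "osum e N - osum_neg3 N = (\<Sum>t<2 ^ N. (2 * of_nat t + 1) ^ e - 1 / (2 * of_nat t + 1) ^ 3) / 4 ^ N"
  by (simp add: osum_def osum_neg3_def odd_power_sum_def sum_subtractf diff_divide_distrib)
 hence "abs2 (osum e N - osum_neg3 N) = abs2 (\<Sum>t<2 ^ N. (2 * of_nat t + 1) ^ e - 1 / (2 * of_nat t + 1) ^ 3) / abs2 (2 ^ (2 * N))"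
  by (simp add: abs2_divide power_mult)
 also have "abs2 (\<Sum>t<2 ^ N. (2 * of_nat t + 1) ^ e - 1 / (2 * of_nat t + 1) ^ 3) \<le> (1/2) ^ g"
 proof (rule abs2_sum_le)
  fix t :: nat
  define u where "u = 2 * int t + 1"
  have u: "odd u" "u \<noteq> 0" by (simp_all add: u_def)
  obtain w where w: "u ^ (e + 3) - 1 = 2 ^ g * w" using odd_power_two_power[OF u(1), of g k] assms by auto
  have "(2 * of_nat t + 1 :: rat) ^ e - 1 / (2 * of_nat t + 1) ^ 3 = of_int (u ^ (e + 3) - 1) / of_int (u ^ 3)"
   using u(2) by (simp add: u_def power_add diff_divide_distrib)
  also have "... = 2 ^ g * of_int w / of_int (u ^ 3)" unfolding w by simp
  finally have "abs2 ((2 * of_nat t + 1 :: rat) ^ e - 1 / (2 * of_nat t + 1) ^ 3) = (1/2) ^ g * abs2 (of_int w)"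
   using u(1) abs2_of_int_odd[of "u ^ 3"] by (simp add: abs2_divide abs2_mult abs2_two_power del: of_int_power)
  also have "... \<le> (1/2) ^ g * 1" by (intro mult_left_mono abs2_of_int_le) auto
  finally show "abs2 ((2 * of_nat t + 1 :: rat) ^ e - 1 / (2 * of_nat t + 1) ^ 3) \<le> (1/2) ^ g" by simp
 qed auto
 hence "abs2 (\<Sum>t<2 ^ N. (2 * of_nat t + 1 :: rat) ^ e - 1 / (2 * of_nat t + 1) ^ 3) / abs2 (2 ^ (2 * N)) \<le> (1/2) ^ g / (1/2) ^ (2 * N)"
  unfolding abs2_two_power by (intro divide_right_mono) auto
 also have "... = 4 ^ N * (1/2) ^ g"
 proof -
  have "(1/2 :: real) ^ (2 * N) = 1 / 4 ^ N" by (simp add: power_mult power_one_over power2_eq_square)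
  thus ?thesis by simp
 qed
 finally show ?thesis .
qed

lemma osum_neg3_step: "abs2 (osum_neg3 (Suc N) - osum_neg3 N) \<le> 4 * (1/2) ^ N"
proof -
 \<comment> \<open>Agreement modulo \<open>2^(3 N + 3)\<close> outweighs the loss of
   \<open>4^(N + 1)\<close> in the normalisation at level \<open>N + 1\<close>.\<close>
 define g where "g = 3 * N + 3"
 define e where "e = 2 ^ g * 1 - (3 :: nat)"
 have g2: "(2::nat) ^ g \<ge> 2 ^ 3" by (intro power_increasing) (auto simp: g_def)
 have e: "e + 3 = 2 ^ g * 1" using g2 by (simp add: e_def)
 have oe: "odd e" "e \<ge> 3"
 proof -
  have "even (e + 3)" unfolding e by (simp add: g_def)
  thus "odd e" by simp
  show "e \<ge> 3" using g2 by (simp add: e_def)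
 qed
 have A: "abs2 (osum_neg3 M - osum e M) \<le> 4 * (1/2) ^ N" if "M \<le> Suc N" for M
 proof -
  have "abs2 (osum_neg3 M - osum e M) \<le> 4 ^ M * (1/2) ^ g"
   using osum_neg3_approx[OF e, of M] by (simp add: abs2_minus_commute)
  also have "... \<le> 4 ^ Suc N * (1/2) ^ g" using that by (intro mult_right_mono power_increasing) auto
  also have "... = (4 * 4 ^ N * (1/2) ^ (2 * N)) * ((1/2) ^ N * (1/8))"
  proof -
   have "g = 2 * N + (N + 3)" by (simp add: g_def)
   thus ?thesis by (simp only: power_add power_Suc mult.assoc) (simp add: power3_eq_cube)
  qed
  also have "(4 * 4 ^ N * (1/2) ^ (2 * N)) = (4 :: real)" by (simp add: power_mult power_one_over power2_eq_square)
  also have "4 * ((1/2) ^ N * (1/8)) \<le> 4 * (1/2 :: real) ^ N" by simp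
  finally show ?thesis .
 qed
 have "abs2 (osum_neg3 (Suc N) - osum_neg3 N) \<le> max (abs2 (osum_neg3 (Suc N) - osum e (Suc N))) (abs2 (osum e (Suc N) - osum_neg3 N))"
  by (rule abs2_diff_le)
 also have "... \<le> max (abs2 (osum_neg3 (Suc N) - osum e (Suc N))) (max (abs2 (osum e (Suc N) - osum e N)) (abs2 (osum e N - osum_neg3 N)))"
  by (intro max.mono order_refl abs2_diff_le)
 also have "... \<le> 4 * (1/2) ^ N"
  using A[of "Suc N"] A[of N] osum_step[OF oe, of N] by (simp add: abs2_minus_commute)
 finally show ?thesis .
qed

section \<open>Zeta values at negative odd integers\<close>

lemma connected_punctured_complex: "connected (- {1 :: complex})"
 by (rule connected_punctured_universe) simp

text \<open>The choice in the definition needs a witness, namely the continued series for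
  \<open>c = 1\<close>.\<close>

lemma riemann_zeta:
 "riemann_zeta holomorphic_on - {1}"
 "Re s > 1 ==> (\<lambda>n. of_nat (Suc n) powr (- s)) sums riemann_zeta s"
proof -
 obtain f where f: "f holomorphic_on -{1}" "\<forall>s. Re s > 1 \<longrightarrow> (\<lambda>n. of_real (real n + 1) powr (-s)) sums f s"
  using hurwitz_continuation[of 1] by auto
 have "of_real (real n + 1) = (of_nat (Suc n) :: complex)" for n by simp
 with f(2) have "\<forall>s. Re s > 1 \<longrightarrow> (\<lambda>n. of_nat (Suc n) powr (- s)) sums f s" by (simp only:)
 with f(1) have "\<exists>f. f holomorphic_on - {1} \<and> (\<forall>s. Re s > 1 \<longrightarrow> (\<lambda>n. of_nat (Suc n) powr (- s)) sums f s)"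
  by blast
 from someI_ex[OF this] show "riemann_zeta holomorphic_on - {1}"
  "Re s > 1 ==> (\<lambda>n. of_nat (Suc n) powr (- s)) sums riemann_zeta s"
  unfolding riemann_zeta_def[symmetric] by auto
qed

lemma zeta_star_sums:
 assumes "Re s > 1"
 shows "(\<lambda>n. of_nat (2 * n + 1) powr (- s)) sums zeta_star s"
proof -
 have 1: "(\<lambda>n. of_nat (Suc n) powr (- s)) sums riemann_zeta s" by (rule riemann_zeta(2)[OF assms])
 have "(\<lambda>n. \<Sum>i = n * 2..<n * 2 + 2. of_nat (Suc i) powr (- s)) sums riemann_zeta s"
  by (rule sums_group[OF 1]) simp
 moreover have "(\<Sum>i = n * 2..<n * 2 + 2. of_nat (Suc i) powr (- s)) = of_nat (2 * n + 1) powr (- s) + of_nat (2 * n + 2) powr (- s)" for n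
  by (simp add: numeral_2_eq_2 mult.commute)
 ultimately have "(\<lambda>n. of_nat (2 * n + 1) powr (- s) + of_nat (2 * n + 2) powr (- s)) sums riemann_zeta s" by simp
 moreover have "(\<lambda>n. 2 powr (- s) * of_nat (Suc n) powr (- s)) sums (2 powr (- s) * riemann_zeta s)"
  by (rule sums_mult[OF 1])
 moreover have "2 powr (- s) * of_nat (Suc n) powr (- s) = of_nat (2 * n + 2) powr (- s)" for n
 proof -
  have "of_nat (2 * n + 2) = 2 * (of_nat (Suc n) :: complex)" by simp
  moreover have "(2 * of_nat (Suc n)) powr (- s) = 2 powr (- s) * of_nat (Suc n) powr (- s)"
   by (rule powr_times_real) auto
  ultimately show ?thesis by (simp only:)
 qed
 ultimately have "(\<lambda>n. of_nat (2 * n + 1) powr (- s) + of_nat (2 * n + 2) powr (- s) - of_nat (2 * n + 2) powr (- s)) sums (riemann_zeta s - 2 powr (- s) * riemann_zeta s)"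
  by (intro sums_diff) simp_all
 thus ?thesis by (simp add: zeta_star_def algebra_simps)
qed

text \<open>The odd terms from 3 on are \<open>2 powr (- s)\<close> times the series with
  \<open>c = 3/2\<close>. The term 1 is split off because the continuation is built for
  \<open>c >= 1\<close>, which excludes \<open>c = 1/2\<close>.\<close>

lemma zeta_star_hurwitz:
 assumes h: "h holomorphic_on -{1}" "\<And>s. Re s > 1 ==> (\<lambda>n. of_real (real n + 3/2) powr (-s)) sums h s"
  and s: "s \<noteq> 1"
 shows "zeta_star s = 1 + 2 powr (- s) * h s"
proof (rule analytic_continuation_open[of "{s. Re s > 1}" "- {1}" zeta_star "\<lambda>s. 1 + 2 powr (- s) * h s"])
 show "open {s. Re s > 1}" by (rule open_halfspace_Re_gt)
 show "{s. Re s > 1} \<noteq> {}" by (auto intro!: exI[of _ "2::complex"])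
 show "connected (- {1 :: complex})" by (rule connected_punctured_complex)
 show "{s. Re s > 1} \<subseteq> - {1}" by auto
 show "zeta_star holomorphic_on - {1}"
  unfolding zeta_star_def[abs_def] by (intro holomorphic_intros riemann_zeta(1)) auto
 show "(\<lambda>s. 1 + 2 powr (- s) * h s) holomorphic_on - {1}" by (intro holomorphic_intros h(1)) auto
 show "s \<in> - {1}" using s by simp
 fix z :: complex assume "z \<in> {s. Re s > 1}"
 hence z: "Re z > 1" by simp
 have "(\<lambda>n. 2 powr (- z) * of_real (real n + 3/2) powr (-z)) sums (2 powr (- z) * h z)"
  by (intro sums_mult h(2) z)
 moreover have "2 powr (- z) * of_real (real n + 3/2) powr (-z) = of_nat (2 * Suc n + 1) powr (- z)" for n
 proof -
  have "of_nat (2 * Suc n + 1) = 2 * (of_real (real n + 3/2) :: complex)" by simp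
  moreover have "(2 * of_real (real n + 3/2)) powr (- z) = 2 powr (- z) * of_real (real n + 3/2) powr (- z)"
   by (rule powr_times_real) auto
  ultimately show ?thesis by (simp only:)
 qed
 ultimately have "(\<lambda>n. of_nat (2 * Suc n + 1) powr (- z)) sums (2 powr (- z) * h z)" by simp
 hence "(\<lambda>n. of_nat (2 * n + 1) powr (- z)) sums (2 powr (- z) * h z + of_nat (2 * 0 + 1) powr (- z))"
  by (rule sums_Suc)
 with zeta_star_sums[OF z] have "zeta_star z = 2 powr (- z) * h z + of_nat (2 * 0 + 1) powr (- z)" by (rule sums_unique2)
 thus "zeta_star z = 1 + 2 powr (- z) * h z" by simp
qed auto

lemma em_d_neg_nat: "em_d k (- of_nat e) = of_rat (em_f e k 1)"
proof (cases "k \<le> e + 1")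
 case False
 have "(\<Prod>i<k. 1 - (- of_nat e) - of_nat i :: complex) = 0"
  by (rule prod_zero) (use False in \<open>auto intro!: bexI[of _ "Suc e"]\<close>)
 thus ?thesis using False by (simp add: em_d_def em_f_def)
next
 case True
 have "(\<Prod>i<k. 1 - (- of_nat e) - of_nat i :: complex) = fact (e + 1) / fact (e + 1 - k)" using True
 proof (induction k)
  case (Suc k)
  have "e + 1 - k = Suc (e + 1 - Suc k)" using Suc.prems by simp
  hence f: "fact (e + 1 - k) = (of_nat (e + 1 - k) :: complex) * fact (e + 1 - Suc k)"
   by (metis fact_Suc)
  have n: "1 - - of_nat e - of_nat k = (of_nat (e + 1 - k) :: complex)" using Suc.prems by (simp add: of_nat_diff)
  have "of_nat (e + 1 - k) \<noteq> (0 :: complex)" using Suc.prems by (simp only: of_nat_eq_0_iff diff_is_0_eq not_le)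
  thus ?case using Suc.IH Suc.prems unfolding prod.lessThan_Suc n
  proof -
   have gen: "a / (c * b) * c = a / b" if "c \<noteq> 0" for a b c :: complex using that by simp
   assume a: "k \<le> e + 1 ==> (\<Prod>i<k. 1 - - of_nat e - of_nat i :: complex) = fact (e + 1) / fact (e + 1 - k)" "Suc k \<le> e + 1" "of_nat (e + 1 - k) \<noteq> (0 :: complex)"
   have "(\<Prod>i<k. 1 - - of_nat e - of_nat i :: complex) = fact (e + 1) / (of_nat (e + 1 - k) * fact (e + 1 - Suc k))"
    using a(1)[OF Suc_leD[OF a(2)]] unfolding f .
   thus "(\<Prod>i<k. 1 - - of_nat e - of_nat i :: complex) * of_nat (e + 1 - k) = fact (e + 1) / fact (e + 1 - Suc k)"
    using gen[OF a(3)] by (simp only:)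
  qed
 qed (simp del: fact_Suc of_nat_Suc)
 moreover have "fact (e + 1) = (1 + of_nat e :: complex) * fact e" by simp
 moreover have "1 + of_nat e \<noteq> (0 :: complex)" by (metis of_nat_Suc of_nat_neq_0)
 ultimately show ?thesis using True of_nat_neq_0[where 'a = complex, of e] by (simp add: em_d_def em_f_def of_rat_divide of_rat_fact del: fact_Suc)
qed

text \<open>The continuation yields \<open>1 - 2^e * em_poly e 1\<close>, and the difference
  equation at \<open>x = 1/2\<close> turns this into \<open>- 2^e * em_poly e 0\<close>. The
  constant term of \<open>em_poly e\<close> contains \<open>em_b\<close> at index
  \<open>(e + 1) div 2\<close>, the coefficient that governs the \<open>n^2\<close> term for the
  exponent \<open>e + 2\<close>; hence the shift by 2.\<close>

lemma zeta_star_neg_odd: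
 assumes "odd e"
 shows "zeta_star (- of_nat e) = of_rat (- (zcoeff (e + 2) / of_nat (2 * (e + 1) * (e + 2))))"
proof -
 obtain h where h: "h holomorphic_on -{1}" "\<forall>s. Re s > 1 \<longrightarrow> (\<lambda>n. of_real (real n + 3/2) powr (-s)) sums h s"
   "\<forall>e N. e+1<2*N \<longrightarrow> h (-of_nat e) = - em_G N (-of_nat e) (of_real (3/2-1/2))"
  using hurwitz_continuation[of "3/2"] by auto
 define M where "M = (e + 1) div 2"
 have e: "e + 1 = 2 * M" using assms by (simp add: M_def)
 have one: "complex_of_real (3/2 - 1/2) = 1" by simp
 have "em_G (Suc M) (- of_nat e) 1 = of_rat (em_poly e 1)"
  unfolding em_G_def em_poly_def M_def[symmetric] em_d_neg_nat lessThan_Suc_atMost by (simp add: of_rat_sum of_rat_mult)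
 hence "h (- of_nat e) = - of_rat (em_poly e 1)" using h(3)[rule_format, of e "Suc M"] e unfolding one by simp
 moreover have "zeta_star (- of_nat e) = 1 + 2 powr (- (- of_nat e)) * h (- of_nat e)"
 proof (rule zeta_star_hurwitz[OF h(1)])
  have "Re (- of_nat e) \<noteq> Re 1" by simp
  thus "- of_nat e \<noteq> (1 :: complex)" by metis
 qed (use h(2) in auto)
 ultimately have z: "zeta_star (- of_nat e) = of_rat (1 - 2 ^ e * em_poly e 1)"
  by (simp add: powr_nat' of_rat_diff of_rat_mult of_rat_power)
 have "em_poly e 1 - em_poly e 0 = (1/2) ^ e" using em_poly_diff[OF assms, of "1/2"] by simp
 hence "1 - 2 ^ e * em_poly e 1 = - (2 ^ e * em_poly e 0)" by (simp add: algebra_simps power_one_over)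
 moreover have "em_poly e 0 = em_b M * fact e"
 proof -
  have "em_poly e 0 = (\<Sum>i\<in>{..M}. em_b i * em_f e (2 * i) 0)" by (simp add: em_poly_def M_def)
  also have "... = (\<Sum>i\<in>{M}. em_b i * em_f e (2 * i) 0)"
   by (rule sum.mono_neutral_right) (use e in \<open>auto simp: em_f_def power_0_left\<close>)
  finally show ?thesis using e by (simp add: em_f_def)
 qed
 moreover have "zcoeff (e + 2) / of_nat (2 * (e + 1) * (e + 2)) = 2 ^ e * (em_b M * fact e)"
 proof -
  have "(e + 2 - 1) div 2 = M" by (simp add: M_def)
  moreover have "fact (e + 2) = (of_nat (e + 2) * of_nat (e + 1) * fact e :: rat)" by (simp add: algebra_simps)
  ultimately have "zcoeff (e + 2) = 2 ^ e * (em_b M * fact e) * of_nat (2 * (e + 1) * (e + 2))"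
   by (simp only: zcoeff_def power_add of_nat_mult) (simp add: algebra_simps)
  moreover have "of_nat (2 * (e + 1) * (e + 2)) \<noteq> (0 :: rat)" by (simp only: of_nat_eq_0_iff) simp
  ultimately show ?thesis by (simp only: nonzero_mult_div_cancel_right not_False_eq_True)
 qed
 ultimately show ?thesis using z by simp
qed

lemma zeta_star_rat_neg:
 assumes "j > 0"
 shows "zeta_star_rat (- int j) = - (zcoeff (2 * j + 1) / of_nat (4 * j * (2 * j + 1)))"
proof -
 define e where "e = 2 * j - 1"
 have e: "odd e" "e + 2 = 2 * j + 1" "e + 1 = 2 * j" using assms by (simp_all add: e_def)
 have "of_int (1 + 2 * (- int j)) = (- of_nat e :: complex)" using assms by (simp add: e_def of_nat_diff)
 hence "zeta_star (of_int (1 + 2 * (- int j))) = of_rat (- (zcoeff (2 * j + 1) / of_nat (4 * j * (2 * j + 1))))"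
  using zeta_star_neg_odd[OF e(1)] unfolding e(2,3) by (simp only:) (simp add: algebra_simps)
 thus ?thesis unfolding zeta_star_rat_def by (intro the_equality) auto
qed

lemma abs2_of_int_less:
 assumes "abs2 (of_int k) < (1/2) ^ g"
 shows "2 ^ g dvd k"
proof (cases "k = 0")
 case False
 define v where "v = multiplicity 2 k"
 obtain u where u: "k = 2 ^ v * u" "\<not> 2 dvd u"
  using multiplicity_decompose'[of k 2] False unfolding v_def by auto
 have "abs2 (of_int k) = (1/2) ^ v" using u(2) unfolding u(1) by (simp add: abs2_mult abs2_two_power abs2_of_int_odd)
 with assms have "(1/2 :: real) ^ v < (1/2) ^ g" by simp
 hence "v > g" by (rule power_strict_decreasing_iff[THEN iffD1, rotated -1]) auto
 thus ?thesis using u(1) by (metis dvd_triv_left dvd_trans le_imp_power_dvd less_imp_le)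
qed simp

text \<open>As \<open>j = - m\<close> tends to -2, the exponent \<open>2 j + 1\<close> tends to -3
  and the denominator \<open>w = 4 j (2 j + 1)\<close> to 24. The modulus \<open>2^(3 N + 6)\<close>
  pays for the normalisation \<open>4^N\<close> and for the factor 64 that comes from dividing by 24
  and by \<open>w\<close>, both of valuation 3.\<close>

lemma zeta_star_rat_approx:
 assumes "m < 0" "2 ^ (3 * N + 6) dvd m - 2"
 shows "abs2 (zeta_star_rat m - - (osum_neg3 N / 24)) \<le> 32 * (1/2) ^ N"
proof -
 define g where "g = 3 * N + 6"
 define j where "j = nat (- m)"
 have j: "m = - int j" "j > 0" using assms(1) by (simp_all add: j_def)
 have "2 ^ g dvd - (m - 2)" using assms(2) unfolding g_def by (subst dvd_minus_iff)
 also have "- (m - 2) = int (j + 2)" using j by simp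
 finally have "2 ^ g dvd j + 2" by (metis of_nat_dvd_iff of_nat_numeral of_nat_power)
 then obtain k where k: "j + 2 = 2 ^ g * k" by (elim dvdE)
 define e where "e = 2 * j + 1"
 have e: "odd e" "e \<ge> 3" "e + 3 = 2 ^ g * (2 * k)" using j(2) k by (simp_all add: e_def)
 define w :: int where "w = 4 * int j * (2 * int j + 1)"
 have w24: "w - 24 = 2 ^ (g + 2) * ((2 * int j - 3) * int k)"
 proof -
  have "w - 24 = 4 * ((2 * int j - 3) * int (j + 2))" by (simp add: w_def algebra_simps)
  thus ?thesis unfolding k by (simp add: power_add)
 qed
 have w: "abs2 (of_int w) = 1/8"
 proof -
  have "(2::nat) ^ g = 4 * 2 ^ (g - 2)" by (simp add: g_def numeral_eq_Suc)
  hence "j + 2 = 4 * (2 ^ (g - 2) * k)" using k by simp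
  then obtain l where "j + 2 = 4 * l" by blast
  hence "int j = 2 * (2 * int l - 1)" by simp
  hence "w = 2 ^ 3 * ((2 * int l - 1) * (2 * int j + 1))" by (simp add: w_def)
  hence "of_int w = 2 ^ 3 * (of_int ((2 * int l - 1) * (2 * int j + 1)) :: rat)" by (simp only: of_int_mult of_int_power of_int_numeral)
  moreover have "abs2 (of_int ((2 * int l - 1) * (2 * int j + 1))) = 1" by (rule abs2_of_int_odd) simp
  ultimately show ?thesis by (simp only: abs2_mult abs2_two_power) (simp add: power3_eq_cube)
 qed
 have w0: "(of_int w :: rat) \<noteq> 0" using w abs2_eq_0_iff[of "of_int w"] by (auto simp del: abs2_eq_0_iff)
 have t: "abs2 24 = 1/8"
 proof -
  have "abs2 (2 ^ 3 * of_int 3) = 1/8" unfolding abs2_mult abs2_two_power by (subst abs2_of_int_odd) (auto simp: power3_eq_cube)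
  thus ?thesis by simp
 qed
 have g4: "4 ^ N * (1/2 :: real) ^ g = (1/2) ^ N / 64"
 proof -
  have "g = 2 * N + N + 6" by (simp add: g_def)
  hence "(1/2 :: real) ^ g = (1/2) ^ (2 * N) * (1/2) ^ N / 64" by (simp only: power_add) (simp add: power_one_over)
  also have "(1/2 :: real) ^ (2 * N) = 1 / 4 ^ N" by (simp add: power_mult power_one_over power2_eq_square)
  finally show ?thesis by simp
 qed
 have "zeta_star_rat m - - (osum_neg3 N / 24) = - ((zcoeff e - osum_neg3 N) / of_int w) + osum_neg3 N * (of_int (w - 24) / (24 * of_int w))"
 proof -
  have "zeta_star_rat m = - (zcoeff e / of_int w)"
   using zeta_star_rat_neg[OF j(2)] unfolding j(1) e_def w_def by (simp add: algebra_simps)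
  thus ?thesis using w0 by (simp add: field_simps)
 qed
 also have "abs2 ... \<le> max (abs2 ((zcoeff e - osum_neg3 N) / of_int w)) (abs2 (osum_neg3 N * (of_int (w - 24) / (24 * of_int w))))"
  using abs2_ultra by (metis abs2_minus)
 also have "... \<le> 32 * (1/2) ^ N"
 proof (rule max.boundedI)
  have "abs2 (zcoeff e - osum_neg3 N) \<le> max (abs2 (zcoeff e - osum e N)) (abs2 (osum e N - osum_neg3 N))"
   by (rule abs2_diff_le)
  also have "... \<le> 4 * (1/2) ^ N"
   using zcoeff_approx[OF e(1,2), of N] osum_neg3_approx[OF e(3), of N] zero_le_power[of "1/2::real" N] unfolding g4
   by (intro max.boundedI) linarith+
  finally show "abs2 ((zcoeff e - osum_neg3 N) / of_int w) \<le> 32 * (1/2) ^ N"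
   by (simp add: abs2_divide w)
  have "abs2 (osum_neg3 N) = abs2 (\<Sum>t<2 ^ N. 1 / (2 * of_nat t + 1) ^ 3) / abs2 (2 ^ (2 * N))"
   by (simp add: osum_neg3_def abs2_divide power_mult)
  also have "... \<le> 1 / (1/2) ^ (2 * N)"
   unfolding abs2_two_power
  proof (intro divide_right_mono abs2_sum_le)
   fix t :: nat
   have "abs2 (1 / of_int ((2 * int t + 1) ^ 3)) \<le> 1" unfolding abs2_divide by (subst abs2_of_int_odd) auto
   thus "abs2 (1 / (2 * of_nat t + 1) ^ 3) \<le> 1" by simp
  qed auto
  also have "1 / (1/2) ^ (2 * N) = (4 :: real) ^ N" by (simp add: power_mult power_one_over power2_eq_square)
  finally have 1: "abs2 (osum_neg3 N) \<le> 4 ^ N" .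
  have "abs2 (of_int (w - 24)) = (1/2) ^ (g + 2) * abs2 (of_int ((2 * int j - 3) * int k))"
   unfolding w24 by (simp add: abs2_mult abs2_two_power del: power_add power_Suc)
  also have "... \<le> (1/2) ^ (g + 2) * 1" by (intro mult_left_mono abs2_of_int_le) auto
  also have "(1/2) ^ (g + 2) * 1 \<le> (1/2 :: real) ^ g" by (simp add: power_add)
  finally have 2: "abs2 (of_int (w - 24)) \<le> (1/2) ^ g" .
  have "abs2 (osum_neg3 N * (of_int (w - 24) / (24 * of_int w))) = abs2 (osum_neg3 N) * abs2 (of_int (w - 24)) * 64"
   by (simp add: abs2_mult abs2_divide t w)
  also have "... \<le> 4 ^ N * (1/2) ^ g * 64" using 1 2 by (intro mult_right_mono mult_mono) auto
  also have "... \<le> 32 * (1/2) ^ N" unfolding g4 by simp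
  finally show "abs2 (osum_neg3 N * (of_int (w - 24) / (24 * of_int w))) \<le> 32 * (1/2) ^ N" .
 qed
 finally show ?thesis .
qed

section \<open>Passage to the limit in the 2-adic numbers\<close>

lemma abs_padic2_of_rat: "abs_padic2 (\<lambda>_. r) = of_rat r"
proof -
 have c: "padic2_rel (\<lambda>_. x) (\<lambda>_. x)" for x by (simp add: padic2_rel_def)
 have nat: "abs_padic2 (\<lambda>_. of_nat k) = of_nat k" for k
 proof (induction k)
  case 0
  show ?case using zero_padic2.abs_eq by simp
 next
  case (Suc k)
  have "abs_padic2 (\<lambda>_. 1) + abs_padic2 (\<lambda>_. of_nat k) = abs_padic2 (\<lambda>n. 1 + of_nat k)"
   by (rule plus_padic2.abs_eq) (rule c)+
  thus ?case using Suc one_padic2.abs_eq by simp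
 qed
 have int: "abs_padic2 (\<lambda>_. of_int k) = of_int k" for k
 proof (cases k rule: int_cases2)
  case (nonneg n)
  thus ?thesis using nat by simp
 next
  case (nonpos n)
  have "- abs_padic2 (\<lambda>_. of_nat n) = abs_padic2 (\<lambda>_. - of_nat n)"
   by (rule uminus_padic2.abs_eq) (rule c)
  thus ?thesis using nat nonpos by simp
 qed
 obtain a b where r: "r = of_int a / of_int b" "b \<noteq> 0" by (rule rat_fracE)
 have "abs_padic2 (\<lambda>_. r) * abs_padic2 (\<lambda>_. of_int b) = abs_padic2 (\<lambda>_. r * of_int b)"
  by (rule times_padic2.abs_eq) (rule c)+
 hence "abs_padic2 (\<lambda>_. r) * of_int b = of_int a" using int r by simp
 moreover have "of_int b \<noteq> (0 :: padic2)" using r(2) by simp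
 ultimately show ?thesis unfolding r(1) of_rat_divide by (simp add: eq_divide_eq)
qed

lemma norm2_abs_padic2_diff_le:
 assumes "cauchy2 X" "\<And>n. n \<ge> N ==> abs2 (X n - r) \<le> B"
 shows "norm2 (abs_padic2 X - of_rat r) \<le> B"
proof -
 have c: "padic2_rel X X" "padic2_rel (\<lambda>_. x) (\<lambda>_. x)" for x using assms by (simp_all add: padic2_rel_def)
 have "- of_rat r = abs_padic2 (\<lambda>_. - r)" by (simp add: abs_padic2_of_rat of_rat_minus)
 hence "abs_padic2 X - of_rat r = abs_padic2 X + abs_padic2 (\<lambda>_. - r)" by (simp add: minus_padic2_def)
 also have "... = abs_padic2 (\<lambda>n. X n + - r)" by (rule plus_padic2.abs_eq) (rule c)+
 also have "norm2 ... = lim (\<lambda>n. abs2 (X n + - r))"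
  by (rule norm2.abs_eq) (use cauchy2_add[OF assms(1) cauchy2_const[of "- r"]] in \<open>simp add: padic2_rel_def\<close>)
 also have "... \<le> B"
  by (rule LIMSEQ_le_const2[OF cauchy2_LIMSEQ[OF cauchy2_add]]) (use assms in auto)
 finally show ?thesis .
qed

text \<open>The candidate for the limit is the class of the Cauchy sequence
  \<open>- osum_neg3 N / 24\<close> in the completion. Zeta values at negative \<open>m\<close>
  close to 2 are as near to its \<open>N\<close>-th term as the candidate itself is.\<close>

lemma zeta_2_5_approx: "norm2 (zeta_2_5 - of_rat (- (osum_neg3 N / 24))) \<le> 32 * (1/2) ^ N"
proof -
 define X where "X N = - (osum_neg3 N / 24)" for N
 have t: "abs2 24 = 1/8"
 proof -
  have "abs2 (2 ^ 3 * of_int 3) = 1/8" unfolding abs2_mult abs2_two_power by (subst abs2_of_int_odd) (auto simp: power3_eq_cube)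
  thus ?thesis by simp
 qed
 have X: "abs2 (X M - X N) \<le> 32 * (1/2) ^ N" if "M \<ge> N" for M N
 proof -
  have "abs2 (X M - X N) = abs2 (- ((osum_neg3 M - osum_neg3 N) / 24))" by (simp add: X_def diff_divide_distrib)
  also have "... = 8 * abs2 (osum_neg3 M - osum_neg3 N)" unfolding abs2_minus abs2_divide t by simp
  also have "... \<le> 8 * (4 * (1/2) ^ N)"
   using abs2_telescope[of osum_neg3 4 N M, OF osum_neg3_step] that by simp
  finally show ?thesis by simp
 qed
 have lim0: "\<exists>N. 32 * (1/2) ^ N < e" if "e > 0" for e :: real
  using real_arch_pow_inv[of "e/32" "1/2"] that by (auto simp: field_simps)
 have c: "cauchy2 X"
  unfolding cauchy2_def
 proof (intro allI impI)
  fix e :: real assume "e > 0"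
  then obtain N where N: "32 * (1/2) ^ N < e" using lim0 by blast
  have "abs2 (X m - X n) < e" if "m \<ge> N" "n \<ge> N" for m n
  proof -
   have "abs2 (X m - X n) \<le> max (abs2 (X m - X N)) (abs2 (X N - X n))" by (rule abs2_diff_le)
   thus ?thesis using X[OF that(1)] X[OF that(2)] N by (simp add: abs2_minus_commute[of "X N"])
  qed
  thus "\<exists>N. \<forall>m\<ge>N. \<forall>n\<ge>N. abs2 (X m - X n) < e" by blast
 qed
 define z where "z = abs_padic2 X"
 have z: "norm2 (z - of_rat (X N)) \<le> 32 * (1/2) ^ N" for N
  unfolding z_def by (rule norm2_abs_padic2_diff_le[OF c X])
 have "((\<lambda>m. of_rat (zeta_star_rat m)) \<longlongrightarrow> z) neg_ints_to_2"
 proof (rule tendstoI)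
  fix e :: real assume "e > 0"
  then obtain N where N: "32 * (1/2) ^ N < e" using lim0 by blast
  have "dist (of_rat (zeta_star_rat m)) z < e" if m: "m < 0" "abs2 (of_int (m - 2)) < (1/2) ^ (3 * N + 6)" for m
  proof -
   have "norm2 (of_rat (zeta_star_rat m) - of_rat (X N)) = abs2 (zeta_star_rat m - X N)"
    by (simp add: norm2_of_rat flip: of_rat_diff)
   also have "... \<le> 32 * (1/2) ^ N"
    unfolding X_def by (rule zeta_star_rat_approx[OF m(1) abs2_of_int_less[OF m(2)]])
   finally have 1: "norm2 (of_rat (zeta_star_rat m) - of_rat (X N)) \<le> 32 * (1/2) ^ N" .
   have "dist (of_rat (zeta_star_rat m)) z = norm2 ((of_rat (zeta_star_rat m) - of_rat (X N)) + - (z - of_rat (X N)))"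
    by (simp add: dist_padic2_def)
   also have "... \<le> max (norm2 (of_rat (zeta_star_rat m) - of_rat (X N))) (norm2 (- (z - of_rat (X N))))"
    by (rule norm2_ultra)
   also have "... < e" using 1 z[of N] N unfolding norm2_minus by simp
   finally show ?thesis .
  qed
  thus "\<forall>\<^sub>F m in neg_ints_to_2. dist (of_rat (zeta_star_rat m)) z < e"
   unfolding eventually_neg_ints_to_2 by (intro exI[of _ "(1/2) ^ (3 * N + 6)"]) simp
 qed
 hence "zeta_2_5 = z" unfolding zeta_2_5_def by (rule tendsto_Lim[OF neg_ints_to_2_neq_bot])
 thus ?thesis using z[of N] by (simp add: X_def)
qed

section \<open>Partial fractions and the linear form\<close>

lemma sum_off_diagonal_swap:
 fixes h :: "'b => 'b => 'a::comm_monoid_add"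
 assumes "finite J"
 shows "(\<Sum>j\<in>J. \<Sum>i\<in>J - {j}. h i j) = (\<Sum>j\<in>J. \<Sum>i\<in>J - {j}. h j i)"
proof -
 have 1: "J - {j} = {i. i \<in> J \<and> i \<noteq> j}" for j by auto
 have 2: "J - {j} = {i. i \<in> J \<and> j \<noteq> i}" for j by auto
 show ?thesis
  by (subst 1, subst 2, subst sum.swap_restrict[OF assms assms]) simp
qed

lemma sum_off_diagonal_antisym:
 fixes h :: "'b => 'b => 'a::field_char_0"
 assumes "finite J" "\<And>i j. i \<in> J ==> j \<in> J ==> i \<noteq> j ==> h i j + h j i = 0"
 shows "(\<Sum>j\<in>J. \<Sum>i\<in>J - {j}. h j i) = 0"
proof -
 have "2 * (\<Sum>j\<in>J. \<Sum>i\<in>J - {j}. h j i) = (\<Sum>j\<in>J. \<Sum>i\<in>J - {j}. h j i) + (\<Sum>j\<in>J. \<Sum>i\<in>J - {j}. h i j)"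
  by (simp only: sum_off_diagonal_swap[OF assms(1), of h] mult_2)
 also have "... = (\<Sum>j\<in>J. \<Sum>i\<in>J - {j}. h j i + h i j)" by (simp add: sum.distrib)
 also have "... = 0" by (intro sum.neutral ballI) (use assms(2) in auto)
 finally show ?thesis by simp
qed

lemma square_sum_off_diagonal:
 fixes F :: "'b => 'a::comm_ring_1"
 assumes "finite J" "\<And>i j. i \<in> J ==> j \<in> J ==> i \<noteq> j ==> F j * F i = h j i + h i j"
 shows "(\<Sum>j\<in>J. F j)\<^sup>2 = (\<Sum>j\<in>J. (F j)\<^sup>2 + 2 * (\<Sum>i\<in>J - {j}. h j i))"
proof -
 have "(\<Sum>j\<in>J. F j)\<^sup>2 = (\<Sum>j\<in>J. \<Sum>i\<in>J. F j * F i)"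
  by (simp add: power2_eq_square sum_product)
 also have "... = (\<Sum>j\<in>J. (F j)\<^sup>2 + (\<Sum>i\<in>J - {j}. h j i + h i j))"
 proof (intro sum.cong refl)
  fix j assume j: "j \<in> J"
  have "(\<Sum>i\<in>J. F j * F i) = F j * F j + (\<Sum>i\<in>J - {j}. F j * F i)" by (rule sum.remove[OF assms(1) j])
  also have "(\<Sum>i\<in>J - {j}. F j * F i) = (\<Sum>i\<in>J - {j}. h j i + h i j)"
   by (intro sum.cong refl assms(2)) (use j in auto)
  finally show "(\<Sum>i\<in>J. F j * F i) = (F j)\<^sup>2 + (\<Sum>i\<in>J - {j}. h j i + h i j)" by (simp add: power2_eq_square)
 qed
 also have "... = (\<Sum>j\<in>J. (F j)\<^sup>2 + 2 * (\<Sum>i\<in>J - {j}. h j i))"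
  by (simp only: sum.distrib sum_off_diagonal_swap[OF assms(1), of h] mult_2)
 finally show ?thesis .
qed

text \<open>Near the pole \<open>j\<close>, the remaining terms
  \<open>u i / (w - i)^2 + v i / (w - i)\<close> form a regular function. \<open>pfg\<close> is its
  value at \<open>j\<close> and \<open>pfh\<close> its derivative, the two Taylor coefficients that
  enter the principal part of the square.\<close>

definition pfg :: "int set => (int => 'a) => (int => 'a) => int => 'a::field_char_0" where
 "pfg J u v j = (\<Sum>i\<in>J - {j}. u i / of_int (j - i) ^ 2 + v i / of_int (j - i))"

definition pfh :: "int set => (int => 'a) => (int => 'a) => int => 'a::field_char_0" where
 "pfh J u v j = (\<Sum>i\<in>J - {j}. - 2 * u i / of_int (j - i) ^ 3 - v i / of_int (j - i) ^ 2)"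

text \<open>Products of terms at different poles are separated by
  \<open>1 / (x y) = (1 / x - 1 / y) / (y - x)\<close>. Collecting them at one pole amounts to
  multiplying its principal part by the first-order expansion of the regular part.\<close>

lemma pf_square:
 fixes u v :: "int => 'a::field_char_0"
 assumes J: "finite J" and w: "\<And>j. j \<in> J ==> w \<noteq> of_int j"
 shows "(\<Sum>j\<in>J. u j / (w - of_int j) ^ 2 + v j / (w - of_int j))\<^sup>2 =
  (\<Sum>j\<in>J. (u j)\<^sup>2 / (w - of_int j) ^ 4 + 2 * u j * v j / (w - of_int j) ^ 3
    + ((v j)\<^sup>2 + 2 * u j * pfg J u v j) / (w - of_int j) ^ 2
    + (2 * v j * pfg J u v j + 2 * u j * pfh J u v j) / (w - of_int j))" (is "?L = ?R")
proof -
 define g where "g j i = u i / of_int (j - i) ^ 2 + v i / of_int (j - i)" for j i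
 define g' where "g' j i = - 2 * u i / of_int (j - i) ^ 3 - v i / of_int (j - i) ^ 2" for j i
 define h where "h j i = u j * g j i / (w - of_int j) ^ 2 + (v j * g j i + u j * g' j i) / (w - of_int j)" for j i
 have key: "(u j / (w - of_int j) ^ 2 + v j / (w - of_int j)) * (u i / (w - of_int i) ^ 2 + v i / (w - of_int i)) = h j i + h i j"
  if "i \<in> J" "j \<in> J" "i \<noteq> j" for i j
 proof -
  define x where "x = w - of_int j"
  define y where "y = w - of_int i"
  have xy: "x \<noteq> 0" "y \<noteq> 0" "y \<noteq> x" using w[OF that(1)] w[OF that(2)] that(3) by (auto simp: x_def y_def)
  have d: "of_int (j - i) = y - x" "of_int (i - j) = x - y" by (simp_all add: x_def y_def)
  define a b D where "a = 1 / x" and "b = 1 / y" and "D = 1 / (y - x)"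
  have D': "1 / (x - y) = - D" unfolding D_def by (metis minus_diff_eq minus_divide_right)
  have ab: "a * b = D * (a - b)"
  proof -
   have "a - b = (y - x) * (a * b)" using xy by (simp add: a_def b_def field_simps)
   moreover have "D * (y - x) = 1" using xy by (simp add: D_def)
   ultimately show ?thesis by (metis mult.assoc mult_1)
  qed
  have e: "p / x ^ n = p * a ^ n" "p / x = p * a" "p / y ^ n = p * b ^ n" "p / y = p * b"
   "p / (y - x) = p * D" "p / (y - x) ^ n = p * D ^ n" "p / (x - y) = p * (- D)" "p / (x - y) ^ n = p * (- D) ^ n" for p n
   unfolding D'[symmetric] by (simp_all add: a_def b_def D_def power_one_over)
  have "(u j * a\<^sup>2 + v j * a) * (u i * b\<^sup>2 + v i * b) = h j i + h i j"
   unfolding h_def g_def g'_def d x_def[symmetric] y_def[symmetric] e using ab by algebra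
  thus ?thesis unfolding x_def[symmetric] y_def[symmetric] e .
 qed
 have "?L =
   (\<Sum>j\<in>J. (u j / (w - of_int j) ^ 2 + v j / (w - of_int j))\<^sup>2 + 2 * (\<Sum>i\<in>J - {j}. h j i))"
  by (rule square_sum_off_diagonal[OF J key])
 also have "... = ?R"
 proof (intro sum.cong refl)
  fix j assume "j \<in> J"
  define x where "x = w - of_int j"
  have g: "pfg J u v j = (\<Sum>i\<in>J - {j}. g j i)" "pfh J u v j = (\<Sum>i\<in>J - {j}. g' j i)"
   by (simp_all add: pfg_def pfh_def g_def g'_def)
  have hs: "(\<Sum>i\<in>J - {j}. h j i) = u j * pfg J u v j / x ^ 2 + (v j * pfg J u v j + u j * pfh J u v j) / x"
   unfolding h_def g x_def[symmetric] by (simp add: sum.distrib sum_distrib_left sum_divide_distrib add_divide_distrib)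
  define q where "q = 1 / x"
  have e: "p / x ^ n = p * q ^ n" "p / x = p * q" for p n by (simp_all add: q_def power_one_over)
  have sq: "(U * q ^ 2 + V * q)\<^sup>2 + 2 * (U * G * q ^ 2 + (V * G + U * H) * q)
   = U\<^sup>2 * q ^ 4 + 2 * U * V * q ^ 3 + (V\<^sup>2 + 2 * U * G) * q ^ 2 + (2 * V * G + 2 * U * H) * q" for U V G H
   by (simp add: algebra_simps power2_eq_square power3_eq_cube power4_eq_xxxx)
  show "(u j / (w - of_int j) ^ 2 + v j / (w - of_int j))\<^sup>2 + 2 * (\<Sum>i\<in>J - {j}. h j i) =
    (u j)\<^sup>2 / (w - of_int j) ^ 4 + 2 * u j * v j / (w - of_int j) ^ 3
    + ((v j)\<^sup>2 + 2 * u j * pfg J u v j) / (w - of_int j) ^ 2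
    + (2 * v j * pfg J u v j + 2 * u j * pfh J u v j) / (w - of_int j)"
   unfolding hs x_def[symmetric] e by (rule sq)
 qed
 finally show ?thesis .
qed

text \<open>The square is \<open>O(w^(-2))\<close> at infinity, so its residues sum to 0.
  Algebraically, the contributions of two poles to each other cancel.\<close>

lemma pf_residue_sum:
 fixes u v :: "int => 'a::field_char_0"
 assumes "finite J"
 shows "(\<Sum>j\<in>J. 2 * v j * pfg J u v j + 2 * u j * pfh J u v j) = 0"
proof -
 define h where "h j i = 2 * v j * (u i / of_int (j - i) ^ 2 + v i / of_int (j - i)) + 2 * u j * (- 2 * u i / of_int (j - i) ^ 3 - v i / of_int (j - i) ^ 2)" for j i
 have "(\<Sum>j\<in>J. 2 * v j * pfg J u v j + 2 * u j * pfh J u v j) = (\<Sum>j\<in>J. \<Sum>i\<in>J - {j}. h j i)"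
  by (simp only: pfg_def pfh_def h_def sum_distrib_left sum.distrib[symmetric])
 also have "... = 0"
 proof (rule sum_off_diagonal_antisym[OF assms])
  fix i j :: int assume "i \<noteq> j"
  define D :: 'a where "D = of_int (i - j)"
  have D: "of_int (j - i) = - D" "of_int (i - j) = D" by (simp_all add: D_def)
  define e where "e = 1 / D"
  have q: "p / D = p * e" "p / D ^ 2 = p * e ^ 2" "p / D ^ 3 = p * e ^ 3"
   "p / (- D) = - (p * e)" "p / (- D) ^ 2 = p * e ^ 2" "p / (- D) ^ 3 = - (p * e ^ 3)" for p
   by (simp_all add: e_def power_one_over)
  show "h i j + h j i = 0" unfolding h_def D q by (simp add: algebra_simps)
 qed
 finally show ?thesis .
qed

text \<open>Both sides are the coefficient of \<open>w^(-2)\<close> at infinity of the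
  square.\<close>

lemma pf_second_moment:
 fixes u v :: "int => 'a::field_char_0"
 assumes "finite J"
 shows "(\<Sum>j\<in>J. of_int j * (2 * v j * pfg J u v j + 2 * u j * pfh J u v j) + ((v j)\<^sup>2 + 2 * u j * pfg J u v j)) = (\<Sum>j\<in>J. v j)\<^sup>2" (is "?L = _")
proof -
 define h where "h j i = of_int j * (2 * v j * (u i / of_int (j - i) ^ 2 + v i / of_int (j - i)) + 2 * u j * (- 2 * u i / of_int (j - i) ^ 3 - v i / of_int (j - i) ^ 2))
   + 2 * u j * (u i / of_int (j - i) ^ 2 + v i / of_int (j - i)) - v j * v i" for j i
 have "?L - (\<Sum>j\<in>J. v j)\<^sup>2
  = (\<Sum>j\<in>J. \<Sum>i\<in>J - {j}. h j i)"
 proof -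
  have "(\<Sum>j\<in>J. v j)\<^sup>2 = (\<Sum>j\<in>J. (v j)\<^sup>2 + (\<Sum>i\<in>J - {j}. v j * v i))"
   unfolding power2_eq_square sum_product
   by (intro sum.cong refl) (simp add: sum.remove[OF assms])
  moreover have gen: "c * (2 * v j * sum X S + 2 * u j * sum Y S) + ((v j)\<^sup>2 + 2 * u j * sum X S) - ((v j)\<^sup>2 + sum Z S)
    = (\<Sum>i\<in>S. c * (2 * v j * X i + 2 * u j * Y i) + 2 * u j * X i - Z i)" for c j S and X Y Z :: "int => 'a"
   by (simp add: sum.distrib sum_subtractf flip: sum_distrib_left)
  ultimately show ?thesis
   by (simp only: sum_subtractf[symmetric] pfg_def pfh_def h_def gen)
 qed
 also have "... = 0"
 proof (rule sum_off_diagonal_antisym[OF assms])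
  fix i j :: int assume "i \<noteq> j"
  define D :: 'a where "D = of_int (i - j)"
  have D: "D \<noteq> 0" "of_int (j - i) = - D" "of_int (i - j) = D" "of_int i = of_int j + D"
   using \<open>i \<noteq> j\<close> by (simp_all add: D_def)
  define e where "e = 1 / D"
  have De: "D * e = 1" using D(1) by (simp add: e_def)
  have q: "p / D = p * e" "p / D ^ 2 = p * e ^ 2" "p / D ^ 3 = p * e ^ 3"
   "p / (- D) = - (p * e)" "p / (- D) ^ 2 = p * e ^ 2" "p / (- D) ^ 3 = - (p * e ^ 3)" for p
   by (simp_all add: e_def power_one_over)
  show "h i j + h j i = 0" unfolding h_def D(2,3,4) q using De by algebra
 qed
 finally show ?thesis by simp
qed

text \<open>The fourth power is obtained by squaring twice. The first square has double poles with
  coefficients \<open>(A j)^2\<close> and simple ones with \<open>pf_b1\<close>; \<open>pf_G\<close>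
  and \<open>pf_H\<close> are value and derivative of its regular part at \<open>j\<close>.\<close>

definition pf_b1 :: "int set => (int => 'a) => int => 'a::field_char_0" where
 "pf_b1 J A j = 2 * A j * pfg J (\<lambda>_. 0) A j"

definition pf_G :: "int set => (int => 'a) => int => 'a::field_char_0" where
 "pf_G J A j = pfg J (\<lambda>j. (A j)\<^sup>2) (pf_b1 J A) j"

definition pf_H :: "int set => (int => 'a) => int => 'a::field_char_0" where
 "pf_H J A j = pfh J (\<lambda>j. (A j)\<^sup>2) (pf_b1 J A) j"

text \<open>\<open>pf_c J A i j\<close> and \<open>pf_a J A i j\<close> are the coefficients of \<open>1 / (w - j)^i\<close> in the partial fraction
expansions of \<open>(\<Sum>j\<in>J. A j / (w - j))^4\<close> and of \<open>w\<close> times this function.\<close>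

definition pf_c :: "int set => (int => 'a) => nat => int => 'a::field_char_0" where
 "pf_c J A i j =
  (if i = 4 then A j ^ 4 else
   if i = 3 then 2 * (A j)\<^sup>2 * pf_b1 J A j else
   if i = 2 then (pf_b1 J A j)\<^sup>2 + 2 * (A j)\<^sup>2 * pf_G J A j else
   if i = 1 then 2 * pf_b1 J A j * pf_G J A j + 2 * (A j)\<^sup>2 * pf_H J A j else 0)"

definition pf_a :: "int set => (int => 'a) => nat => int => 'a::field_char_0" where
 "pf_a J A i j = of_int j * pf_c J A i j + pf_c J A (i + 1) j"

lemma sum_1_4: "(\<Sum>i=1..4. F i) = F 4 + F 3 + F 2 + F (1 :: nat)"
 for F :: "nat => 'a::comm_monoid_add"
 by (simp add: eval_nat_numeral add_ac)

lemma pf_fourth_power: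
 assumes J: "finite J" and w: "\<And>j. j \<in> J ==> w \<noteq> of_int j"
 shows "(\<Sum>j\<in>J. A j / (w - of_int j)) ^ 4 = (\<Sum>j\<in>J. \<Sum>i=1..4. pf_c J A i j / (w - of_int j) ^ i)"
proof -
 have "(\<Sum>j\<in>J. A j / (w - of_int j))\<^sup>2 = (\<Sum>j\<in>J. (A j)\<^sup>2 / (w - of_int j) ^ 2 + pf_b1 J A j / (w - of_int j))"
  using pf_square[OF J w, of "\<lambda>_. 0" A] by (simp add: pf_b1_def)
 hence "(\<Sum>j\<in>J. A j / (w - of_int j)) ^ 4 = (\<Sum>j\<in>J. (A j)\<^sup>2 / (w - of_int j) ^ 2 + pf_b1 J A j / (w - of_int j))\<^sup>2"
  by (metis power_mult numeral_Bit0_eq_double mult_2 power_even_eq)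
 also have "... = (\<Sum>j\<in>J. \<Sum>i=1..4. pf_c J A i j / (w - of_int j) ^ i)"
  unfolding pf_square[OF J w, of "\<lambda>j. (A j)\<^sup>2" "pf_b1 J A", simplified]
  by (intro sum.cong refl) (simp only: sum_1_4, simp add: pf_c_def pf_G_def pf_H_def)
 finally show ?thesis .
qed

lemma pf_c1_sum: "finite J ==> (\<Sum>j\<in>J. pf_c J A 1 j) = 0"
 unfolding pf_c_def pf_G_def pf_H_def using pf_residue_sum[of J "pf_b1 J A"] by simp

text \<open>The residues of \<open>w * r^4\<close> sum to the coefficient of \<open>w^(-2)\<close>
  of \<open>r^4\<close>, which is the square of the sum of the residues of \<open>r^2\<close> and
  therefore 0.\<close>

lemma pf_a1_sum:
 assumes "finite J"
 shows "(\<Sum>j\<in>J. pf_a J A 1 j) = 0"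
proof -
 have "(\<Sum>j\<in>J. pf_a J A 1 j) = (\<Sum>j\<in>J. pf_b1 J A j)\<^sup>2"
  unfolding pf_a_def pf_c_def pf_G_def pf_H_def
  using pf_second_moment[OF assms, of "pf_b1 J A" "\<lambda>j. (A j)\<^sup>2"] by simp
 also have "(\<Sum>j\<in>J. pf_b1 J A j) = 0"
  using pf_residue_sum[OF assms, of A "\<lambda>_. 0"] by (simp add: pf_b1_def)
 finally show ?thesis by simp
qed

text \<open>Writing \<open>w\<close> as \<open>(w - j) + j\<close> shifts the coefficients by one
  order; the constant that splits off is the sum of the residues of \<open>r^4\<close>, which is
  0.\<close>

lemma pf_expansion:
 assumes J: "finite J" and w: "\<And>j. j \<in> J ==> w \<noteq> of_int j"
 shows "w * (\<Sum>j\<in>J. A j / (w - of_int j)) ^ 4 = (\<Sum>j\<in>J. \<Sum>i=1..4. pf_a J A i j / (w - of_int j) ^ i)"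
proof -
 have X: "w * (\<Sum>i=1..4. pf_c J A i j / (w - of_int j) ^ i) = pf_c J A 1 j + (\<Sum>i=1..4. pf_a J A i j / (w - of_int j) ^ i)"
  if "j \<in> J" for j
 proof -
  define x where "x = w - of_int j"
  have x: "x \<noteq> 0" using w[OF that] by (simp add: x_def)
  have 1: "w * (c / x ^ Suc i) = c / x ^ i + of_int j * c / x ^ Suc i" for c i
  proof -
   have "w = x + of_int j" by (simp add: x_def)
   thus ?thesis using x by (simp add: distrib_right add_divide_distrib)
  qed
  have "w * (\<Sum>i=1..4. pf_c J A i j / x ^ i) = w * (\<Sum>i<4. pf_c J A (Suc i) j / x ^ Suc i)"
   by (simp only: One_nat_def sum.atLeast1_atMost_eq)
  also have "... = (\<Sum>i<4. pf_c J A (Suc i) j / x ^ i) + (\<Sum>i<4. of_int j * pf_c J A (Suc i) j / x ^ Suc i)"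
   unfolding sum_distrib_left 1 by (rule sum.distrib)
  also have "(\<Sum>i<4. pf_c J A (Suc i) j / x ^ i) = pf_c J A 1 j + (\<Sum>i<4. pf_c J A (Suc (Suc i)) j / x ^ Suc i)"
  proof -
   have S: "(\<Sum>i<4. F i) = F 0 + F 1 + F 2 + F 3" for F :: "nat => 'a" by (simp add: numeral_eq_Suc)
   have "pf_c J A 5 j = 0" by (simp add: pf_c_def)
   thus ?thesis unfolding S by (simp add: eval_nat_numeral)
  qed
  finally show ?thesis
   by (simp only: One_nat_def sum.atLeast1_atMost_eq x_def[symmetric] pf_a_def add_divide_distrib sum.distrib) (simp add: add_ac)
 qed
 have "w * (\<Sum>j\<in>J. A j / (w - of_int j)) ^ 4 = w * (\<Sum>j\<in>J. \<Sum>i=1..4. pf_c J A i j / (w - of_int j) ^ i)"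
  by (simp only: pf_fourth_power[OF J w])
 also have "... = (\<Sum>j\<in>J. w * (\<Sum>i=1..4. pf_c J A i j / (w - of_int j) ^ i))"
  by (rule sum_distrib_left)
 also have "... = (\<Sum>j\<in>J. pf_c J A 1 j + (\<Sum>i=1..4. pf_a J A i j / (w - of_int j) ^ i))"
  by (rule sum.cong[OF refl X])
 also have "... = (\<Sum>j\<in>J. pf_c J A 1 j) + (\<Sum>j\<in>J. \<Sum>i=1..4. pf_a J A i j / (w - of_int j) ^ i)"
  by (rule sum.distrib)
 finally have "w * (\<Sum>j\<in>J. A j / (w - of_int j)) ^ 4 = ..." .
 thus ?thesis using pf_c1_sum[OF J, of A] by simp
qed

lemma sum_reflect:
 fixes f :: "int => 'a::comm_monoid_add"
 assumes "\<forall>i\<in>J. - i \<in> J"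
 shows "(\<Sum>i\<in>J - {- j}. f i) = (\<Sum>i\<in>J - {j}. f (- i))"
 by (rule sum.reindex_bij_witness[of _ uminus uminus]) (use assms in auto)

context
 fixes J :: "int set" and A :: "int => 'a::field_char_0"
 assumes J: "\<forall>i\<in>J. - i \<in> J" and even_A: "\<And>j. A (- j) = A j"
begin

lemma pf_b1_minus: "pf_b1 J A (- j) = - pf_b1 J A j"
proof -
 have "pfg J (\<lambda>_. 0) A (- j) = - pfg J (\<lambda>_. 0) A j"
  unfolding pfg_def sum_reflect[OF J] sum_negf[symmetric]
  by (intro sum.cong refl) (simp add: even_A minus_divide_right)
 thus ?thesis by (simp add: pf_b1_def even_A)
qed

lemma pf_G_minus: "pf_G J A (- j) = pf_G J A j"
proof -
 have 1: "of_int (- j - - i) = - (of_int (j - i) :: 'a)" for i by simp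
 show ?thesis
  unfolding pf_G_def pfg_def sum_reflect[OF J] 1 even_A pf_b1_minus by (intro sum.cong refl) (simp del: minus_diff_eq of_int_diff)
qed

lemma pf_H_minus: "pf_H J A (- j) = - pf_H J A j"
proof -
 have 1: "of_int (- j - - i) = - (of_int (j - i) :: 'a)" for i by simp
 show ?thesis
 unfolding pf_H_def pfh_def sum_reflect[OF J] sum_negf[symmetric] 1 even_A pf_b1_minus
  by (intro sum.cong refl) (simp del: minus_diff_eq of_int_diff)
qed

lemma pf_c_minus: "pf_c J A i (- j) = (-1) ^ i * pf_c J A i j"
proof -
 consider "i = 1" | "i = 2" | "i = 3" | "i = 4" | "i \<notin> {1,2,3,4}" by blast
 thus ?thesis
  by cases (simp_all add: pf_c_def even_A pf_b1_minus pf_G_minus pf_H_minus)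
qed

lemma pf_a_minus: "pf_a J A i (- j) = (-1) ^ (i + 1) * pf_a J A i j"
 by (simp add: pf_a_def pf_c_minus algebra_simps)

text \<open>For even \<open>A\<close> the function \<open>w * r^4\<close> is odd, so its
  coefficients of even order at \<open>j\<close> and \<open>- j\<close> are opposite.\<close>

lemma pf_a_sum_even:
 assumes "even i"
 shows "(\<Sum>j\<in>J. pf_a J A i j) = 0"
proof -
 have "(\<Sum>j\<in>J. pf_a J A i j) = (\<Sum>j\<in>J. pf_a J A i (- j))"
  by (rule sum.reindex_bij_witness[of _ uminus uminus]) (use J in auto)
 also have "... = - (\<Sum>j\<in>J. pf_a J A i j)" using assms by (simp add: pf_a_minus sum_negf)
 finally have "2 * (\<Sum>j\<in>J. pf_a J A i j) = 0" by (metis mult_2 add.right_inverse)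
 thus ?thesis by simp
qed

end

text \<open>The second derivative at \<open>x\<close> of the principal part of
  \<open>w * r^4\<close> at the pole \<open>j\<close>.\<close>

definition pf_D :: "int set => (int => 'a) => int => 'a => 'a::field_char_0" where
 "pf_D J A j x = (\<Sum>i=1..4. pf_a J A i j * of_nat (i * (i + 1)) / (x - of_int j) ^ (i + 2))"

definition rho3 :: "nat => (int => rat) => rat" where
 "rho3 nu A = (\<Sum>j\<in>{- int nu..int nu}. pf_a {- int nu..int nu} A 3 j)"

text \<open>The boundary terms left when the sums of \<open>1 / (t + 1/2 - j)^i\<close> over
  \<open>t\<close> are shifted back to \<open>j = 0\<close>. Only \<open>j > 0\<close> is listed:
  \<open>j\<close> and \<open>- j\<close> contribute equally and together absorb the 1/2 of the
  Taylor formula.\<close>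

definition rho0 :: "nat => (int => rat) => rat" where
 "rho0 nu A = - 2 * (\<Sum>j=1..nu. \<Sum>s<j. pf_D {- int nu..int nu} A (int j) (of_nat s + 1/2))"

text \<open>A zero of \<open>r\<close> makes \<open>w * r^4\<close> vanish to order 4, hence also
  its second derivative, which the sum expresses through partial fractions. Derivatives are taken
  over the reals; \<open>of_rat_pf\<close> carries the identity back to the rationals.\<close>

lemma pf_D_sum_eq_0_real:
 fixes A :: "int => real"
 assumes J: "finite J" and x: "\<And>j. j \<in> J ==> x \<noteq> of_int j" and zero: "(\<Sum>j\<in>J. A j / (x - of_int j)) = 0"
 shows "(\<Sum>j\<in>J. pf_D J A j x) = 0"
proof -
 define U where "U = - (of_int ` J :: real set)"
 have U: "open U" "x \<in> U" using J x by (auto simp: U_def intro!: open_Compl finite_imp_closed)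
 have ne: "w - of_int j \<noteq> 0" if "w \<in> U" "j \<in> J" for w j using that by (auto simp: U_def)
 define s where "s i w = (\<Sum>j\<in>J. A j / (w - of_int j) ^ i)" for i :: nat and w
 define G where "G w = w * s 1 w ^ 4" for w
 define G1 where "G1 w = s 1 w ^ 4 - 4 * w * s 1 w ^ 3 * s 2 w" for w
 have inv: "((\<lambda>w. b / (w - of_int j) ^ i) has_field_derivative (- (of_nat i * b / (w - of_int j) ^ (i + 1)))) (at w)"
  if "w \<in> U" "j \<in> J" for w b i j
 proof (cases i)
  case (Suc m)
  define y where "y = w - of_int j"
  have y: "y \<noteq> 0" using ne[OF that] by (simp add: y_def)
  have "((\<lambda>w. b / (w - of_int j) ^ Suc m) has_field_derivative - (b * (of_nat (Suc m) * y ^ m)) / (y ^ Suc m * y ^ Suc m)) (at w)"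
  proof -
   have "((\<lambda>w. w - of_int j) has_field_derivative 1) (at w)" by (auto intro!: derivative_eq_intros)
   from DERIV_power[OF this, of "Suc m"]
   have "((\<lambda>w. (w - of_int j) ^ Suc m) has_field_derivative of_nat (Suc m) * y ^ m) (at w)" by (simp add: y_def)
   from DERIV_quotient[OF DERIV_const[of b] this] y
   show ?thesis by (simp add: y_def mult.commute)
  qed
  moreover have "- (b * (of_nat (Suc m) * y ^ m)) / (y ^ Suc m * y ^ Suc m) = - (of_nat (Suc m) * b / y ^ (Suc m + 1))"
   using y by (simp add: field_simps del: of_nat_Suc)
  ultimately show ?thesis unfolding Suc y_def by simp
 qed simp
 have ds: "(s i has_field_derivative (- (of_nat i * s (i + 1) w))) (at w)" if "w \<in> U" for w i
  unfolding s_def[abs_def] sum_distrib_left sum_negf[symmetric]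
  by (intro DERIV_sum) (use inv[OF that] in \<open>simp add: mult.assoc\<close>)
 have P: "((\<lambda>w. \<Sum>j\<in>J. \<Sum>i=1..4. b i j / (w - of_int j) ^ (i + k)) has_field_derivative
   (\<Sum>j\<in>J. \<Sum>i=1..4. - (of_nat (i + k) * b i j / (w - of_int j) ^ (i + k + 1)))) (at w)" if "w \<in> U" for w b k
  by (intro DERIV_sum inv[OF that])
 have dG: "(G has_field_derivative G1 w) (at w)" if "w \<in> U" for w
  unfolding G_def[abs_def] G1_def
  by (rule derivative_eq_intros ds[OF that] refl)+ (simp add: algebra_simps numeral_2_eq_2)
 have dG1: "(G1 has_field_derivative 0) (at x)"
 proof -
  have s0: "s 1 x = 0" using zero by (simp add: s_def)
  have "(G1 has_field_derivative (4 * s 1 x ^ 3 * (- (of_nat 1 * s (1 + 1) x)) - ((4 * x) * (3 * s 1 x ^ 2 * (- (of_nat 1 * s (1 + 1) x)) * s 2 x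
    + s 1 x ^ 3 * (- (of_nat 2 * s (2 + 1) x))) + 4 * (s 1 x ^ 3 * s 2 x)))) (at x)"
   unfolding G1_def[abs_def] mult.assoc[of _ "s 1 _ ^ 3"]
   by (rule derivative_eq_intros ds[OF U(2)] refl)+ (simp add: algebra_simps)
  thus ?thesis unfolding s0 by simp
 qed
 define P0 where "P0 w = (\<Sum>j\<in>J. \<Sum>i=1..4. pf_a J A i j / (w - of_int j) ^ (i + 0))" for w
 define P1 where "P1 w = (\<Sum>j\<in>J. \<Sum>i=1..4. - (of_nat (i + 0) * pf_a J A i j) / (w - of_int j) ^ (i + 1))" for w
 have dP0: "(P0 has_field_derivative P1 w) (at w)" if "w \<in> U" for w
  using P[OF that, of "pf_a J A" 0] unfolding P0_def[abs_def] P1_def by simp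
 have dP1: "(P1 has_field_derivative (\<Sum>j\<in>J. pf_D J A j x)) (at x)"
 proof -
  have "(P1 has_field_derivative (\<Sum>j\<in>J. \<Sum>i=1..4. - (of_nat (i + 1) * - (of_nat (i + 0) * pf_a J A i j) / (x - of_int j) ^ (i + 1 + 1)))) (at x)"
   unfolding P1_def[abs_def] by (rule P[OF U(2)])
  also have "(\<Sum>j\<in>J. \<Sum>i=1..4. - (of_nat (i + 1) * - (of_nat (i + 0) * pf_a J A i j) / (x - of_int j) ^ (i + 1 + 1))) = (\<Sum>j\<in>J. pf_D J A j x)"
  proof -
   have "- (of_nat (i + 1) * - (of_nat (i + 0) * b) / X) = b * of_nat (i * (i + 1)) / X" for i and b X :: real
   proof -
    have "of_nat (i + 1) * - (of_nat (i + 0) * b) = - (b * of_nat (i * (i + 1)))" by (simp add: algebra_simps)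
    thus ?thesis by (simp only: minus_divide_left[symmetric] minus_minus)
   qed
   moreover have "(i + 1 + 1 :: nat) = i + 2" for i by simp
   ultimately show ?thesis unfolding pf_D_def by (simp only:)
  qed
  finally show ?thesis .
 qed
 have GP: "P0 w = G w" if "w \<in> U" for w
  unfolding P0_def G_def s_def using pf_expansion[OF J, of w A] ne[OF that] by auto
 have GP1: "P1 w = G1 w" if "w \<in> U" for w
 proof (rule DERIV_unique[OF dP0[OF that]])
  show "(P0 has_field_derivative G1 w) (at w)"
   by (rule has_field_derivative_transform_within_open[OF dG[OF that] U(1) that]) (simp add: GP)
 qed
 show ?thesis
 proof (rule DERIV_unique[OF dP1])
  show "(P1 has_field_derivative 0) (at x)"
   by (rule has_field_derivative_transform_within_open[OF dG1 U]) (simp add: GP1)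
 qed
qed

lemma of_rat_pf:
 fixes A :: "int => rat"
 shows "of_rat (pf_a J A i j) = pf_a J (\<lambda>j. of_rat (A j) :: real) i j"
  "of_rat (pf_D J A j x) = pf_D J (\<lambda>j. of_rat (A j) :: real) j (of_rat x)"
proof -
 have g: "of_rat (pfg J u v j) = pfg J (\<lambda>j. of_rat (u j) :: real) (\<lambda>j. of_rat (v j)) j" for u v j
  by (simp add: pfg_def of_rat_sum of_rat_add of_rat_divide of_rat_power of_rat_diff)
 have h: "of_rat (pfh J u v j) = pfh J (\<lambda>j. of_rat (u j) :: real) (\<lambda>j. of_rat (v j)) j" for u v j
  by (simp add: pfh_def of_rat_sum of_rat_add of_rat_divide of_rat_power of_rat_diff of_rat_mult of_rat_minus)
 have b: "of_rat (pf_b1 J A j) = pf_b1 J (\<lambda>j. of_rat (A j) :: real) j" for j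
  by (simp add: pf_b1_def g of_rat_mult)
 have c: "of_rat (pf_c J A i j) = pf_c J (\<lambda>j. of_rat (A j) :: real) i j" for i j
  by (simp add: pf_c_def pf_G_def pf_H_def g h b of_rat_mult of_rat_power of_rat_add)
 show a: "of_rat (pf_a J A i j) = pf_a J (\<lambda>j. of_rat (A j) :: real) i j" for i j
  by (simp add: pf_a_def c of_rat_mult of_rat_add)
 show "of_rat (pf_D J A j x) = pf_D J (\<lambda>j. of_rat (A j) :: real) j (of_rat x)"
  by (simp add: pf_D_def a of_rat_sum of_rat_mult of_rat_add of_rat_divide of_rat_power of_rat_diff)
qed

lemma pf_D_sum_eq_0:
 fixes A :: "int => rat"
 assumes J: "finite J" and x: "\<And>j. j \<in> J ==> x \<noteq> of_int j" and zero: "(\<Sum>j\<in>J. A j / (x - of_int j)) = 0"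
 shows "(\<Sum>j\<in>J. pf_D J A j x) = 0"
proof -
 have "(of_rat (\<Sum>j\<in>J. A j / (x - of_int j)) :: real) = 0" using zero by simp
 hence z: "(\<Sum>j\<in>J. of_rat (A j) / (of_rat x - of_int j) :: real) = 0"
  by (simp add: of_rat_sum of_rat_divide of_rat_diff)
 have "(of_rat x :: real) \<noteq> of_int j" if "j \<in> J" for j
  using x[OF that] by (metis of_rat_eq_iff of_rat_of_int_eq)
 from pf_D_sum_eq_0_real[OF J this z] have "(of_rat (\<Sum>j\<in>J. pf_D J A j x) :: real) = 0"
  by (simp add: of_rat_sum of_rat_pf)
 thus ?thesis by simp
qed

text \<open>Negative powers of \<open>y\<close> and \<open>y + h\<close> are 2-adically at most 1,
  and \<open>i (i + 1) / 2\<close> is an integer, so multiplying the expansion for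
  \<open>i + 1\<close> by \<open>y + h\<close> reproduces the one for \<open>i\<close> up to a term
  of size \<open>h^3\<close>.\<close>

lemma inverse_power_Taylor2:
 fixes y h :: rat
 assumes y: "abs2 y \<ge> 1" "abs2 (y + h) \<ge> 1"
 shows "abs2 (1 / (y + h) ^ i - (1 / y ^ i - of_nat i * h / y ^ (i + 1) + of_nat (i * (i + 1)) / 2 * h\<^sup>2 / y ^ (i + 2))) \<le> abs2 h ^ 3"
proof (induction i)
 case (Suc i)
 define L where "L i = 1 / y ^ i - of_nat i * h / y ^ (i + 1) + of_nat (i * (i + 1)) / 2 * h\<^sup>2 / y ^ (i + 2)" for i
 define t :: rat where "t = of_nat (Suc i * (Suc i + 1)) / 2"
 have ne: "y \<noteq> 0" "y + h \<noteq> 0" using y by (metis abs2_0 not_one_le_zero)+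
 have key: "L i - (y + h) * L (Suc i) = - (t * h ^ 3 / y ^ (i + 3))"
 proof -
  define q where "q = 1 / y"
  define z where "z = q ^ i"
  have yq: "y * q = 1" using ne by (simp add: q_def)
  have e: "p / y ^ n = p * q ^ n" for p n by (simp add: q_def power_one_over)
  define c where "c = of_nat (i * (i + 1)) / (2 :: rat)"
  have "L i = z - of_nat i * h * (z * q) + c * h\<^sup>2 * (z * q\<^sup>2)"
   unfolding L_def e c_def by (simp add: z_def power_add power2_eq_square)
  moreover have "L (Suc i) = z * q - of_nat (Suc i) * h * (z * q\<^sup>2) + t * h\<^sup>2 * (z * q ^ 3)"
   unfolding L_def e t_def by (simp add: z_def power_add power2_eq_square power3_eq_cube)
  moreover have "t * h ^ 3 / y ^ (i + 3) = t * h ^ 3 * (z * q ^ 3)"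
   unfolding e by (simp add: z_def power_add)
  moreover have X: "(y + h) * (z * q - of_nat (Suc i) * h * (z * q\<^sup>2) + t * h\<^sup>2 * (z * q ^ 3))
    = z * (y * q) - of_nat (Suc i) * h * (z * q) * (y * q) + t * h\<^sup>2 * (z * q\<^sup>2) * (y * q)
     + h * (z * q) - of_nat (Suc i) * h\<^sup>2 * (z * q\<^sup>2) + t * h ^ 3 * (z * q ^ 3)"
   by (simp add: algebra_simps power2_eq_square power3_eq_cube)
  moreover have "t = c + of_nat (Suc i)" by (simp add: t_def c_def field_simps)
  ultimately show ?thesis
  proof -
   assume a: "L i = z - of_nat i * h * (z * q) + c * h\<^sup>2 * (z * q\<^sup>2)"
    "L (Suc i) = z * q - of_nat (Suc i) * h * (z * q\<^sup>2) + t * h\<^sup>2 * (z * q ^ 3)"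
    "t * h ^ 3 / y ^ (i + 3) = t * h ^ 3 * (z * q ^ 3)" "t = c + of_nat (Suc i)"
   show ?thesis unfolding a(1,2,3) X yq unfolding a(4) by (simp add: algebra_simps)
  qed
 qed
 have "1 / (y + h) ^ Suc i - L (Suc i) = 1 / (y + h) * ((1 / (y + h) ^ i - L i) + (L i - (y + h) * L (Suc i)))"
 proof -
  define v where "v = y + h"
  have "v \<noteq> 0" using ne by (simp add: v_def)
  thus ?thesis unfolding v_def[symmetric] by (simp add: right_diff_distrib)
 qed
 hence "abs2 (1 / (y + h) ^ Suc i - L (Suc i)) = 1 / abs2 (y + h) * abs2 ((1 / (y + h) ^ i - L i) + - (t * h ^ 3 / y ^ (i + 3)))"
  unfolding key by (simp add: abs2_mult abs2_divide)
 also have "... \<le> 1 * abs2 h ^ 3"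
 proof (intro mult_mono)
  show "1 / abs2 (y + h) \<le> 1" using y(2) by (simp add: divide_le_eq)
  have "t = of_int (int ((Suc i * (Suc i + 1)) div 2))"
  proof -
   have "even (Suc i * (Suc i + 1))" by simp
   then obtain m where "Suc i * (Suc i + 1) = 2 * m" by (elim evenE)
   thus ?thesis unfolding t_def by simp
  qed
  hence t: "abs2 t \<le> 1" using abs2_of_int_le by metis
  have "abs2 (t * h ^ 3 / y ^ (i + 3)) = abs2 t * abs2 h ^ 3 * (1 / abs2 y ^ (i + 3))"
   by (simp add: abs2_mult abs2_divide abs2_power)
  also have "... \<le> 1 * abs2 h ^ 3 * 1"
   by (intro mult_mono t) (use y(1) in \<open>auto simp: divide_le_eq one_le_power\<close>)
  finally have "abs2 (- (t * h ^ 3 / y ^ (i + 3))) \<le> abs2 h ^ 3" by simp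
  thus "abs2 ((1 / (y + h) ^ i - L i) + - (t * h ^ 3 / y ^ (i + 3))) \<le> abs2 h ^ 3"
   using Suc.IH abs2_ultra[of "1 / (y + h) ^ i - L i" "- (t * h ^ 3 / y ^ (i + 3))"] unfolding L_def by linarith
 qed auto
 finally show ?case unfolding L_def by simp
qed simp

section \<open>Asymptotics of sums over shifted half-integers\<close>

lemma sum_shift_int_up:
 fixes f :: "int => 'a::ab_group_add"
 shows "(\<Sum>t<n. f (int t + int j)) = (\<Sum>t<n. f (int t)) + (\<Sum>s<j. f (int s + int n) - f (int s))"
proof (induction j)
 case (Suc j)
 have "(\<Sum>t<n. f (int t + int (Suc j))) = (\<Sum>t<n. f (int t + int j)) + (f (int j + int n) - f (int j))"
  by (induction n) (simp_all add: algebra_simps)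
 thus ?case using Suc by (simp add: algebra_simps)
qed simp

lemma sum_shift_int_down:
 fixes f :: "int => 'a::ab_group_add"
 shows "(\<Sum>t<n. f (int t - int j)) = (\<Sum>t<n. f (int t)) + (\<Sum>s<j. f (- 1 - int s) - f (- 1 - int s + int n))"
proof (induction j)
 case (Suc j)
 have "(\<Sum>t<n. f (int t - int (Suc j))) = (\<Sum>t<n. f (int t - int j)) + (f (- 1 - int j) - f (- 1 - int j + int n))"
  by (induction n) (simp_all add: algebra_simps)
 thus ?case using Suc by (simp add: algebra_simps)
qed simp

lemma abs2_half_odd: "abs2 (of_int k + 1/2) = 2"
proof -
 have "(of_int k + 1/2 :: rat) = of_int (2 * k + 1) / 2" by (simp add: field_simps)
 also have "abs2 ... = 2" by (simp only: abs2_divide abs2_2) (subst abs2_of_int_odd; simp)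
 finally show ?thesis .
qed

text \<open>Shifting the range by \<open>j\<close> costs \<open>j\<close> boundary differences
  across a distance \<open>n\<close>, expanded to second order in \<open>n\<close>. The boundary
  points for \<open>j\<close> and \<open>- j\<close> are opposite, so with the weights
  \<open>a\<close> and \<open>(-1)^(i + 1) a\<close> the linear terms cancel, while the quadratic
  ones add up.\<close>

lemma pole_pair_asymptotics:
 fixes a :: rat
 defines "f \<equiv> \<lambda>i (t :: int). 1 / (of_int t + 1/2 :: rat) ^ i"
 shows "abs2 (a * (\<Sum>t<n. f i (int t - int j)) + ((-1) ^ (i + 1) * a) * (\<Sum>t<n. f i (int t + int j))
   - ((a + (-1) ^ (i + 1) * a) * (\<Sum>t<n. f i (int t))
    - of_nat n ^ 2 * (\<Sum>s<j. a * of_nat (i * (i + 1)) / (of_nat s + 1/2 - of_int (int j)) ^ (i + 2)))) \<le> abs2 a * abs2 (of_nat n) ^ 3"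
proof -
 define h :: rat where "h = of_nat n"
 define c where "c = of_nat (i * (i + 1)) / (2 :: rat)"
 define E where "E y = 1 / (y + h) ^ i - (1 / y ^ i - of_nat i * h / y ^ (i + 1) + c * h\<^sup>2 / y ^ (i + 2))" for y
 define z where "z s = of_int (int s) + (1/2 :: rat)" for s
 define \<sigma> :: rat where "\<sigma> = (-1) ^ (i + 1)"
 have ss: "\<sigma> * \<sigma> = 1" unfolding \<sigma>_def by (simp flip: power_add mult_2)
 have down: "f i (- 1 - int s) - f i (- 1 - int s + int n) = of_nat i * h * \<sigma> / z s ^ (i + 1) + \<sigma> * c * h\<^sup>2 / z s ^ (i + 2) - E (- z s)" for s
 proof -
  have y: "of_int (- 1 - int s) + 1/2 = - z s" "of_int (- 1 - int s + int n) + 1/2 = - z s + h"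
   by (simp_all add: z_def h_def)
  have p: "(- z s) ^ (i + 1) = \<sigma> * z s ^ (i + 1)" "(- z s) ^ (i + 2) = - (\<sigma> * z s ^ (i + 2))"
   unfolding power_minus[of "z s"] by (simp_all add: \<sigma>_def)
  have q: "p / (\<sigma> * v) = p * \<sigma> / v" for p v
  proof -
   have "\<sigma> = 1 \<or> \<sigma> = -1" unfolding \<sigma>_def by (cases "even i") auto
   thus ?thesis by auto
  qed
  show ?thesis unfolding f_def y E_def p minus_divide_right[symmetric] q by (simp add: algebra_simps)
 qed
 have up: "f i (int s + int n) - f i (int s) = - (of_nat i * h / z s ^ (i + 1)) + c * h\<^sup>2 / z s ^ (i + 2) + E (z s)" for s
  unfolding f_def E_def z_def h_def by (simp add: add_ac)
 have D: "(\<Sum>s<j. a * of_nat (i * (i + 1)) / (of_nat s + 1/2 - of_int (int j)) ^ (i + 2)) = (\<Sum>s<j. - (\<sigma> * (2 * a * c) / z s ^ (i + 2)))"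
 proof -
  have "(\<Sum>s<j. a * of_nat (i * (i + 1)) / (of_nat s + 1/2 - of_int (int j)) ^ (i + 2))
    = (\<Sum>s<j. a * of_nat (i * (i + 1)) / (of_nat (j - Suc s) + 1/2 - of_int (int j)) ^ (i + 2))"
   by (rule sum.nat_diff_reindex[symmetric])
  also have "... = (\<Sum>s<j. - (\<sigma> * (2 * a * c) / z s ^ (i + 2)))"
  proof (intro sum.cong refl)
   fix s assume "s \<in> {..<j}"
   hence "of_nat (j - Suc s) + 1/2 - of_int (int j) = - z s" by (simp add: z_def of_nat_diff)
   moreover have "(- z s) ^ (i + 2) = - (\<sigma> * z s ^ (i + 2))" unfolding power_minus[of "z s"] by (simp add: \<sigma>_def)
   moreover have "p / - (\<sigma> * v) = - (\<sigma> * p / v)" for p v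
   proof -
    have "\<sigma> = 1 \<or> \<sigma> = -1" unfolding \<sigma>_def by (cases "even i") auto
    thus ?thesis by auto
   qed
   ultimately show "a * of_nat (i * (i + 1)) / (of_nat (j - Suc s) + 1/2 - of_int (int j)) ^ (i + 2) = - (\<sigma> * (2 * a * c) / z s ^ (i + 2))"
    by (simp add: c_def)
  qed
  finally show ?thesis .
 qed
 have "a * (\<Sum>t<n. f i (int t - int j)) + (\<sigma> * a) * (\<Sum>t<n. f i (int t + int j))
   - ((a + \<sigma> * a) * (\<Sum>t<n. f i (int t)) - h ^ 2 * (\<Sum>s<j. - (\<sigma> * (2 * a * c) / z s ^ (i + 2))))
   = (\<Sum>s<j. a * (f i (- 1 - int s) - f i (- 1 - int s + int n)) + (\<sigma> * a) * (f i (int s + int n) - f i (int s)) - h\<^sup>2 * (\<sigma> * (2 * a * c) / z s ^ (i + 2)))"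
 proof -
  have 1: "(\<Sum>s<j. a * X s + b * Y s - k * V s) = a * sum X {..<j} + b * sum Y {..<j} - k * sum V {..<j}"
   for b k and X Y V :: "nat => rat"
   by (simp add: sum.distrib sum_subtractf sum_distrib_left)
  have 2: "a * (S + x) + b * (S + y) - ((a + b) * S - k * (- v)) = a * x + b * y - k * v" for S x y b k v :: rat
   by (simp add: algebra_simps)
  show ?thesis
   unfolding sum_shift_int_up[of "f i" j n] sum_shift_int_down[of "f i" j n] sum_negf 1 by (rule 2)
 qed
 also have "... = (\<Sum>s<j. a * (\<sigma> * E (z s) - E (- z s)))"
  unfolding up down by (intro sum.cong refl) (simp add: algebra_simps)
 also have "abs2 ... \<le> abs2 a * abs2 h ^ 3"
 proof (rule abs2_sum_le)
  fix s
  have E: "abs2 (E y) \<le> abs2 h ^ 3" if "abs2 y = 2" "abs2 (y + h) = 2" for y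
   unfolding E_def c_def by (rule inverse_power_Taylor2) (use that in auto)
  have 1: "abs2 (E (z s)) \<le> abs2 h ^ 3"
  proof (rule E)
   show "abs2 (z s) = 2" unfolding z_def by (rule abs2_half_odd)
   show "abs2 (z s + h) = 2" using abs2_half_odd[of "int s + int n"] by (simp add: z_def h_def algebra_simps)
  qed
  have 2: "abs2 (E (- z s)) \<le> abs2 h ^ 3"
  proof (rule E)
   show "abs2 (- z s) = 2" unfolding z_def abs2_minus by (rule abs2_half_odd)
   show "abs2 (- z s + h) = 2" using abs2_half_odd[of "- 1 - int s + int n"] by (simp add: z_def h_def algebra_simps)
  qed
  have "abs2 \<sigma> = 1" unfolding \<sigma>_def by (simp add: abs2_power)
  hence "abs2 (\<sigma> * E (z s) - E (- z s)) \<le> abs2 h ^ 3"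
   using 1 2 abs2_ultra[of "\<sigma> * E (z s)" "- E (- z s)"] by (simp add: abs2_mult)
  thus "abs2 (a * (\<sigma> * E (z s) - E (- z s))) \<le> abs2 a * abs2 h ^ 3"
   by (simp add: abs2_mult mult_left_mono)
 qed auto
 finally show ?thesis unfolding D h_def[symmetric] \<sigma>_def[symmetric] .
qed

lemma sum_symmetric_interval:
 fixes g :: "int => 'a::comm_monoid_add"
 shows "(\<Sum>j\<in>{- int nu..int nu}. g j) = g 0 + (\<Sum>j=1..nu. g (int j) + g (- int j))"
proof (induction nu)
 case (Suc n)
 have "{- int (Suc n)..int (Suc n)} = insert (int (Suc n)) (insert (- int (Suc n)) {- int n..int n})" by auto
 hence "(\<Sum>j\<in>{- int (Suc n)..int (Suc n)}. g j) = g (int (Suc n)) + (g (- int (Suc n)) + (\<Sum>j\<in>{- int n..int n}. g j))"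
  by (simp only:) (subst sum.insert; simp)+
 thus ?case using Suc by (simp add: add_ac)
qed simp

text \<open>After shifting, the average of order \<open>i\<close> is multiplied by the sum of all
  coefficients of that order, which vanishes for \<open>i = 1\<close> by the decay at infinity and
  for even \<open>i\<close> by symmetry.\<close>

theorem linear_form_approx:
 fixes A :: "int => rat" and nu :: nat
 assumes even_A: "\<And>j. A (- j) = A j"
 defines "R \<equiv> \<lambda>w. w * (\<Sum>j\<in>{- int nu..int nu}. A j / (w - of_int j)) ^ 4"
 shows "\<exists>C. \<forall>N. abs2 (2 * ((\<Sum>t<2 ^ N. R (of_nat t + 1/2)) / 4 ^ N) - (16 * rho3 nu A * osum_neg3 N + rho0 nu A)) \<le> C * (1/2) ^ N"
proof -
 define J where "J = {- int nu..int nu}"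
 have J: "finite J" "\<forall>i\<in>J. - i \<in> J" by (auto simp: J_def)
 define a where "a = pf_a J A"
 define f where "f i t = 1 / (of_int t + 1/2 :: rat) ^ i" for i and t :: int
 let ?T = "\<lambda>n. \<Sum>t<n. R (of_nat t + 1/2)" and ?L = "\<lambda>n. rho3 nu A * (\<Sum>t<n. f 3 (int t)) + of_nat n ^ 2 * (rho0 nu A / 2)"
 have am: "a i (- j) = (-1) ^ (i + 1) * a i j" for i j unfolding a_def by (rule pf_a_minus[where J = J and A = A, OF J(2) even_A])
 define C where "C = (\<Sum>j=1..nu. \<Sum>i=1..4. abs2 (a i (int j)))"
 have rho: "(\<Sum>j\<in>J. a i j) = (if i = 3 then rho3 nu A else 0)" if "i \<in> {1..4}" for i
 proof -
  have "i = 1 \<or> i = 3 \<or> even i" using that by auto presburger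
  thus ?thesis using pf_a1_sum[OF J(1), of A] pf_a_sum_even[where J = J and A = A and i = i, OF J(2) even_A] unfolding a_def rho3_def J_def by auto
 qed
 have bound: "abs2 (?T n - ?L n) \<le> C * abs2 (of_nat n) ^ 3" for n
 proof -
  define T where "T i j = (\<Sum>t<n. f i (int t - j))" for i and j :: int
  define W where "W i j = of_nat n ^ 2 * (\<Sum>s<j. a i (int j) * of_nat (i * (i + 1)) / (of_nat s + 1/2 - of_int (int j)) ^ (i + 2))" for i and j :: nat
  let ?X = "\<lambda>i j. a i (int j) * T i (int j) + ((-1) ^ (i + 1) * a i (int j)) * T i (- int j)
      - ((a i (int j) + (-1) ^ (i + 1) * a i (int j)) * T i 0 - W i j)"
  have "?T n = (\<Sum>t<n. \<Sum>j\<in>J. \<Sum>i=1..4. a i j * f i (int t - j))"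
  proof (intro sum.cong refl)
   fix t
   have "of_nat t + 1/2 \<noteq> (of_int j :: rat)" for j
   proof
    assume "of_nat t + 1/2 = (of_int j :: rat)"
    hence "(of_int (2 * int t + 1) :: rat) = of_int (2 * j)" by (simp add: field_simps)
    hence "2 * int t + 1 = 2 * j" by (simp only: of_int_eq_iff)
    thus False by presburger
   qed
   hence "R (of_nat t + 1/2) = (\<Sum>j\<in>J. \<Sum>i=1..4. a i j / (of_nat t + 1/2 - of_int j) ^ i)"
    unfolding R_def J_def[symmetric] a_def by (intro pf_expansion J) auto
   thus "R (of_nat t + 1/2) = (\<Sum>j\<in>J. \<Sum>i=1..4. a i j * f i (int t - j))"
    by (simp add: f_def algebra_simps)
  qed
  also have "... = (\<Sum>j\<in>J. \<Sum>t<n. \<Sum>i=1..4. a i j * f i (int t - j))" by (rule sum.swap)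
  also have "... = (\<Sum>j\<in>J. \<Sum>i=1..4. \<Sum>t<n. a i j * f i (int t - j))"
   by (rule sum.cong[OF refl], rule sum.swap)
  also have "... = (\<Sum>j\<in>J. \<Sum>i=1..4. a i j * T i j)" by (simp only: T_def sum_distrib_left)
  also have "... = (\<Sum>i=1..4. a i 0 * T i 0) + (\<Sum>j=1..nu. (\<Sum>i=1..4. a i (int j) * T i (int j)) + (\<Sum>i=1..4. a i (- int j) * T i (- int j)))"
   unfolding J_def by (rule sum_symmetric_interval)
  finally have 1: "?T n = ..." .
  have "rho3 nu A * (\<Sum>t<n. f 3 (int t)) = (\<Sum>i=1..4. (if i = 3 then rho3 nu A else 0) * T i 0)"
   unfolding sum_1_4 T_def by simp
  also have "... = (\<Sum>i=1..4. \<Sum>j\<in>J. a i j * T i 0)"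
  proof (intro sum.cong refl)
   fix i :: nat assume "i \<in> {1..4}"
   from rho[OF this] show "(if i = 3 then rho3 nu A else 0) * T i 0 = (\<Sum>j\<in>J. a i j * T i 0)"
    by (simp only: sum_distrib_right[symmetric])
  qed
  also have "... = (\<Sum>j\<in>J. \<Sum>i=1..4. a i j * T i 0)" by (rule sum.swap)
  also have "... = (\<Sum>i=1..4. a i 0 * T i 0) + (\<Sum>j=1..nu. (\<Sum>i=1..4. a i (int j) * T i 0) + (\<Sum>i=1..4. a i (- int j) * T i 0))"
   unfolding J_def by (rule sum_symmetric_interval)
  finally have 2: "rho3 nu A * (\<Sum>t<n. f 3 (int t)) = ..." .
  have 3: "of_nat n ^ 2 * (rho0 nu A / 2) = - (\<Sum>j=1..nu. \<Sum>i=1..4. W i j)"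
  proof -
   have "(\<Sum>j=1..nu. \<Sum>s<j. pf_D J A (int j) (of_nat s + 1/2)) = (\<Sum>j=1..nu. \<Sum>i=1..4. \<Sum>s<j. a i (int j) * of_nat (i * (i + 1)) / (of_nat s + 1/2 - of_int (int j)) ^ (i + 2))"
    unfolding pf_D_def a_def by (rule sum.cong[OF refl], rule sum.swap)
   thus ?thesis unfolding rho0_def J_def[symmetric] W_def sum_distrib_left[symmetric] by simp
  qed
  have "?T n - ?L n
   = (\<Sum>j=1..nu. \<Sum>i=1..4. ?X i j)"
   unfolding 1 2 3 am by (simp add: sum.distrib sum_subtractf sum_negf distrib_right left_diff_distrib)
  also have "abs2 ... \<le> C * abs2 (of_nat n) ^ 3"
  proof (intro abs2_sum_le)
   fix j i :: nat assume ji: "j \<in> {1..nu}" "i \<in> {1..4}"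
   have "abs2 (?X i j) \<le> abs2 (a i (int j)) * abs2 (of_nat n) ^ 3"
    using pole_pair_asymptotics[where a = "a i (int j)" and n = n and i = i and j = j] unfolding T_def W_def f_def by simp
   also have "abs2 (a i (int j)) \<le> (\<Sum>i=1..4. abs2 (a i (int j)))" using ji(2) by (intro member_le_sum) auto
   hence "abs2 (a i (int j)) \<le> C"
    unfolding C_def by (rule order_trans) (rule member_le_sum[of j "{1..nu}" "\<lambda>j. \<Sum>i=1..4. abs2 (a i (int j))"], use ji in \<open>auto intro: sum_nonneg\<close>)
   hence "abs2 (a i (int j)) * abs2 (of_nat n) ^ 3 \<le> C * abs2 (of_nat n) ^ 3" by (intro mult_right_mono) auto
   finally show "abs2 (?X i j) \<le> C * abs2 (of_nat n) ^ 3" .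
  qed (auto simp: C_def intro!: sum_nonneg mult_nonneg_nonneg)
  finally show ?thesis .
 qed
 have "abs2 (2 * (?T (2 ^ N) / 4 ^ N) - (16 * rho3 nu A * osum_neg3 N + rho0 nu A)) \<le> C * (1/2) ^ N" for N
 proof -
  define n where "n = (2 :: nat) ^ N"
  have n4: "(of_nat n :: rat) ^ 2 = 4 ^ N" "(4 :: rat) ^ N = 2 ^ (2 * N)"
   unfolding n_def by (simp_all add: power2_eq_square power_mult flip: power_mult_distrib)
  \<comment> \<open>\<open>1 / (t + 1/2)^3 = 8 / (2 t + 1)^3\<close>; together with the outer factor
    2 this is the 16 of the statement.\<close>
  have f3: "(\<Sum>t<n. f 3 (int t)) = 8 * 4 ^ N * osum_neg3 N"
  proof -
   have "f 3 (int t) = 8 * (1 / (2 * of_nat t + 1) ^ 3)" for t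
   proof -
    have "(2 * of_nat t + 1 :: rat) = 2 * (of_nat t + 1/2)" by simp
    hence "(2 * of_nat t + 1 :: rat) ^ 3 = 8 * (of_nat t + 1/2) ^ 3" by (simp only: power_mult_distrib) simp
    thus ?thesis by (simp add: f_def)
   qed
   hence "(\<Sum>t<n. f 3 (int t)) = 8 * (\<Sum>t<n. 1 / (2 * of_nat t + 1) ^ 3)" by (simp only: sum_distrib_left)
   thus ?thesis by (simp add: osum_neg3_def n_def)
  qed
  have "2 * (?T n / 4 ^ N) - (16 * rho3 nu A * osum_neg3 N + rho0 nu A)
   = 2 * ((?T n - ?L n) / 2 ^ (2 * N))"
   unfolding f3 n4(1) n4(2)[symmetric] by (simp add: field_simps)
  hence "abs2 (2 * (?T n / 4 ^ N) - (16 * rho3 nu A * osum_neg3 N + rho0 nu A))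
   = 1/2 * (abs2 (?T n - ?L n) / (1/2) ^ (2 * N))"
   by (simp only: abs2_mult abs2_divide abs2_two_power abs2_2)
  also have "... \<le> 1/2 * (C * abs2 (of_nat n) ^ 3 / (1/2) ^ (2 * N))"
   by (intro mult_left_mono divide_right_mono bound) auto
  also have "abs2 (of_nat n) = (1/2) ^ N" by (simp add: n_def abs2_power abs2_2)
  also have "1/2 * (C * ((1/2) ^ N) ^ 3 / (1/2) ^ (2 * N)) = 1/2 * (C * (1/2) ^ N)"
  proof -
   have "((1/2 :: real) ^ N) ^ 3 = (1/2) ^ (2 * N) * (1/2) ^ N" by (simp flip: power_add power_mult add: mult.commute)
   thus ?thesis by simp
  qed
  also have "... \<le> C * (1/2) ^ N"
  proof -
   have "C \<ge> 0" unfolding C_def by (intro sum_nonneg) auto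
   thus ?thesis by simp
  qed
  finally show ?thesis by (simp add: n_def)
 qed
 thus ?thesis by blast
qed

text \<open>A polynomial of degree \<open>2 M\<close> whose zeros are the half-integers between
  \<open>- M\<close> and \<open>M\<close>. The factorial and the power of 4 make the residues
  integral.\<close>

definition rnum :: "nat => nat => rat => rat" where
 "rnum nu M w = fact (2 * nu) * 4 ^ (2 * M) * ((w + of_nat M - 1/2) gchoose (2 * M))"

definition coefA :: "nat => nat => int => rat" where
 "coefA nu M j = (if j \<in> {- int nu..int nu}
   then rnum nu M (of_int j) / (\<Prod>i\<in>{- int nu..int nu} - {j}. of_int (j - i)) else 0)"

text \<open>Lagrange interpolation at the \<open>2 nu + 1\<close> poles of a numerator of degree at
  most \<open>2 M <= 2 nu\<close>.\<close>

lemma rational_partial_fractions: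
 assumes "M \<le> nu" and w: "\<And>j. j \<in> {- int nu..int nu} ==> w \<noteq> of_int j"
 shows "rnum nu M w / (\<Prod>i\<in>{- int nu..int nu}. w - of_int i) = (\<Sum>j\<in>{- int nu..int nu}. coefA nu M j / (w - of_int j))"
proof -
 define J where "J = {- int nu..int nu}"
 have J: "finite J" "card J = 2 * nu + 1" by (simp_all add: J_def)
 define p where "p = smult (fact (2 * nu) * 4 ^ (2 * M) / fact (2 * M)) (\<Prod>i<2 * M. [:of_nat M - 1/2 - of_nat i, 1 :: rat:])"
 define q where "q = (\<Sum>j\<in>J. smult (coefA nu M j) (\<Prod>i\<in>J - {j}. [:- of_int i, 1 :: rat:]))"
 have p: "poly p x = rnum nu M x" for x
 proof -
  have "(x + of_nat M - 1/2) gchoose (2 * M) = (\<Prod>i<2 * M. x + of_nat M - 1/2 - of_nat i) / fact (2 * M)"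
   by (simp add: gbinomial_prod_rev atLeast0LessThan)
  also have "(\<Prod>i<2 * M. x + of_nat M - 1/2 - of_nat i) = (\<Prod>i<2 * M. poly [:of_nat M - 1/2 - of_nat i, 1 :: rat:] x)"
   by (intro prod.cong refl) (simp add: algebra_simps)
  finally show ?thesis by (simp add: p_def rnum_def poly_prod)
 qed
 have q: "poly q x = (\<Sum>j\<in>J. coefA nu M j * (\<Prod>i\<in>J - {j}. x - of_int i))" for x
 proof -
  have "x - of_int i = poly [:- of_int i, 1 :: rat:] x" for i by simp
  thus ?thesis by (simp only: q_def poly_sum poly_smult poly_prod)
 qed
 have "p = q"
 proof (rule poly_eqI_degree)
  fix x assume "x \<in> (of_int ` J :: rat set)"
  then obtain j where j: "j \<in> J" "x = of_int j" by auto
  have "poly q x = (\<Sum>k\<in>{j}. coefA nu M k * (\<Prod>i\<in>J - {k}. x - of_int i))"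
   unfolding q
  proof (rule sum.mono_neutral_right)
   show "\<forall>k\<in>J - {j}. coefA nu M k * (\<Prod>i\<in>J - {k}. x - of_int i) = 0"
   proof
    fix k assume "k \<in> J - {j}"
    hence "(\<Prod>i\<in>J - {k}. x - of_int i) = 0" using J j by (intro prod_zero) auto
    thus "coefA nu M k * (\<Prod>i\<in>J - {k}. x - of_int i) = 0" by simp
   qed
  qed (use J j in auto)
  also have "... = coefA nu M j * (\<Prod>i\<in>J - {j}. of_int (j - i))" using j by simp
  also have "... = rnum nu M x"
  proof -
   have "(\<Prod>i\<in>J - {j}. of_int (j - i) :: rat) \<noteq> 0" using J by (subst prod_zero_iff) auto
   thus ?thesis using j unfolding coefA_def J_def[symmetric] by (simp del: of_int_diff)
  qed
  finally show "poly p x = poly q x" by (simp add: p)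
 next
  have c: "card (of_int ` J :: rat set) = 2 * nu + 1" using J by (subst card_image) (auto simp: inj_on_def)
  have "degree (\<Prod>i<2 * M. [:of_nat M - 1/2 - of_nat i, 1 :: rat:]) \<le> (\<Sum>i<2 * M. degree [:of_nat M - 1/2 - of_nat i, 1 :: rat:])"
   by (rule degree_prod_sum_le[unfolded o_def]) simp
  hence "degree p \<le> 2 * M" unfolding p_def by (intro order_trans[OF degree_smult_le]) simp
  thus "degree p < card (of_int ` J :: rat set)" using assms(1) by (simp add: c)
  have "degree (\<Prod>i\<in>J - {j}. [:- of_int i, 1 :: rat:]) \<le> 2 * nu" if "j \<in> J" for j
  proof -
   have "degree (\<Prod>i\<in>J - {j}. [:- of_int i, 1 :: rat:]) \<le> (\<Sum>i\<in>J - {j}. degree [:- of_int i, 1 :: rat:])"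
    by (rule degree_prod_sum_le[unfolded o_def]) (use J in simp)
   also have "... = card (J - {j})" by simp
   also have "... = 2 * nu" using J that by simp
   finally show ?thesis .
  qed
  hence "degree q \<le> 2 * nu" unfolding q_def using J
   by (intro degree_sum_le order_trans[OF degree_smult_le]) auto
  thus "degree q < card (of_int ` J :: rat set)" by (simp add: c)
 qed
 hence "rnum nu M w = (\<Sum>j\<in>J. coefA nu M j * (\<Prod>i\<in>J - {j}. w - of_int i))" using p[of w] q[of w] by simp
 hence "rnum nu M w / (\<Prod>i\<in>J. w - of_int i) = (\<Sum>j\<in>J. coefA nu M j * (\<Prod>i\<in>J - {j}. w - of_int i) / (\<Prod>i\<in>J. w - of_int i))"
  by (simp add: sum_divide_distrib)
 also have "... = (\<Sum>j\<in>J. coefA nu M j / (w - of_int j))"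
 proof (intro sum.cong refl)
  fix j assume j: "j \<in> J"
  have "(\<Prod>i\<in>J - {j}. w - of_int i) \<noteq> 0" using J w unfolding J_def by (subst prod_zero_iff) auto
  moreover have "(\<Prod>i\<in>J. w - of_int i) = (w - of_int j) * (\<Prod>i\<in>J - {j}. w - of_int i)" by (rule prod.remove[OF J(1) j])
  ultimately show "coefA nu M j * (\<Prod>i\<in>J - {j}. w - of_int i) / (\<Prod>i\<in>J. w - of_int i) = coefA nu M j / (w - of_int j)" by simp
 qed
 finally show ?thesis by (simp add: J_def)
qed

lemma rnum_minus: "rnum nu M (- w) = rnum nu M w"
proof -
 have "(\<Prod>i<2 * M. - w + of_nat M - 1/2 - of_nat i) = (\<Prod>i<2 * M. - w + of_nat M - 1/2 - of_nat (2 * M - Suc i))"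
  by (rule prod.nat_diff_reindex[symmetric])
 also have "... = (\<Prod>i<2 * M. - (w + of_nat M - 1/2 - of_nat i))"
  by (intro prod.cong refl) (simp add: of_nat_diff)
 also have "... = (\<Prod>i<2 * M. w + of_nat M - 1/2 - of_nat i)"
  unfolding prod_uminus by simp
 finally show ?thesis by (simp add: rnum_def gbinomial_prod_rev atLeast0LessThan)
qed

lemma coefA_minus: "coefA nu M (- j) = coefA nu M j"
proof (cases "j \<in> {- int nu..int nu}")
 case True
 define J where "J = {- int nu..int nu}"
 have "(\<Prod>i\<in>J - {- j}. of_int (- j - i) :: rat) = (\<Prod>i\<in>J - {j}. - of_int (j - i))"
  by (rule prod.reindex_bij_witness[of _ uminus uminus]) (auto simp: J_def)
 also have "... = (-1) ^ card (J - {j}) * (\<Prod>i\<in>J - {j}. of_int (j - i))" by (rule prod_uminus)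
 also have "card (J - {j}) = 2 * nu" using True by (simp add: J_def)
 finally show ?thesis using True rnum_minus[of nu M "of_int j"] by (simp add: coefA_def J_def)
qed (auto simp: coefA_def)

lemma prod_int_differences:
 assumes "j \<in> {- int nu..int nu}"
 shows "(\<Prod>i\<in>{- int nu..int nu} - {j}. of_int (j - i) :: rat) = (-1) ^ nat (int nu - j) * fact (nat (int nu + j)) * fact (nat (int nu - j))"
proof -
 have f: "(\<Prod>s<n. of_nat (Suc s) :: rat) = fact n" for n by (induction n) (simp_all add: mult.commute)
 have split: "{- int nu..int nu} - {j} = {- int nu..<j} \<union> {j<..int nu}" using assms by auto
 have "(\<Prod>i\<in>{- int nu..int nu} - {j}. of_int (j - i) :: rat) = (\<Prod>i\<in>{- int nu..<j}. of_int (j - i)) * (\<Prod>i\<in>{j<..int nu}. of_int (j - i))"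
  unfolding split by (rule prod.union_disjoint) auto
 also have "(\<Prod>i\<in>{- int nu..<j}. of_int (j - i) :: rat) = (\<Prod>s<nat (int nu + j). of_nat (Suc s))"
  by (rule prod.reindex_bij_witness[of _ "\<lambda>s. j - 1 - int s" "\<lambda>i. nat (j - 1 - i)"]) (use assms in auto)
 also have "(\<Prod>i\<in>{j<..int nu}. of_int (j - i) :: rat) = (\<Prod>s<nat (int nu - j). - of_nat (Suc s))"
  by (rule prod.reindex_bij_witness[of _ "\<lambda>s. j + 1 + int s" "\<lambda>i. nat (i - j - 1)"]) (use assms in auto)
 finally show ?thesis unfolding prod_uminus f by simp
qed

lemma coefA_binomial:
 assumes "j \<in> {- int nu..int nu}"
 shows "coefA nu M j = (-1) ^ nat (int nu - j) * of_nat (2 * nu choose nat (int nu + j)) * (4 ^ (2 * M) * ((of_int j + of_nat M - 1/2) gchoose (2 * M)))"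
proof -
 have "nat (int nu + j) \<le> 2 * nu" "2 * nu - nat (int nu + j) = nat (int nu - j)" using assms by auto
 hence b: "(of_nat (2 * nu choose nat (int nu + j)) :: rat) = fact (2 * nu) / (fact (nat (int nu + j)) * fact (nat (int nu - j)))"
  by (simp add: binomial_fact)
 have s: "1 / (-1 :: rat) ^ n = (-1) ^ n" for n by (cases "even n") auto
 show ?thesis
  unfolding coefA_def rnum_def prod_int_differences[OF assms] b using assms
  by (simp add: divide_simps) (simp add: flip: power_add mult_2 power_mult_distrib)?
qed

text \<open>At the upper argument -1/2 the number is a signed central binomial coefficient; Pascal's
  rule then raises the argument.\<close>

lemma four_power_gbinomial_half_Ints: "4 ^ n * ((of_nat m - 1/2 :: rat) gchoose n) \<in> \<int>"
proof (induction m arbitrary: n)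
 case 0
 have "4 ^ n * ((- 1/2 :: rat) gchoose n) = (-1) ^ n * of_nat (2 * n choose n)"
 proof (induction n)
  case (Suc n)
  have 1: "(- 1/2 :: rat) gchoose Suc n = ((- 1/2) gchoose n) * (- 1/2 - of_nat n) / of_nat (Suc n)"
   by (simp add: gbinomial_prod_rev)
  have "Suc n * (2 * Suc n choose Suc n) = 2 * (2 * n + 1) * (2 * n choose n)"
  proof -
   have "Suc n * (2 * Suc n choose Suc n) = 2 * Suc n * (2 * n + 1 choose n)"
    using Suc_times_binomial[of n "2 * n + 1"] by simp
   moreover have "Suc n * (2 * n + 1 choose n) = (2 * n + 1) * (2 * n choose n)"
   proof -
    have "(2 * n + 1 choose n) = (2 * n + 1 choose Suc n)"
     using binomial_symmetric[of n "2 * n + 1"] by simp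
    thus ?thesis using Suc_times_binomial[of n "2 * n"] by simp
   qed
   ultimately show ?thesis by (simp only: mult.assoc)
  qed
  hence "of_nat (Suc n) * of_nat (2 * Suc n choose Suc n) = (2 * (2 * of_nat n + 1) * of_nat (2 * n choose n) :: rat)"
   by (metis (no_types, lifting) of_nat_1 of_nat_add of_nat_mult of_nat_numeral)
  hence 2: "of_nat (2 * Suc n choose Suc n) = (2 * (2 * of_nat n + 1) * of_nat (2 * n choose n) :: rat) / of_nat (Suc n)"
   by (metis nonzero_mult_div_cancel_left of_nat_neq_0)
  have "4 ^ Suc n * ((- 1/2 :: rat) gchoose Suc n) = (4 ^ n * ((- 1/2) gchoose n)) * (4 * (- 1/2 - of_nat n)) / of_nat (Suc n)"
   unfolding 1 by simp
  thus ?case unfolding Suc 2 by (simp add: algebra_simps)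
 qed simp
 thus ?case by simp
next
 case (Suc m)
 show ?case
 proof (cases n)
  case (Suc k)
  have "of_nat (Suc m) - 1/2 = (of_nat m - 1/2 :: rat) + 1" by simp
  hence "(of_nat (Suc m) - 1/2 :: rat) gchoose n = ((of_nat m - 1/2) gchoose k) + ((of_nat m - 1/2) gchoose Suc k)"
   unfolding Suc by (simp only: gbinomial_Suc_Suc)
  hence "4 ^ n * ((of_nat (Suc m) - 1/2 :: rat) gchoose n) = 4 * (4 ^ k * ((of_nat m - 1/2) gchoose k)) + 4 ^ Suc k * ((of_nat m - 1/2) gchoose Suc k)"
   unfolding Suc by (simp add: algebra_simps)
  also have "... \<in> \<int>" by (intro Ints_add Ints_mult[OF _ Suc.IH] Suc.IH) auto
  finally show ?thesis .
 qed simp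
qed

lemma coefA_Ints: "coefA nu M j \<in> \<int>"
proof -
 have nonneg: "coefA nu M j \<in> \<int>" if "j \<in> {0..int nu}" for j
 proof -
  have e: "of_int j + of_nat M - 1/2 = (of_nat (nat j + M) - 1/2 :: rat)" using that by simp
  have "coefA nu M j = (-1) ^ nat (int nu - j) * of_nat (2 * nu choose nat (int nu + j)) * (4 ^ (2 * M) * ((of_int j + of_nat M - 1/2) gchoose (2 * M)))"
   by (rule coefA_binomial) (use that in auto)
  also have "... \<in> \<int>" unfolding e by (intro Ints_mult four_power_gbinomial_half_Ints) auto
  finally show ?thesis .
 qed
 show ?thesis
 proof (cases "j \<in> {- int nu..int nu}")
  case True
  thus ?thesis using nonneg[of j] nonneg[of "- j"] coefA_minus[of nu M j] by (cases "j \<ge> 0") auto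
 qed (auto simp: coefA_def)
qed

section \<open>Archimedean bounds for the residues\<close>

lemma binomial_add_le: "a \<le> n ==> (n + k choose a) \<le> (n choose a) * (a + k choose k)"
proof (induction k)
 case (Suc k)
 define b where "b = n - a"
 have n: "n = a + b" using Suc.prems by (simp add: b_def)
 have 1: "(b + k + 1) * (n + Suc k choose a) = (n + k + 1) * (n + k choose a)"
 proof -
  have "(n + Suc k - a) * (n + Suc k choose a) = (n + Suc k) * (n + k choose a)"
   using binomial_absorb_comp[of "n + Suc k" a] by simp
  thus ?thesis by (simp add: n)
 qed
 have 2: "(k + 1) * (a + Suc k choose Suc k) = (a + k + 1) * (a + k choose k)"
  using Suc_times_binomial[of k "a + k"] by simp
 have "((b + k + 1) * (k + 1)) * (n + Suc k choose a) = (k + 1) * (n + k + 1) * (n + k choose a)"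
  using 1 by (metis mult.assoc mult.commute)
 also have "... \<le> ((b + k + 1) * (a + k + 1)) * ((n choose a) * (a + k choose k))"
 proof (rule mult_mono)
  show "(k + 1) * (n + k + 1) \<le> (b + k + 1) * (a + k + 1)" by (simp add: n algebra_simps)
 qed (use Suc in auto)
 also have "... = ((b + k + 1) * (k + 1)) * ((n choose a) * (a + Suc k choose Suc k))"
 proof -
  have "((b + k + 1) * (a + k + 1)) * ((n choose a) * (a + k choose k)) = (b + k + 1) * (n choose a) * ((a + k + 1) * (a + k choose k))"
   by (simp only: mult_ac)
  also have "... = (b + k + 1) * (n choose a) * ((k + 1) * (a + Suc k choose Suc k))" unfolding 2 ..
  finally show ?thesis by (simp only: mult_ac)
 qed
 finally have X: "((b + k + 1) * (k + 1)) * (n + Suc k choose a) \<le> ((b + k + 1) * (k + 1)) * ((n choose a) * (a + Suc k choose Suc k))" .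
 show ?case by (rule mult_left_le_imp_le[OF X]) simp
qed simp

lemma prod_lessThan_add:
 fixes f :: "nat => 'a::comm_monoid_mult"
 shows "(\<Prod>i<a + b. f i) = (\<Prod>i<a. f i) * (\<Prod>i<b. f (a + i))"
 by (induction b) (simp_all add: mult.assoc)

lemma prod_descending: "(\<Prod>s<n. of_nat (n - s) :: rat) = fact n"
proof -
 have f: "(\<Prod>s<n. of_nat (Suc s) :: rat) = fact n" by (induction n) (simp_all add: mult.commute)
 have "(\<Prod>s<n. of_nat (Suc s) :: rat) = (\<Prod>s<n. of_nat (Suc (n - Suc s)))" by (rule prod.nat_diff_reindex[symmetric])
 also have "... = (\<Prod>s<n. of_nat (n - s))" by (intro prod.cong refl) auto
 finally show ?thesis using f by simp
qed

text \<open>Rounding each half-integral factor away from 0 gives the product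
  \<open>(M + j)! (M - j)!\<close>.\<close>

lemma abs_gbinomial_half_le_inner:
 assumes "j \<le> M"
 shows "\<bar>(of_nat j + of_nat M - 1/2 :: rat) gchoose (2 * M)\<bar> * of_nat (2 * M choose (M + j)) \<le> 1"
proof -
 define x where "x = (of_nat j + of_nat M - 1/2 :: rat)"
 have f: "(\<Prod>s<n. of_nat (Suc s) :: rat) = fact n" for n by (induction n) (simp_all add: mult.commute)
 have M: "2 * M = (M + j) + (M - j)" using assms by simp
 have g: "\<bar>x gchoose (2 * M)\<bar> = (\<Prod>i<2 * M. \<bar>x - of_nat i\<bar>) / fact (2 * M)"
  by (simp add: gbinomial_prod_rev atLeast0LessThan abs_prod)
 have "(\<Prod>i<2 * M. \<bar>x - of_nat i\<bar>) = (\<Prod>i<M + j. \<bar>x - of_nat i\<bar>) * (\<Prod>i<M - j. \<bar>x - of_nat (M + j + i)\<bar>)"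
  by (subst M) (rule prod_lessThan_add)
 also have "... \<le> (\<Prod>i<M + j. of_nat (M + j - i)) * (\<Prod>i<M - j. of_nat (Suc i))"
 proof (intro mult_mono prod_mono conjI)
  fix i assume "i \<in> {..<M + j}"
  hence "(of_nat (M + j - i) :: rat) = of_nat M + of_nat j - of_nat i" "(of_nat i :: rat) + 1 \<le> of_nat M + of_nat j"
   by (auto simp: of_nat_diff simp flip: of_nat_add of_nat_Suc)
  thus "\<bar>x - of_nat i\<bar> \<le> of_nat (M + j - i)" by (simp add: x_def)
 next
  fix i
  have "x - of_nat (M + j + i) = - (of_nat i + 1/2)" by (simp add: x_def)
  thus "\<bar>x - of_nat (M + j + i)\<bar> \<le> of_nat (Suc i)" by simp
 qed (auto intro!: prod_nonneg)
 also have "... = fact (M + j) * fact (M - j)" unfolding prod_descending f ..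
 finally have "(\<Prod>i<2 * M. \<bar>x - of_nat i\<bar>) \<le> fact (M + j) * fact (M - j)" .
 hence "\<bar>x gchoose (2 * M)\<bar> \<le> fact (M + j) * fact (M - j) / fact (2 * M)"
  unfolding g by (intro divide_right_mono) auto
 moreover have "(of_nat (2 * M choose (M + j)) :: rat) = fact (2 * M) / (fact (M + j) * fact (M - j))"
  using binomial_fact[of "M + j" "2 * M", where 'a = rat] assms by (simp add: diff_add_inverse)
 ultimately have "\<bar>x gchoose (2 * M)\<bar> * of_nat (2 * M choose (M + j))
   \<le> (fact (M + j) * fact (M - j) / fact (2 * M)) * (fact (2 * M) / (fact (M + j) * fact (M - j)))"
  by (simp only:) (intro mult_right_mono, auto)
 also have "... = 1" by simp
 finally show ?thesis by (simp add: x_def)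
qed

lemma abs_gbinomial_half_le_outer:
 assumes "n \<le> m"
 shows "\<bar>(of_nat m - 1/2 :: rat) gchoose n\<bar> \<le> of_nat (m choose n)"
proof -
 have g: "\<bar>(of_nat m - 1/2 :: rat) gchoose n\<bar> = (\<Prod>i<n. \<bar>of_nat m - 1/2 - of_nat i\<bar>) / fact n"
  by (simp add: gbinomial_prod_rev atLeast0LessThan abs_prod)
 have h: "(of_nat (m choose n) :: rat) = (\<Prod>i<n. of_nat m - of_nat i) / fact n"
  by (simp add: binomial_gbinomial gbinomial_prod_rev atLeast0LessThan)
 show ?thesis unfolding g h
 proof (intro divide_right_mono prod_mono conjI)
  fix i assume "i \<in> {..<n}"
  hence "(of_nat i :: rat) + 1 \<le> of_nat m" using assms by (simp flip: of_nat_Suc)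
  thus "\<bar>of_nat m - 1/2 - of_nat i\<bar> \<le> (of_nat m - of_nat i :: rat)" by simp
 qed auto
qed

text \<open>For \<open>|j| <= M\<close> the large coefficient \<open>C(2 nu, nu + j)\<close> is
  compensated by the half-integral binomial, at most \<open>1 / C(2 M, M + j)\<close>; for
  \<open>|j| > M\<close> it is itself far from the centre. In both ranges what remains is
  \<open>C(2 nu, k)\<close> with \<open>k = nu - M\<close>, up to the factor
  \<open>2^k\<close>.\<close>

lemma abs_coefA_le:
 assumes nu: "nu = M + k"
 shows "\<bar>coefA nu M j\<bar> \<le> 4 ^ (2 * M) * 2 ^ k * of_nat (2 * nu choose k)"
proof -
 have nonneg: "\<bar>coefA nu M (int j)\<bar> \<le> 4 ^ (2 * M) * (2 ^ k * of_nat (2 * nu choose k))" if j: "j \<le> nu" for j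
 proof -
  let ?c = "2 * nu choose (nu + j)" and ?d = "2 * nu choose k"
  define G where "G = \<bar>(of_nat j + of_nat M - 1/2 :: rat) gchoose (2 * M)\<bar>"
  have nj: "nat (int nu + int j) = nu + j" by simp
  have "\<bar>coefA nu M (int j)\<bar> = of_nat ?c * (4 ^ (2 * M) * G)"
   using coefA_binomial[of "int j" nu M] j unfolding nj G_def by (simp add: abs_mult power_abs)
  moreover have "of_nat ?c * G \<le> 2 ^ k * of_nat ?d"
  proof (cases "j \<le> M")
   case True
   have "(nu + j choose k) * ?c = ?d * (2 * M + k choose (M + j))"
   proof -
    have "?c * (nu + j choose k) = ?d * (2 * nu - k choose (nu + j - k))"
     by (rule choose_mult) (use j nu in auto)
    moreover have "2 * nu - k = 2 * M + k" "nu + j - k = M + j" using nu by auto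
    ultimately show ?thesis by (simp only: mult.commute)
   qed
   also have "(2 * M + k choose (M + j)) \<le> (2 * M choose (M + j)) * (M + j + k choose k)"
    by (rule binomial_add_le) (use True in simp)
   hence "?d * (2 * M + k choose (M + j)) \<le> (nu + j choose k) * (?d * (2 * M choose (M + j)))"
    using nu by (simp add: add_ac mult_ac)
   finally have "?c \<le> ?d * (2 * M choose (M + j))"
    using nu by (simp add: mult_le_cancel1)
   hence "(of_nat ?c :: rat) \<le> of_nat (?d * (2 * M choose (M + j)))"
    by (simp only: of_nat_le_iff)
   hence "of_nat ?c * G \<le> of_nat (?d * (2 * M choose (M + j))) * G"
    by (rule mult_right_mono) (simp add: G_def)
   also have "... = of_nat ?d * (G * of_nat (2 * M choose (M + j)))" by (simp add: mult_ac)
   also have "... \<le> of_nat ?d * 1"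
    unfolding G_def by (intro mult_left_mono abs_gbinomial_half_le_inner True) auto
   also have "... \<le> 2 ^ k * of_nat ?d"
    using mult_right_mono[of 1 "2 ^ k :: rat" "of_nat ?d"] by simp
   finally show ?thesis .
  next
   case False
   define u where "u = j - M"
   have u: "j = M + u" "u \<le> k" using False j nu by (simp_all add: u_def)
   have e: "of_nat j + of_nat M - 1/2 = (of_nat (2 * M + u) - 1/2 :: rat)" by (simp add: u)
   have G: "G \<le> of_nat (2 * M + u choose (2 * M))"
    unfolding G_def e by (rule abs_gbinomial_half_le_outer) simp
   have "?c * (2 * M + u choose (2 * M)) \<le> (2 * nu choose (k - u)) * (2 * M + k + u choose u)"
   proof (rule mult_mono)
    have "?c = 2 * nu choose (2 * nu - (nu + j))" by (rule binomial_symmetric) (use j in simp)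
    also have "2 * nu - (nu + j) = k - u" using u nu by simp
    finally show "2 * nu choose (nu + j) \<le> 2 * nu choose (k - u)" by simp
    have "2 * M + u choose (2 * M) = 2 * M + u choose u" using binomial_symmetric[of "2 * M" "2 * M + u"] by simp
    also have "... \<le> 2 * M + k + u choose u" by (rule binomial_right_mono) simp
    finally show "2 * M + u choose (2 * M) \<le> 2 * M + k + u choose u" .
   qed auto
   also have "... = ?d * (k choose (k - u))"
   proof -
    have "?d * (k choose (k - u)) = (2 * nu choose (k - u)) * (2 * nu - (k - u) choose (k - (k - u)))"
     by (rule choose_mult) (use u nu in auto)
    moreover have "2 * nu - (k - u) = 2 * M + k + u" "k - (k - u) = u" using u nu by auto
    ultimately show ?thesis by simp
   qed
   also have "... \<le> ?d * 2 ^ k" by (intro mult_left_mono binomial_le_pow2) auto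
   finally have "(of_nat (?c * (2 * M + u choose (2 * M))) :: rat) \<le> of_nat (?d * 2 ^ k)"
    by (simp only: of_nat_le_iff)
   moreover have "of_nat ?c * G \<le> of_nat ?c * of_nat (2 * M + u choose (2 * M))"
    by (rule mult_left_mono[OF G]) simp
   ultimately show ?thesis by (simp add: mult.commute)
  qed
  ultimately show ?thesis
   using mult_left_mono[of "of_nat ?c * G" "2 ^ k * of_nat ?d" "4 ^ (2 * M)"]
   by (simp add: mult_ac)
 qed
 show ?thesis
 proof (cases "j \<in> {- int nu..int nu}")
  case True
  have "\<bar>coefA nu M j\<bar> = \<bar>coefA nu M (int (nat \<bar>j\<bar>))\<bar>" using coefA_minus[of nu M j] by (cases "j \<ge> 0") auto
  also have "... \<le> 4 ^ (2 * M) * (2 ^ k * of_nat (2 * nu choose k))" by (rule nonneg) (use True in auto)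
  finally show ?thesis by (simp add: mult.assoc)
 qed (auto simp: coefA_def)
qed

lemma rnum_zero:
 assumes "x + of_nat M - 1/2 = of_nat i" "i < 2 * M"
 shows "rnum nu M x = 0"
 using assms by (simp add: rnum_def gbinomial_prod_rev)

section \<open>The 2-adic absolute value of the linear form\<close>

definition rfun :: "nat => nat => rat => rat" where
 "rfun nu M w = (\<Sum>j\<in>{- int nu..int nu}. coefA nu M j / (w - of_int j))"

definition Rfun :: "nat => nat => rat => rat" where
 "Rfun nu M w = w * rfun nu M w ^ 4"

text \<open>The fourth power of \<open>tau\<close> times the product of all
  \<open>tau^2 - 4 j^2\<close>, as a polynomial in \<open>tau^2\<close>; with
  \<open>tau = 2 w\<close> this is the denominator of \<open>r^4\<close> up to a power of 2.\<close>

definition qpoly :: "nat => int poly" where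
 "qpoly nu = [:0, 0, 1:] * (\<Prod>j=1..nu. [:- 4 * int j ^ 2, 1:]) ^ 4"

text \<open>The constant of \<open>rnum\<close> together with the powers of 2 from the
  \<open>2 nu + 1\<close> denominators \<open>w - i = (tau - 2 i) / 2\<close>.\<close>

definition cconst :: "nat => nat => rat" where
 "cconst nu M = fact (2 * nu) * 2 ^ (4 * M + 2 * nu + 1)"

lemma prod_symmetric_interval:
 fixes g :: "int => 'a::comm_monoid_mult"
 shows "(\<Prod>j\<in>{- int nu..int nu}. g j) = g 0 * (\<Prod>j=1..nu. g (int j) * g (- int j))"
proof (induction nu)
 case (Suc n)
 have "{- int (Suc n)..int (Suc n)} = insert (int (Suc n)) (insert (- int (Suc n)) {- int n..int n})" by auto
 hence "(\<Prod>j\<in>{- int (Suc n)..int (Suc n)}. g j) = g (int (Suc n)) * (g (- int (Suc n)) * (\<Prod>j\<in>{- int n..int n}. g j))"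
  by (simp only:) (subst prod.insert; simp)+
 thus ?case using Suc by (simp add: mult_ac)
qed simp

text \<open>At \<open>w = x - M + 1/2\<close> the numerator becomes an ordinary binomial
  coefficient, so \<open>R\<close> is a constant times a summand of a binomial sum divided by an odd
  integer.\<close>

lemma Rfun_half_integer:
 fixes x :: nat
 assumes "M \<le> nu"
 defines "\<tau> \<equiv> 2 * int x + 1 - int (2 * M)"
 shows "Rfun nu M (of_nat x - of_nat M + 1/2) = cconst nu M ^ 4 / 2 * (of_nat (x choose (2 * M)) ^ 4 * of_int \<tau> / of_int (poly (qpoly nu) (\<tau>\<^sup>2)))"
proof -
 define w where "w = (of_nat x - of_nat M + 1/2 :: rat)"
 define P where "P = (\<Prod>j=1..nu. \<tau>\<^sup>2 - 4 * int j ^ 2)"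
 have w: "w = of_int \<tau> / 2" by (simp add: w_def \<tau>_def field_simps)
 have odd: "odd \<tau>" by (simp add: \<tau>_def)
 have ne: "w \<noteq> of_int j" for j
 proof
  assume "w = of_int j"
  hence "(of_int \<tau> :: rat) = of_int (2 * j)" by (simp add: w)
  hence "\<tau> = 2 * j" by (simp only: of_int_eq_iff)
  thus False using odd by simp
 qed
 have num: "rnum nu M w = fact (2 * nu) * 4 ^ (2 * M) * of_nat (x choose (2 * M))"
 proof -
  have "w + of_nat M - 1/2 = of_nat x" by (simp add: w_def)
  thus ?thesis by (simp add: rnum_def binomial_gbinomial)
 qed
 have "(\<Prod>i\<in>{- int nu..int nu}. w - of_int i) = (\<Prod>i\<in>{- int nu..int nu}. of_int (\<tau> - 2 * i) / 2)"
  by (intro prod.cong refl) (simp add: w field_simps)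
 also have "... = of_int (\<Prod>i\<in>{- int nu..int nu}. \<tau> - 2 * i) / 2 ^ (2 * nu + 1)"
 proof -
  have card: "card {- int nu..int nu} = 2 * nu + 1" by simp
  show ?thesis by (simp only: prod_dividef prod_constant card of_int_prod)
 qed
 also have "(\<Prod>i\<in>{- int nu..int nu}. \<tau> - 2 * i) = \<tau> * P"
  unfolding prod_symmetric_interval P_def by (simp add: algebra_simps power2_eq_square)
 finally have den: "(\<Prod>i\<in>{- int nu..int nu}. w - of_int i) = of_int (\<tau> * P) / 2 ^ (2 * nu + 1)" .
 have "rfun nu M w = rnum nu M w / (\<Prod>i\<in>{- int nu..int nu}. w - of_int i)"
  unfolding rfun_def by (rule rational_partial_fractions[symmetric]) (use assms(1) ne in auto)
 also have "... = cconst nu M * of_nat (x choose (2 * M)) / of_int (\<tau> * P)"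
  unfolding num den cconst_def by (simp add: power_add power_mult)
 finally have r: "rfun nu M w = cconst nu M * of_nat (x choose (2 * M)) / of_int (\<tau> * P)" .
 have q: "poly (qpoly nu) (\<tau>\<^sup>2) = \<tau> ^ 4 * P ^ 4"
 proof -
  have "\<tau>\<^sup>2 * \<tau>\<^sup>2 = \<tau> ^ 4" by (simp flip: power_add)
  thus ?thesis by (simp add: qpoly_def poly_prod P_def)
 qed
 have t0: "of_int \<tau> \<noteq> (0 :: rat)" using odd by auto
 have "Rfun nu M w = of_int \<tau> / 2 * (cconst nu M * of_nat (x choose (2 * M)) / of_int (\<tau> * P)) ^ 4"
  unfolding Rfun_def r unfolding w ..
 also have "... = cconst nu M ^ 4 / 2 * (of_nat (x choose (2 * M)) ^ 4 * of_int \<tau> / of_int (poly (qpoly nu) (\<tau>\<^sup>2)))"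
  unfolding q by (simp add: power_mult_distrib power_divide)
 finally show ?thesis unfolding w_def .
qed

lemma odd_qpoly: "odd y ==> odd (poly (qpoly nu) y)"
 by (simp add: qpoly_def poly_prod even_prod_iff)

lemma abs2_Rfun_le:
 assumes "M \<le> nu"
 shows "abs2 (Rfun nu M (of_nat x - of_nat M + 1/2)) \<le> 2 * abs2 (cconst nu M) ^ 4 * abs2 (of_nat (x choose (2 * M))) ^ 4"
proof -
 have "odd (2 * int x + 1 - int (2 * M))" by simp
 thus ?thesis
  unfolding Rfun_half_integer[OF assms] abs2_mult abs2_divide abs2_power abs2_2
  by (subst (1 2) abs2_of_int_odd) (auto intro!: odd_qpoly)
qed

text \<open>Among the factors of the descending product is
  \<open>(2^N + s) - s = 2^N\<close>.\<close>

lemma abs2_binomial_near_power: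
 assumes "s < 2 * M"
 shows "abs2 (of_nat (2 ^ N + s choose (2 * M))) \<le> (1/2) ^ N / abs2 (fact (2 * M))"
proof -
 have "fact (2 * M) * of_nat (2 ^ N + s choose (2 * M)) = (\<Prod>i<2 * M. of_nat (2 ^ N + s) - of_nat i :: rat)"
  by (simp add: binomial_gbinomial gbinomial_prod_rev atLeast0LessThan)
 also have "... = (of_nat (2 ^ N + s) - of_nat s) * (\<Prod>i\<in>{..<2 * M} - {s}. of_nat (2 ^ N + s) - of_nat i)"
  by (rule prod.remove) (use assms in auto)
 also have "... = 2 ^ N * of_int (\<Prod>i\<in>{..<2 * M} - {s}. int (2 ^ N + s) - int i)" by simp
 finally have "abs2 (fact (2 * M)) * abs2 (of_nat (2 ^ N + s choose (2 * M))) = (1/2) ^ N * abs2 (of_int (\<Prod>i\<in>{..<2 * M} - {s}. int (2 ^ N + s) - int i))"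
  by (metis abs2_mult abs2_two_power)
 also have "... \<le> (1/2) ^ N * 1" by (intro mult_left_mono abs2_of_int_le) auto
 finally have "abs2 (of_nat (2 ^ N + s choose (2 * M))) * abs2 (fact (2 * M)) \<le> (1/2) ^ N" by (simp add: mult.commute)
 moreover have "abs2 (fact (2 * M)) > 0" by (rule abs2_pos) simp
 ultimately show ?thesis by (simp add: pos_le_divide_eq)
qed

text \<open>Replacing \<open>t\<close> by \<open>x = t + M\<close> changes the sum by boundary terms
  near 0 and near \<open>2^N\<close>; the former vanish, the latter are small. The odd value
  \<open>u\<close> of \<open>qpoly\<close> is inverted modulo \<open>2^(4 N)\<close> by the power
  \<open>u^(2^(4 N) - 1)\<close>, which turns the sum into a \<open>binom4_sum\<close> of known
  valuation. The comparison value \<open>y\<close> varies with \<open>N\<close>, its absolute value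
  does not.\<close>

lemma Rfun_sum_abs2:
 assumes "M \<le> nu"
 shows "\<exists>K. \<forall>N. 2 * M < 2 ^ N \<longrightarrow> (\<exists>y. abs2 y = abs2 (cconst nu M) ^ 4 * 2 ^ digit_sum2 M \<and>
   abs2 (2 * ((\<Sum>t<2 ^ N. Rfun nu M (of_nat t + 1/2)) / 4 ^ N) - y) \<le> K * (1/2) ^ N)"
proof -
 define c where "c = cconst nu M"
 define W where "W x = Rfun nu M (of_nat x - of_nat M + 1/2)" for x
 define F where "F = max 1 ((1 / abs2 (fact (2 * M))) ^ 4)"
 have F: "F \<ge> 1" "F \<ge> (1 / abs2 (fact (2 * M))) ^ 4" by (simp_all add: F_def)
 have "\<exists>y. abs2 y = abs2 c ^ 4 * 2 ^ digit_sum2 M \<and>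
   abs2 (2 * ((\<Sum>t<2 ^ N. Rfun nu M (of_nat t + 1/2)) / 4 ^ N) - y) \<le> (abs2 c ^ 4 * F) * (1/2) ^ N" if N: "2 * M < 2 ^ N" for N
 proof -
  define n where "n = (2 :: nat) ^ N"
  define e where "e = qpoly nu ^ (2 ^ (4 * N) - 1)"
  define \<tau> where "\<tau> x = 2 * int x + 1 - int (2 * M)" for x
  define y where "y = c ^ 4 * (of_int (binom4_sum N (2 * M) e) / 4 ^ N)"
  let ?T = "\<Sum>t<n. Rfun nu M (of_nat t + 1/2)" and ?b = "c ^ 4 / 2 * of_int (binom4_sum N (2 * M) e)"
   and ?E = "2 * abs2 c ^ 4 * F * (1/2) ^ (4 * N)" and ?p = "\<lambda>x. of_int (poly e ((\<tau> x)\<^sup>2)) :: rat"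
  have two: "(2 :: rat) * (S / 4 ^ N) = 2 * S / 2 ^ (2 * N)" for S by (simp add: power_mult)
  have pw: "(1/2 :: real) ^ (4 * N) / (1/2) ^ (2 * N) \<le> (1/2) ^ N"
  proof -
   have "(1/2 :: real) ^ (4 * N) = (1/2) ^ (2 * N) * (1/2) ^ (2 * N)" by (simp flip: power_add)
   hence "(1/2 :: real) ^ (4 * N) / (1/2) ^ (2 * N) = (1/2) ^ (2 * N)" by simp
   also have "... \<le> (1/2) ^ N" by (intro power_decreasing) auto
   finally show ?thesis .
  qed
  have a1: "abs2 (?T - (\<Sum>x<n. W x)) \<le> ?E"
  proof -
   have z: "W x = 0" if "x < M" for x
    unfolding W_def Rfun_half_integer[OF assms] using that by simp
   have "?T = (\<Sum>t<n. W (t + M))" by (simp add: W_def)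
   also have "... = (\<Sum>x<n. W x) + ((\<Sum>s<M. W (n + s)) - (\<Sum>s<M. W s))"
   proof -
    have "(\<Sum>t<n. W (t + m)) + (\<Sum>s<m. W s) = (\<Sum>x<n. W x) + (\<Sum>s<m. W (n + s))" for m
    proof -
     have add: "(\<Sum>t<a + b. f t) = (\<Sum>t<a. f t) + (\<Sum>t<b. f (a + t))" for a b and f :: "nat => rat"
      by (induction b) (simp_all add: add.assoc)
     show ?thesis using add[of W m n] add[of W n m] by (simp add: add.commute)
    qed
    from this[of M] show ?thesis by (simp add: algebra_simps)
   qed
   also have "(\<Sum>s<M. W s) = 0" using z by simp
   finally have "?T - (\<Sum>x<n. W x) = (\<Sum>s<M. W (n + s))" by simp
   also have "abs2 ... \<le> ?E"
   proof (rule abs2_sum_le)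
    fix s assume s: "s \<in> {..<M}"
    have "abs2 (W (n + s)) \<le> 2 * abs2 c ^ 4 * abs2 (of_nat (2 ^ N + s choose (2 * M))) ^ 4"
     unfolding W_def c_def n_def by (rule abs2_Rfun_le[OF assms])
    also have "... \<le> 2 * abs2 c ^ 4 * ((1/2) ^ N / abs2 (fact (2 * M))) ^ 4"
     by (intro mult_left_mono power_mono abs2_binomial_near_power) (use s in auto)
    also have "... = 2 * abs2 c ^ 4 * ((1 / abs2 (fact (2 * M))) ^ 4 * (1/2) ^ (4 * N))"
     by (simp add: power_divide power_mult_distrib power_mult[symmetric] mult.commute)
    also have "... \<le> 2 * abs2 c ^ 4 * (F * (1/2) ^ (4 * N))"
     by (intro mult_left_mono mult_right_mono F) auto
    finally show "abs2 (W (n + s)) \<le> ?E" by (simp add: mult.assoc)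
   qed (use F in auto)
   finally show ?thesis .
  qed
  have a2: "abs2 ((\<Sum>x<n. W x) - ?b) \<le> 2 * abs2 c ^ 4 * (1/2) ^ (4 * N)"
  proof -
   have "(\<Sum>x<n. W x) - ?b
    = (\<Sum>x<n. c ^ 4 / 2 * (of_nat (x choose (2 * M)) ^ 4 * of_int (\<tau> x) * (1 / of_int (poly (qpoly nu) ((\<tau> x)\<^sup>2)) - ?p x)))"
   proof -
    have "?b = (\<Sum>x<n. c ^ 4 / 2 * (of_nat (x choose (2 * M)) ^ 4 * of_int (\<tau> x) * ?p x))"
     unfolding binom4_sum_def n_def \<tau>_def by (simp add: sum_distrib_left)
    moreover have "W x = c ^ 4 / 2 * (of_nat (x choose (2 * M)) ^ 4 * of_int (\<tau> x) * (1 / of_int (poly (qpoly nu) ((\<tau> x)\<^sup>2))))" for x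
     unfolding W_def Rfun_half_integer[OF assms] c_def \<tau>_def by simp
    ultimately show ?thesis by (simp only: right_diff_distrib sum_subtractf)
   qed
   also have "abs2 ... \<le> 2 * abs2 c ^ 4 * (1/2) ^ (4 * N)"
   proof (rule abs2_sum_le)
    fix x
    define u where "u = poly (qpoly nu) ((\<tau> x)\<^sup>2)"
    have u: "odd u" unfolding u_def \<tau>_def by (rule odd_qpoly) simp
    hence u0: "of_int u \<noteq> (0 :: rat)" by auto
    obtain k where k: "u ^ (2 ^ (4 * N)) - 1 = 2 ^ (4 * N) * k"
     using odd_power_two_power[OF u, of "4 * N" 1] by (auto elim: dvdE)
    have "?p x = (of_int u ^ (2 ^ (4 * N) - 1) :: rat)" by (simp add: e_def u_def)
    also have "... = of_int (u ^ (2 ^ (4 * N))) / of_int u"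
     using u0 by (simp add: power_diff)
    finally have "1 / of_int u - ?p x = - (of_int (u ^ (2 ^ (4 * N)) - 1) / of_int u :: rat)"
     by (simp add: diff_divide_distrib)
    also have "... = - (2 ^ (4 * N) * of_int k / of_int u)" unfolding k by simp
    finally have "abs2 (1 / of_int u - ?p x) = (1/2) ^ (4 * N) * abs2 (of_int k)"
     using abs2_of_int_odd[OF u] by (simp only: abs2_minus abs2_divide abs2_mult abs2_two_power)
    also have "... \<le> (1/2) ^ (4 * N) * 1" by (intro mult_left_mono abs2_of_int_le) auto
    finally have d: "abs2 (1 / of_int u - ?p x) \<le> (1/2) ^ (4 * N)" by simp
    have "abs2 (of_int (int (x choose (2 * M)))) \<le> 1" by (rule abs2_of_int_le)
    hence b: "abs2 (of_nat (x choose (2 * M))) \<le> 1" by simp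
    have "abs2 (c ^ 4 / 2 * (of_nat (x choose (2 * M)) ^ 4 * of_int (\<tau> x) * (1 / of_int u - ?p x)))
     = 2 * abs2 c ^ 4 * (abs2 (of_nat (x choose (2 * M))) ^ 4 * abs2 (of_int (\<tau> x)) * abs2 (1 / of_int u - ?p x))"
     by (simp only: abs2_mult abs2_divide abs2_power abs2_2) simp
    also have "... \<le> 2 * abs2 c ^ 4 * (1 * 1 * (1/2) ^ (4 * N))"
     by (intro mult_left_mono mult_mono d power_le_one b abs2_of_int_le) auto
    finally show "abs2 (c ^ 4 / 2 * (of_nat (x choose (2 * M)) ^ 4 * of_int (\<tau> x) * (1 / of_int (poly (qpoly nu) ((\<tau> x)\<^sup>2)) - ?p x)))
     \<le> 2 * abs2 c ^ 4 * (1/2) ^ (4 * N)" by (simp add: u_def)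
   qed auto
   finally show ?thesis .
  qed
  have "abs2 (?T - ?b)
   \<le> max (abs2 (?T - (\<Sum>x<n. W x))) (abs2 ((\<Sum>x<n. W x) - ?b))"
   by (rule abs2_diff_le)
  also have "... \<le> ?E"
  proof (rule max.boundedI[OF a1 order_trans[OF a2]])
   have "2 * abs2 c ^ 4 * 1 * (1/2) ^ (4 * N) \<le> ?E"
    by (intro mult_right_mono mult_left_mono F) auto
   thus "2 * abs2 c ^ 4 * (1/2) ^ (4 * N) \<le> ?E" by simp
  qed
  finally have a3: "abs2 (?T - ?b) \<le> ?E" .
  have "2 * (?T / 4 ^ N) - y
   = 2 * (?T - ?b) / 2 ^ (2 * N)"
   unfolding y_def two by (simp add: diff_divide_distrib right_diff_distrib power_mult)
  hence "abs2 (2 * (?T / 4 ^ N) - y)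
   = 1/2 * abs2 (?T - ?b) / (1/2) ^ (2 * N)"
   by (simp only: abs2_mult abs2_divide abs2_two_power abs2_2)
  also have "... \<le> 1/2 * (?E) / (1/2) ^ (2 * N)"
   by (intro divide_right_mono mult_left_mono a3) auto
  also have "... = (abs2 c ^ 4 * F) * ((1/2) ^ (4 * N) / (1/2) ^ (2 * N))" by simp
  also have "... \<le> (abs2 c ^ 4 * F) * (1/2) ^ N" using F by (intro mult_left_mono pw) auto
  finally have b1: "abs2 (2 * (?T / 4 ^ N) - y) \<le> (abs2 c ^ 4 * F) * (1/2) ^ N" .
  obtain z where z: "2 ^ digit_sum2 (2 * M) * binom4_sum N (2 * M) e = 2 ^ (2 * N) * z"
   "odd (poly e (of_bool (even (2 * M)))) ==> odd z"
   using binom4_sum_valuation[of "2 * M" N e] N by auto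
  have oz: "odd z" by (rule z(2)) (simp add: e_def odd_qpoly)
  have "(2 :: rat) ^ digit_sum2 M * of_int (binom4_sum N (2 * M) e) = 2 ^ (2 * N) * of_int z"
   using arg_cong[OF z(1), of "of_int :: int => rat"] by (simp add: digit_sum2_double)
  hence "(1/2) ^ digit_sum2 M * abs2 (of_int (binom4_sum N (2 * M) e)) = (1/2) ^ (2 * N)"
   using abs2_of_int_odd[OF oz] by (metis abs2_mult abs2_two_power mult.right_neutral)
  hence "abs2 (of_int (binom4_sum N (2 * M) e)) / (1/2) ^ (2 * N) = 2 ^ digit_sum2 M"
   by (simp add: field_simps power_one_over)
  moreover have "y = c ^ 4 * (of_int (binom4_sum N (2 * M) e) / 2 ^ (2 * N))" by (simp add: y_def power_mult)
  ultimately have "abs2 y = abs2 c ^ 4 * 2 ^ digit_sum2 M"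
   by (simp only: abs2_mult abs2_divide abs2_power abs2_2)
  thus ?thesis using b1 unfolding n_def by blast
 qed
 thus ?thesis unfolding c_def by blast
qed

definition rho0_form :: "nat => nat => rat" where
 "rho0_form nu M = rho0 nu (coefA nu M)"

definition rho3_form :: "nat => nat => rat" where
 "rho3_form nu M = rho3 nu (coefA nu M)"

lemma abs2_cconst: "abs2 (cconst nu M) = 2 ^ digit_sum2 nu / 2 ^ (4 * nu + 4 * M + 1)"
proof -
 obtain z :: int where z: "odd z" "2 ^ digit_sum2 (2 * nu) * fact (2 * nu) = 2 ^ (2 * nu) * z"
  using fact_2adic[of "2 * nu"] by blast
 have "(2 :: rat) ^ digit_sum2 nu * of_int (fact (2 * nu)) = 2 ^ (2 * nu) * of_int z"
  using arg_cong[OF z(2), of "of_int :: int => rat"] by (simp add: digit_sum2_double)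
 hence "(2 :: rat) ^ digit_sum2 nu * fact (2 * nu) = 2 ^ (2 * nu) * of_int z" by simp
 hence "(1/2) ^ digit_sum2 nu * abs2 (fact (2 * nu)) = (1/2) ^ (2 * nu)"
  using abs2_of_int_odd[OF z(1)] by (metis abs2_mult abs2_two_power mult.right_neutral)
 hence "abs2 (fact (2 * nu)) = 2 ^ digit_sum2 nu * (1/2) ^ (2 * nu)"
  by (simp add: field_simps power_one_over)
 moreover have "(1/2 :: real) ^ (2 * nu) * (1/2) ^ (4 * M + 2 * nu + 1) = 1 / 2 ^ (4 * nu + 4 * M + 1)"
  by (simp add: power_one_over flip: power_add)
 moreover have "abs2 (cconst nu M) = abs2 (fact (2 * nu)) * (1/2) ^ (4 * M + 2 * nu + 1)"
  by (simp only: cconst_def abs2_mult abs2_two_power)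
 ultimately show ?thesis by (simp only: mult.assoc) simp
qed

lemma norm2_eq_of_less:
 assumes "norm2 (x + y) < norm2 (x :: padic2)"
 shows "norm2 y = norm2 x"
 using norm2_ultra[of "x + y" "- y"] norm2_ultra[of "x + y" "- x"] assms by (auto simp: max_def split: if_splits)

text \<open>\<open>S\<close> and \<open>y\<close> approximate the same average; once the errors drop
  below \<open>V = abs2 y\<close>, the ultrametric inequality forces \<open>norm2 S = V\<close>. The
  factor 384 is \<open>16 * 24\<close>, the product of the coefficient of the average and of its
  ratio to the zeta value.\<close>

theorem norm2_linear_form:
 assumes "M \<le> nu"
 shows "norm2 (of_rat (rho0_form nu M) - of_rat (384 * rho3_form nu M) * zeta_2_5)
   = 2 ^ (4 * digit_sum2 nu + digit_sum2 M) / 2 ^ (4 * (4 * nu + 4 * M + 1))"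
proof -
 define S where "S = of_rat (rho0_form nu M) - of_rat (384 * rho3_form nu M) * zeta_2_5"
 define V where "V = abs2 (cconst nu M) ^ 4 * 2 ^ digit_sum2 M"
 define T where "T N = 2 * ((\<Sum>t<2 ^ N. Rfun nu M (of_nat t + 1/2)) / 4 ^ N)" for N
 define r0 r3 where "r0 = rho0_form nu M" and "r3 = rho3_form nu M"
 have "cconst nu M \<noteq> 0" by (simp add: cconst_def)
 hence V: "V > 0" unfolding V_def by (intro mult_pos_pos zero_less_power abs2_pos) auto
 obtain K1 where K1: "\<And>N. 2 * M < 2 ^ N ==> \<exists>y. abs2 y = V \<and> abs2 (T N - y) \<le> K1 * (1/2) ^ N"
  using Rfun_sum_abs2[OF assms] unfolding V_def T_def by blast
 obtain K2 where K2: "\<And>N. abs2 (T N - (16 * r3 * osum_neg3 N + r0)) \<le> K2 * (1/2) ^ N"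
  using linear_form_approx[of "coefA nu M" nu, OF coefA_minus]
  unfolding T_def Rfun_def rfun_def r0_def r3_def rho0_form_def rho3_form_def by blast
 define K where "K = max (max K1 K2) (abs2 (384 * r3) * 32)"
 have K: "K1 \<le> K" "K2 \<le> K" "abs2 (384 * r3) * 32 \<le> K" by (auto simp: K_def)
 have "(\<lambda>N. K * (1/2) ^ N) \<longlonglongrightarrow> K * 0" by (intro tendsto_mult tendsto_const LIMSEQ_realpow_zero) auto
 hence "\<forall>\<^sub>F N in sequentially. K * (1/2) ^ N < V" using V by (intro order_tendstoD(2)) auto
 then obtain N0 where N0: "\<And>N. N \<ge> N0 ==> K * (1/2) ^ N < V" unfolding eventually_sequentially by blast
 define N where "N = max N0 (2 * M)"
 have N: "K * (1/2) ^ N < V" by (rule N0) (simp add: N_def)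
 have "2 * M \<le> N" by (simp add: N_def)
 also have "N < 2 ^ N" by (rule less_exp)
 finally have "2 * M < 2 ^ N" .
 then obtain y where y: "abs2 y = V" "abs2 (T N - y) \<le> K1 * (1/2) ^ N" using K1 by blast
 define \<delta> where "\<delta> = zeta_2_5 - of_rat (- (osum_neg3 N / 24))"
 let ?u = "r0 + 16 * r3 * osum_neg3 N - T N"
 have "S - of_rat y = of_rat (?u + (T N - y)) + - (of_rat (384 * r3) * \<delta>)"
 proof -
  have "of_rat (384 * r3) * \<delta> = of_rat (384 * r3) * zeta_2_5 + of_rat (384 * r3 * (osum_neg3 N / 24))"
   unfolding \<delta>_def of_rat_minus by (simp only: diff_minus_eq_add distrib_left of_rat_mult)
  also have "384 * r3 * (osum_neg3 N / 24) = 16 * r3 * osum_neg3 N" by simp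
  finally show ?thesis unfolding S_def r0_def[symmetric] r3_def[symmetric]
   by (simp add: of_rat_add of_rat_diff)
 qed
 also have "norm2 ... \<le> max (norm2 (of_rat (?u + (T N - y)))) (norm2 (of_rat (384 * r3) * \<delta>))"
  by (metis norm2_minus norm2_ultra)
 also have "... \<le> K * (1/2) ^ N"
 proof (rule max.boundedI)
  have "abs2 (?u + (T N - y)) \<le> max (abs2 ?u) (abs2 (T N - y))"
   by (rule abs2_ultra)
  also have "... \<le> K * (1/2) ^ N"
  proof (rule max.boundedI)
   have "abs2 ?u \<le> K2 * (1/2) ^ N"
    using K2[of N] by (simp add: abs2_minus_commute add.commute)
   also have "... \<le> K * (1/2) ^ N" by (intro mult_right_mono K) auto
   finally show "abs2 ?u \<le> K * (1/2) ^ N" .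
   show "abs2 (T N - y) \<le> K * (1/2) ^ N" by (rule order_trans[OF y(2)]) (intro mult_right_mono K, auto)
  qed
  finally show "norm2 (of_rat (?u + (T N - y))) \<le> K * (1/2) ^ N"
   by (simp only: norm2_of_rat)
  have "norm2 (of_rat (384 * r3) * \<delta>) \<le> abs2 (384 * r3) * (32 * (1/2) ^ N)"
   unfolding norm2_mult norm2_of_rat \<delta>_def by (intro mult_left_mono zeta_2_5_approx) auto
  also have "... \<le> K * (1/2) ^ N" using mult_right_mono[OF K(3), of "(1/2) ^ N"] by (simp add: mult.assoc)
  finally show "norm2 (of_rat (384 * r3) * \<delta>) \<le> K * (1/2) ^ N" .
 qed
 finally have d: "norm2 (S - of_rat y) < V" using N by linarith
 have ny: "norm2 (of_rat y :: padic2) = V" by (simp add: norm2_of_rat y)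
 have "norm2 S = V" using norm2_eq_of_less[of "of_rat y" "- S"] norm2_minus[of "S - of_rat y"] d ny by simp
 also have "V = 2 ^ (4 * digit_sum2 nu + digit_sum2 M) / 2 ^ (4 * (4 * nu + 4 * M + 1))"
  unfolding V_def abs2_cconst power_divide power_mult[symmetric] by (simp add: power_add mult.commute)
 finally show ?thesis unfolding S_def .
qed

section \<open>Denominators\<close>

text \<open>For prime \<open>p\<close>, \<open>pge p n x\<close> means that the \<open>p\<close>-adic valuation of \<open>x\<close> is at least \<open>n\<close>, and \<open>plead p n x y\<close> that
\<open>x\<close> and \<open>y\<close> have in addition the same leading term in degree \<open>n\<close>.\<close>

definition pge :: "int => int => rat => bool" where
 "pge p n x \<longleftrightarrow> (\<exists>a b. \<not> p dvd b \<and> x * of_int b = of_int a * of_int p powi n)"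

definition plead :: "int => int => rat => rat => bool" where
 "plead p n x y \<longleftrightarrow> pge p n x \<and> pge p n y \<and> pge p (n + 1) (x - y)"

context
 fixes p :: int
 assumes p: "prime p"
begin

lemma p_nz: "(of_int p :: rat) \<noteq> 0"
 using p by auto

lemma p_powi_add: "of_int p powi (m + n) = of_int p powi m * (of_int p powi n :: rat)"
 by (rule power_int_add) (use p_nz in blast)

lemma pge_0 [simp]: "pge p n 0"
 unfolding pge_def by (intro exI[of _ 0] exI[of _ 1]) (use p in \<open>auto simp: not_prime_unit\<close>)

lemma pge_add:
 assumes "pge p n x" "pge p n y"
 shows "pge p n (x + y)"
proof -
 obtain a b where 1: "\<not> p dvd b" "x * of_int b = of_int a * of_int p powi n" using assms(1) by (auto simp: pge_def)
 obtain c d where 2: "\<not> p dvd d" "y * of_int d = of_int c * of_int p powi n" using assms(2) by (auto simp: pge_def)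
 have "(x + y) * of_int (b * d) = (x * of_int b) * of_int d + (y * of_int d) * of_int b" by (simp add: algebra_simps)
 also have "... = of_int (a * d + c * b) * of_int p powi n" unfolding 1 2 by (simp add: algebra_simps)
 finally show ?thesis unfolding pge_def using 1 2 prime_dvd_mult_iff[OF p, of b d] by blast
qed

lemma pge_mult:
 assumes "pge p m x" "pge p n y"
 shows "pge p (m + n) (x * y)"
proof -
 obtain a b where 1: "\<not> p dvd b" "x * of_int b = of_int a * of_int p powi m" using assms(1) by (auto simp: pge_def)
 obtain c d where 2: "\<not> p dvd d" "y * of_int d = of_int c * of_int p powi n" using assms(2) by (auto simp: pge_def)
 have "(x * y) * of_int (b * d) = (x * of_int b) * (y * of_int d)" by simp
 also have "... = of_int (a * c) * of_int p powi (m + n)" unfolding 1 2 p_powi_add by simp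
 finally show ?thesis unfolding pge_def using 1 2 prime_dvd_mult_iff[OF p, of b d] by blast
qed

lemma pge_mono:
 assumes "pge p n x" "m \<le> n"
 shows "pge p m x"
proof -
 obtain a b where 1: "\<not> p dvd b" "x * of_int b = of_int a * of_int p powi n" using assms(1) by (auto simp: pge_def)
 have "of_int p powi n = of_int (p ^ nat (n - m)) * (of_int p powi m :: rat)"
 proof -
  have "of_int p powi n = (of_int p powi (int (nat (n - m)) + m) :: rat)" using assms(2) by simp
  also have "... = of_int p powi int (nat (n - m)) * of_int p powi m" by (rule p_powi_add)
  finally show ?thesis by (simp only: power_int_of_nat of_int_power)
 qed
 hence "x * of_int b = of_int (a * p ^ nat (n - m)) * of_int p powi m" using 1(2) by (simp only: of_int_mult mult.assoc)
 thus ?thesis unfolding pge_def using 1(1) by blast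
qed

lemma pge_of_int [simp]: "pge p 0 (of_int k)"
 unfolding pge_def by (intro exI[of _ k] exI[of _ 1]) (use p in \<open>auto simp: not_prime_unit\<close>)

lemma pge_of_nat [simp]: "pge p 0 (of_nat k)"
 using pge_of_int[of "int k"] by simp

lemma pge_numeral [simp]: "pge p 0 (numeral k)"
 using pge_of_int[of "numeral k"] by simp

lemma pge_1 [simp]: "pge p 0 1"
 using pge_of_int[of 1] by simp

lemma pge_of_int_dvd: "p dvd k ==> pge p 1 (of_int k)"
 unfolding pge_def by (elim dvdE, intro exI[of _ "k div p"] exI[of _ 1]) (use p in \<open>auto simp: not_prime_unit\<close>)

lemma pge_inverse_unit:
 assumes "\<not> p dvd k"
 shows "pge p 0 (1 / of_int k)"
proof -
 have "k \<noteq> 0" using assms by auto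
 thus ?thesis unfolding pge_def by (intro exI[of _ 1] exI[of _ k]) (use assms in auto)
qed

lemma pge_inverse_simple:
 assumes "\<not> p\<^sup>2 dvd k"
 shows "pge p (- 1) (1 / of_int k)"
proof (cases "p dvd k")
 case True
 then obtain u where u: "k = p * u" by blast
 have "\<not> p dvd u" using assms by (auto simp: u power2_eq_square)
 moreover have "1 / of_int k * of_int u = (of_int p powi (- 1) :: rat)"
  using \<open>\<not> p dvd u\<close> p_nz by (auto simp: u power_int_minus field_simps)
 ultimately show ?thesis unfolding pge_def by (intro exI[of _ 1] exI[of _ u]) simp
next
 case False
 thus ?thesis by (intro pge_mono[OF pge_inverse_unit]) auto
qed

lemma pge_minus: "pge p n x ==> pge p n (- x)"
 using pge_mult[OF pge_of_int[of "-1"], of n x] by simp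

lemma pge_diff: "pge p n x ==> pge p n y ==> pge p n (x - y)"
 using pge_add[of n x "- y"] pge_minus[of n y] by simp

lemma pge_sum: "(\<And>i. i \<in> S ==> pge p n (f i)) ==> pge p n (\<Sum>i\<in>S. f i)"
 by (induction S rule: infinite_finite_induct) (auto intro: pge_add)

lemma pge_power: "pge p n x ==> pge p (int k * n) (x ^ k)"
proof (induction k)
 case (Suc k)
 thus ?case using pge_mult[of n x "int k * n" "x ^ k"] by (simp add: algebra_simps)
qed simp

lemma pge_prod_0: "(\<And>i. i \<in> S ==> pge p 0 (f i)) ==> pge p 0 (\<Prod>i\<in>S. f i)"
proof (induction S rule: infinite_finite_induct)
 case (insert i S)
 thus ?case using pge_mult[of 0 "f i" 0 "prod f S"] by simp
qed auto

lemma pge_prod_const: "(\<And>i. i \<in> S ==> pge p n (f i)) ==> pge p (int (card S) * n) (\<Prod>i\<in>S. f i)"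
proof (induction S rule: infinite_finite_induct)
 case (insert i S)
 thus ?case using pge_mult[of n "f i" "int (card S) * n" "prod f S"] by (simp add: algebra_simps)
qed auto

lemma pge_cmult: "pge p 0 c ==> pge p n x ==> pge p n (c * x)"
 using pge_mult[of 0 c n x] by simp

lemma plead_refl: "pge p n x ==> plead p n x x"
 by (simp add: plead_def)

lemma plead_sym: "plead p n x y ==> plead p n y x"
 unfolding plead_def using pge_minus[of "n + 1" "x - y"] by simp

lemma plead_trans: "plead p n x y ==> plead p n y z ==> plead p n x z"
 unfolding plead_def using pge_add[of "n + 1" "x - y" "y - z"] by simp

lemma plead_small: "pge p (n + 1) x ==> pge p (n + 1) y ==> plead p n x y"
 unfolding plead_def by (auto intro: pge_mono pge_diff)

lemma plead_add: "plead p n x y ==> plead p n z w ==> plead p n (x + z) (y + w)"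
 unfolding plead_def using pge_add[of "n + 1" "x - y" "z - w"] by (auto intro: pge_add simp: algebra_simps)

lemma plead_mult:
 assumes "plead p m x y" "plead p n z w"
 shows "plead p (m + n) (x * z) (y * w)"
proof -
 have "x * z - y * w = (x - y) * z + y * (z - w)" by (simp add: algebra_simps)
 moreover have "pge p (m + n + 1) ((x - y) * z)" using assms pge_mult[of "m + 1" "x - y" n z] by (simp add: plead_def algebra_simps)
 moreover have "pge p (m + n + 1) (y * (z - w))" using assms pge_mult[of m y "n + 1" "z - w"] by (simp add: plead_def algebra_simps)
 ultimately show ?thesis using assms pge_mult unfolding plead_def by (auto intro: pge_add)
qed

lemma plead_power: "plead p n x y ==> plead p (int k * n) (x ^ k) (y ^ k)"
proof (induction k)
 case 0
 show ?case by (simp add: plead_refl)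
next
 case (Suc k)
 thus ?case using plead_mult[of n x y "int k * n" "x ^ k" "y ^ k"] by (simp add: algebra_simps)
qed

lemma plead_cmult: "pge p 0 c ==> plead p n x y ==> plead p n (c * x) (c * y)"
 using plead_mult[of 0 c c n x y] by (simp add: plead_refl)

lemma plead_minus: "plead p n x y ==> plead p n (- x) (- y)"
 using plead_cmult[OF pge_of_int[of "-1"], of n x y] by simp

lemma plead_sum: "(\<And>i. i \<in> S ==> plead p n (f i) (g i)) ==> plead p n (\<Sum>i\<in>S. f i) (\<Sum>i\<in>S. g i)"
 by (induction S rule: infinite_finite_induct) (auto intro: plead_add plead_refl)

lemma plead_prod_0: "(\<And>i. i \<in> S ==> plead p 0 (f i) (g i)) ==> plead p 0 (\<Prod>i\<in>S. f i) (\<Prod>i\<in>S. g i)"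
proof (induction S rule: infinite_finite_induct)
 case (insert i S)
 thus ?case using plead_mult[of 0 "f i" "g i" 0 "prod f S" "prod g S"] by simp
qed (auto intro: plead_refl)

lemma plead_inverse_unit:
 assumes "\<not> p dvd k" "p dvd k - l"
 shows "plead p 0 (1 / of_int k) (1 / of_int l)"
proof -
 have l: "\<not> p dvd l" using assms by (metis dvd_diffD1 dvd_minus_iff minus_diff_eq diff_add_cancel dvd_add)
 hence nz: "of_int k \<noteq> (0 :: rat)" "of_int l \<noteq> (0 :: rat)" using assms(1) by auto
 have "1 / of_int k - 1 / of_int l = (- of_int (k - l)) * ((1 / of_int k) * (1 / of_int l) :: rat)"
  using nz by (simp add: field_simps)
 moreover have "pge p (1 + (0 + 0)) ((- of_int (k - l)) * ((1 / of_int k) * (1 / of_int l)))"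
  by (intro pge_mult pge_minus pge_of_int_dvd assms pge_inverse_unit l)
 ultimately show ?thesis unfolding plead_def using assms(1) l by (simp add: pge_inverse_unit)
qed

text \<open>Only the poles congruent to \<open>j\<close> contribute to the leading terms, and these only depend on
 the differences of the poles, so that they are unchanged by a translation \<open>\<phi>\<close>.\<close>

context
 fixes J S S' :: "int set" and A B :: "int => rat" and v :: int and c :: int
 assumes J: "finite J" and S: "S \<subseteq> J" "S' = (\<lambda>i. i - c) ` S"
  and out: "\<And>i j. j \<in> S ==> i \<in> J ==> i \<notin> S ==> \<not> p dvd j - i"
  and simple: "\<And>i j. i \<in> J ==> j \<in> J ==> i \<noteq> j ==> \<not> p\<^sup>2 dvd j - i"
  and A: "\<And>i. i \<in> J ==> pge p v (A i)"
  and AB: "\<And>i. i \<in> S ==> plead p v (A i) (B (i - c))"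
begin

lemma class_sum_plead:
 assumes j: "j \<in> S" and f: "\<And>i. i \<in> S - {j} ==> plead p n (f i) (g (i - c))" "\<And>i. i \<in> J - S ==> pge p (n + 1) (f i)"
 shows "plead p n (\<Sum>i\<in>J - {j}. f i) (\<Sum>i\<in>S' - {j - c}. g i)"
proof -
 have "J - {j} = (S - {j}) \<union> (J - S)" using S j by auto
 hence "(\<Sum>i\<in>J - {j}. f i) = (\<Sum>i\<in>S - {j}. f i) + (\<Sum>i\<in>J - S. f i)"
  using J finite_subset[OF S(1) J] by (simp only:) (rule sum.union_disjoint, auto)
 moreover have "(\<Sum>i\<in>S' - {j - c}. g i) = (\<Sum>i\<in>S - {j}. g (i - c))"
  by (rule sum.reindex_bij_witness[of _ "\<lambda>i. i - c" "\<lambda>i. i + c"]) (auto simp: S)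
 moreover have "plead p n (\<Sum>i\<in>S - {j}. f i) (\<Sum>i\<in>S - {j}. g (i - c))" by (rule plead_sum) (rule f)
 moreover have "plead p n (\<Sum>i\<in>J - S. f i) 0" by (intro plead_small pge_sum f) auto
 ultimately show ?thesis using plead_add by fastforce
qed

lemma inv_diff_pge: "i \<in> J ==> j \<in> J ==> i \<noteq> j ==> pge p (- int k) (1 / of_int (j - i) ^ k)"
 using pge_power[OF pge_inverse_simple[OF simple], of i j k] by (simp add: power_one_over)

lemma inv_diff_pge_out: "j \<in> S ==> i \<in> J - S ==> pge p 0 (1 / of_int (j - i) ^ k)"
 using pge_power[OF pge_inverse_unit[OF out], of j i k] by (simp add: power_one_over)

lemma class_term_plead:
 assumes "i \<in> S - {j}" "j \<in> S" "plead p m x y"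
 shows "plead p (m - int k) (x / of_int (j - i) ^ k) (y / of_int (j - c - (i - c)) ^ k)"
proof -
 have "plead p (m + - int k) (x * (1 / of_int (j - i) ^ k)) (y * (1 / of_int (j - i) ^ k))"
  by (intro plead_mult assms plead_refl inv_diff_pge) (use assms S in auto)
 thus ?thesis by simp
qed

lemma pge_term:
 assumes "i \<in> J" "j \<in> J" "i \<noteq> j" "pge p m x"
 shows "pge p (m - int k) (x / of_int (j - i) ^ k)"
 using pge_mult[OF assms(4) inv_diff_pge[OF assms(1-3), of k]] by simp

lemma pge_term_out:
 assumes "j \<in> S" "i \<in> J - S" "pge p m x"
 shows "pge p m (x / of_int (j - i) ^ k)"
 using pge_mult[OF assms(3) inv_diff_pge_out[OF assms(1,2), of k]] by simp

lemma pge_pf_b1: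
 assumes "j \<in> J"
 shows "pge p (2 * v - 1) (pf_b1 J A j)"
proof -
 have "pge p (v - 1) (\<Sum>i\<in>J - {j}. A i / of_int (j - i) ^ 1)"
 proof (rule pge_sum)
  fix i assume "i \<in> J - {j}"
  thus "pge p (v - 1) (A i / of_int (j - i) ^ 1)" using pge_term[of i j v "A i" 1] A assms by auto
 qed
 from pge_mult[OF A[OF assms] this] have "pge p (2 * v - 1) (A j * (\<Sum>i\<in>J - {j}. A i / of_int (j - i) ^ 1))" by simp
 from pge_cmult[OF pge_numeral this] show ?thesis by (simp add: pf_b1_def pfg_def mult.assoc)
qed

lemma plead_pf_b1:
 assumes "j \<in> S"
 shows "plead p (2 * v - 1) (pf_b1 J A j) (pf_b1 S' B (j - c))"
proof -
 have "plead p (v - 1) (\<Sum>i\<in>J - {j}. A i / of_int (j - i) ^ 1) (\<Sum>i\<in>S' - {j - c}. B i / of_int (j - c - i) ^ 1)"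
 proof (rule class_sum_plead[OF assms])
  fix i assume "i \<in> S - {j}"
  thus "plead p (v - 1) (A i / of_int (j - i) ^ 1) (B (i - c) / of_int (j - c - (i - c)) ^ 1)"
   using class_term_plead[of i j v "A i" "B (i - c)" 1] assms AB by simp
 next
  fix i assume "i \<in> J - S"
  thus "pge p (v - 1 + 1) (A i / of_int (j - i) ^ 1)"
   using pge_term_out[OF assms, of i v "A i" 1] A by simp
 qed
 from plead_mult[OF AB[OF assms] this]
 have "plead p (2 * v - 1) (A j * (\<Sum>i\<in>J - {j}. A i / of_int (j - i) ^ 1)) (B (j - c) * (\<Sum>i\<in>S' - {j - c}. B i / of_int (j - c - i) ^ 1))" by simp
 from plead_cmult[OF pge_numeral this] show ?thesis by (simp add: pf_b1_def pfg_def mult.assoc)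
qed

lemma A2: "i \<in> J ==> pge p (2 * v) ((A i)\<^sup>2)"
 using pge_power[OF A, of i 2] by simp

lemma AB2: "i \<in> S ==> plead p (2 * v) ((A i)\<^sup>2) ((B (i - c))\<^sup>2)"
 using plead_power[OF AB, of i 2] by simp

lemma plead_pf_G:
 assumes "j \<in> S"
 shows "plead p (2 * v - 2) (pf_G J A j) (pf_G S' B (j - c))"
 unfolding pf_G_def pfg_def
proof (rule class_sum_plead[OF assms])
 fix i assume i: "i \<in> S - {j}"
 have "plead p (2 * v - int 2) ((A i)\<^sup>2 / of_int (j - i) ^ 2) ((B (i - c))\<^sup>2 / of_int (j - c - (i - c)) ^ 2)"
  using i by (intro class_term_plead assms AB2) auto
 moreover have "plead p (2 * v - 1 - int 1) (pf_b1 J A i / of_int (j - i) ^ 1) (pf_b1 S' B (i - c) / of_int (j - c - (i - c)) ^ 1)"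
  using i by (intro class_term_plead assms plead_pf_b1) auto
 ultimately show "plead p (2 * v - 2) ((A i)\<^sup>2 / of_int (j - i) ^ 2 + pf_b1 J A i / of_int (j - i))
  ((B (i - c))\<^sup>2 / of_int (j - c - (i - c)) ^ 2 + pf_b1 S' B (i - c) / of_int (j - c - (i - c)))"
  by (intro plead_add) simp_all
next
 fix i assume i: "i \<in> J - S"
 have "pge p (2 * v) ((A i)\<^sup>2 / of_int (j - i) ^ 2)" using i by (intro pge_term_out assms A2) auto
 moreover have "pge p (2 * v - 1) (pf_b1 J A i / of_int (j - i) ^ 1)" using i by (intro pge_term_out assms pge_pf_b1) auto
 ultimately show "pge p (2 * v - 2 + 1) ((A i)\<^sup>2 / of_int (j - i) ^ 2 + pf_b1 J A i / of_int (j - i))"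
  by (intro pge_add) (auto intro: pge_mono)
qed

lemma plead_pf_H:
 assumes "j \<in> S"
 shows "plead p (2 * v - 3) (pf_H J A j) (pf_H S' B (j - c))"
 unfolding pf_H_def pfh_def
proof (rule class_sum_plead[OF assms])
 fix i assume i: "i \<in> S - {j}"
 have "plead p (2 * v - int 3) ((of_int (-2) * (A i)\<^sup>2) / of_int (j - i) ^ 3) ((of_int (-2) * (B (i - c))\<^sup>2) / of_int (j - c - (i - c)) ^ 3)"
  using i by (intro class_term_plead assms plead_cmult pge_of_int AB2) auto
 moreover have "plead p (2 * v - 1 - int 2) (- pf_b1 J A i / of_int (j - i) ^ 2) (- pf_b1 S' B (i - c) / of_int (j - c - (i - c)) ^ 2)"
  using i by (intro class_term_plead assms plead_minus plead_pf_b1) auto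
 ultimately have "plead p (2 * v - 3) ((of_int (-2) * (A i)\<^sup>2) / of_int (j - i) ^ 3 + - pf_b1 J A i / of_int (j - i) ^ 2)
   ((of_int (-2) * (B (i - c))\<^sup>2) / of_int (j - c - (i - c)) ^ 3 + - pf_b1 S' B (i - c) / of_int (j - c - (i - c)) ^ 2)"
  by (intro plead_add) simp_all
 thus "plead p (2 * v - 3) (- 2 * (A i)\<^sup>2 / of_int (j - i) ^ 3 - pf_b1 J A i / of_int (j - i) ^ 2)
  (- 2 * (B (i - c))\<^sup>2 / of_int (j - c - (i - c)) ^ 3 - pf_b1 S' B (i - c) / of_int (j - c - (i - c)) ^ 2)"
  by simp
next
 fix i assume i: "i \<in> J - S"
 have "pge p (2 * v) ((of_int (-2) * (A i)\<^sup>2) / of_int (j - i) ^ 3)"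
  using i by (intro pge_term_out assms pge_cmult pge_of_int A2) auto
 moreover have "pge p (2 * v - 1) (- pf_b1 J A i / of_int (j - i) ^ 2)" using i by (intro pge_term_out assms pge_minus pge_pf_b1) auto
 ultimately have "pge p (2 * v - 3 + 1) ((of_int (-2) * (A i)\<^sup>2) / of_int (j - i) ^ 3 + - pf_b1 J A i / of_int (j - i) ^ 2)"
  by (intro pge_add) (auto intro: pge_mono)
 thus "pge p (2 * v - 3 + 1) (- 2 * (A i)\<^sup>2 / of_int (j - i) ^ 3 - pf_b1 J A i / of_int (j - i) ^ 2)" by simp
qed

text \<open>The coefficient of order \<open>i\<close> consists of products of four residues divided
  by \<open>4 - i\<close> differences of poles, each of which contains \<open>p\<close> at most
  once.\<close>

lemma plead_pf_c:
 assumes j: "j \<in> S"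
 shows "plead p (4 * v - 4 + int i) (pf_c J A i j) (pf_c S' B i (j - c))"
proof -
 note b1 = plead_pf_b1[OF j] and G = plead_pf_G[OF j] and H = plead_pf_H[OF j]
 note AA = plead_cmult[OF pge_numeral[of "num.Bit0 num.One"] AB2[OF j]]
 note bb = plead_cmult[OF pge_numeral[of "num.Bit0 num.One"] b1]
 consider "i = 1" | "i = 2" | "i = 3" | "i = 4" | "i \<notin> {1,2,3,4}" by blast
 thus ?thesis
 proof cases
  case 1
  show ?thesis using plead_add[OF plead_mult[OF bb G] plead_mult[OF AA H, THEN back_subst[of "\<lambda>n. plead p n _ _"]]] 1
   by (simp add: pf_c_def)
 next
  case 2
  show ?thesis using plead_add[OF plead_power[OF b1, of 2, simplified] plead_mult[OF AA G, THEN back_subst[of "\<lambda>n. plead p n _ _"]]] 2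
   by (simp add: pf_c_def)
 next
  case 3
  show ?thesis using plead_mult[OF AA b1] 3 by (simp add: pf_c_def)
 next
  case 4
  show ?thesis using plead_power[OF AB[OF j], of 4] 4 by (simp add: pf_c_def)
 qed (auto simp: pf_c_def plead_refl)
qed

end

end

section \<open>Poles and zeros modulo a large prime\<close>

lemma fact_eq_prod_above:
 assumes "m \<le> n"
 shows "(fact n :: 'a::{comm_semiring_1,semiring_char_0}) = fact m * (\<Prod>i\<in>{m<..n}. of_nat i)"
 using assms
proof (induction n rule: dec_induct)
 case (step n)
 have "{m<..Suc n} = insert (Suc n) {m<..n}" using step by auto
 thus ?case using step by (simp add: mult_ac)
qed simp

text \<open>\<open>2 nu < 2 M + p\<close> keeps the midpoints between consecutive poles of a residue
  class within the range of the zeros. \<open>4 nu < p^2\<close> excludes the factor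
  \<open>p^2\<close> from differences of poles and from doubled differences of poles and
  zeros.\<close>

locale large_prime =
 fixes p :: int and nu M :: nat
 assumes p: "prime p" and odd_p: "odd p" and M: "M \<le> nu"
  and large: "2 * int nu < 2 * int M + p" "4 * int nu < p\<^sup>2"
begin

text \<open>The zeros are half-integers and are stored as odd integers, multiplied by 2. The poles in the residue class
\<open>cls j\<close> run from \<open>low j\<close> to \<open>high j\<close>.\<close>

definition "poles = {- int nu..int nu}"

definition "zeros = {z. odd z \<and> \<bar>z\<bar> < 2 * int M}"

text \<open>The valuation guaranteed by the factor \<open>(2 nu)! / (2 M)!\<close> of the
  residues.\<close>

definition "v0 = (of_bool (\<exists>i\<in>{2 * M<..2 * nu}. p dvd int i) :: int)"

definition "cls j = {i \<in> poles. p dvd j - i}"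

definition "Zc j = {z \<in> zeros. p dvd 2 * j - z}"

definition "low j = (j + int nu) mod p - int nu"

definition "high j = int nu - (int nu - j) mod p"

text \<open>In doubled coordinates, \<open>2 * high j + p\<close> and \<open>2 * low j - p\<close>
  are the next positions for zeros beyond the outermost poles of the class; in a good class both lie
  outside the range of the zeros.\<close>

definition "good j \<longleftrightarrow> 2 * high j + p \<ge> 2 * int M \<and> 2 * low j - p \<le> - 2 * int M"

lemma p_pos: "p > 0"
 using p by (simp add: prime_gt_0_int)

lemma finite_poles: "finite poles"
 by (simp add: poles_def)

lemma finite_zeros: "finite zeros"
 by (rule finite_subset[of _ "{- 2 * int M..2 * int M}"]) (auto simp: zeros_def)

lemma p_dvd_double: "p dvd 2 * k \<longleftrightarrow> p dvd k"
proof
 assume "p dvd 2 * k"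
 hence "p dvd 2 \<or> p dvd k" using p by (simp add: prime_dvd_mult_iff)
 moreover have "\<not> p dvd 2"
 proof
  assume "p dvd 2"
  hence "p \<le> 2" by (rule zdvd_imp_le) simp
  thus False using odd_p p prime_ge_2_int[of p] by auto
 qed
 ultimately show "p dvd k" by blast
qed simp

lemma dvd_diff_self_mod: "p dvd k - k mod p"
 by (simp add: dvd_minus_mod)

lemma low: assumes "j \<in> poles" shows "low j \<in> cls j" "i \<in> cls j ==> low j \<le> i"
proof -
 have 1: "0 \<le> (j + int nu) mod p" "(j + int nu) mod p \<le> j + int nu"
  using p_pos assms by (auto simp: poles_def intro!: zmod_le_nonneg_dividend)
 have "p dvd j - low j" using dvd_diff_self_mod[of "j + int nu"] by (simp add: low_def algebra_simps)
 thus "low j \<in> cls j" using 1 assms by (auto simp: cls_def poles_def low_def)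
 assume i: "i \<in> cls j"
 hence "(j + int nu) mod p = (i + int nu) mod p" by (auto simp: cls_def mod_eq_dvd_iff)
 also have "... \<le> i + int nu" using p_pos i by (intro zmod_le_nonneg_dividend) (auto simp: cls_def poles_def)
 finally show "low j \<le> i" by (simp add: low_def)
qed

lemma high: assumes "j \<in> poles" shows "high j \<in> cls j" "i \<in> cls j ==> i \<le> high j"
proof -
 have 1: "0 \<le> (int nu - j) mod p" "(int nu - j) mod p \<le> int nu - j"
  using p_pos assms by (auto simp: poles_def intro!: zmod_le_nonneg_dividend)
 have "p dvd j - high j" using dvd_minus_iff[THEN iffD2, OF dvd_diff_self_mod[of "int nu - j"]] by (simp add: high_def algebra_simps)
 thus "high j \<in> cls j" using 1 assms by (auto simp: cls_def poles_def high_def)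
 assume i: "i \<in> cls j"
 hence "p dvd (int nu - i) - (int nu - j)" by (simp add: cls_def)
 hence "(int nu - j) mod p = (int nu - i) mod p" by (metis mod_eq_dvd_iff)
 also have "... \<le> int nu - i" using p_pos i by (intro zmod_le_nonneg_dividend) (auto simp: cls_def poles_def)
 finally show "i \<le> high j" by (simp add: high_def)
qed

lemma cls_cong:
 assumes "p dvd i - j"
 shows "cls i = cls j" "low i = low j" "high i = high j" "good i = good j" "Zc i = Zc j"
proof -
 have e: "p dvd i - k \<longleftrightarrow> p dvd j - k" for k
  using dvd_add_right_iff[OF assms, of "j - k"] by simp
 show "cls i = cls j" by (simp add: cls_def e)
 show l: "low i = low j" using assms by (simp add: low_def mod_eq_dvd_iff)
 have "p dvd (int nu - i) - (int nu - j)" using assms by (simp add: dvd_diff_commute)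
 thus h: "high i = high j" by (simp add: high_def mod_eq_dvd_iff)
 show "good i = good j" by (simp add: good_def l h)
 have "p dvd 2 * i - 2 * j" using assms by (metis dvd_mult right_diff_distrib')
 hence "p dvd 2 * i - k \<longleftrightarrow> p dvd 2 * j - k" for k
  using dvd_add_right_iff[of p "2 * i - 2 * j" "2 * j - k"] by simp
 thus "Zc i = Zc j" by (simp add: Zc_def)
qed

lemma not_square_dvd: "i \<in> poles ==> j \<in> poles ==> i \<noteq> j ==> \<not> p\<^sup>2 dvd j - i"
proof
 assume a: "i \<in> poles" "j \<in> poles" "i \<noteq> j" "p\<^sup>2 dvd j - i"
 hence "p\<^sup>2 \<le> \<bar>j - i\<bar>" using dvd_imp_le_int[of "j - i" "p\<^sup>2"] by simp
 thus False using a large by (auto simp: poles_def)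
qed

lemma not_square_dvd_zero: "j \<in> poles ==> z \<in> zeros ==> \<not> p\<^sup>2 dvd z - 2 * j"
proof
 assume a: "j \<in> poles" "z \<in> zeros" "p\<^sup>2 dvd z - 2 * j"
 hence "z - 2 * j \<noteq> 0" by (auto simp: zeros_def)
 hence "p\<^sup>2 \<le> \<bar>z - 2 * j\<bar>" using dvd_imp_le_int[of "z - 2 * j" "p\<^sup>2"] a by simp
 thus False using a large M by (auto simp: poles_def zeros_def)
qed

lemma dvd_between: "p dvd k ==> k > 0 ==> k \<ge> p"
 by (rule zdvd_imp_le)

text \<open>A pole \<open>i\<close> of the class is sent to the doubled midpoint between
  \<open>i\<close> and its neighbour in the direction of \<open>j\<close>. It is odd because
  \<open>p\<close> is, and lies among the zeros because the class stays in \<open>[- nu, nu]\<close>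
  and \<open>2 nu < 2 M + p\<close>.\<close>

lemma poles_midpoint_inj:
 assumes j: "j \<in> poles"
 defines "f \<equiv> \<lambda>i. if i < j then 2 * i + p else 2 * i - p"
 shows "inj_on f (cls j - {j})" "f ` (cls j - {j}) \<subseteq> Zc j" "\<And>z. z \<in> f ` (cls j - {j}) ==> 2 * low j < z \<and> z < 2 * high j"
proof -
 have lt: "i \<le> j - p" if "i \<in> cls j" "i < j" for i using dvd_between[of "j - i"] that by (simp add: cls_def)
 have gt: "i \<ge> j + p" if "i \<in> cls j" "i > j" for i
 proof -
  have "p dvd i - j" using that by (simp add: cls_def dvd_diff_commute)
  thus ?thesis using dvd_between[of "i - j"] that by simp
 qed
 have cl: "f i < 2 * j \<longleftrightarrow> i < j" if "i \<in> cls j - {j}" for i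
  using lt[of i] gt[of i] that p_pos by (auto simp: f_def)
 show "inj_on f (cls j - {j})"
 proof (rule inj_onI)
  fix x y assume "x \<in> cls j - {j}" "y \<in> cls j - {j}" "f x = f y"
  thus "x = y" using cl[of x] cl[of y] by (auto simp: f_def split: if_splits)
 qed
 show "f ` (cls j - {j}) \<subseteq> Zc j"
 proof
  fix z assume "z \<in> f ` (cls j - {j})"
  then obtain i where i: "i \<in> cls j" "i \<noteq> j" "z = f i" by auto
  have "p dvd j - i" using i by (simp add: cls_def)
  hence d: "p dvd 2 * (j - i)" by (rule dvd_mult)
  have "p dvd 2 * (j - i) - p" "p dvd 2 * (j - i) + p" by (rule dvd_diff[OF d dvd_refl], rule dvd_add[OF d dvd_refl])
  hence "p dvd 2 * j - z" using i by (auto simp: f_def algebra_simps)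
  moreover have "odd z" using i odd_p by (simp add: f_def)
  moreover have "\<bar>z\<bar> < 2 * int M"
   using lt[of i] gt[of i] i j large p_pos by (auto simp: f_def cls_def poles_def)
  ultimately show "z \<in> Zc j" by (simp add: Zc_def zeros_def)
 qed
 fix z assume "z \<in> f ` (cls j - {j})"
 then obtain i where i: "i \<in> cls j" "i \<noteq> j" "z = f i" by auto
 have "j \<in> cls j" using j by (simp add: cls_def)
 thus "2 * low j < z \<and> z < 2 * high j"
  using lt[of i] gt[of i] i low(2)[OF j, of i] high(2)[OF j, of i] low(2)[OF j, of j] high(2)[OF j, of j] p_pos by (auto simp: f_def)
qed

lemma finite_cls: "finite (cls j)"
 using finite_poles by (simp add: cls_def)

lemma finite_Zc: "finite (Zc j)"
 using finite_zeros by (simp add: Zc_def)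

lemma card_cls_le: "j \<in> poles ==> card (cls j - {j}) \<le> card (Zc j)"
 using card_inj_on_le[OF poles_midpoint_inj(1,2) finite_Zc] .

text \<open>A bad class has a zero beyond its outermost poles, where no midpoint lies; this zero
  gives the residues an additional factor \<open>p\<close>.\<close>

lemma card_cls_less:
 assumes j: "j \<in> poles" and bad: "\<not> good j"
 shows "card (cls j - {j}) < card (Zc j)"
proof -
 define f where "f = (\<lambda>i. if i < j then 2 * i + p else 2 * i - p)"
 note f = poles_midpoint_inj[OF j, folded f_def]
 have lh: "low j \<in> poles" "p dvd j - low j" "high j \<in> poles" "p dvd j - high j" "low j \<le> high j"
  using low(1)[OF j] high(1)[OF j] low(2)[OF j high(1)[OF j]] by (auto simp: cls_def)
 have "\<exists>z\<in>Zc j. z < 2 * low j \<or> z > 2 * high j"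
 proof (cases "2 * high j + p < 2 * int M")
  case True
  have "p dvd 2 * (j - high j) - p" by (intro dvd_diff dvd_mult lh dvd_refl)
  hence "2 * high j + p \<in> Zc j" using True lh large odd_p p_pos
   by (auto simp: Zc_def zeros_def poles_def algebra_simps)
  thus ?thesis using p_pos by force
 next
  case False
  hence "2 * low j - p > - 2 * int M" using bad by (simp add: good_def)
  moreover have "p dvd 2 * (j - low j) + p" by (intro dvd_add dvd_mult lh dvd_refl)
  ultimately have "2 * low j - p \<in> Zc j" using lh large odd_p p_pos
   by (auto simp: Zc_def zeros_def poles_def algebra_simps)
  thus ?thesis using p_pos by force
 qed
 then obtain z where z: "z \<in> Zc j" "z < 2 * low j \<or> z > 2 * high j" by blast
 have "z \<notin> f ` (cls j - {j})"
 proof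
  assume "z \<in> f ` (cls j - {j})"
  from f(3)[OF this] z(2) show False by linarith
 qed
 hence "f ` (cls j - {j}) \<subset> Zc j" using f(2) z by auto
 from psubset_card_mono[OF finite_Zc this] show ?thesis by (simp add: card_image f(1))
qed

lemma good_zeros:
 assumes j: "j \<in> poles" and good: "good j" and z: "z \<in> Zc j"
 shows "2 * low j + p \<le> z" "z \<le> 2 * high j - p"
proof -
 have lh: "p dvd j - low j" "p dvd j - high j" using low(1)[OF j] high(1)[OF j] by (auto simp: cls_def)
 have d: "p dvd 2 * j - z" using z by (simp add: Zc_def)
 have "p dvd (2 * j - z) - 2 * (j - low j)" "p dvd (2 * j - z) - 2 * (j - high j)"
  by (intro dvd_diff dvd_mult d lh)+
 hence d2: "p dvd 2 * low j - z" "p dvd 2 * high j - z" by (simp_all add: algebra_simps)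
 hence d3: "p dvd z - 2 * low j" "p dvd z - 2 * high j" by (simp_all add: dvd_diff_commute)
 have o: "odd z" "\<bar>z\<bar> < 2 * int M" using z by (auto simp: Zc_def zeros_def)
 have ne: "z \<noteq> 2 * low j" "z \<noteq> 2 * high j" using o by auto
 have "\<not> z < 2 * low j" using dvd_between[OF d2(1)] good o by (auto simp: good_def)
 thus "2 * low j + p \<le> z" using dvd_between[OF d3(1)] ne by linarith
 have "\<not> z > 2 * high j" using dvd_between[OF d3(2)] good o by (auto simp: good_def)
 thus "z \<le> 2 * high j - p" using dvd_between[OF d2(2)] ne by linarith
qed

text \<open>The inverse map sends a zero to the neighbouring pole on the side away from
  \<open>j\<close>. It stays in the class since a good class has no zeros outside its outermost
  poles.\<close>

lemma card_Zc_good: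
 assumes j: "j \<in> poles" and good: "good j"
 shows "card (Zc j) = card (cls j - {j})"
proof -
 define g where "g = (\<lambda>z. if z < 2 * j then (z - p) div 2 else (z + p) div 2)"
 have lh: "low j \<in> poles" "high j \<in> poles" using low(1)[OF j] high(1)[OF j] by (auto simp: cls_def)
 have g2: "2 * g z = (if z < 2 * j then z - p else z + p)" if "z \<in> Zc j" for z
  using that odd_p by (auto simp: g_def Zc_def zeros_def)
 have side: "(z < 2 * j \<longrightarrow> z \<le> 2 * j - p) \<and> (z > 2 * j \<longrightarrow> z \<ge> 2 * j + p) \<and> z \<noteq> 2 * j" if "z \<in> Zc j" for z
 proof -
  have d: "p dvd 2 * j - z" "odd z" using that by (auto simp: Zc_def zeros_def)
  have d2: "p dvd z - 2 * j" using d(1) by (rule dvd_diff_commute[THEN iffD1])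
  have "z < 2 * j ==> z \<le> 2 * j - p" using dvd_between[OF d(1)] by simp
  moreover have "z > 2 * j ==> z \<ge> 2 * j + p" using dvd_between[OF d2] by simp
  moreover have "z \<noteq> 2 * j" using d(2) by (metis dvd_triv_left)
  ultimately show ?thesis by blast
 qed
 have "inj_on g (Zc j)"
 proof (rule inj_onI)
  fix x y assume xy: "x \<in> Zc j" "y \<in> Zc j" "g x = g y"
  have e: "(if x < 2 * j then x - p else x + p) = (if y < 2 * j then y - p else y + p)"
   using g2[OF xy(1)] g2[OF xy(2)] xy(3) by simp
  show "x = y"
   using e side[OF xy(1)] side[OF xy(2)] p_pos by (cases "x < 2 * j"; cases "y < 2 * j"; simp)
 qed
 moreover have "g ` Zc j \<subseteq> cls j - {j}"
 proof
  fix i assume "i \<in> g ` Zc j"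
  then obtain z where z: "z \<in> Zc j" "i = g z" by auto
  have b: "low j \<le> i" "i \<le> high j" "i \<noteq> j"
  proof -
   have "low j \<le> j" "j \<le> high j" using low(2)[OF j, of j] high(2)[OF j, of j] j by (simp_all add: cls_def)
   moreover have "2 * i = (if z < 2 * j then z - p else z + p)" using g2[OF z(1)] z(2) by simp
   ultimately show "low j \<le> i" "i \<le> high j" "i \<noteq> j"
    using good_zeros[OF j good z(1)] side[OF z(1)] p_pos by (cases "z < 2 * j"; simp)+
  qed
  have d: "p dvd 2 * j - z" using z by (simp add: Zc_def)
  have "2 * (j - i) = (2 * j - z) + p \<or> 2 * (j - i) = (2 * j - z) - p"
   using g2[OF z(1)] z(2) by (auto split: if_splits)
  hence "p dvd 2 * (j - i)" using dvd_add[OF d dvd_refl] dvd_diff[OF d dvd_refl] by metis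
  hence "p dvd j - i" by (simp only: p_dvd_double)
  thus "i \<in> cls j - {j}" using b lh by (auto simp: cls_def poles_def)
 qed
 ultimately have "card (Zc j) \<le> card (cls j - {j})" using card_inj_on_le finite_cls by blast
 thus ?thesis using card_cls_le[OF j] by simp
qed

text \<open>\<open>(2 nu)! / (2 M)!\<close> and what is left of \<open>4^(2 M)\<close> after
  doubling the zeros.\<close>

definition "coefE = (\<Prod>i\<in>{2 * M<..2 * nu}. int i) * 2 ^ (2 * M)"

lemma pge_coefE: "pge p v0 (of_int coefE)"
proof (cases "\<exists>i\<in>{2 * M<..2 * nu}. p dvd int i")
 case True
 then obtain i where "i \<in> {2 * M<..2 * nu}" "p dvd int i" by blast
 hence "p dvd (\<Prod>i\<in>{2 * M<..2 * nu}. int i)" by (metis dvd_prodI dvd_trans finite_greaterThanAtMost)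
 hence "p dvd coefE" by (simp add: coefE_def)
 thus ?thesis using True pge_of_int_dvd[OF p] by (simp add: v0_def)
qed (simp add: v0_def pge_of_int[OF p])

text \<open>The factors of the residue in which \<open>p\<close> occurs; \<open>outX\<close>
  collects the units.\<close>

definition "inX j = (\<Prod>z\<in>Zc j. of_int (2 * j - z)) * (\<Prod>i\<in>cls j - {j}. 1 / of_int (j - i) :: rat)"

definition "outX j = (\<Prod>z\<in>zeros - Zc j. of_int (2 * j - z)) * (\<Prod>i\<in>poles - cls j. 1 / of_int (j - i) :: rat)"

lemma coefA_factors:
 assumes j: "j \<in> poles"
 shows "coefA nu M j = of_int coefE * (inX j * outX j)"
proof -
 have "(\<Prod>i<2 * M. of_int j + of_nat M - 1/2 - of_nat i :: rat) = (\<Prod>i<2 * M. of_int (2 * j - (2 * int i + 1 - 2 * int M)) / 2)"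
  by (intro prod.cong refl) (simp add: field_simps)
 also have "... = (\<Prod>i<2 * M. of_int (2 * j - (2 * int i + 1 - 2 * int M))) / 2 ^ (2 * M)"
  by (simp only: prod_dividef prod_constant card_lessThan)
 also have "(\<Prod>i<2 * M. of_int (2 * j - (2 * int i + 1 - 2 * int M)) :: rat) = (\<Prod>z\<in>zeros. of_int (2 * j - z))"
 proof (rule prod.reindex_bij_witness[of _ "\<lambda>z. nat ((z + 2 * int M - 1) div 2)" "\<lambda>i. 2 * int i + 1 - 2 * int M"])
  fix z assume z: "z \<in> zeros"
  hence "even (z + 2 * int M - 1)" by (simp add: zeros_def)
  then obtain m where m: "z + 2 * int M - 1 = 2 * m" by (elim evenE)
  have "\<bar>z\<bar> < 2 * int M" using z by (simp add: zeros_def)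
  thus "2 * int (nat ((z + 2 * int M - 1) div 2)) + 1 - 2 * int M = z" "nat ((z + 2 * int M - 1) div 2) \<in> {..<2 * M}"
   using m by auto
 qed (auto simp: zeros_def)
 finally have P: "(of_int j + of_nat M - 1/2 :: rat) gchoose (2 * M) = (\<Prod>z\<in>zeros. of_int (2 * j - z)) / 2 ^ (2 * M) / fact (2 * M)"
  by (simp only: gbinomial_prod_rev atLeast0LessThan)
 have E: "(fact (2 * nu) :: rat) = fact (2 * M) * of_int (\<Prod>i\<in>{2 * M<..2 * nu}. int i)"
  using fact_eq_prod_above[of "2 * M" "2 * nu", where 'a = rat] M by simp
 have 4: "(4 :: rat) ^ (2 * M) = 2 ^ (2 * M) * 2 ^ (2 * M)" by (simp flip: power_mult_distrib)
 have num: "rnum nu M (of_int j) = of_int coefE * (\<Prod>z\<in>zeros. of_int (2 * j - z))"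
  unfolding rnum_def P E 4 coefE_def by simp
 have "(\<Prod>z\<in>zeros. of_int (2 * j - z) :: rat) = (\<Prod>z\<in>Zc j. of_int (2 * j - z)) * (\<Prod>z\<in>zeros - Zc j. of_int (2 * j - z))"
  by (subst prod.subset_diff[of "Zc j" zeros]) (auto simp: finite_zeros Zc_def mult.commute)
 moreover have "(\<Prod>i\<in>poles - {j}. 1 / of_int (j - i) :: rat) = (\<Prod>i\<in>cls j - {j}. 1 / of_int (j - i)) * (\<Prod>i\<in>poles - cls j. 1 / of_int (j - i))"
 proof -
  have "poles - {j} = (cls j - {j}) \<union> (poles - cls j)" using j by (auto simp: cls_def)
  thus ?thesis using finite_poles finite_cls by (simp only:) (rule prod.union_disjoint, auto)
 qed
 moreover have "coefA nu M j = rnum nu M (of_int j) * (\<Prod>i\<in>poles - {j}. 1 / of_int (j - i))"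
  using j by (simp add: coefA_def poles_def prod_dividef del: of_int_diff)
 ultimately show ?thesis unfolding num inX_def outX_def by (simp only: mult_ac)
qed

lemma not_dvd_out: "j \<in> poles ==> i \<in> poles - cls j ==> \<not> p dvd j - i"
 by (simp add: cls_def)

lemma pge_outX:
 assumes "j \<in> poles"
 shows "pge p 0 (outX j)"
proof -
 have "pge p 0 (\<Prod>z\<in>zeros - Zc j. of_int (2 * j - z))"
  by (rule pge_prod_0[OF p], rule pge_of_int[OF p])
 moreover have "pge p 0 (\<Prod>i\<in>poles - cls j. 1 / of_int (j - i))"
  by (rule pge_prod_0[OF p], rule pge_inverse_unit[OF p not_dvd_out[OF assms]])
 ultimately show ?thesis unfolding outX_def using pge_mult[OF p] by fastforce
qed

lemma pge_inX:
 assumes j: "j \<in> poles"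
 shows "pge p (int (card (Zc j)) - int (card (cls j - {j}))) (inX j)"
proof -
 have "pge p (int (card (Zc j)) * 1) (\<Prod>z\<in>Zc j. of_int (2 * j - z))"
  by (rule pge_prod_const[OF p], rule pge_of_int_dvd[OF p]) (simp add: Zc_def)
 moreover have "pge p (int (card (cls j - {j})) * (- 1)) (\<Prod>i\<in>cls j - {j}. 1 / of_int (j - i))"
  by (rule pge_prod_const[OF p], rule pge_inverse_simple[OF p], rule not_square_dvd) (use j in \<open>auto simp: cls_def\<close>)
 ultimately show ?thesis unfolding inX_def using pge_mult[OF p] by fastforce
qed

lemma pge_coefA: "j \<in> poles ==> pge p v0 (coefA nu M j)"
 using pge_mult[OF p pge_coefE pge_mult[OF p pge_mono[OF p pge_inX, of j 0] pge_outX, of j]] card_cls_le[of j]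
 by (simp add: coefA_factors)

lemma coefA_bad: "j \<in> poles ==> \<not> good j ==> pge p (v0 + 1) (coefA nu M j)"
 using pge_mult[OF p pge_coefE pge_mult[OF p pge_mono[OF p pge_inX, of j 1] pge_outX, of j]] card_cls_less[of j]
 by (simp add: coefA_factors)

text \<open>The sum of the extreme poles, so that \<open>i -> centre j - i\<close> reverses the
  class.\<close>

definition "centre j = low j + high j"

lemma reflect_cls:
 assumes j: "j \<in> poles"
 shows "centre j - j \<in> poles" "p dvd (centre j - j) - j" "i \<in> cls j ==> centre j - i \<in> cls j"
proof -
 have lh: "low j \<in> poles" "p dvd j - low j" "high j \<in> poles" "p dvd j - high j"
  using low(1)[OF j] high(1)[OF j] by (auto simp: cls_def)
 show *: "centre j - i \<in> cls j" if "i \<in> cls j" for i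
 proof -
  have "p dvd (j - low j) + (j - high j) - (j - i)"
  proof -
   have "p dvd j - i" using that by (simp add: cls_def)
   from dvd_diff[OF dvd_add[OF lh(2,4)] this] show ?thesis .
  qed
  hence "p dvd j - (centre j - i)" by (simp add: centre_def algebra_simps)
  moreover have "centre j - i \<in> poles" using low(2)[OF j that] high(2)[OF j that] lh by (auto simp: centre_def poles_def)
  ultimately show ?thesis by (simp add: cls_def)
 qed
 have "j \<in> cls j" using j by (simp add: cls_def)
 from *[OF this] show "centre j - j \<in> poles" "p dvd (centre j - j) - j" by (auto simp: cls_def dvd_diff_commute)
qed

lemma reflect_Zc:
 assumes j: "j \<in> poles" and good: "good j" and z: "z \<in> Zc j"
 shows "2 * centre j - z \<in> Zc j"
proof -
 have lh: "low j \<in> poles" "p dvd j - low j" "high j \<in> poles" "p dvd j - high j"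
  using low(1)[OF j] high(1)[OF j] by (auto simp: cls_def)
 have "p dvd 2 * (j - low j) + 2 * (j - high j) - (2 * j - z)"
 proof -
  have "p dvd 2 * j - z" using z by (simp add: Zc_def)
  from dvd_diff[OF dvd_add[OF dvd_mult[OF lh(2)] dvd_mult[OF lh(4)]] this] show ?thesis .
 qed
 hence "p dvd 2 * j - (2 * centre j - z)" by (simp add: centre_def algebra_simps)
 moreover have "\<bar>2 * centre j - z\<bar> < 2 * int M" using good_zeros[OF assms] lh large by (auto simp: centre_def poles_def)
 ultimately show ?thesis using z by (simp add: Zc_def zeros_def)
qed

text \<open>Reversal changes the sign of every factor, and a good class has as many zeros as it has
  poles other than \<open>j\<close>.\<close>

lemma inX_reflect:
 assumes j: "j \<in> poles" and good: "good j"
 shows "inX (centre j - j) = inX j"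
proof -
 define j' where "j' = centre j - j"
 note r = reflect_cls[OF j, folded j'_def]
 have c: "cls j' = cls j" "Zc j' = Zc j" using cls_cong[OF r(2)] by simp_all
 have "(\<Prod>z\<in>Zc j. of_int (2 * j' - z) :: rat) = (\<Prod>z\<in>Zc j. - of_int (2 * j - z))"
  by (rule prod.reindex_bij_witness[of _ "\<lambda>z. 2 * centre j - z" "\<lambda>z. 2 * centre j - z"])
    (auto simp: j'_def reflect_Zc[OF j good])
 also have "... = (-1) ^ card (Zc j) * (\<Prod>z\<in>Zc j. of_int (2 * j - z))" by (rule prod_uminus)
 finally have 1: "(\<Prod>z\<in>Zc j. of_int (2 * j' - z) :: rat) = (-1) ^ card (Zc j) * (\<Prod>z\<in>Zc j. of_int (2 * j - z))" .
 have "(\<Prod>i\<in>cls j - {j'}. 1 / of_int (j' - i) :: rat) = (\<Prod>i\<in>cls j - {j}. - (1 / of_int (j - i)))"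
 proof (rule prod.reindex_bij_witness[of _ "\<lambda>i. centre j - i" "\<lambda>i. centre j - i"])
  fix i assume "i \<in> cls j - {j'}"
  have "of_int (j - (centre j - i)) = - (of_int (j' - i) :: rat)" by (simp add: j'_def)
  thus "- (1 / of_int (j - (centre j - i))) = (1 / of_int (j' - i) :: rat)" by (simp only: minus_divide_right minus_minus)
 qed (auto simp: j'_def r)
 also have "... = (-1) ^ card (cls j - {j}) * (\<Prod>i\<in>cls j - {j}. 1 / of_int (j - i))" by (rule prod_uminus)
 finally have 2: "(\<Prod>i\<in>cls j - {j'}. 1 / of_int (j' - i) :: rat) = (-1) ^ card (Zc j) * (\<Prod>i\<in>cls j - {j}. 1 / of_int (j - i))"
  unfolding card_Zc_good[OF assms] .
 have s: "(-1 :: rat) ^ n * a * ((-1) ^ n * b) = a * b" for n a b by (cases "even n") auto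
 show ?thesis unfolding j'_def[symmetric] inX_def c 1 2 by (rule s)
qed

text \<open>The reflected pole is congruent to \<open>j\<close> modulo \<open>p\<close>, and all
  factors are prime to \<open>p\<close>.\<close>

lemma outX_reflect:
 assumes j: "j \<in> poles"
 shows "plead p 0 (outX j) (outX (centre j - j))"
proof -
 define j' where "j' = centre j - j"
 note r = reflect_cls[OF j, folded j'_def]
 have c: "cls j' = cls j" "Zc j' = Zc j" using cls_cong[OF r(2)] by simp_all
 have d: "p dvd j - j'" using r(2) by (simp add: dvd_diff_commute)
 have "plead p 0 (of_int (2 * j - z)) (of_int (2 * j' - z))" for z
 proof -
  have "of_int (2 * j - z) - of_int (2 * j' - z) = (of_int (2 * (j - j')) :: rat)" by simp
  moreover have "pge p 1 (of_int (2 * (j - j')))" by (rule pge_of_int_dvd[OF p], rule dvd_mult[OF d])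
  ultimately show ?thesis unfolding plead_def using pge_of_int[OF p] by (simp only: add_0)
 qed
 moreover have "plead p 0 (1 / of_int (j - i)) (1 / of_int (j' - i))" if "i \<in> poles - cls j" for i
  by (rule plead_inverse_unit[OF p not_dvd_out[OF j that]]) (use d in simp)
 ultimately have "plead p (0 + 0) (outX j) (outX j')"
  unfolding outX_def c by (intro plead_mult[OF p] plead_prod_0[OF p])
 thus ?thesis by (simp add: j'_def)
qed

text \<open>Combined with the evenness of the residues, the reflection becomes a translation by
  \<open>centre j\<close>, which preserves the differences of poles that enter the partial
  fractions.\<close>

lemma coefA_good:
 assumes j: "j \<in> poles" and good: "good j"
 shows "plead p v0 (coefA nu M j) (coefA nu M (j - centre j))"
proof -
 have "plead p (v0 + (0 + 0)) (of_int coefE * (inX j * outX j)) (of_int coefE * (inX j * outX (centre j - j)))"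
  by (intro plead_mult[OF p] outX_reflect[OF j] plead_refl[OF p] pge_coefE pge_mono[OF p pge_inX[OF j]])
    (use card_cls_le[OF j] in simp)
 moreover have "coefA nu M (j - centre j) = of_int coefE * (inX j * outX (centre j - j))"
  using coefA_minus[of nu M "centre j - j"] coefA_factors[OF reflect_cls(1)[OF j]] inX_reflect[OF assms] by simp
 ultimately show ?thesis using coefA_factors[OF j] by simp
qed

end

lemma zeros_eq: "{z. odd z \<and> \<bar>z\<bar> < 2 * int M} = (\<lambda>s. 2 * int s + 1) ` {..<M} \<union> (\<lambda>s. - (2 * int s + 1)) ` {..<M}"
proof -
 have "z \<in> (\<lambda>s. 2 * int s + 1) ` {..<M} \<union> (\<lambda>s. - (2 * int s + 1)) ` {..<M}" if z: "odd z" "\<bar>z\<bar> < 2 * int M" for z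
 proof (cases "z > 0")
  case True
  have "z = 2 * int (nat (z div 2)) + 1" "nat (z div 2) < M" using z True by (auto elim!: oddE)
  thus ?thesis by blast
 next
  case False
  have "z = - (2 * int (nat ((- z) div 2)) + 1)" "nat ((- z) div 2) < M" using z False by (auto elim!: oddE)
  thus ?thesis by blast
 qed
 thus ?thesis by (auto)
qed

lemma pf_D_minus:
 fixes A :: "int => 'a::field_char_0"
 assumes "\<forall>i\<in>J. - i \<in> J" "\<And>j. A (- j) = A j"
 shows "pf_D J A (- j) (- x) = - pf_D J A j x"
proof -
 have "- x - of_int (- j) = - (x - of_int j)" by simp
 moreover have "(-1) ^ (i + 1) * a / (- y) ^ (i + 2) = - (a / y ^ (i + 2))" for i and a y :: 'a
 proof (cases "even i")
  case True
  hence "(- y) ^ (i + 2) = y ^ (i + 2)" "(-1 :: 'a) ^ (i + 1) = - 1" by simp_all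
  thus ?thesis by (simp only:) simp
 next
  case False
  hence "(- y) ^ (i + 2) = - (y ^ (i + 2))" "(-1 :: 'a) ^ (i + 1) = 1" by simp_all
  thus ?thesis by (simp only:) simp
 qed
 ultimately show ?thesis
  unfolding pf_D_def pf_a_minus[where J = J and A = A, OF assms] sum_negf[symmetric]
  by (simp only: mult.assoc)
qed

text \<open>At a zero of \<open>r\<close> the second derivatives of all principal parts sum to 0, so
  the sum over the poles above the zero is half of the sum weighted by signs. The sign depends only
  on the difference of pole and zero, and by symmetry the sum extends to negative zeros too; this
  makes it suitable for translating whole classes. The half-integers between \<open>M\<close> and
  \<open>nu\<close>, which are not zeros, stay separate.\<close>

lemma rho0_form_decomposition:
 assumes "M \<le> nu"
 defines "D \<equiv> pf_D {- int nu..int nu} (coefA nu M)"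
 shows "rho0_form nu M = - (1/2) * (\<Sum>z\<in>{z. odd z \<and> \<bar>z\<bar> < 2 * int M}. \<Sum>j\<in>{- int nu..int nu}. of_int (sgn (2 * j - z)) * D j (of_int z / 2))
   - 2 * (\<Sum>s\<in>{M..<nu}. \<Sum>j\<in>{j \<in> {- int nu..int nu}. 2 * j > 2 * int s + 1}. D j (of_int (2 * int s + 1) / 2))"
proof -
 define J where "J = {- int nu..int nu}"
 have J: "finite J" "\<forall>i\<in>J. - i \<in> J" by (auto simp: J_def)
 define U where "U s = (\<Sum>j\<in>{j \<in> J. 2 * j > 2 * int s + 1}. D j (of_int (2 * int s + 1) / 2))" for s
 define f where "f z = (\<Sum>j\<in>J. of_int (sgn (2 * j - z)) * D j (of_int z / 2))" for z
 have "(\<Sum>j=1..nu. \<Sum>s<j. D (int j) (of_nat s + 1/2)) = (\<Sum>j\<in>{1..nu}. \<Sum>s\<in>{s. s \<in> {..<nu} \<and> s < j}. D (int j) (of_nat s + 1/2))"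
  by (intro sum.cong refl) auto
 also have "... = (\<Sum>s\<in>{..<nu}. \<Sum>j\<in>{j. j \<in> {1..nu} \<and> s < j}. D (int j) (of_nat s + 1/2))"
  by (rule sum.swap_restrict) auto
 also have "... = (\<Sum>s<nu. U s)"
 proof (intro sum.cong refl)
  fix s
  have e: "of_nat s + 1/2 = (of_int (2 * int s + 1) / 2 :: rat)" by (simp add: field_simps)
  show "(\<Sum>j\<in>{j. j \<in> {1..nu} \<and> s < j}. D (int j) (of_nat s + 1/2)) = U s"
   unfolding U_def e by (intro sum.reindex_bij_witness[of _ nat int]) (auto simp: J_def)
 qed
 also have "{..<nu} = {..<M} \<union> {M..<nu}" using assms(1) by auto
 also have "sum U ({..<M} \<union> {M..<nu}) = sum U {..<M} + sum U {M..<nu}" by (rule sum.union_disjoint) auto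
 finally have F: "rho0_form nu M = - 2 * (sum U {..<M} + sum U {M..<nu})"
  by (simp add: rho0_form_def rho0_def D_def)
 have half: "2 * U s = f (2 * int s + 1)" if s: "s < M" for s
 proof -
  define x :: rat where "x = of_int (2 * int s + 1) / 2"
  have ne: "x \<noteq> of_int j" for j
  proof
   assume "x = of_int j"
   hence "(of_int (2 * int s + 1) :: rat) = of_int (2 * j)" by (simp add: x_def field_simps)
   hence "2 * int s + 1 = 2 * j" by (simp only: of_int_eq_iff)
   thus False by presburger
  qed
  have "rnum nu M x = 0"
   by (rule rnum_zero[of _ _ "s + M"]) (use s in \<open>auto simp: x_def field_simps\<close>)
  hence "(\<Sum>j\<in>J. coefA nu M j / (x - of_int j)) = 0"
   using rational_partial_fractions[OF assms(1), of x] ne by (simp add: J_def)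
  hence z: "(\<Sum>j\<in>J. D j x) = 0" unfolding D_def J_def[symmetric] by (intro pf_D_sum_eq_0 J ne)
  have "f (2 * int s + 1) = (\<Sum>j\<in>J. of_int (sgn (2 * j - (2 * int s + 1))) * D j x)"
   by (simp only: f_def x_def)
  also have "... = (\<Sum>j\<in>J. of_int (sgn (2 * j - (2 * int s + 1))) * D j x) + (\<Sum>j\<in>J. D j x)"
   by (simp only: z add_0_right)
  also have "... = (\<Sum>j\<in>J. if 2 * j > 2 * int s + 1 then 2 * D j x else 0)"
   unfolding sum.distrib[symmetric]
  proof (intro sum.cong refl)
   fix j
   have "2 * j \<noteq> 2 * int s + 1" by presburger
   thus "of_int (sgn (2 * j - (2 * int s + 1))) * D j x + D j x = (if 2 * j > 2 * int s + 1 then 2 * D j x else 0)"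
    by (auto simp: sgn_if)
  qed
  also have "... = 2 * U s" unfolding U_def x_def[symmetric] sum_distrib_left
   by (rule sum.inter_filter[symmetric, OF J(1)])
  finally show ?thesis ..
 qed
 have f_minus: "f (- z) = f z" for z
 proof -
  have "f (- z) = (\<Sum>j\<in>J. of_int (sgn (2 * (- j) - (- z))) * D (- j) (- (of_int z / 2)))"
   unfolding f_def by (rule sum.reindex_bij_witness[of _ uminus uminus]) (use J in auto)
  also have "... = f z"
   unfolding f_def D_def J_def[symmetric] pf_D_minus[where A = "coefA nu M", OF J(2) coefA_minus]
   by (intro sum.cong refl) (auto simp: sgn_if)
  finally show ?thesis .
 qed
 have "(\<Sum>z\<in>{z. odd z \<and> \<bar>z\<bar> < 2 * int M}. f z) = (\<Sum>s<M. f (2 * int s + 1)) + (\<Sum>s<M. f (- (2 * int s + 1)))"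
  unfolding zeros_eq by (subst sum.union_disjoint) (auto simp: sum.reindex inj_on_def)
 hence "(\<Sum>z\<in>{z. odd z \<and> \<bar>z\<bar> < 2 * int M}. f z) = 2 * (\<Sum>s<M. f (2 * int s + 1))" unfolding f_minus by simp
 also have "(\<Sum>s<M. f (2 * int s + 1)) = (\<Sum>s<M. 2 * U s)" using half by (intro sum.cong) auto
 finally have "(\<Sum>z\<in>{z. odd z \<and> \<bar>z\<bar> < 2 * int M}. f z) = 4 * sum U {..<M}" by (simp add: sum_distrib_left)
 thus ?thesis unfolding F f_def U_def J_def by simp
qed

section \<open>Valuations of \<open>rho0_form\<close> and \<open>rho3_form\<close> at a large
  prime\<close>

context large_prime
begin

lemma poles_Ivl: "{- int nu..int nu} = poles"
 by (simp add: poles_def)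

lemma cls_self: "j \<in> poles ==> j \<in> cls j"
 by (simp add: cls_def)

lemma pf_c_class:
 assumes j: "j \<in> poles" and AB: "\<And>i. i \<in> cls j ==> plead p v0 (coefA nu M i) (B (i - c))"
 shows "plead p (4 * v0 - 4 + int n) (pf_c poles (coefA nu M) n j) (pf_c ((\<lambda>i. i - c) ` cls j) B n (j - c))"
proof (rule plead_pf_c[OF p, where S = "cls j"])
 fix i k assume "k \<in> cls j" "i \<in> poles" "i \<notin> cls j"
 thus "\<not> p dvd k - i" using cls_cong(1)[of k j] dvd_diff_commute[of p k j] by (auto simp: cls_def)
qed (use finite_poles pge_coefA not_square_dvd AB cls_self[OF j] in \<open>auto simp: cls_def\<close>)

lemma pf_c_class_self:
 assumes "j \<in> poles"
 shows "plead p (4 * v0 - 4 + int n) (pf_c poles (coefA nu M) n j) (pf_c (cls j) (coefA nu M) n j)"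
proof -
 have "plead p v0 (coefA nu M i) (coefA nu M (i - 0))" if "i \<in> cls j" for i
  using that pge_coefA by (auto simp: cls_def intro!: plead_refl[OF p])
 from pf_c_class[OF assms this, of n] show ?thesis by simp
qed

lemma pge_pf_c: "j \<in> poles ==> pge p (4 * v0 - 4 + int n) (pf_c poles (coefA nu M) n j)"
 using pf_c_class_self by (auto simp: plead_def)

text \<open>All residues of a bad class have a spare factor \<open>p\<close>, so at leading order
  the class is indistinguishable from the zero function.\<close>

lemma pge_pf_c_bad:
 assumes j: "j \<in> poles" and bad: "\<not> good j"
 shows "pge p (4 * v0 - 4 + int n + 1) (pf_c poles (coefA nu M) n j)"
proof -
 have "plead p v0 (coefA nu M i) 0" if "i \<in> cls j" for i
 proof -
  have "\<not> good i" using cls_cong(4)[of j i] that bad by (simp add: cls_def)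
  thus ?thesis using that by (intro plead_small[OF p] coefA_bad pge_0[OF p]) (auto simp: cls_def)
 qed
 note X = pf_c_class[OF j, where B = "\<lambda>_. 0" and c = 0 and n = n, OF this]
 have Z: "pf_c S (\<lambda>_. 0) n i = (0 :: rat)" for S i by (simp add: pf_c_def pf_b1_def)
 have "plead p (4 * v0 - 4 + int n) (pf_c poles (coefA nu M) n j) 0"
  using X unfolding Z .
 thus ?thesis by (simp add: plead_def)
qed

lemma low_high_minus: "low (- j) = - high j" "high (- j) = - low j" "good (- j) = good j"
proof -
 show l: "low (- j) = - high j" and h: "high (- j) = - low j" by (simp_all add: low_def high_def add.commute)
 show "good (- j) = good j" unfolding good_def l h by auto
qed

text \<open>The translate \<open>j - centre j\<close> lies in the class of \<open>- j\<close>; this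
  sign makes the leading terms of \<open>rho0\<close> cancel in pairs.\<close>

lemma reflect_cong:
 assumes j: "j \<in> poles"
 shows "p dvd (j - centre j) - (- j)"
proof -
 have "p dvd j - low j" "p dvd j - high j" using low(1)[OF j] high(1)[OF j] by (auto simp: cls_def)
 from dvd_add[OF this] show ?thesis by (simp add: centre_def algebra_simps)
qed

lemma translate:
 assumes j: "j \<in> poles"
 shows "low (j - centre j) = - high j" "high (j - centre j) = - low j" "centre (j - centre j) = - centre j"
  "good (j - centre j) = good j" "j - centre j \<in> poles"
proof -
 note c = cls_cong[OF reflect_cong[OF j]]
 show "low (j - centre j) = - high j" "high (j - centre j) = - low j" "good (j - centre j) = good j"
  by (simp_all only: c low_high_minus)
 thus "centre (j - centre j) = - centre j" by (simp add: centre_def)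
 show "j - centre j \<in> poles" using reflect_cls(1)[OF j] by (auto simp: poles_def)
qed

lemma centre_cong: "p dvd i - j ==> centre i = centre j"
 using cls_cong[of i j] by (simp add: centre_def)

lemma cls_translate:
 assumes j: "j \<in> poles"
 shows "cls (j - centre j) = (\<lambda>i. i - centre j) ` cls j"
proof
 note t = translate[OF j]
 have lh: "low j \<in> poles" "high j \<in> poles" using low(1)[OF j] high(1)[OF j] by (auto simp: cls_def)
 show "cls (j - centre j) \<subseteq> (\<lambda>i. i - centre j) ` cls j"
 proof
  fix i assume i: "i \<in> cls (j - centre j)"
  have "- high j \<le> i" "i \<le> - low j" using low(2)[OF t(5) i] high(2)[OF t(5) i] t by simp_all
  hence "i + centre j \<in> poles" using lh by (auto simp: centre_def poles_def)
  moreover have "p dvd j - (i + centre j)" using i by (simp add: cls_def algebra_simps)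
  ultimately have "i + centre j \<in> cls j" by (simp add: cls_def)
  thus "i \<in> (\<lambda>i. i - centre j) ` cls j" by (rule rev_image_eqI) simp
 qed
 show "(\<lambda>i. i - centre j) ` cls j \<subseteq> cls (j - centre j)"
 proof
  fix i' assume "i' \<in> (\<lambda>i. i - centre j) ` cls j"
  then obtain i where i: "i \<in> cls j" "i' = i - centre j" by auto
  have "low j \<le> i" "i \<le> high j" using low(2)[OF j i(1)] high(2)[OF j i(1)] .
  hence "i' \<in> poles" using lh i(2) by (auto simp: centre_def poles_def)
  thus "i' \<in> cls (j - centre j)" using i by (simp add: cls_def)
 qed
qed

lemma pf_c_good:
 assumes j: "j \<in> poles" and good: "good j"
 shows "plead p (4 * v0 - 4 + int n) (pf_c poles (coefA nu M) n j) (pf_c poles (coefA nu M) n (j - centre j))"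
proof -
 have "plead p v0 (coefA nu M i) (coefA nu M (i - centre j))" if "i \<in> cls j" for i
 proof -
  have "p dvd i - j" using that dvd_diff_commute[of p i j] by (simp add: cls_def)
  hence "good i" "centre i = centre j" using cls_cong(4)[of i j] good centre_cong by auto
  thus ?thesis using coefA_good[of i] that by (simp add: cls_def)
 qed
 from pf_c_class[OF j this, of n]
 have "plead p (4 * v0 - 4 + int n) (pf_c poles (coefA nu M) n j) (pf_c (cls (j - centre j)) (coefA nu M) n (j - centre j))"
  unfolding cls_translate[OF j] .
 from plead_trans[OF p this plead_sym[OF p pf_c_class_self[OF translate(5)[OF j]]]] show ?thesis .
qed

text \<open>The second derivative at \<open>z / 2\<close> of the principal part of
  \<open>r^4\<close> at \<open>j\<close>. The difference of \<open>pf_D\<close> and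
  \<open>j * Esum\<close> involves coefficients of the next higher order, which have one more factor
  \<open>p\<close>.\<close>

definition "Esum j z = (\<Sum>i=1..4. pf_c poles (coefA nu M) i j * of_nat (i * (i + 1)) / (of_int z / 2 - of_int j) ^ (i + 2))"

lemma half_diff: "1 / (of_int z / 2 - of_int j :: rat) ^ n = (2 * (1 / of_int (z - 2 * j))) ^ n"
proof -
 have "of_int z / 2 - of_int j = (of_int (z - 2 * j) / 2 :: rat)" by (simp add: field_simps)
 thus ?thesis by (simp only:) (simp add: power_divide power_mult_distrib del: of_int_diff)
qed

lemma pge_half_diff: "j \<in> poles ==> z \<in> zeros ==> pge p (- int n) (1 / (of_int z / 2 - of_int j) ^ n)"
 unfolding half_diff
 using pge_power[OF p pge_cmult[OF p pge_numeral[OF p] pge_inverse_simple[OF p not_square_dvd_zero]], of j z n] by simp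

lemma pge_half_diff_unit: "\<not> p dvd z - 2 * j ==> pge p 0 (1 / (of_int z / 2 - of_int j) ^ n)"
 unfolding half_diff
 using pge_power[OF p pge_cmult[OF p pge_numeral[OF p] pge_inverse_unit[OF p]], of "z - 2 * j" n] by simp

lemma pge_term_half:
 assumes "pge p m c" "j \<in> poles" "z \<in> zeros"
 shows "pge p (m - int k) (c * of_nat l / (of_int z / 2 - of_int j) ^ k)"
 using pge_mult[OF p pge_mult[OF p assms(1) pge_of_nat[OF p]] pge_half_diff[OF assms(2,3)]] by simp

lemma pge_term_half_unit:
 assumes "pge p m c" "\<not> p dvd z - 2 * j"
 shows "pge p m (c * of_nat l / (of_int z / 2 - of_int j) ^ k)"
 using pge_mult[OF p pge_mult[OF p assms(1) pge_of_nat[OF p]] pge_half_diff_unit[OF assms(2)]] by simp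

lemma pge_pf_a:
 assumes "j \<in> poles"
 shows "pge p (4 * v0 - 4 + int n) (pf_a poles (coefA nu M) n j)"
proof -
 have "pge p (4 * v0 - 4 + int n) (of_int j * pf_c poles (coefA nu M) n j)"
  by (intro pge_cmult[OF p] pge_of_int[OF p] pge_pf_c assms)
 moreover have "pge p (4 * v0 - 4 + int n) (pf_c poles (coefA nu M) (n + 1) j)"
  by (rule pge_mono[OF p pge_pf_c[OF assms]]) simp
 ultimately show ?thesis unfolding pf_a_def by (rule pge_add[OF p])
qed

lemma pge_pf_D_unit:
 assumes "j \<in> poles" "\<not> p dvd z - 2 * j"
 shows "pge p (4 * v0 - 5) (pf_D poles (coefA nu M) j (of_int z / 2))"
 unfolding pf_D_def
 by (rule pge_sum[OF p], rule pge_mono[OF p pge_term_half_unit[OF pge_pf_a[OF assms(1)] assms(2)]]) simp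

lemma pge_pf_D_Esum:
 assumes "j \<in> poles" "z \<in> zeros"
 shows "pge p (4 * v0 - 5) (pf_D poles (coefA nu M) j (of_int z / 2) - of_int j * Esum j z)"
proof -
 have "pf_D poles (coefA nu M) j (of_int z / 2) - of_int j * Esum j z
   = (\<Sum>i=1..4. pf_c poles (coefA nu M) (i + 1) j * of_nat (i * (i + 1)) / (of_int z / 2 - of_int j) ^ (i + 2))"
  unfolding pf_D_def Esum_def sum_distrib_left sum_subtractf[symmetric]
  by (intro sum.cong refl) (simp only: pf_a_def distrib_right add_divide_distrib times_divide_eq_right mult.assoc add_diff_cancel_left')
 also have "pge p (4 * v0 - 5) ..."
  by (rule pge_sum[OF p], rule pge_mono[OF p pge_term_half[OF pge_pf_c[OF assms(1)] assms]]) simp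
 finally show ?thesis .
qed

text \<open>The leading part of a signed term of \<open>rho0\<close>, indexed by a pole and a zero.
  Only if \<open>p\<close> divides their doubled difference, as in \<open>pairs\<close>, can the
  full power of \<open>p\<close> occur in the denominator; \<open>shift\<close> matches such pairs
  with one another.\<close>

definition "tm x = of_int (sgn (2 * fst x - snd x)) * (of_int (fst x) * Esum (fst x) (snd x))"

definition "pairs = {x \<in> poles \<times> zeros. p dvd snd x - 2 * fst x}"

definition "shift x = (fst x - centre (fst x), snd x - 2 * centre (fst x))"

lemma tm_bad:
 assumes "x \<in> pairs" "\<not> good (fst x)"
 shows "pge p (4 * v0 - 5) (tm x)"
proof -
 have x: "fst x \<in> poles" "snd x \<in> zeros" using assms(1) by (auto simp: pairs_def)
 have "pge p (4 * v0 - 5) (Esum (fst x) (snd x))"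
  unfolding Esum_def
  by (rule pge_sum[OF p], rule pge_mono[OF p pge_term_half[OF pge_pf_c_bad[OF x(1) assms(2)] x]]) simp
 thus ?thesis unfolding tm_def by (intro pge_cmult[OF p] pge_of_int[OF p])
qed

lemma shift_pairs:
 assumes "x \<in> pairs" "good (fst x)"
 shows "shift x \<in> pairs" "good (fst (shift x))" "shift (shift x) = x"
proof -
 obtain j z where x: "x = (j, z)" by (cases x)
 have j: "j \<in> poles" "z \<in> zeros" "p dvd z - 2 * j" "good j" using assms by (auto simp: pairs_def x)
 have "p dvd 2 * j - z" using j(3) by (rule dvd_diff_commute[THEN iffD1])
 hence z: "z \<in> Zc j" using j by (simp add: Zc_def)
 have "p dvd 2 * (centre j - j) - 2 * j"
  using dvd_mult[OF reflect_cls(2)[OF j(1)], of 2] by (simp add: algebra_simps)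
 have lh: "low j \<in> poles" "high j \<in> poles" using low(1)[OF j(1)] high(1)[OF j(1)] by (auto simp: cls_def)
 have "\<bar>z - 2 * centre j\<bar> < 2 * int M" using good_zeros[OF j(1,4) z] lh large by (auto simp: centre_def poles_def)
 hence "z - 2 * centre j \<in> zeros" using j by (simp add: zeros_def)
 moreover have "(z - 2 * centre j) - 2 * (j - centre j) = z - 2 * j" by simp
 ultimately show "shift x \<in> pairs" using translate(5)[OF j(1)] j(3) by (simp add: shift_def pairs_def x)
 show "good (fst (shift x))" using translate(4)[OF j(1)] j by (simp add: shift_def x)
 show "shift (shift x) = x" using translate(3)[OF j(1)] by (simp add: shift_def x)
qed

text \<open>The translation keeps the difference of pole and zero, hence sign and denominators, and
  it keeps \<open>Esum\<close> at leading order, while the factor \<open>j\<close> becomes its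
  negative modulo \<open>p\<close>.\<close>

lemma tm_shift:
 assumes "x \<in> pairs" "good (fst x)"
 shows "pge p (4 * v0 - 5) (tm x + tm (shift x))"
proof -
 obtain j z where x: "x = (j, z)" by (cases x)
 have j: "j \<in> poles" "z \<in> zeros" "p dvd z - 2 * j" "good j" using assms by (auto simp: pairs_def x)
 define j' z' where "j' = j - centre j" and "z' = z - 2 * centre j"
 have j': "j' \<in> poles" "z' \<in> zeros" using shift_pairs(1)[OF assms] by (auto simp: pairs_def shift_def x j'_def z'_def)
 have d: "of_int z' / 2 - of_int j' = (of_int z / 2 - of_int j :: rat)" by (simp add: j'_def z'_def field_simps)
 have E: "plead p (4 * v0 - 6) (Esum j z) (Esum j' z')"
  unfolding Esum_def d
 proof (rule plead_sum[OF p])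
  fix i :: nat
  have "plead p (4 * v0 - 4 + int i + 0 + (- int (i + 2))) (pf_c poles (coefA nu M) i j * of_nat (i * (i + 1)) * (1 / (of_int z / 2 - of_int j) ^ (i + 2)))
    (pf_c poles (coefA nu M) i j' * of_nat (i * (i + 1)) * (1 / (of_int z / 2 - of_int j) ^ (i + 2)))"
   unfolding j'_def
   by (intro plead_mult[OF p] pf_c_good plead_refl[OF p] pge_half_diff pge_of_nat[OF p] j)
  thus "plead p (4 * v0 - 6) (pf_c poles (coefA nu M) i j * of_nat (i * (i + 1)) / (of_int z / 2 - of_int j) ^ (i + 2))
    (pf_c poles (coefA nu M) i j' * of_nat (i * (i + 1)) / (of_int z / 2 - of_int j) ^ (i + 2))" by simp
 qed
 have jj: "pge p 1 (of_int (j' + j))"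
  by (rule pge_of_int_dvd[OF p]) (use reflect_cong[OF j(1)] in \<open>simp add: j'_def\<close>)
 have "2 * j' - z' = 2 * j - z" by (simp add: j'_def z'_def)
 hence "tm x + tm (shift x) = of_int (sgn (2 * j - z)) * (of_int j * (Esum j z - Esum j' z') + of_int (j' + j) * Esum j' z')"
  by (simp add: tm_def x shift_def flip: j'_def z'_def) (simp add: algebra_simps)
 moreover have "pge p (4 * v0 - 5) (of_int j * (Esum j z - Esum j' z'))"
  using E by (intro pge_cmult[OF p] pge_of_int[OF p]) (simp add: plead_def)
 moreover have "pge p (1 + (4 * v0 - 6)) (of_int (j' + j) * Esum j' z')"
  using E by (intro pge_mult[OF p] jj) (simp add: plead_def)
 moreover have "1 + (4 * v0 - 6) = 4 * v0 - 5" by simp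
 ultimately show ?thesis using pge_cmult[OF p pge_of_int[OF p] pge_add[OF p]] by (simp only:)
qed

lemma pge_halve: "pge p n (2 * x) ==> pge p n x"
proof -
 assume "pge p n (2 * x)"
 moreover have "\<not> p dvd 2" using p_dvd_double[of 1] prime_gt_1_int[OF p] by auto
 hence "pge p 0 (1 / of_int 2)" by (rule pge_inverse_unit[OF p])
 ultimately show ?thesis using pge_cmult[OF p] by fastforce
qed

text \<open>Summing over \<open>shift\<close> doubles the sum, and 2 is a unit, so fixed points of
  the involution do no harm.\<close>

lemma pge_sum_tm: "pge p (4 * v0 - 5) (\<Sum>x\<in>pairs. tm x)"
proof -
 define G where "G = {x \<in> pairs. good (fst x)}"
 have fin: "finite pairs" unfolding pairs_def using finite_poles finite_zeros by auto
 have "(\<Sum>x\<in>G. tm x) = (\<Sum>x\<in>G. tm (shift x))"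
  by (rule sum.reindex_bij_witness[of _ shift shift]) (auto simp: G_def shift_pairs)
 hence "2 * (\<Sum>x\<in>G. tm x) = (\<Sum>x\<in>G. tm x + tm (shift x))" by (simp add: sum.distrib)
 moreover have "pge p (4 * v0 - 5) (\<Sum>x\<in>G. tm x + tm (shift x))"
  by (rule pge_sum[OF p], rule tm_shift) (auto simp: G_def)
 ultimately have "pge p (4 * v0 - 5) (\<Sum>x\<in>G. tm x)" using pge_halve by simp
 moreover have "pge p (4 * v0 - 5) (\<Sum>x\<in>pairs - G. tm x)"
  by (rule pge_sum[OF p], rule tm_bad) (auto simp: G_def)
 moreover have "(\<Sum>x\<in>pairs. tm x) = (\<Sum>x\<in>pairs - G. tm x) + (\<Sum>x\<in>G. tm x)"
  by (rule sum.subset_diff) (auto simp: G_def fin)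
 ultimately show ?thesis using pge_add[OF p] by simp
qed

lemma pge_zero_part: "pge p (4 * v0 - 5) (\<Sum>z\<in>zeros. \<Sum>j\<in>poles. of_int (sgn (2 * j - z)) * pf_D poles (coefA nu M) j (of_int z / 2))"
proof -
 define T where "T x = of_int (sgn (2 * fst x - snd x)) * pf_D poles (coefA nu M) (fst x) (of_int (snd x) / 2)" for x
 have "(\<Sum>z\<in>zeros. \<Sum>j\<in>poles. of_int (sgn (2 * j - z)) * pf_D poles (coefA nu M) j (of_int z / 2)) = (\<Sum>x\<in>poles \<times> zeros. T x)"
  by (subst sum.swap) (simp add: T_def sum.cartesian_product case_prod_beta)
 also have "... = (\<Sum>x\<in>poles \<times> zeros - pairs. T x) + (\<Sum>x\<in>pairs. T x)"
  by (rule sum.subset_diff) (auto simp: pairs_def finite_poles finite_zeros)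
 also have "(\<Sum>x\<in>pairs. T x) = (\<Sum>x\<in>pairs. T x - tm x) + (\<Sum>x\<in>pairs. tm x)" by (simp add: sum_subtractf)
 also have "pge p (4 * v0 - 5) ((\<Sum>x\<in>poles \<times> zeros - pairs. T x) + ((\<Sum>x\<in>pairs. T x - tm x) + (\<Sum>x\<in>pairs. tm x)))"
 proof (intro pge_add[OF p] pge_sum_tm pge_sum[OF p])
  fix x assume "x \<in> poles \<times> zeros - pairs"
  thus "pge p (4 * v0 - 5) (T x)"
   unfolding T_def by (intro pge_cmult[OF p] pge_of_int[OF p] pge_pf_D_unit) (auto simp: pairs_def)
 next
  fix x assume x: "x \<in> pairs"
  have "T x - tm x = of_int (sgn (2 * fst x - snd x)) * (pf_D poles (coefA nu M) (fst x) (of_int (snd x) / 2) - of_int (fst x) * Esum (fst x) (snd x))"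
   by (simp add: T_def tm_def right_diff_distrib)
  also have "pge p (4 * v0 - 5) ..."
   by (intro pge_cmult[OF p] pge_of_int[OF p] pge_pf_D_Esum) (use x in \<open>auto simp: pairs_def\<close>)
  finally show "pge p (4 * v0 - 5) (T x - tm x)" .
 qed
 finally show ?thesis .
qed

theorem pge_rho0_form: "pge p (4 * v0 - 5) (rho0_form nu M)"
proof -
 have "pge p (4 * v0 - 5) (\<Sum>s\<in>{M..<nu}. \<Sum>j\<in>{j \<in> poles. 2 * j > 2 * int s + 1}. pf_D poles (coefA nu M) j (of_int (2 * int s + 1) / 2))"
 proof (intro pge_sum[OF p])
  fix s j assume s: "s \<in> {M..<nu}" and j: "j \<in> {j \<in> poles. 2 * j > 2 * int s + 1}"
  \<comment> \<open>Pole and half-integer both lie between \<open>M\<close> and \<open>nu\<close>,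
    so the doubled difference is positive and less than \<open>p\<close>.\<close>
  have "\<not> p dvd 2 * j - (2 * int s + 1)"
  proof
   assume "p dvd 2 * j - (2 * int s + 1)"
   from dvd_between[OF this] show False using s j large by (auto simp: poles_def)
  qed
  hence "\<not> p dvd (2 * int s + 1) - 2 * j" using dvd_diff_commute by blast
  thus "pge p (4 * v0 - 5) (pf_D poles (coefA nu M) j (of_int (2 * int s + 1) / 2))"
   using j by (intro pge_pf_D_unit) auto
 qed
 from pge_cmult[OF p pge_numeral[OF p] this]
 have 2: "pge p (4 * v0 - 5) (2 * (\<Sum>s\<in>{M..<nu}. \<Sum>j\<in>{j \<in> poles. 2 * j > 2 * int s + 1}. pf_D poles (coefA nu M) j (of_int (2 * int s + 1) / 2)))" .
 have "pge p (4 * v0 - 5) (- (1/2) * (\<Sum>z\<in>zeros. \<Sum>j\<in>poles. of_int (sgn (2 * j - z)) * pf_D poles (coefA nu M) j (of_int z / 2)))"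
  using pge_minus[OF p pge_zero_part] by - (rule pge_halve, simp)
 from pge_diff[OF p this 2] show ?thesis
  unfolding rho0_form_decomposition[OF M] poles_Ivl zeros_def[symmetric] .
qed

theorem pge_rho3_form: "pge p (4 * v0 - 1) (rho3_form nu M)"
 unfolding rho3_form_def rho3_def poles_Ivl
 using pge_pf_a[of _ 3] by (intro pge_sum[OF p]) simp

end

section \<open>Denominators at all primes together\<close>

definition dint :: "nat => nat => rat => bool" where
 "dint L n x \<longleftrightarrow> of_nat L ^ n * x \<in> \<int>"

lemma dint_mono: "dint L m x ==> m \<le> n ==> dint L n x"
proof -
 assume "dint L m x" "m \<le> n"
 moreover have "of_nat L ^ n * x = of_nat L ^ (n - m) * (of_nat L ^ m * x)"
  using \<open>m \<le> n\<close> by (simp flip: power_add mult.assoc)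
 moreover have "of_nat L ^ (n - m) * (of_nat L ^ m * x) \<in> \<int>"
  using \<open>dint L m x\<close> unfolding dint_def by (rule Ints_mult[OF Ints_power[OF Ints_of_nat]])
 ultimately show ?thesis unfolding dint_def by (simp only:)
qed

lemma dint_mult: "dint L m x ==> dint L n y ==> dint L (m + n) (x * y)"
proof -
 assume "dint L m x" "dint L n y"
 hence "(of_nat L ^ m * x) * (of_nat L ^ n * y) \<in> \<int>" unfolding dint_def by (rule Ints_mult)
 thus ?thesis unfolding dint_def by (simp add: power_add mult_ac)
qed

lemma dint_add: "dint L n x ==> dint L n y ==> dint L n (x + y)"
 unfolding dint_def distrib_left by (rule Ints_add)

lemma dint_diff: "dint L n x ==> dint L n y ==> dint L n (x - y)"
 unfolding dint_def right_diff_distrib by (rule Ints_diff)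

lemma dint_sum: "(\<And>i. i \<in> S ==> dint L n (f i)) ==> dint L n (\<Sum>i\<in>S. f i)"
 unfolding dint_def sum_distrib_left by (rule Ints_sum)

lemma dint_Ints: "x \<in> \<int> ==> dint L 0 x"
 by (simp add: dint_def)

lemma dint_cmult: "c \<in> \<int> ==> dint L n x ==> dint L n (c * x)"
 using dint_mult[OF dint_Ints, of c L n x] by simp

lemma dint_power: "dint L n x ==> dint L (k * n) (x ^ k)"
proof (induction k)
 case (Suc k)
 thus ?case using dint_mult[of L n x "k * n" "x ^ k"] by simp
qed (simp add: dint_def)

lemma dint_inverse:
 assumes "k \<noteq> 0" "\<bar>k\<bar> \<le> int n"
 shows "dint (Lcm {1..n}) 1 (1 / of_int k)"
proof -
 have "nat \<bar>k\<bar> \<in> {1..n}" using assms by auto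
 hence "nat \<bar>k\<bar> dvd Lcm {1..n}" by (rule dvd_Lcm)
 hence "int (nat \<bar>k\<bar>) dvd int (Lcm {1..n})" by (simp only: of_nat_dvd_iff)
 hence "k dvd int (Lcm {1..n})" by simp
 then obtain m where "int (Lcm {1..n}) = k * m" by (elim dvdE)
 hence "(of_nat (Lcm {1..n}) :: rat) = of_int (k * m)" by (metis of_int_of_nat_eq)
 thus ?thesis using assms(1) by (simp add: dint_def)
qed

lemma dint_div_power:
 assumes "k \<noteq> 0" "\<bar>k\<bar> \<le> int n" "dint (Lcm {1..n}) m x"
 shows "dint (Lcm {1..n}) (m + e) (x / of_int k ^ e)"
proof -
 have "dint (Lcm {1..n}) (m + e * 1) (x * (1 / of_int k) ^ e)"
  by (intro dint_mult assms dint_power dint_inverse)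
 thus ?thesis by (simp add: power_one_over)
qed

text \<open>A coefficient of order \<open>i\<close> involves \<open>4 - i\<close> divisions by
  differences of poles, all of absolute value at most \<open>2 nu\<close>.\<close>

lemma dint_pf_c:
 fixes A :: "int => rat"
 assumes A: "\<And>j. A j \<in> \<int>" and j: "j \<in> {- int nu..int nu}" and i: "i \<le> 4"
 shows "dint (Lcm {1..2 * nu}) (4 - i) (pf_c {- int nu..int nu} A i j)"
proof -
 define J L where "J = {- int nu..int nu}" and "L = Lcm {1..2 * nu}"
 have A0: "dint L 0 (A j)" for j by (rule dint_Ints[OF A])
 have A2: "dint L 0 ((A j)\<^sup>2)" for j by (rule dint_Ints) (simp add: A Ints_power)
 have d: "dint L (m + e) (x / of_int (j - i) ^ e)" if "j \<in> J" "i \<in> J - {j}" "dint L m x" for i j m e x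
  unfolding L_def by (rule dint_div_power) (use that in \<open>auto simp: J_def L_def\<close>)
 have two: "(2 :: rat) \<in> \<int>" "(- 2 :: rat) \<in> \<int>" by simp_all
 have b1: "dint L 1 (pf_b1 J A j)" if "j \<in> J" for j
 proof -
  have "dint L (0 + 1) (\<Sum>i\<in>J - {j}. A i / of_int (j - i) ^ 1)"
   by (rule dint_sum, rule d[OF that _ A0])
  from dint_cmult[OF Ints_mult[OF two(1) A] this] show ?thesis by (simp add: pf_b1_def pfg_def)
 qed
 have G: "dint L 2 (pf_G J A j)" if "j \<in> J" for j
  unfolding pf_G_def pfg_def
 proof (rule dint_sum)
  fix i assume i: "i \<in> J - {j}"
  have "dint L (0 + 2) ((A i)\<^sup>2 / of_int (j - i) ^ 2)" "dint L (1 + 1) (pf_b1 J A i / of_int (j - i) ^ 1)"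
   by (rule d[OF that i A2], rule d[OF that i b1]) (use i in auto)
  thus "dint L 2 ((A i)\<^sup>2 / of_int (j - i) ^ 2 + pf_b1 J A i / of_int (j - i))"
   by (intro dint_add) (simp_all add: numeral_2_eq_2)
 qed
 have H: "dint L 3 (pf_H J A j)" if "j \<in> J" for j
  unfolding pf_H_def pfh_def
 proof (rule dint_sum)
  fix i assume i: "i \<in> J - {j}"
  have "dint L (0 + 3) (- 2 * (A i)\<^sup>2 / of_int (j - i) ^ 3)" "dint L (1 + 2) (pf_b1 J A i / of_int (j - i) ^ 2)"
   by (rule d[OF that i dint_cmult[OF two(2) A2]], rule d[OF that i b1]) (use i in auto)
  thus "dint L 3 (- 2 * (A i)\<^sup>2 / of_int (j - i) ^ 3 - pf_b1 J A i / of_int (j - i) ^ 2)"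
   by (intro dint_diff) (simp_all add: numeral_3_eq_3)
 qed
 have j: "j \<in> J" using j by (simp add: J_def)
 have AA: "2 * (A j)\<^sup>2 \<in> \<int>" by (intro Ints_mult two Ints_power A)
 consider "i = 0" | "i = 1" | "i = 2" | "i = 3" | "i = 4" using i by linarith
 hence "dint L (4 - i) (pf_c J A i j)"
 proof cases
  case 1
  thus ?thesis by (simp add: pf_c_def dint_def)
 next
  case 2
  have "dint L (1 + 2) (2 * pf_b1 J A j * pf_G J A j)" by (intro dint_mult dint_cmult two b1 G j)
  moreover have "dint L 3 (2 * (A j)\<^sup>2 * pf_H J A j)" by (intro dint_cmult AA H j)
  ultimately show ?thesis using 2 by (simp add: pf_c_def dint_add numeral_3_eq_3)
 next
  case 3
  have "dint L (2 * 1) ((pf_b1 J A j)\<^sup>2)" by (intro dint_power b1 j)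
  moreover have "dint L 2 (2 * (A j)\<^sup>2 * pf_G J A j)" by (intro dint_cmult AA G j)
  ultimately show ?thesis using 3 by (simp add: pf_c_def dint_add)
 next
  case 4
  have "dint L 1 (2 * (A j)\<^sup>2 * pf_b1 J A j)" by (intro dint_cmult AA b1 j)
  thus ?thesis using 4 by (simp add: pf_c_def)
 next
  case 5
  thus ?thesis using A by (simp add: pf_c_def dint_Ints Ints_power)
 qed
 thus ?thesis by (simp add: J_def L_def)
qed

lemma dint_pf_a:
 fixes A :: "int => rat"
 assumes A: "\<And>j. A j \<in> \<int>" and j: "j \<in> {- int nu..int nu}" and i: "i \<le> 4"
 shows "dint (Lcm {1..2 * nu}) (4 - i) (pf_a {- int nu..int nu} A i j)"
proof -
 have "dint (Lcm {1..2 * nu}) (4 - i) (pf_c {- int nu..int nu} A (i + 1) j)"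
 proof (cases "i = 4")
  case True
  thus ?thesis by (simp add: pf_c_def dint_def)
 next
  case False
  thus ?thesis by (intro dint_mono[OF dint_pf_c[OF A j]]) (use i in auto)
 qed
 thus ?thesis unfolding pf_a_def by (intro dint_add dint_cmult dint_pf_c assms) auto
qed

lemma dint_rho3: "dint (Lcm {1..2 * nu}) 6 (rho3_form nu M)"
 unfolding rho3_form_def rho3_def
 by (rule dint_sum, rule dint_mono[OF dint_pf_a[OF coefA_Ints]]) auto

text \<open>There are \<open>4 - i\<close> divisions in the coefficient and \<open>i + 2\<close> in
  the second derivative, always 6 in total. The doubled distances of the half-integers below
  \<open>j\<close> from \<open>j\<close> are at most \<open>2 nu\<close>.\<close>

lemma dint_rho0: "dint (Lcm {1..2 * nu}) 6 (rho0_form nu M)"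
 unfolding rho0_form_def rho0_def
proof (intro dint_cmult dint_sum)
 fix j s assume j: "j \<in> {1..nu}" and s: "s \<in> {..<j}"
 have x: "of_nat s + 1/2 - of_int (int j) = (of_int (2 * int s + 1 - 2 * int j) / 2 :: rat)" by (simp add: field_simps)
 show "dint (Lcm {1..2 * nu}) 6 (pf_D {- int nu..int nu} (coefA nu M) (int j) (of_nat s + 1/2))"
  unfolding pf_D_def x
 proof (rule dint_sum)
  fix i :: nat assume i: "i \<in> {1..4}"
  have "dint (Lcm {1..2 * nu}) ((4 - i) + (i + 2)) ((of_nat (i * (i + 1)) * 2 ^ (i + 2)) * pf_a {- int nu..int nu} (coefA nu M) i (int j) / of_int (2 * int s + 1 - 2 * int j) ^ (i + 2))"
   by (intro dint_div_power dint_cmult dint_pf_a coefA_Ints) (use i j s in \<open>auto simp: Ints_mult Ints_power\<close>)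
  moreover have "(4 - i) + (i + 2) = 6" using i by auto
  moreover have "pf_a {- int nu..int nu} (coefA nu M) i (int j) * of_nat (i * (i + 1)) / (of_int (2 * int s + 1 - 2 * int j) / 2) ^ (i + 2)
   = (of_nat (i * (i + 1)) * 2 ^ (i + 2)) * pf_a {- int nu..int nu} (coefA nu M) i (int j) / of_int (2 * int s + 1 - 2 * int j) ^ (i + 2)"
   by (simp only: power_divide divide_divide_eq_right) (simp only: mult_ac)
  ultimately show "dint (Lcm {1..2 * nu}) 6 (pf_a {- int nu..int nu} (coefA nu M) i (int j) * of_nat (i * (i + 1)) / (of_int (2 * int s + 1 - 2 * int j) / 2) ^ (i + 2))"
   by (simp only:)
 qed
qed simp

text \<open>Every prime factor of the denominator is one of the finitely many primes in
  \<open>S\<close>, and each of these is excluded locally.\<close>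

lemma Ints_if_prime_local:
 fixes x :: rat
 assumes "finite S" "\<And>q. q \<in> S ==> prime q" "of_nat (\<Prod>q\<in>S. q ^ e q) * x \<in> \<int>"
  and loc: "\<And>q. q \<in> S ==> pge (int q) 0 x"
 shows "x \<in> \<int>"
proof -
 define N where "N = (\<Prod>q\<in>S. q ^ e q)"
 obtain a b where ab: "quotient_of x = (a, b)" by (cases "quotient_of x")
 have x: "x = of_int a / of_int b" and b: "b > 0" and cop: "coprime a b"
  using quotient_of_div[OF ab] quotient_of_denom_pos[OF ab] quotient_of_coprime[OF ab] by auto
 obtain m where m: "of_nat N * x = of_int m" using assms(3) by (auto simp: N_def elim: Ints_cases)
 have "(of_int (int N * a) :: rat) = of_int (m * b)" using m b by (simp add: x field_simps)
 hence "int N * a = m * b" by (simp only: of_int_eq_iff)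
 hence "b dvd int N * a" by simp
 hence bN: "b dvd int N" using cop by (metis coprime_commute coprime_dvd_mult_left_iff)
 have "is_unit b"
 proof (rule ccontr)
  assume "\<not> is_unit b"
  moreover have "b \<noteq> 0" using b by simp
  ultimately obtain r where r: "prime r" "r dvd b" using prime_divisor_exists[of b] by blast
  have "nat r dvd N" using dvd_trans[OF r(2) bN] prime_gt_0_int[OF r(1)] by (simp add: nat_dvd_iff)
  have rn: "prime (nat r)" using r(1) by simp
  hence "\<exists>q\<in>S. nat r dvd q ^ e q" using \<open>nat r dvd N\<close> assms(1) unfolding N_def by (simp add: prime_dvd_prod_iff)
  then obtain q where q: "q \<in> S" "nat r dvd q ^ e q" by blast
  hence "nat r dvd q" using rn prime_dvd_power by blast
  hence "nat r = q" using rn assms(2)[OF q(1)] by (metis primes_dvd_imp_eq)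
  hence rq: "r = int q" using prime_gt_0_int[OF r(1)] by simp
  from loc[OF q(1)] obtain c d where cd: "\<not> r dvd d" "x * of_int d = of_int c" unfolding rq by (auto simp: pge_def)
  have "(of_int (a * d) :: rat) = of_int (c * b)" using cd(2) b by (simp add: x field_simps)
  hence "a * d = c * b" by (simp only: of_int_eq_iff)
  hence "r dvd a * d" using r(2) by simp
  hence "r dvd a" using cd(1) r(1) by (simp add: prime_dvd_mult_iff)
  hence "is_unit r" using r(2) cop by (meson coprime_common_divisor)
  thus False using r(1) not_prime_unit by blast
 qed
 hence "b = 1" using b by simp
 thus ?thesis by (simp add: x)
qed

definition big_primes :: "nat => nat set" where
 "big_primes k = {q. prime q \<and> 2 * k < q \<and> q \<le> 20 * k}"

text \<open>The exponent \<open>1 + 4 * v0\<close> by which the local estimates improve on the sixth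
  power of the lcm.\<close>

definition saving :: "nat => nat => nat" where
 "saving k q = 1 + 4 * of_bool (\<exists>i\<in>{18 * k<..20 * k}. q dvd i)"

definition denom :: "nat => rat" where
 "denom k = of_nat (Lcm {1..20 * k}) ^ 6 / of_nat (\<Prod>q\<in>big_primes k. q ^ saving k q)"

lemma finite_big_primes: "finite (big_primes k)"
 by (rule finite_subset[of _ "{..20 * k}"]) (auto simp: big_primes_def)

lemma denom_pos: "denom k > 0"
proof -
 have "0 < (\<Prod>q\<in>big_primes k. q ^ saving k q)"
  by (rule prod_pos) (auto simp: big_primes_def prime_gt_0_nat)
 moreover have "0 < Lcm {1..20 * k}" by (rule Nat.gr0I) (auto simp: Lcm_0_iff)
 ultimately show ?thesis unfolding denom_def by (intro divide_pos_pos zero_less_power) (simp_all del: of_nat_prod)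
qed

text \<open>For \<open>k >= 10\<close> and \<open>q > 2 k\<close> one has
  \<open>40 k <= (2 k)^2 < q^2\<close>, the condition \<open>4 nu < p^2\<close> of the local
  analysis at \<open>nu = 10 k\<close>.\<close>

lemma denom_local:
 assumes k: "k \<ge> 10" and q: "q \<in> big_primes k"
 shows "pge (int q) 0 (denom k * rho0_form (10 * k) (9 * k))" "pge (int q) 0 (denom k * rho3_form (10 * k) (9 * k))"
proof -
 have pq: "prime q" "2 * k < q" "q \<le> 20 * k" using q by (auto simp: big_primes_def)
 have pi: "prime (int q)" using pq by simp
 have "odd q" using pq k prime_odd_nat[of q] by simp
 have "40 * k < q\<^sup>2"
 proof -
  have "40 * k \<le> (2 * k) * (2 * k)" using k by simp
  also have "... < q * q" using pq by (intro mult_strict_mono) auto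
  finally show ?thesis by (simp add: power2_eq_square)
 qed
 hence sq: "40 * int k < (int q)\<^sup>2" by (metis of_nat_less_iff of_nat_mult of_nat_numeral of_nat_power)
 interpret large_prime "int q" "10 * k" "9 * k"
  by unfold_locales (use pi \<open>odd q\<close> pq sq in auto)
 have v: "v0 = of_bool (\<exists>i\<in>{18 * k<..20 * k}. q dvd i)" unfolding v0_def by simp
 have sv: "int (saving k q) = 1 + 4 * v0" unfolding saving_def v by simp
 have L: "pge (int q) 1 (of_nat (Lcm {1..20 * k}))"
 proof -
  have "q dvd Lcm {1..20 * k}" by (rule dvd_Lcm) (use pq in auto)
  hence "int q dvd int (Lcm {1..20 * k})" by simp
  from pge_of_int_dvd[OF pi this] show ?thesis by simp
 qed
 define P where "P = (\<Prod>r\<in>big_primes k - {q}. r ^ saving k r)"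
 have split: "(\<Prod>r\<in>big_primes k. r ^ saving k r) = q ^ saving k q * P"
  unfolding P_def by (rule prod.remove[OF finite_big_primes q])
 have "\<not> q dvd P"
 proof
  assume "q dvd P"
  then obtain r where r: "r \<in> big_primes k - {q}" "q dvd r ^ saving k r"
   unfolding P_def using pq(1) finite_big_primes[of k] by (auto simp: prime_dvd_prod_iff)
  hence "q dvd r" using pq(1) prime_dvd_power by blast
  thus False using r(1) pq(1) primes_dvd_imp_eq[of q r] by (auto simp: big_primes_def)
 qed
 hence "\<not> int q dvd int P" by simp
 from pge_inverse_unit[OF pi this] have P: "pge (int q) 0 (1 / of_nat P)" by simp
 have "pge (int q) (- 1) (1 / of_int (int q))"
 proof (rule pge_inverse_simple[OF pi])
  have "\<not> q\<^sup>2 dvd q"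
  proof
   assume "q\<^sup>2 dvd q"
   hence "q\<^sup>2 \<le> q" by (rule dvd_imp_le) (use pq in simp)
   hence "q * q \<le> q * 1" by (simp add: power2_eq_square)
   thus False using prime_gt_1_nat[OF pq(1)] by simp
  qed
  thus "\<not> (int q)\<^sup>2 dvd int q" by (metis of_nat_dvd_iff of_nat_power)
 qed
 from pge_power[OF pi this, of "saving k q"]
 have Q: "pge (int q) (- (1 + 4 * v0)) (1 / of_nat q ^ saving k q)" by (simp add: sv power_one_over)
 have "denom k = of_nat (Lcm {1..20 * k}) ^ 6 * (1 / of_nat q ^ saving k q * (1 / of_nat P))"
  unfolding denom_def split by simp
 moreover have "pge (int q) (int 6 * 1 + (- (1 + 4 * v0) + 0)) (of_nat (Lcm {1..20 * k}) ^ 6 * (1 / of_nat q ^ saving k q * (1 / of_nat P)))"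
  by (intro pge_mult[OF pi] pge_power[OF pi] L Q P)
 ultimately have d: "pge (int q) (5 - 4 * v0) (denom k)" by simp
 show "pge (int q) 0 (denom k * rho0_form (10 * k) (9 * k))"
  using pge_mult[OF pi d pge_rho0_form] by simp
 show "pge (int q) 0 (denom k * rho3_form (10 * k) (9 * k))"
  using pge_mono[OF pi pge_mult[OF pi d pge_rho3_form], of 0] by simp
qed

theorem denom_Ints:
 assumes "k \<ge> 10"
 shows "denom k * rho0_form (10 * k) (9 * k) \<in> \<int>" "denom k * rho3_form (10 * k) (9 * k) \<in> \<int>"
proof -
 have pos: "0 < (\<Prod>q\<in>big_primes k. q ^ saving k q)"
  by (rule prod_pos) (auto simp: big_primes_def prime_gt_0_nat)
 have e: "of_nat (\<Prod>q\<in>big_primes k. q ^ saving k q) * (denom k * x) = of_nat (Lcm {1..2 * (10 * k)}) ^ 6 * x" for x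
  using pos unfolding denom_def by (simp del: of_nat_prod)
 have pr: "prime q" if "q \<in> big_primes k" for q using that by (simp add: big_primes_def)
 have d: "of_nat (Lcm {1..2 * (10 * k)}) ^ 6 * rho0_form (10 * k) (9 * k) \<in> \<int>" "of_nat (Lcm {1..2 * (10 * k)}) ^ 6 * rho3_form (10 * k) (9 * k) \<in> \<int>"
  using dint_rho0[of "10 * k" "9 * k"] dint_rho3[of "10 * k" "9 * k"] by (simp_all only: dint_def)
 show "denom k * rho0_form (10 * k) (9 * k) \<in> \<int>"
  by (rule Ints_if_prime_local[OF finite_big_primes pr d(1)[folded e] denom_local(1)[OF assms]])
 show "denom k * rho3_form (10 * k) (9 * k) \<in> \<int>"
  by (rule Ints_if_prime_local[OF finite_big_primes pr d(2)[folded e] denom_local(2)[OF assms]])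
qed

section \<open>Size of the coefficients\<close>

context
 fixes nu :: nat and A :: "int => rat" and a n :: rat
 assumes A: "\<And>j. \<bar>A j\<bar> \<le> a" and n: "n = of_nat (2 * nu + 1)"
begin

definition "Jv = {- int nu..int nu}"

lemma a_nonneg: "a \<ge> 0"
 using A[of 0] by simp

lemma n_ge_1: "n \<ge> 1"
 by (simp add: n)

lemma card_Jv: "of_nat (card Jv) = n"
 by (simp add: Jv_def n nat_add_distrib nat_mult_distrib)

lemma abs_sum_Jv_le:
 assumes "\<And>i. i \<in> Jv ==> \<bar>f i\<bar> \<le> (B :: rat)"
 shows "\<bar>sum f (Jv - {j})\<bar> \<le> n * B" "\<bar>sum f Jv\<bar> \<le> n * B"
proof -
 have fin: "finite Jv" by (simp add: Jv_def)
 have B: "B \<ge> 0" using assms[of 0] by (simp add: Jv_def)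
 have "\<bar>sum f (Jv - {j})\<bar> \<le> of_nat (card (Jv - {j})) * B"
  by (rule order_trans[OF sum_abs sum_bounded_above]) (use assms in auto)
 also have "... \<le> of_nat (card Jv) * B"
  by (intro mult_right_mono B) (simp add: card_Diff1_le fin)
 finally show "\<bar>sum f (Jv - {j})\<bar> \<le> n * B" by (simp only: card_Jv)
 show "\<bar>sum f Jv\<bar> \<le> n * B"
  unfolding card_Jv[symmetric] by (rule order_trans[OF sum_abs sum_bounded_above]) (use assms in auto)
qed

lemma abs_div_le: "i \<noteq> j ==> \<bar>x\<bar> \<le> B ==> \<bar>x / of_int (j - i) ^ k\<bar> \<le> (B :: rat)"
proof -
 assume "i \<noteq> j" "\<bar>x\<bar> \<le> B"
 have "1 \<le> \<bar>j - i\<bar>" using \<open>i \<noteq> j\<close> by simp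
 hence "(1 :: rat) \<le> of_int \<bar>j - i\<bar>" by (simp only: of_int_1_le_iff)
 hence "1 \<le> \<bar>of_int (j - i) :: rat\<bar> ^ k" by (intro one_le_power) simp
 moreover have "\<bar>x\<bar> / y \<le> \<bar>x\<bar>" if "1 \<le> y" for y
 proof -
  have "\<bar>x\<bar> * 1 \<le> \<bar>x\<bar> * y" using that by (intro mult_left_mono) auto
  thus ?thesis using that by (simp add: divide_le_eq)
 qed
 ultimately have "\<bar>x\<bar> / \<bar>of_int (j - i)\<bar> ^ k \<le> \<bar>x\<bar>" by blast
 thus ?thesis using \<open>\<bar>x\<bar> \<le> B\<close> by (simp only: abs_divide power_abs)
qed

lemma abs_mult_le: "\<bar>x\<bar> \<le> B ==> \<bar>y\<bar> \<le> C ==> \<bar>x * y\<bar> \<le> B * (C :: rat)"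
 unfolding abs_mult by (rule mult_mono) auto

lemma abs_add_le: "\<bar>x\<bar> \<le> B ==> \<bar>y\<bar> \<le> C ==> \<bar>x + y\<bar> \<le> B + (C :: rat)"
 by linarith

lemma abs_A2: "\<bar>(A j)\<^sup>2\<bar> \<le> a\<^sup>2"
 unfolding power2_eq_square by (intro abs_mult_le A)

lemma abs_sum_Diff_le:
 assumes "\<And>i. i \<noteq> j ==> \<bar>f i\<bar> \<le> (B :: rat)" "B \<ge> 0"
 shows "\<bar>sum f (Jv - {j})\<bar> \<le> n * B"
proof -
 have "sum f (Jv - {j}) = sum (\<lambda>i. if i = j then 0 else f i) (Jv - {j})" by (intro sum.cong) auto
 thus ?thesis using abs_sum_Jv_le(1)[of "\<lambda>i. if i = j then 0 else f i" B j] assms by simp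
qed

lemma abs_pf_b1: "\<bar>pf_b1 Jv A j\<bar> \<le> 2 * n * a\<^sup>2"
proof -
 have "\<bar>\<Sum>i\<in>Jv - {j}. A i / of_int (j - i) ^ 1\<bar> \<le> n * a"
  by (intro abs_sum_Diff_le abs_div_le A a_nonneg) auto
 from abs_mult_le[OF abs_mult_le[OF _ A[of j], of 2 2] this]
 have "\<bar>2 * A j * (\<Sum>i\<in>Jv - {j}. A i / of_int (j - i) ^ 1)\<bar> \<le> 2 * a * (n * a)" by simp
 thus ?thesis by (simp add: pf_b1_def pfg_def power2_eq_square mult_ac)
qed

lemma n_powers: "1 \<le> n ^ k" "x \<ge> 0 ==> k \<le> l ==> n ^ k * x \<le> n ^ l * x"
 using n_ge_1 by (auto intro!: one_le_power mult_right_mono power_increasing)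

lemma pos_na: "0 \<le> n ^ k * a ^ 4"
 using n_ge_1 a_nonneg by (intro mult_nonneg_nonneg zero_le_power) auto

lemma abs_pf_G: "\<bar>pf_G Jv A j\<bar> \<le> 3 * n\<^sup>2 * a\<^sup>2"
proof -
 have "\<bar>pf_G Jv A j\<bar> \<le> n * (a\<^sup>2 + 2 * n * a\<^sup>2)"
  unfolding pf_G_def pfg_def
 proof (rule abs_sum_Diff_le)
  fix i assume "i \<noteq> j"
  thus "\<bar>(A i)\<^sup>2 / of_int (j - i) ^ 2 + pf_b1 Jv A i / of_int (j - i)\<bar> \<le> a\<^sup>2 + 2 * n * a\<^sup>2"
   using abs_div_le[OF _ abs_pf_b1, of i j i 1] by (intro abs_add_le abs_div_le abs_A2) simp_all
 qed (use n_ge_1 in simp)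
 also have "... \<le> 3 * n\<^sup>2 * a\<^sup>2"
  using n_powers(2)[of "a\<^sup>2" 1 2] by (simp add: power2_eq_square algebra_simps)
 finally show ?thesis .
qed

lemma abs_pf_H: "\<bar>pf_H Jv A j\<bar> \<le> 4 * n\<^sup>2 * a\<^sup>2"
proof -
 have "\<bar>pf_H Jv A j\<bar> \<le> n * (2 * a\<^sup>2 + 2 * n * a\<^sup>2)"
  unfolding pf_H_def pfh_def
 proof (rule abs_sum_Diff_le)
  fix i assume i: "i \<noteq> j"
  have "\<bar>(- 2 * (A i)\<^sup>2) / of_int (j - i) ^ 3\<bar> \<le> 2 * a\<^sup>2"
   by (rule abs_div_le[OF i]) (use abs_A2[of i] in \<open>simp add: abs_mult\<close>)
  moreover have "\<bar>- pf_b1 Jv A i / of_int (j - i) ^ 2\<bar> \<le> 2 * n * a\<^sup>2"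
   by (rule abs_div_le[OF i]) (use abs_pf_b1[of i] in simp)
  ultimately show "\<bar>- 2 * (A i)\<^sup>2 / of_int (j - i) ^ 3 - pf_b1 Jv A i / of_int (j - i) ^ 2\<bar> \<le> 2 * a\<^sup>2 + 2 * n * a\<^sup>2"
   by linarith
 qed (use n_ge_1 in simp)
 also have "... \<le> 4 * n\<^sup>2 * a\<^sup>2"
  using n_powers(2)[of "a\<^sup>2" 1 2] by (simp add: power2_eq_square algebra_simps)
 finally show ?thesis .
qed

text \<open>Only the exponential growth of \<open>a^4\<close> matters in the end, so constants and
  powers of the number \<open>n\<close> of poles are estimated crudely.\<close>

lemma abs_pf_c: "\<bar>pf_c Jv A i j\<bar> \<le> 20 * n ^ 3 * a ^ 4"
proof -
 have p4: "x ^ 4 = x\<^sup>2 * x\<^sup>2" for x :: rat by (simp add: power4_eq_xxxx power2_eq_square mult_ac)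
 note a4 = p4[of a]
 have a0: "0 \<le> a ^ 4" by (rule zero_le_power[OF a_nonneg])
 have N3: "0 \<le> n ^ 3 * a ^ 4" by (rule mult_nonneg_nonneg[OF _ a0]) (use n_powers(1)[of 3] in linarith)
 note n1 = n_powers(2)[OF a0, of 0 3] and n2 = n_powers(2)[OF a0, of 1 3] and n3 = n_powers(2)[OF a0, of 2 3]
 have AA: "\<bar>2 * (A j)\<^sup>2\<bar> \<le> 2 * a\<^sup>2" using abs_A2[of j] by (simp add: abs_mult)
 have bb: "\<bar>2 * pf_b1 Jv A j\<bar> \<le> 4 * n * a\<^sup>2" using abs_pf_b1[of j] by (simp add: abs_mult)
 consider "i = 1" | "i = 2" | "i = 3" | "i = 4" | "i \<notin> {1,2,3,4}" by blast
 thus ?thesis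
 proof cases
  case 1
  have "\<bar>2 * pf_b1 Jv A j * pf_G Jv A j + 2 * (A j)\<^sup>2 * pf_H Jv A j\<bar> \<le> 4 * n * a\<^sup>2 * (3 * n\<^sup>2 * a\<^sup>2) + 2 * a\<^sup>2 * (4 * n\<^sup>2 * a\<^sup>2)"
   by (intro abs_add_le abs_mult_le bb abs_pf_G AA abs_pf_H)
  also have "... = 12 * (n ^ 3 * a ^ 4) + 8 * (n\<^sup>2 * a ^ 4)" unfolding a4 by (simp add: power3_eq_cube power2_eq_square mult_ac)
  also have "... \<le> 20 * n ^ 3 * a ^ 4" using n3 by simp
  finally show ?thesis using 1 by (simp add: pf_c_def)
 next
  case 2
  have "\<bar>pf_b1 Jv A j * pf_b1 Jv A j + 2 * (A j)\<^sup>2 * pf_G Jv A j\<bar> \<le> 2 * n * a\<^sup>2 * (2 * n * a\<^sup>2) + 2 * a\<^sup>2 * (3 * n\<^sup>2 * a\<^sup>2)"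
   by (intro abs_add_le abs_mult_le abs_pf_b1 abs_pf_G AA)
  also have "... = 10 * (n\<^sup>2 * a ^ 4)" unfolding a4 by (simp add: power2_eq_square mult_ac)
  also have "... \<le> 20 * n ^ 3 * a ^ 4" using n3 a0 N3 by simp
  finally show ?thesis using 2 by (simp add: pf_c_def power2_eq_square)
 next
  case 3
  have "\<bar>2 * (A j)\<^sup>2 * pf_b1 Jv A j\<bar> \<le> 2 * a\<^sup>2 * (2 * n * a\<^sup>2)" by (intro abs_mult_le AA abs_pf_b1)
  also have "... = 4 * (n ^ 1 * a ^ 4)" unfolding a4 by (simp add: mult_ac)
  also have "... \<le> 20 * n ^ 3 * a ^ 4" using n2 N3 by simp
  finally show ?thesis using 3 by (simp add: pf_c_def)
 next
  case 4
  have "\<bar>(A j)\<^sup>2 * (A j)\<^sup>2\<bar> \<le> a\<^sup>2 * a\<^sup>2" by (intro abs_mult_le abs_A2)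
  hence "\<bar>A j ^ 4\<bar> \<le> a ^ 4" by (simp only: p4)
  also have "... \<le> 20 * n ^ 3 * a ^ 4" using n1 N3 by simp
  finally show ?thesis using 4 by (simp add: pf_c_def)
 next
  case 5
  thus ?thesis using a0 N3 by (simp add: pf_c_def)
 qed
qed

lemma abs_pf_a: "j \<in> Jv ==> \<bar>pf_a Jv A i j\<bar> \<le> 20 * n ^ 4 * a ^ 4"
proof -
 assume j: "j \<in> Jv"
 have "\<bar>j\<bar> \<le> int nu" using j by (auto simp: Jv_def)
 hence "of_int \<bar>j\<bar> \<le> (of_int (int nu) :: rat)" by (simp only: of_int_le_iff)
 hence jb: "\<bar>of_int j :: rat\<bar> \<le> of_nat nu" by simp
 have "\<bar>of_int j * pf_c Jv A i j + pf_c Jv A (i + 1) j\<bar> \<le> of_nat nu * (20 * n ^ 3 * a ^ 4) + 20 * n ^ 3 * a ^ 4"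
  by (intro abs_add_le abs_mult_le abs_pf_c jb)
 also have "... = (of_nat nu + 1) * (20 * n ^ 3 * a ^ 4)" by (simp add: algebra_simps)
 also have "... \<le> n * (20 * n ^ 3 * a ^ 4)"
 proof (rule mult_right_mono)
  show "0 \<le> 20 * n ^ 3 * a ^ 4" using pos_na[of 3] by simp
 qed (simp add: n)
 also have "... = 20 * n ^ 4 * a ^ 4" by (simp add: eval_nat_numeral)
 finally show ?thesis unfolding pf_a_def .
qed

lemma abs_rho3: "\<bar>rho3 nu A\<bar> \<le> 20 * n ^ 5 * a ^ 4"
proof -
 have "\<bar>rho3 nu A\<bar> \<le> n * (20 * n ^ 4 * a ^ 4)"
  unfolding rho3_def Jv_def[symmetric] by (rule abs_sum_Jv_le(2)) (rule abs_pf_a)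
 thus ?thesis by (simp add: eval_nat_numeral mult_ac)
qed

text \<open>\<open>102400 = 4 * 20 * 20 * 64\<close>: four orders, the constant of
  \<open>abs_pf_a\<close>, \<open>i (i + 1) <= 20\<close>, and at most six divisions by a distance
  of at least 1/2.\<close>

lemma abs_pf_D:
 assumes "j \<in> Jv"
 shows "\<bar>pf_D Jv A j (of_nat s + 1/2)\<bar> \<le> 102400 * n ^ 4 * a ^ 4"
proof -
 define B where "B = 20 * n ^ 4 * a ^ 4"
 have B: "B \<ge> 0" unfolding B_def using pos_na[of 4] by simp
 define x :: rat where "x = of_nat s + 1/2 - of_int j"
 have "1/2 \<le> \<bar>x\<bar>"
 proof -
  have "(1 :: int) \<le> \<bar>2 * int s + 1 - 2 * j\<bar>" by presburger
  hence "(1 :: rat) \<le> of_int \<bar>2 * int s + 1 - 2 * j\<bar>" by (simp only: of_int_1_le_iff)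
  moreover have "of_int (2 * int s + 1 - 2 * j) = 2 * x" by (simp add: x_def)
  ultimately show ?thesis by (simp only: of_int_abs)
 qed
 hence x2: "\<bar>1 / x\<bar> \<le> 2" by (simp add: abs_divide divide_le_eq)
 have t: "\<bar>pf_a Jv A i j * of_nat (i * (i + 1)) / x ^ (i + 2)\<bar> \<le> B * 20 * 64" if i: "i \<in> {1..4}" for i
 proof -
  have i4: "i \<le> 4" using i by simp
  have "\<bar>(1 / x) ^ (i + 2)\<bar> \<le> 2 ^ (i + 2)" unfolding power_abs by (rule power_mono[OF x2]) simp
  also have "... \<le> (2 :: rat) ^ 6" using i4 by (intro power_increasing) auto
  finally have 1: "\<bar>(1 / x) ^ (i + 2)\<bar> \<le> 64" by simp
  have "i * (i + 1) \<le> 4 * (4 + 1)" using i4 by (intro mult_mono) auto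
  hence "i * (i + 1) \<le> 20" by simp
  hence "(of_nat (i * (i + 1)) :: rat) \<le> of_nat 20" by (simp only: of_nat_le_iff)
  hence 2: "\<bar>of_nat (i * (i + 1)) :: rat\<bar> \<le> 20" by simp
  have "\<bar>pf_a Jv A i j * of_nat (i * (i + 1)) * (1 / x) ^ (i + 2)\<bar> \<le> B * 20 * 64"
   unfolding B_def by (intro abs_mult_le 1 2 abs_pf_a assms)
  thus ?thesis by (simp add: power_one_over)
 qed
 have "\<bar>pf_D Jv A j (of_nat s + 1/2)\<bar> \<le> (\<Sum>i\<in>{1..4::nat}. B * 20 * 64)"
  unfolding pf_D_def x_def[symmetric] by (rule order_trans[OF sum_abs sum_mono]) (rule t)
 also have "... = 102400 * n ^ 4 * a ^ 4" by (simp add: B_def)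
 finally show ?thesis .
qed

lemma abs_rho0: "\<bar>rho0 nu A\<bar> \<le> 204800 * n ^ 6 * a ^ 4"
proof -
 define B where "B = 102400 * n ^ 4 * a ^ 4"
 have B: "B \<ge> 0" unfolding B_def using pos_na[of 4] by simp
 have nun: "(of_nat nu :: rat) \<le> n" by (simp add: n)
 have "\<bar>\<Sum>s<j. pf_D Jv A (int j) (of_nat s + 1/2)\<bar> \<le> n * B" if j: "j \<in> {1..nu}" for j
 proof -
  have "\<bar>\<Sum>s<j. pf_D Jv A (int j) (of_nat s + 1/2)\<bar> \<le> (\<Sum>s<j. B)"
   unfolding B_def by (rule order_trans[OF sum_abs sum_mono]) (rule abs_pf_D, use j in \<open>simp add: Jv_def\<close>)
  also have "... = of_nat j * B" by simp
  also have "... \<le> n * B"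
  proof (rule mult_right_mono[OF _ B])
   have "(of_nat j :: rat) \<le> of_nat nu" using j by simp
   thus "of_nat j \<le> n" using nun by simp
  qed
  finally show ?thesis .
 qed
 hence "\<bar>\<Sum>j=1..nu. \<Sum>s<j. pf_D Jv A (int j) (of_nat s + 1/2)\<bar> \<le> (\<Sum>j=1..nu. n * B)"
  by (intro order_trans[OF sum_abs sum_mono])
 also have "... = of_nat nu * (n * B)" by simp
 also have "... \<le> n * (n * B)" using nun B n_ge_1 by (intro mult_right_mono) auto
 finally have "\<bar>\<Sum>j=1..nu. \<Sum>s<j. pf_D Jv A (int j) (of_nat s + 1/2)\<bar> \<le> n * (n * B)" .
 hence "\<bar>rho0 nu A\<bar> \<le> 2 * (n * (n * B))" unfolding rho0_def Jv_def[symmetric] by (simp add: abs_mult)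
 also have "... = 204800 * n ^ 6 * a ^ 4" by (simp add: B_def eval_nat_numeral)
 finally show ?thesis .
qed

end

definition height_bound :: "nat => rat" where
 "height_bound k = 204800 * of_nat (20 * k + 1) ^ 6 * (4 ^ (18 * k) * 2 ^ k * of_nat (20 * k choose k)) ^ 4"

lemma abs_rho_forms:
 "\<bar>rho0_form (10 * k) (9 * k)\<bar> \<le> height_bound k" "\<bar>384 * rho3_form (10 * k) (9 * k)\<bar> \<le> height_bound k"
proof -
 define a :: rat where "a = 4 ^ (18 * k) * 2 ^ k * of_nat (20 * k choose k)"
 define n :: rat where "n = of_nat (2 * (10 * k) + 1)"
 have A: "\<bar>coefA (10 * k) (9 * k) j\<bar> \<le> a" for j
  using abs_coefA_le[of "10 * k" "9 * k" k j] by (simp add: a_def)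
 have a4: "a ^ 4 \<ge> 0" by (simp add: a_def)
 have n: "n \<ge> 1" by (simp add: n_def)
 have h: "height_bound k = 204800 * n ^ 6 * a ^ 4" by (simp add: height_bound_def a_def n_def)
 show "\<bar>rho0_form (10 * k) (9 * k)\<bar> \<le> height_bound k"
  unfolding h rho0_form_def by (rule abs_rho0[where A = "coefA (10 * k) (9 * k)", OF A n_def])
 have "\<bar>384 * rho3_form (10 * k) (9 * k)\<bar> \<le> 384 * (20 * n ^ 5 * a ^ 4)"
  using mult_left_mono[OF abs_rho3[where A = "coefA (10 * k) (9 * k)", OF A n_def], of 384]
  unfolding rho3_form_def abs_mult by simp
 also have "... \<le> 204800 * n ^ 6 * a ^ 4"
 proof -
  have "n ^ 5 * a ^ 4 \<le> n ^ 6 * a ^ 4" by (intro mult_right_mono a4 power_increasing n) auto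
  moreover have "0 \<le> n ^ 6 * a ^ 4" using a4 n by simp
  ultimately have "7680 * (n ^ 5 * a ^ 4) \<le> 204800 * (n ^ 6 * a ^ 4)" by linarith
  thus ?thesis by (simp add: mult_ac)
 qed
 finally show "\<bar>384 * rho3_form (10 * k) (9 * k)\<bar> \<le> height_bound k" by (simp add: h)
qed

section \<open>The prime number theorem\<close>

lemma norm_powr_diff_le:
 fixes s :: complex
 assumes "0 < a" "a \<le> x" "Re s \<le> 1"
 shows "norm (of_real x powr s - of_real a powr s) \<le> norm s * a powr (Re s - 1) * (x - a)"
proof -
 let ?S = "closed_segment (of_real a) (of_real x :: complex)"
 have S: "\<exists>y. w = of_real y \<and> a \<le> y \<and> y \<le> x" if "w \<in> ?S" for w
  using that assms unfolding closed_segment_of_real closed_segment_eq_real_ivl by auto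
 have "norm (of_real x powr s - of_real a powr s) \<le> (norm s * a powr (Re s - 1)) * norm (of_real x - of_real a :: complex)"
 proof (rule field_differentiable_bound[where S = ?S and f' = "\<lambda>w. s * w powr (s - 1)"])
  fix w assume "w \<in> ?S"
  then obtain y where y: "w = of_real y" "a \<le> y" "y \<le> x" using S by blast
  have "w \<notin> \<real>\<^sub>\<le>\<^sub>0" using y assms by (auto simp: complex_nonpos_Reals_iff)
  thus "((\<lambda>w. w powr s) has_field_derivative s * w powr (s - 1)) (at w within ?S)"
   by (intro has_field_derivative_at_within[OF has_field_derivative_powr])
  have "norm (w powr (s - 1)) = y powr (Re s - 1)" using y assms by (subst norm_powr_real_powr) auto
  also have "... \<le> a powr (Re s - 1)" using y assms by (intro powr_mono2') auto
  finally show "norm (s * w powr (s - 1)) \<le> norm s * a powr (Re s - 1)"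
   by (simp add: norm_mult mult_left_mono)
 qed auto
 thus ?thesis using assms by (simp flip: of_real_diff)
qed

text \<open>The error in replacing the decrement of \<open>n powr (- z)\<close> by its derivative.
  Since decrements telescope, sums of \<open>edif\<close> are Dirichlet series with exponent
  \<open>z + 1\<close> up to a boundary term.\<close>

definition edif :: "nat => complex => complex" where
 "edif n z = of_nat n powr (- z) - of_nat (Suc n) powr (- z) - z * of_nat n powr (- z - 1)"

lemma norm_edif_le:
 assumes "n > 0" "Re z \<ge> -2"
 shows "norm (edif n z) \<le> norm z * norm (z + 1) * real n powr (- Re z - 2)"
proof -
 define a where "a = real n"
 have a: "a > 0" using assms by (simp add: a_def)
 let ?S = "closed_segment (of_real a) (of_real (a + 1) :: complex)"
 have S: "\<exists>y. w = of_real y \<and> a \<le> y \<and> y \<le> a + 1" if "w \<in> ?S" for w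
  using that unfolding closed_segment_of_real closed_segment_eq_real_ivl by auto
 let ?c = "of_real a powr (- z - 1)"
 let ?h = "\<lambda>w. w powr (- z) + z * ?c * w"
 have "norm (?h (of_real (a + 1)) - ?h (of_real a))
   \<le> (norm z * norm (z + 1) * a powr (- Re z - 2)) * norm (of_real (a + 1) - of_real a :: complex)"
 proof (rule field_differentiable_bound[where S = ?S and f' = "\<lambda>w. (- z) * w powr (- z - 1) + z * ?c"])
  fix w assume "w \<in> ?S"
  then obtain y where y: "w = of_real y" "a \<le> y" "y \<le> a + 1" using S by blast
  have "w \<notin> \<real>\<^sub>\<le>\<^sub>0" using y a by (auto simp: complex_nonpos_Reals_iff)
  hence "((\<lambda>w. w powr (- z)) has_field_derivative (- z) * w powr (- z - 1)) (at w)"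
   by (rule has_field_derivative_powr)
  hence "(?h has_field_derivative (- z) * w powr (- z - 1) + z * ?c) (at w)"
   using DERIV_cmult_Id[of "z * ?c" w UNIV] by (rule DERIV_add)
  thus "(?h has_field_derivative (- z) * w powr (- z - 1) + z * ?c) (at w within ?S)"
   by (rule has_field_derivative_at_within)
  have "norm ((- z) * w powr (- z - 1) + z * ?c) = norm z * norm (w powr (- z - 1) - ?c)"
   by (subst norm_minus_commute) (simp add: algebra_simps flip: norm_mult)
  also have "... \<le> norm z * (norm (- z - 1) * a powr (Re (- z - 1) - 1) * (y - a))"
   unfolding y(1) using y a assms by (intro mult_left_mono norm_powr_diff_le) auto
  also have "... \<le> norm z * (norm (- z - 1) * a powr (Re (- z - 1) - 1) * 1)"
   using y by (intro mult_left_mono) auto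
  also have "norm (- z - 1) = norm (z + 1)" using norm_minus_cancel[of "z + 1"] by simp
  also have "Re (- z - 1) - 1 = - Re z - 2" by simp
  finally show "norm ((- z) * w powr (- z - 1) + z * ?c) \<le> norm z * norm (z + 1) * a powr (- Re z - 2)"
   by (simp only: mult_1_right mult.assoc)
 qed auto
 also have "norm (of_real (a + 1) - of_real a :: complex) = 1" by simp
 also have "?h (of_real (a + 1)) - ?h (of_real a) = - edif n z"
  by (simp add: edif_def a_def algebra_simps)
 finally show ?thesis by (simp add: a_def)
qed

lemma holomorphic_edif: "edif n holomorphic_on A"
proof (cases "n = 0")
 case True
 hence "edif n = (\<lambda>z. - (1 powr (- z)))" by (auto simp: edif_def fun_eq_iff)
 thus ?thesis by (simp add: holomorphic_intros)
qed (auto simp: edif_def[abs_def] intro!: holomorphic_intros)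

lemma sum_edif: "(\<Sum>n<N. edif n z) = - (of_nat N powr (- z)) - z * (\<Sum>n<N. of_nat n powr (- z - 1))"
 by (induction N) (simp_all add: edif_def algebra_simps)

text \<open>The terms \<open>edif n z\<close> are of order \<open>n powr (- Re z - 2)\<close>.\<close>

lemma holomorphic_edif_series:
 fixes c :: "nat => complex"
 assumes c: "\<And>n. n > 0 ==> norm (c n) \<le> C * real n powr b" and C: "C \<ge> 0" and b: "-1 \<le> b"
 shows "\<exists>g. g holomorphic_on {z. Re z > b - 1} \<and> (\<forall>z\<in>{z. Re z > b - 1}. (\<lambda>n. c n * edif n z) sums g z)"
proof (rule holomorphic_series)
 show "open {z. Re z > b - 1}" by (rule open_halfspace_Re_gt)
 show "(\<lambda>z. c n * edif n z) holomorphic_on {z. Re z > b - 1}" for n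
  by (intro holomorphic_intros holomorphic_edif)
 fix z0 :: complex assume z0: "z0 \<in> {z. Re z > b - 1}"
 define \<delta> where "\<delta> = (Re z0 - (b - 1)) / 2"
 have \<delta>: "\<delta> > 0" using z0 by (simp add: \<delta>_def)
 have z2: "Re z0 = b - 1 + 2 * \<delta>" by (simp add: \<delta>_def field_simps)
 define K where "K = (norm z0 + \<delta>) * (norm z0 + \<delta> + 1)"
 define h where "h n = C * K * real n powr (- 1 - \<delta>)" for n
 have "summable h" unfolding h_def using \<delta> by (intro summable_mult) (simp add: summable_real_powr_iff)
 moreover have "\<forall>\<^sub>F n in sequentially. \<forall>y\<in>ball z0 \<delta> \<inter> {z. Re z > b - 1}. norm (c n * edif n y) \<le> h n"
  using eventually_gt_at_top[of 0]
 proof eventually_elim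
  case (elim n)
  show ?case
  proof
   fix y assume y: "y \<in> ball z0 \<delta> \<inter> {z. Re z > b - 1}"
   have d: "norm (z0 - y) < \<delta>" using y by (simp add: dist_norm)
   have "Re z0 - Re y \<le> norm (z0 - y)" using complex_Re_le_cmod[of "z0 - y"] by simp
   hence re: "Re y \<ge> b - 1 + \<delta>" using d z2 by linarith
   have ny: "norm y \<le> norm z0 + \<delta>" using d norm_triangle_ineq4[of z0 "z0 - y"] by simp
   have ny1: "norm (y + 1) \<le> norm z0 + \<delta> + 1" using ny norm_triangle_ineq[of y 1] by simp
   have "norm (edif n y) \<le> norm y * norm (y + 1) * real n powr (- Re y - 2)"
    using elim re b \<delta> by (intro norm_edif_le) auto
   also have "... \<le> K * real n powr (- 1 - \<delta> - b)"
    unfolding K_def using ny ny1 re elim \<delta> by (intro mult_mono powr_mono) auto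
   finally have "norm (c n * edif n y) \<le> (C * real n powr b) * (K * real n powr (- 1 - \<delta> - b))"
    unfolding norm_mult using c elim C by (intro mult_mono) auto
   also have "... = h n" by (simp add: h_def algebra_simps flip: powr_add)
   finally show "norm (c n * edif n y) \<le> h n" .
  qed
 qed
 ultimately show "\<exists>d>0. \<exists>h. summable h \<and> (\<forall>\<^sub>F n in sequentially. \<forall>y\<in>ball z0 d \<inter> {z. Re z > b - 1}. norm (c n * edif n y) \<le> h n)"
  using \<delta> by blast
qed

lemma tendsto_nat_powr_neg:
 fixes z :: complex
 assumes "Re z > 0"
 shows "(\<lambda>N. of_nat N powr (- z)) \<longlonglongrightarrow> 0"
proof (rule tendsto_norm_zero_cancel)
 have "(\<lambda>N. real N powr (- Re z)) \<longlonglongrightarrow> 0"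
  using assms by (intro tendsto_neg_powr filterlim_real_sequentially) auto
 moreover have "norm (of_nat N powr (- z)) = real N powr (- Re z)" for N
  using norm_powr_real_powr[of "of_nat N" "- z"] by simp
 ultimately show "(\<lambda>N. norm (of_nat N powr (- z) :: complex)) \<longlonglongrightarrow> 0" by simp
qed

text \<open>\<open>(s - 1)\<close> times zeta is the sum of \<open>- edif n (s - 1)\<close>, which
  converges for \<open>Re s > 0\<close>. At \<open>s = 1\<close> all terms with \<open>n > 0\<close>
  vanish, and the term \<open>n = 0\<close> is 1 because of the convention
  \<open>0 powr 0 = 0\<close>.\<close>

lemma zeta_times_holomorphic:
 obtains W where "W holomorphic_on {s. Re s > 0}" "W 1 = 1"
  "\<And>s. Re s > 1 ==> (\<lambda>n. of_nat n powr (- s)) sums (W s / (s - 1))"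
proof -
 obtain g where g: "g holomorphic_on {z. Re z > 0 - 1}"
   "\<forall>z\<in>{z. Re z > 0 - 1}. (\<lambda>n. - 1 * edif n z) sums g z"
  using holomorphic_edif_series[of "\<lambda>_. -1" 1 0] by force
 define W where "W s = g (s - 1)" for s
 show ?thesis
 proof
  show "W holomorphic_on {s. Re s > 0}" unfolding W_def
   by (rule holomorphic_on_compose_gen[OF _ g(1), unfolded o_def]) (auto intro!: holomorphic_intros)
  have "(\<lambda>n. - edif n 0) sums g 0" using g(2) by simp
  moreover have "(\<lambda>n. - edif n 0) = (\<lambda>n. of_bool (n = 0))" by (auto simp: edif_def fun_eq_iff simp del: of_nat_Suc)
  ultimately have "(\<lambda>n. of_bool (n = 0)) sums g 0" by (simp only:)
  moreover have "(\<lambda>n::nat. of_bool (n = 0) :: complex) sums 1"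
   using sums_single[of 0 "\<lambda>_. 1 :: complex"] by (simp add: of_bool_def cong: if_cong)
  ultimately show "W 1 = 1" unfolding W_def using sums_unique2 by auto
  fix s :: complex assume s: "Re s > 1"
  have "(\<lambda>N. \<Sum>n<N. - edif n (s - 1)) \<longlonglongrightarrow> W s"
   using g(2) s by (simp add: sums_def W_def)
  moreover have "(\<lambda>N. of_nat N powr (- (s - 1))) \<longlonglongrightarrow> (0 :: complex)" using s by (intro tendsto_nat_powr_neg) auto
  ultimately have "(\<lambda>N. (\<Sum>n<N. - edif n (s - 1)) - of_nat N powr (- (s - 1))) \<longlonglongrightarrow> W s - 0"
   by (rule tendsto_diff)
  moreover have "(\<Sum>n<N. - edif n (s - 1)) - of_nat N powr (- (s - 1)) = (s - 1) * (\<Sum>n<N. of_nat n powr (- s))" for N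
   by (simp add: sum_negf sum_edif)
  ultimately have "(\<lambda>N. (s - 1) * (\<Sum>n<N. of_nat n powr (- s))) \<longlonglongrightarrow> W s" by simp
  hence "(\<lambda>N. (s - 1) * (\<Sum>n<N. of_nat n powr (- s)) / (s - 1)) \<longlonglongrightarrow> W s / (s - 1)"
   using s by (intro tendsto_divide tendsto_const) auto
  moreover have "s - 1 \<noteq> 0" using s by auto
  ultimately show "(\<lambda>n. of_nat n powr (- s)) sums (W s / (s - 1))" by (simp add: sums_def)
 qed
qed

section \<open>The Dirichlet series of the von Mangoldt function\<close>

lemma summable_ln_powr:
 assumes "a > 1"
 shows "summable (\<lambda>n. ln (real n) * real n powr (- a))"
proof (rule summable_comparison_test_ev)
 define e where "e = (a - 1) / 2"
 have e: "e > 0" using assms by (simp add: e_def)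
 show "summable (\<lambda>n. real n powr (- 1 - e) / e)"
  using e by (intro summable_divide) (simp add: summable_real_powr_iff)
 show "\<forall>\<^sub>F n in sequentially. norm (ln (real n) * real n powr (- a)) \<le> real n powr (- 1 - e) / e"
  using eventually_ge_at_top[of 1]
 proof eventually_elim
  case (elim n)
  have "ln (real n) \<le> real n powr e / e" using elim e by (intro ln_powr_bound) auto
  hence "ln (real n) * real n powr (- a) \<le> real n powr e / e * real n powr (- a)"
   by (intro mult_right_mono) auto
  also have "... = real n powr (- 1 - e) / e" by (simp add: e_def field_simps flip: powr_add)
  finally show ?case using elim by (simp add: abs_mult)
 qed
qed

lemma norm_nat_powr: "norm (of_nat n powr (s :: complex)) = real n powr Re s"
 using norm_powr_real_powr[of "of_nat n" s] by simp

lemma summable_mangoldt_powr: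
 assumes "a > 1"
 shows "summable (\<lambda>n. mangoldt n * real n powr (- a))"
proof (rule summable_comparison_test_ev[OF _ summable_ln_powr[OF assms]])
 show "\<forall>\<^sub>F n in sequentially. norm (mangoldt n * real n powr (- a)) \<le> ln (real n) * real n powr (- a)"
  using eventually_gt_at_top[of 0]
  by eventually_elim (auto simp: abs_mult intro!: mult_right_mono mangoldt_le)
qed

definition mangoldt_series :: "complex => complex" where
 "mangoldt_series s = (\<Sum>n. mangoldt n * of_nat n powr (- s))"

lemma norm_summable_mangoldt:
 assumes "Re s > 1"
 shows "summable (\<lambda>n. norm (mangoldt n * of_nat n powr (- s) :: complex))"
 using summable_mangoldt_powr[OF assms] by (simp add: norm_mult norm_nat_powr)

lemma mangoldt_series_sums:
 "Re s > 1 ==> (\<lambda>n. mangoldt n * of_nat n powr (- s)) sums mangoldt_series s"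
 unfolding mangoldt_series_def by (rule summable_sums[OF summable_norm_cancel[OF norm_summable_mangoldt]])

lemma nat_powr_mult: "(of_nat (d * k) :: complex) powr s = of_nat d powr s * of_nat k powr s"
 using powr_times_real[of "of_nat d" "of_nat k" s] by simp

text \<open>Summing the von Mangoldt function over the divisors of \<open>n\<close> gives
  \<open>ln n\<close>; absolute convergence permits regrouping the double series by
  products.\<close>

lemma mangoldt_series_mult:
 assumes s: "Re s > 1" and Z: "(\<lambda>n. of_nat n powr (- s)) sums Z"
 shows "(\<lambda>n. of_real (ln (real n)) * of_nat n powr (- s)) sums (mangoldt_series s * Z)"
proof -
 define a :: "nat => complex" where "a n = mangoldt n * of_nat n powr (- s)" for n
 define b :: "nat => complex" where "b n = of_nat n powr (- s)" for n
 have sa: "summable (\<lambda>n. norm (a n))" unfolding a_def by (rule norm_summable_mangoldt[OF s])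
 have sb: "summable (\<lambda>n. norm (b n))" unfolding b_def using s
  by (simp add: norm_nat_powr summable_real_powr_iff)
 have ha: "(a has_sum mangoldt_series s) UNIV"
  unfolding a_def by (rule norm_summable_imp_has_sum[OF sa[unfolded a_def] mangoldt_series_sums[OF s]])
 have hb: "(b has_sum Z) UNIV"
  unfolding b_def by (rule norm_summable_imp_has_sum[OF sb[unfolded b_def] Z])
 have nb: "(\<lambda>n. norm (b n)) summable_on UNIV" and na: "(\<lambda>n. norm (a n)) summable_on UNIV"
  using sa sb by (auto intro!: norm_summable_imp_summable_on)
 have "(\<lambda>x. norm (a (fst x) * b (snd x))) summable_on (UNIV \<times> UNIV)"
 proof (rule summable_on_SigmaI[where g = "\<lambda>d. norm (a d) * infsum (\<lambda>n. norm (b n)) UNIV"])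
  show "((\<lambda>y. norm (a (fst (x, y)) * b (snd (x, y)))) has_sum norm (a x) * infsum (\<lambda>n. norm (b n)) UNIV) UNIV" for x
   by (simp add: norm_mult has_sum_cmult_right nb)
  show "(\<lambda>d. norm (a d) * infsum (\<lambda>n. norm (b n)) UNIV) summable_on UNIV"
   by (intro summable_on_cmult_left na)
 qed auto
 hence "(\<lambda>x. a (fst x) * b (snd x)) summable_on (UNIV \<times> UNIV)" by (rule abs_summable_summable)
 hence "((\<lambda>x. a (fst x) * b (snd x)) has_sum (mangoldt_series s * Z)) (UNIV \<times> UNIV)"
  by (intro has_sum_SigmaI[where g = "\<lambda>d. a d * Z"]) (auto intro!: has_sum_cmult_right has_sum_cmult_left ha hb)
 also have "?this \<longleftrightarrow> ((\<lambda>x. a (fst x) * b (snd x)) has_sum (mangoldt_series s * Z)) ({0<..} \<times> {0<..})"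
  by (rule has_sum_cong_neutral) (auto simp: a_def b_def)
 also have "... \<longleftrightarrow> ((\<lambda>x. mangoldt (snd x) * of_nat (fst x) powr (- s)) has_sum (mangoldt_series s * Z))
   (SIGMA n:{0<..}. {d. d dvd n})"
 proof (rule has_sum_reindex_bij_witness[where j = "\<lambda>(d, k). (d * k, d)" and i = "\<lambda>(n, d). (d, n div d)"])
  fix x :: "nat \<times> nat" assume "x \<in> {0<..} \<times> {0<..}"
  thus "mangoldt (snd (case x of (d, k) => (d * k, d))) * of_nat (fst (case x of (d, k) => (d * k, d))) powr (- s)
    = a (fst x) * b (snd x)"
   by (simp add: a_def b_def nat_powr_mult mult.assoc split: prod.splits del: of_nat_mult)
 qed (auto elim!: dvdE)
 finally have "((\<lambda>x. mangoldt (snd x) * of_nat (fst x) powr (- s)) has_sum (mangoldt_series s * Z))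
   (SIGMA n:{0<..}. {d. d dvd n})" .
 hence "((\<lambda>n. of_real (ln (real n)) * of_nat n powr (- s)) has_sum (mangoldt_series s * Z)) {0<..}"
 proof (rule has_sum_SigmaD)
  fix n :: nat assume n: "n \<in> {0<..}"
  have "((\<lambda>y. mangoldt (snd (n, y)) * of_nat (fst (n, y)) powr (- s)) has_sum
    (\<Sum>d | d dvd n. mangoldt d * of_nat n powr (- s))) {d. d dvd n}"
   using n by (intro has_sum_finiteI) auto
  thus "((\<lambda>y. mangoldt (snd (n, y)) * of_nat (fst (n, y)) powr (- s)) has_sum
    (of_real (ln (real n)) * of_nat n powr (- s))) {d. d dvd n}"
   using n by (simp add: mangoldt_sum flip: sum_distrib_right)
 qed
 also have "?this \<longleftrightarrow> ((\<lambda>n. of_real (ln (real n)) * of_nat n powr (- s)) has_sum (mangoldt_series s * Z)) UNIV"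
  by (rule has_sum_cong_neutral) auto
 finally show ?thesis by (rule has_sum_imp_sums)
qed

lemma zeta_sum_has_derivative:
 assumes Z: "\<And>s. Re s > 1 ==> (\<lambda>n. of_nat n powr (- s)) sums Z s" and s: "Re s > 1"
 shows "(Z has_field_derivative (- (mangoldt_series s * Z s))) (at s)"
proof -
 define a where "a = (1 + Re s) / 2"
 define S where "S = {z. Re z > a}"
 have a: "a > 1" "s \<in> S" using s by (auto simp: a_def S_def)
 obtain g g' where g: "\<forall>x\<in>S. (\<lambda>n. of_nat n powr (- x)) sums g x \<and>
   (\<lambda>n. - (of_real (ln (real n)) * of_nat n powr (- x))) sums g' x \<and> (g has_field_derivative g' x) (at x)"
 proof (rule series_and_derivative_comparison)
  show "open S" unfolding S_def by (rule open_halfspace_Re_gt)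
  show "summable (\<lambda>n. real n powr (- a))" using a by (simp add: summable_real_powr_iff)
  show "\<forall>\<^sub>F n in sequentially. \<forall>x\<in>S. norm (of_nat n powr (- x) :: complex) \<le> real n powr (- a)"
   using eventually_gt_at_top[of 0]
   by eventually_elim (auto simp: norm_nat_powr S_def intro!: powr_mono)
  show "((\<lambda>x. of_nat n powr (- x)) has_field_derivative - (of_real (ln (real n)) * of_nat n powr (- x))) (at x)"
   for n and x :: complex
  proof (cases "n = 0")
   case False
   have "((\<lambda>x. of_nat n powr (- x)) has_field_derivative (Ln (of_nat n) * of_nat n powr (- x)) * (- 1)) (at x)"
    by (rule DERIV_chain2[OF has_field_derivative_powr_right]) (use False in \<open>auto intro!: derivative_eq_intros\<close>)
   thus ?thesis using False by (simp add: Ln_of_nat)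
  qed auto
 qed
 have "(\<lambda>n. - (of_real (ln (real n)) * of_nat n powr (- s))) sums - (mangoldt_series s * Z s)"
  by (intro sums_minus mangoldt_series_mult s Z)
 hence "g' s = - (mangoldt_series s * Z s)" using g a sums_unique2 by blast
 moreover have "(g has_field_derivative g' s) (at s)" using g a by blast
 ultimately have D: "(g has_field_derivative (- (mangoldt_series s * Z s))) (at s)" by simp
 have opS: "open S" unfolding S_def by (rule open_halfspace_Re_gt)
 have "g x = Z x" if x: "x \<in> S" for x
 proof (rule sums_unique2)
  show "(\<lambda>n. of_nat n powr (- x)) sums g x" using g x by blast
  show "(\<lambda>n. of_nat n powr (- x)) sums Z x" using x a(1) by (intro Z) (auto simp: S_def)
 qed
 thus ?thesis by (rule has_field_derivative_transform_within_open[OF D opS a(2)])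
qed

text \<open>The logarithmic derivative of \<open>(s - 1)\<close> times zeta, kept multiplied by
  \<open>W s\<close> so that it makes sense at possible zeros.\<close>

lemma zeta_log_derivative:
 assumes W: "W holomorphic_on {s. Re s > 0}"
  and sums: "\<And>s. Re s > 1 ==> (\<lambda>n. of_nat n powr (- s)) sums (W s / (s - 1))" and s: "Re s > 1"
 shows "deriv W s = W s * (1 / (s - 1) - mangoldt_series s)"
proof -
 have "(W has_field_derivative deriv W s) (at s)"
  using s by (intro holomorphic_derivI[OF W] open_halfspace_Re_gt) auto
 hence "((\<lambda>s. W s / (s - 1)) has_field_derivative (deriv W s * (s - 1) - W s * 1) / ((s - 1) * (s - 1))) (at s)"
  using s by (intro DERIV_divide derivative_eq_intros) auto
 moreover have "((\<lambda>s. W s / (s - 1)) has_field_derivative (- (mangoldt_series s * (W s / (s - 1))))) (at s)"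
  by (rule zeta_sum_has_derivative[OF sums s])
 ultimately have e: "(deriv W s * (s - 1) - W s * 1) / ((s - 1) * (s - 1)) = - (mangoldt_series s * (W s / (s - 1)))"
  by (rule DERIV_unique)
 define u where "u = s - 1"
 have u: "u \<noteq> 0" using s by (auto simp: u_def)
 from e have "(deriv W s * u - W s * 1) / (u * u) = - (mangoldt_series s * (W s / u))" by (simp only: u_def)
 hence "u * (u * deriv W s + u * (mangoldt_series s * W s)) = u * W s"
  using u by (simp add: field_simps)
 hence "u * deriv W s + u * (mangoldt_series s * W s) = W s" using u by (simp only: mult_cancel_left) simp
 hence "deriv W s = W s * (1 / u - mangoldt_series s)" using u by (simp add: field_simps)
 thus ?thesis by (simp only: u_def)
qed

text \<open>From \<open>W w = g w * (w - z)^m\<close> with \<open>g\<close> free of zeros, the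
  logarithmic derivative behaves like \<open>m / (w - z)\<close> near \<open>z\<close>.\<close>

lemma zero_order_limit:
 assumes W: "W holomorphic_on S" and S: "open S" "connected S" "z \<in> S" and nz: "\<exists>w\<in>S. W w \<noteq> 0"
 obtains m :: nat where "W z = 0 \<longleftrightarrow> m > 0" "\<forall>\<^sub>F h in at_right 0. W (z + of_real h) \<noteq> 0"
  "((\<lambda>h. of_real h * (deriv W (z + of_real h) / W (z + of_real h))) \<longlongrightarrow> of_nat m) (at_right 0)"
proof -
 define g where "g = zor_poly W z"
 define m where "m = nat (zorder W z)"
 obtain r where r: "r > 0" "cball z r \<subseteq> S" "g holomorphic_on cball z r"
   "\<And>w. w \<in> cball z r ==> W w = g w * (w - z) ^ m \<and> g w \<noteq> 0"
  and m: "if W z = 0 then zorder W z > 0 else zorder W z = 0"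
  using zorder_exist_zero[OF W S nz] unfolding g_def m_def by blast
 have gh: "g holomorphic_on ball z r" using r(3) ball_subset_cball by (rule holomorphic_on_subset)
 have in_ball: "\<forall>\<^sub>F h in at_right 0. h > 0 \<and> h < r"
  using eventually_at_right_real[OF r(1)] by eventually_elim auto
 have lim: "(of_real h :: complex) * (deriv W (z + of_real h) / W (z + of_real h))
   = of_real h * (deriv g (z + of_real h) / g (z + of_real h)) + of_nat m" if e: "h > 0" "h < r" for h
 proof -
  define w where "w = z + of_real h"
  have w: "w \<in> ball z r" using e by (simp add: w_def dist_norm)
  have "(g has_field_derivative deriv g w) (at w)" using gh w by (intro holomorphic_derivI) auto
  moreover have "((\<lambda>w. (w - z) ^ m) has_field_derivative (of_nat m * (w - z) ^ (m - 1))) (at w)"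
   by (auto intro!: derivative_eq_intros)
  ultimately have "((\<lambda>w. g w * (w - z) ^ m) has_field_derivative deriv g w * (w - z) ^ m + (of_nat m * (w - z) ^ (m - 1)) * g w) (at w)"
   by (rule DERIV_mult)
  hence "(W has_field_derivative deriv g w * (w - z) ^ m + (of_nat m * (w - z) ^ (m - 1)) * g w) (at w)"
   by (rule has_field_derivative_transform_within_open[of _ _ _ "ball z r"]) (use w r(4) in auto)
  hence d: "deriv W w = deriv g w * (w - z) ^ m + (of_nat m * (w - z) ^ (m - 1)) * g w" by (rule DERIV_imp_deriv)
  have Ww: "W w = g w * (w - z) ^ m" "g w \<noteq> 0" using r(4)[of w] w by auto
  have wz: "w - z = of_real h" "(of_real h :: complex) \<noteq> 0" using e by (auto simp: w_def)
  have pw: "of_real h * (of_nat m * of_real h ^ (m - 1)) = (of_nat m * of_real h ^ m :: complex)"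
   by (cases m) auto
  have "of_real h * deriv W w = of_real h * deriv g w * of_real h ^ m + (of_real h * (of_nat m * of_real h ^ (m - 1))) * g w"
   unfolding d wz by (simp add: algebra_simps)
  hence "of_real h * deriv W w = (of_real h * deriv g w + of_nat m * g w) * of_real h ^ m"
   unfolding pw by (simp add: algebra_simps)
  hence "of_real h * (deriv W w / W w) = of_real h * (deriv g w / g w) + of_nat m"
   using Ww(2) wz(2) unfolding Ww(1) wz(1) by (simp add: field_simps)
  thus ?thesis by (simp only: w_def)
 qed
 show ?thesis
 proof (rule that[of m])
  show "W z = 0 \<longleftrightarrow> m > 0" using m by (auto simp: m_def split: if_splits)
  show "\<forall>\<^sub>F h in at_right 0. W (z + of_real h) \<noteq> 0"
   using in_ball
  proof eventually_elim
   case (elim h)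
   thus ?case using r(4)[of "z + of_real h"] by (simp add: dist_norm)
  qed
  have tz: "((\<lambda>h. z + of_real h) \<longlongrightarrow> z + of_real 0) (at_right 0)" by (intro tendsto_intros)
  have "isCont g z" using gh r(1) by (metis centre_in_ball continuous_on_eq_continuous_at holomorphic_on_imp_continuous_on open_ball)
  hence "((\<lambda>h. g (z + of_real h)) \<longlongrightarrow> g z) (at_right 0)"
   using isCont_tendsto_compose[of z g, OF _ tz[simplified]] by simp
  moreover have "isCont (deriv g) z" using holomorphic_deriv[OF gh open_ball] r(1)
   by (metis centre_in_ball continuous_on_eq_continuous_at holomorphic_on_imp_continuous_on open_ball)
  hence "((\<lambda>h. deriv g (z + of_real h)) \<longlongrightarrow> deriv g z) (at_right 0)"
   using isCont_tendsto_compose[of z "deriv g", OF _ tz[simplified]] by simp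
  moreover have "g z \<noteq> 0" using r(4)[of z] r(1) by auto
  moreover have "((\<lambda>h. of_real h :: complex) \<longlongrightarrow> of_real 0) (at_right 0)" by (intro tendsto_intros)
  ultimately have "((\<lambda>h. of_real h * (deriv g (z + of_real h) / g (z + of_real h)) + of_nat m)
    \<longlongrightarrow> of_real 0 * (deriv g z / g z) + of_nat m) (at_right 0)"
   by (intro tendsto_intros)
  hence "((\<lambda>h. of_real h * (deriv g (z + of_real h) / g (z + of_real h)) + of_nat m) \<longlongrightarrow> of_nat m) (at_right 0)"
   by simp
  moreover have "\<forall>\<^sub>F h in at_right 0. of_real h * (deriv g (z + of_real h) / g (z + of_real h)) + of_nat m
    = of_real h * (deriv W (z + of_real h) / W (z + of_real h))"
   using in_ball
  proof eventually_elim
   case (elim h)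
   thus ?case using lim[of h] by simp
  qed
  ultimately show "((\<lambda>h. of_real h * (deriv W (z + of_real h) / W (z + of_real h))) \<longlongrightarrow> of_nat m) (at_right 0)"
   by (rule Lim_transform_eventually)
 qed
qed

text \<open>The inequality \<open>3 + 4 cos \<theta> + cos (2 \<theta>) = 2 (1 + cos \<theta>)^2 \<ge> 0\<close>.\<close>

lemma mangoldt_series_341:
 assumes "\<sigma> > 1"
 shows "3 * Re (mangoldt_series (Complex \<sigma> 0)) + 4 * Re (mangoldt_series (Complex \<sigma> t))
  + Re (mangoldt_series (Complex \<sigma> (2 * t))) \<ge> 0"
proof -
 have e: "Re (mangoldt n * of_nat n powr (- Complex \<sigma> u)) = mangoldt n * real n powr (- \<sigma>) * cos (u * ln (real n))" for n u
 proof (cases "n = 0")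
  case False
  have "of_nat n powr (- Complex \<sigma> u) = exp (of_real (- \<sigma> * ln (real n))) * cis (- (u * ln (real n)))"
   using False by (simp add: powr_def Ln_of_nat cis_conv_exp complex_eq_iff Re_exp Im_exp flip: exp_add)
  also have "exp (of_real (- \<sigma> * ln (real n)) :: complex) = of_real (real n powr (- \<sigma>))"
   using False by (simp only: exp_of_real powr_def) simp
  finally have "of_nat n powr (- Complex \<sigma> u) = of_real (real n powr (- \<sigma>)) * cis (- (u * ln (real n)))" .
  thus ?thesis by simp
 qed auto
 have s: "(\<lambda>n. mangoldt n * real n powr (- \<sigma>) * cos (u * ln (real n))) sums Re (mangoldt_series (Complex \<sigma> u))" for u
  using sums_Re[OF mangoldt_series_sums[of "Complex \<sigma> u"]] assms by (simp only: e) simp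
 let ?g = "\<lambda>n. 3 * (mangoldt n * real n powr (- \<sigma>) * cos (0 * ln (real n))) + 4 * (mangoldt n * real n powr (- \<sigma>) * cos (t * ln (real n)))
   + mangoldt n * real n powr (- \<sigma>) * cos ((2 * t) * ln (real n))"
 have "?g sums
   (3 * Re (mangoldt_series (Complex \<sigma> 0)) + 4 * Re (mangoldt_series (Complex \<sigma> t))
  + Re (mangoldt_series (Complex \<sigma> (2 * t))))"
  by (intro sums_add sums_mult s)
 moreover have "?g n \<ge> 0" for n
 proof -
  define x where "x = t * ln (real n)"
  have h: "cos ((2 * t) * ln (real n)) = 2 * cos x ^ 2 - 1" using cos_double_cos[of x] by (simp add: x_def mult.assoc)
  have "?g n
   = mangoldt n * real n powr (- \<sigma>) * (2 * (1 + cos x) ^ 2)"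
   unfolding h unfolding x_def[symmetric] by (simp add: power2_eq_square algebra_simps)
  also have "... \<ge> 0" by (intro mult_nonneg_nonneg mangoldt_nonneg) auto
  finally show ?thesis .
 qed
 ultimately show ?thesis by (rule sums_le[OF _ sums_zero, rotated])
qed

text \<open>As \<open>h\<close> tends to 0 from the right,
  \<open>h * Re (mangoldt_series (z + h))\<close> tends to \<open>[z = 1] - m\<close>, with
  \<open>m\<close> the order of vanishing of \<open>W\<close> at \<open>z\<close>. At a zero of
  order \<open>m2\<close> the 3-4-1 inequality would therefore give
  \<open>3 - 4 * m2 >= 0\<close>.\<close>

lemma zeta_nonzero:
 assumes W: "W holomorphic_on {s. Re s > 0}" "W 1 = 1"
  and sums: "\<And>s. Re s > 1 ==> (\<lambda>n. of_nat n powr (- s)) sums (W s / (s - 1))" and s: "Re s \<ge> 1"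
 shows "W s \<noteq> 0"
proof
 assume Ws: "W s = 0"
 have s1: "s \<noteq> 1" using Ws W(2) by auto
 have opS: "open {s. Re s > 0}" by (rule open_halfspace_Re_gt)
 have cS: "connected {s. Re s > 0}" by (intro convex_connected convex_halfspace_Re_gt)
 have nz: "\<exists>w\<in>{s. Re s > 0}. W w \<noteq> 0" using W(2) by (intro bexI[of _ 1]) auto
 have L: "\<exists>m::nat. (W z = 0 \<longleftrightarrow> m > 0) \<and>
   ((\<lambda>h. h * Re (mangoldt_series (z + of_real h))) \<longlongrightarrow> of_bool (z = 1) - real m) (at_right 0)"
  if z: "Re z \<ge> 1" for z
 proof -
  have zS: "z \<in> {s. Re s > 0}" using z by simp
  obtain m :: nat where m: "W z = 0 \<longleftrightarrow> m > 0" "\<forall>\<^sub>F h in at_right 0. W (z + of_real h) \<noteq> 0"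
   "((\<lambda>h. of_real h * (deriv W (z + of_real h) / W (z + of_real h))) \<longlongrightarrow> of_nat m) (at_right 0)"
   using zero_order_limit[OF W(1) opS cS zS nz] by blast
  have l1: "((\<lambda>h. of_real h / (z + of_real h - 1)) \<longlongrightarrow> of_bool (z = 1)) (at_right 0)"
  proof (cases "z = 1")
   case True
   have "((\<lambda>h::real. 1 :: complex) \<longlongrightarrow> 1) (at_right 0)" by simp
   moreover have "\<forall>\<^sub>F h in at_right (0::real). 1 = (of_real h / (z + of_real h - 1) :: complex)"
    using eventually_at_right_less[of "0::real"] by eventually_elim (simp add: True)
   ultimately have "((\<lambda>h. of_real h / (z + of_real h - 1)) \<longlongrightarrow> 1) (at_right 0)"
    by (rule Lim_transform_eventually)
   thus ?thesis using True by simp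
  next
   case False
   have "((\<lambda>h. of_real h / (z + of_real h - 1)) \<longlongrightarrow> of_real 0 / (z + of_real 0 - 1)) (at_right 0)"
    using False by (intro tendsto_intros) auto
   thus ?thesis using False by simp
  qed
  have "((\<lambda>h. of_real h / (z + of_real h - 1) - of_real h * (deriv W (z + of_real h) / W (z + of_real h)))
    \<longlongrightarrow> of_bool (z = 1) - of_nat m) (at_right 0)"
   by (intro tendsto_diff l1 m(3))
  moreover have "\<forall>\<^sub>F h in at_right 0. of_real h / (z + of_real h - 1) - of_real h * (deriv W (z + of_real h) / W (z + of_real h))
    = of_real h * mangoldt_series (z + of_real h)"
   using m(2) eventually_at_right_less[of "0::real"]
  proof eventually_elim
   case (elim h)
   have "Re (z + of_real h) > 1" using z elim by simp
   from zeta_log_derivative[OF W(1) sums this]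
   have "deriv W (z + of_real h) / W (z + of_real h) = 1 / (z + of_real h - 1) - mangoldt_series (z + of_real h)"
    using elim by simp
   thus ?case by (simp only: right_diff_distrib) simp
  qed
  ultimately have "((\<lambda>h. of_real h * mangoldt_series (z + of_real h)) \<longlongrightarrow> of_bool (z = 1) - of_nat m) (at_right 0)"
   by (rule Lim_transform_eventually)
  from tendsto_Re[OF this] have "((\<lambda>h. h * Re (mangoldt_series (z + of_real h))) \<longlongrightarrow> of_bool (z = 1) - real m) (at_right 0)"
   by (simp add: of_bool_def split: if_splits)
  with m(1) show ?thesis by blast
 qed
 define \<sigma> where "\<sigma> = Re s"
 define t where "t = Im s"
 have s': "s = Complex \<sigma> t" by (simp add: \<sigma>_def t_def)
 obtain m1 :: nat where m1: "W (Complex \<sigma> 0) = 0 \<longleftrightarrow> m1 > 0"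
  "((\<lambda>h. h * Re (mangoldt_series (Complex \<sigma> 0 + of_real h))) \<longlongrightarrow> of_bool (Complex \<sigma> 0 = 1) - real m1) (at_right 0)"
  using L[of "Complex \<sigma> 0"] s by (auto simp: \<sigma>_def)
 obtain m2 :: nat where m2: "W s = 0 \<longleftrightarrow> m2 > 0"
  "((\<lambda>h. h * Re (mangoldt_series (s + of_real h))) \<longlongrightarrow> of_bool (s = 1) - real m2) (at_right 0)"
  using L[of s] s by blast
 obtain m3 :: nat where m3:
  "((\<lambda>h. h * Re (mangoldt_series (Complex \<sigma> (2 * t) + of_real h))) \<longlongrightarrow> of_bool (Complex \<sigma> (2 * t) = 1) - real m3) (at_right 0)"
  using L[of "Complex \<sigma> (2 * t)"] s by (auto simp: \<sigma>_def)
 let ?g = "\<lambda>h. 3 * (h * Re (mangoldt_series (Complex \<sigma> 0 + of_real h))) + 4 * (h * Re (mangoldt_series (s + of_real h)))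
   + h * Re (mangoldt_series (Complex \<sigma> (2 * t) + of_real h))"
  and ?l = "3 * (of_bool (Complex \<sigma> 0 = 1) - real m1) + 4 * (of_bool (s = 1) - real m2) + (of_bool (Complex \<sigma> (2 * t) = 1) - real m3)"
 have "(?g \<longlongrightarrow>
   ?l) (at_right 0)"
  by (intro tendsto_intros m1(2) m2(2) m3)
 moreover have "\<forall>\<^sub>F h in at_right 0. ?g h \<ge> 0"
  using eventually_at_right_less[of "0::real"]
 proof eventually_elim
  case (elim h)
  have c: "Complex \<sigma> u + of_real h = Complex (\<sigma> + h) u" for u by (simp add: complex_eq_iff)
  have "h * (3 * Re (mangoldt_series (Complex (\<sigma> + h) 0)) + 4 * Re (mangoldt_series (Complex (\<sigma> + h) t))
   + Re (mangoldt_series (Complex (\<sigma> + h) (2 * t)))) \<ge> 0"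
   using elim s by (intro mult_nonneg_nonneg mangoldt_series_341) (auto simp: \<sigma>_def)
  thus ?case unfolding s' c by (simp add: algebra_simps)
 qed
 ultimately have pos: "?l \<ge> 0"
  by (rule tendsto_lowerbound) simp
 have "m2 \<ge> 1" using Ws m2(1) by simp
 moreover have "Complex \<sigma> (2 * t) \<noteq> 1" using s1 unfolding s' by (auto simp: complex_eq_iff)
 ultimately show False using pos s1 by (cases "Complex \<sigma> 0 = 1") auto
qed

section \<open>Chebyshev's bound\<close>

definition psi :: "nat => real" where "psi n = (\<Sum>m\<le>n. mangoldt m)"

lemma psi_mono: "m \<le> n ==> psi m \<le> psi n"
 unfolding psi_def by (intro sum_mono2 mangoldt_nonneg) auto

lemma psi_nonneg: "psi n \<ge> 0"
 unfolding psi_def by (intro sum_nonneg mangoldt_nonneg)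

lemma ln_fact_mangoldt: "ln (fact n) = (\<Sum>m\<le>n. mangoldt m * real (n div m))"
proof (induction n)
 case (Suc n)
 have "(\<Sum>m\<le>Suc n. mangoldt m * real (Suc n div m)) =
   (\<Sum>m\<le>Suc n. mangoldt m * real (n div m) + (if m dvd Suc n then mangoldt m else 0))"
  by (intro sum.cong refl) (auto simp: div_Suc algebra_simps mod_eq_0_iff_dvd)
 also have "... = (\<Sum>m\<le>Suc n. mangoldt m * real (n div m)) + (\<Sum>m\<in>{m. m \<le> Suc n \<and> m dvd Suc n}. mangoldt m)"
  by (subst sum.distrib, subst sum.inter_filter[symmetric]) (auto simp: atMost_def)
 also have "{m. m \<le> Suc n \<and> m dvd Suc n} = {m. m dvd Suc n}" by (auto dest: dvd_imp_le)
 also have "(\<Sum>m\<in>.... mangoldt m) = ln (real (Suc n))" using mangoldt_sum[of "Suc n", where ?'a = real] by simp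
 also have "(\<Sum>m\<le>Suc n. mangoldt m * real (n div m)) = (\<Sum>m\<le>n. mangoldt m * real (n div m))" by simp
 finally show ?case using Suc.IH by (simp add: ln_mult)
qed simp

text \<open>In the logarithm of \<open>C(2 n, n) <= 4^n\<close>, prime powers between
  \<open>n\<close> and \<open>2 n\<close> have weight 1, and all others have nonnegative
  weight.\<close>

lemma psi_double: "psi (2 * n) \<le> psi n + 2 * real n"
proof -
 let ?d = "\<lambda>m. real (2 * n div m) - 2 * real (n div m)"
 have "(2 * n choose n) \<le> (2::nat) ^ (2 * n)"
  using member_le_sum[of n "{..2 * n}" "\<lambda>k. 2 * n choose k"] by (simp add: choose_row_sum)
 hence c: "real (2 * n choose n) \<le> 2 ^ (2 * n)" by (metis of_nat_le_iff of_nat_numeral of_nat_power)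
 have "(fact (2 * n) :: real) = fact n * fact n * real (2 * n choose n)"
  using binomial_fact_lemma[of n "2 * n"] by (metis (mono_tags, lifting) add_diff_cancel_left' le_add1 mult_2 of_nat_fact of_nat_mult)
 hence "ln (fact (2 * n)) = ln (fact n) + ln (fact n) + ln (real (2 * n choose n))"
  by (simp add: ln_mult)
 moreover have "ln (real (2 * n choose n)) \<le> 2 * real n"
 proof -
  have "ln (real (2 * n choose n)) \<le> ln (2 ^ (2 * n))" using c by (subst ln_le_cancel_iff) auto
  also have "... = 2 * real n * ln 2" by (simp add: ln_realpow)
  also have "... \<le> 2 * real n * 1" using ln_2_less_1 by (intro mult_left_mono) auto
  finally show ?thesis by simp
 qed
 moreover have "ln (fact n) = (\<Sum>m\<le>2 * n. mangoldt m * real (n div m))"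
  unfolding ln_fact_mangoldt by (rule sum.mono_neutral_left) auto
 ultimately have "(\<Sum>m\<le>2 * n. mangoldt m * real (2 * n div m)) \<le> 2 * (\<Sum>m\<le>2 * n. mangoldt m * real (n div m)) + 2 * real n"
  by (simp add: ln_fact_mangoldt)
 hence "(\<Sum>m\<le>2 * n. mangoldt m * ?d m) \<le> 2 * real n"
  by (simp add: right_diff_distrib sum_subtractf sum_distrib_left mult_ac)
 moreover have "psi (2 * n) - psi n \<le> (\<Sum>m\<le>2 * n. mangoldt m * ?d m)"
 proof -
  have "psi (2 * n) - psi n = (\<Sum>m\<in>{..2 * n} - {..n}. mangoldt m)"
   unfolding psi_def by (subst sum_diff) auto
  also have "... = (\<Sum>m\<in>{..2 * n} - {..n}. mangoldt m * ?d m)"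
  proof (rule sum.cong[OF refl])
   fix m assume m: "m \<in> {..2 * n} - {..n}"
   have "2 * n div m = 1" using m by (intro div_nat_eqI) auto
   moreover have "n div m = 0" using m by simp
   ultimately show "mangoldt m = mangoldt m * ?d m" by simp
  qed
  also have "... \<le> (\<Sum>m\<le>2 * n. mangoldt m * ?d m)"
  proof (rule sum_mono2)
   fix m
   have "2 * (n div m) * m \<le> 2 * n" by (simp add: mult.assoc)
   hence "2 * (n div m) \<le> 2 * n div m"
    by (cases "m = 0") (simp_all add: less_eq_div_iff_mult_less_eq)
   hence "real (2 * (n div m)) \<le> real (2 * n div m)" by (simp only: of_nat_le_iff)
   hence "real (2 * n div m) - 2 * real (n div m) \<ge> 0" by simp
   thus "0 \<le> mangoldt m * ?d m"
    by (intro mult_nonneg_nonneg mangoldt_nonneg) auto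
  qed auto
  finally show ?thesis .
 qed
 ultimately show ?thesis by linarith
qed

lemma psi_le: "psi n \<le> 4 * real n"
proof (induction n rule: less_induct)
 case (less n)
 show ?case
 proof (cases "n \<le> 1")
  case True
  have "psi n \<le> psi 1" using True by (rule psi_mono)
  also have "psi 1 = 0" by (simp add: psi_def)
  finally show ?thesis by simp
 next
  case False
  define k where "k = (n + 1) div 2"
  \<comment> \<open>For \<open>n >= 2\<close> the rounded-up half satisfies
    \<open>3 k <= 2 n\<close>, which turns the bound \<open>6 k\<close> into
    \<open>4 n\<close>.\<close>
  have k: "n \<le> 2 * k" "k < n" "2 * k \<le> n + 1" "3 * k \<le> 2 * n" using False by (auto simp: k_def)
  have "psi n \<le> psi (2 * k)" using k(1) by (rule psi_mono)
  also have "... \<le> psi k + 2 * real k" by (rule psi_double)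
  also have "... \<le> 6 * real k" using less.IH[OF k(2)] by simp
  also have "... \<le> 4 * real n" using k(4) by linarith
  finally show ?thesis .
 qed
qed

lemma sum_psi_by_parts:
 fixes a :: "nat => complex"
 shows "(\<Sum>n<N. of_real (psi n) * (a n - a (Suc n))) = (\<Sum>n<N. mangoldt n * a n) - of_real (\<Sum>n<N. mangoldt n) * a N"
proof (induction N)
 case (Suc N)
 have "psi N = (\<Sum>n<N. mangoldt n) + mangoldt N" by (simp add: psi_def flip: lessThan_Suc_atMost)
 thus ?case using Suc.IH by (simp add: algebra_simps)
qed simp

text \<open>Summation by parts; Chebyshev's bound makes the boundary term vanish for
  \<open>Re z > 1\<close>.\<close>

lemma psi_series_sums:
 assumes z: "Re z > 1"
 shows "(\<lambda>n. of_real (psi n) * (of_nat n powr (- z) - of_nat (Suc n) powr (- z))) sums mangoldt_series z"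
proof -
 have "(\<lambda>N. of_real (\<Sum>n<N. mangoldt n) * of_nat N powr (- z)) \<longlonglongrightarrow> (0 :: complex)"
 proof (rule Lim_null_comparison)
  show "\<forall>\<^sub>F N in sequentially. norm (of_real (\<Sum>n<N. mangoldt n) * of_nat N powr (- z) :: complex) \<le> 4 * real N powr (1 - Re z)"
   using eventually_gt_at_top[of 0]
  proof eventually_elim
   case (elim N)
   have "\<bar>\<Sum>n<N. mangoldt n\<bar> = (\<Sum>n<N. mangoldt n :: real)" by (simp add: sum_nonneg mangoldt_nonneg)
   also have "... \<le> psi N" unfolding psi_def by (intro sum_mono2 mangoldt_nonneg) auto
   also have "... \<le> 4 * real N" by (rule psi_le)
   finally have "norm (of_real (\<Sum>n<N. mangoldt n) * of_nat N powr (- z) :: complex) \<le> 4 * real N * real N powr (- Re z)"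
    unfolding norm_mult norm_of_real norm_nat_powr by (simp add: mult_right_mono)
   also have "... = 4 * real N powr (1 - Re z)" using elim by (simp add: powr_diff powr_minus field_simps)
   finally show ?case .
  qed
  have "(\<lambda>N. 4 * real N powr (1 - Re z)) \<longlonglongrightarrow> 4 * 0"
   using z by (intro tendsto_mult tendsto_const tendsto_neg_powr filterlim_real_sequentially) auto
  thus "(\<lambda>N. 4 * real N powr (1 - Re z)) \<longlonglongrightarrow> 0" by simp
 qed
 with mangoldt_series_sums[OF z] have "(\<lambda>N. (\<Sum>n<N. mangoldt n * of_nat n powr (- z)) - of_real (\<Sum>n<N. mangoldt n) * of_nat N powr (- z))
   \<longlonglongrightarrow> mangoldt_series z - 0"
  unfolding sums_def by (rule tendsto_diff)
 thus ?thesis unfolding sums_def sum_psi_by_parts[where a = "\<lambda>n. of_nat n powr (- z)"] by simp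
qed

text \<open>Up to a series converging for \<open>Re z > 0\<close>, the Dirichlet series of \<open>psi n / n - 1\<close> is
 \<open>mangoldt_series z / z\<close> minus the zeta function; the poles at \<open>1\<close> cancel.\<close>

lemma psi_error_continuation:
 obtains g U where "open U" "g holomorphic_on U" "{z. Re z \<ge> 1} \<subseteq> U"
  "\<And>z. Re z > 1 ==> (\<lambda>n. of_real (psi n / real n - 1) * of_nat n powr (- z)) sums g z"
proof -
 obtain W where W: "W holomorphic_on {s. Re s > 0}" "W 1 = 1"
  "\<And>s. Re s > 1 ==> (\<lambda>n. of_nat n powr (- s)) sums (W s / (s - 1))"
  by (rule zeta_times_holomorphic) blast
 have "norm (of_real (psi n) :: complex) \<le> 4 * real n powr 1" if "n > 0" for n
  using psi_le[of n] psi_nonneg[of n] that by simp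
 hence "\<exists>E. E holomorphic_on {z. Re z > 1 - 1} \<and> (\<forall>z\<in>{z. Re z > 1 - 1}. (\<lambda>n. of_real (psi n) * edif n z) sums E z)"
  by (intro holomorphic_edif_series[where C = 4]) auto
 then obtain E where E: "E holomorphic_on {z. Re z > 0}" "\<And>z. Re z > 0 ==> (\<lambda>n. of_real (psi n) * edif n z) sums E z"
  by auto
 \<comment> \<open>The difference quotient of \<open>W\<close> at 1, that is zeta minus
   \<open>1 / (z - 1)\<close> with the singularity removed, since \<open>W 1 = 1\<close>.\<close>
 define Q where "Q z = (if z = 1 then deriv W 1 else (W z - W 1) / (z - 1))" for z
 define g where "g z = - Q z - 1 / z - (deriv W z / W z + E z) / z" for z
 define U where "U = {z. Re z > 0} \<inter> {z. W z \<noteq> 0}"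
 have opS: "open {z. Re z > 0}" by (rule open_halfspace_Re_gt)
 show ?thesis
 proof
  have "open ({z. Re z > 0} \<inter> W -` (- {0}))"
   using holomorphic_on_imp_continuous_on[OF W(1)] opS by (rule continuous_open_preimage) auto
  thus opU: "open U" by (simp add: U_def vimage_def)
  have sub: "U \<subseteq> {z. Re z > 0}" by (auto simp: U_def)
  have "Q holomorphic_on {z. Re z > 0}" unfolding Q_def[abs_def] by (rule pole_lemma_open[OF W(1) opS])
  hence h: "Q holomorphic_on U" "deriv W holomorphic_on U" "W holomorphic_on U" "E holomorphic_on U"
   using holomorphic_deriv[OF W(1) opS] W(1) E(1) sub by (auto intro: holomorphic_on_subset)
  show "g holomorphic_on U" unfolding g_def[abs_def]
   by (intro holomorphic_on_diff holomorphic_on_minus holomorphic_on_divide holomorphic_on_add holomorphic_on_const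
     holomorphic_on_ident h) (auto simp: U_def)
  show "{z. Re z \<ge> 1} \<subseteq> U" using zeta_nonzero[OF W] by (auto simp: U_def)
  fix z :: complex assume z: "Re z > 1"
  have z0: "z \<noteq> 0" "z \<noteq> 1" using z by auto
  have "(\<lambda>n. (of_real (psi n) * (of_nat n powr (- z) - of_nat (Suc n) powr (- z)) - of_real (psi n) * edif n z) / z - of_nat n powr (- z))
    sums ((mangoldt_series z - E z) / z - W z / (z - 1))"
   using z by (intro sums_diff sums_divide psi_series_sums E(2) W(3)) auto
  moreover have "(of_real (psi n) * (of_nat n powr (- z) - of_nat (Suc n) powr (- z)) - of_real (psi n) * edif n z) / z - of_nat n powr (- z)
   = of_real (psi n / real n - 1) * of_nat n powr (- z)" for n
  proof (cases "n = 0")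
   case False
   have "of_nat n powr (- z - 1) = of_nat n powr (- z) / (of_nat n :: complex)"
    using False by (simp add: powr_diff)
   thus ?thesis using z0 False by (simp add: edif_def field_simps)
  qed (simp add: psi_def)
  moreover have "(mangoldt_series z - E z) / z - W z / (z - 1) = g z"
  proof -
   have "W z \<noteq> 0" using zeta_nonzero[OF W] z by auto
   hence m: "deriv W z / W z = 1 / (z - 1) - mangoldt_series z" using zeta_log_derivative[OF W(1,3) z] by simp
   define u where "u = z - 1"
   have u: "u \<noteq> 0" "z = u + 1" using z0 by (auto simp: u_def)
   have "g z = - ((W z - 1) / u) - 1 / z - (1 / u - mangoldt_series z + E z) / z"
    unfolding g_def m using z0 W(2) by (simp add: Q_def u_def)
   also have "1 / u - mangoldt_series z + E z = 1 / u - (mangoldt_series z - E z)" by simp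
   also have "- ((W z - 1) / u) - 1 / z - (1 / u - (mangoldt_series z - E z)) / z
     = (mangoldt_series z - E z) / z - W z / u + (1 / u - 1 / z - 1 / u / z)"
    by (simp add: diff_divide_distrib)
   also have "1 / u - 1 / z - 1 / u / z = 0" using u(1) z0(1) by (simp add: divide_simps) (simp add: u_def)
   finally show ?thesis by (simp add: u_def)
  qed
  ultimately show "(\<lambda>n. of_real (psi n / real n - 1) * of_nat n powr (- z)) sums g z" by simp
 qed
qed

section \<open>Newman's contour argument\<close>

lemma powr_mvt:
 fixes a p :: real
 assumes "a > 0"
 obtains \<xi> where "a < \<xi>" "\<xi> < a + 1" "(a + 1) powr p - a powr p = p * \<xi> powr (p - 1)"
proof -
 have "\<exists>\<xi>>a. \<xi> < a + 1 \<and> (a + 1) powr p - a powr p = (a + 1 - a) * (p * \<xi> powr (p - 1))"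
  by (rule MVT2) (use assms in \<open>auto intro!: derivative_eq_intros\<close>)
 thus ?thesis using that by auto
qed

text \<open>Comparison with the integral of \<open>x powr (u - 1)\<close>, whose monotonicity
  changes at \<open>u = 1\<close>. For \<open>u > 1\<close> the last term protrudes, and
  \<open>u <= N\<close> lets the factor 2 absorb it.\<close>

lemma sum_powr_le:
 assumes "u > 0" "N > 0" "u \<le> real N"
 shows "(\<Sum>n\<le>N. real n powr (u - 1)) \<le> 2 * real N powr u / u"
proof (cases "u \<le> 1")
 case True
 have "(\<Sum>n\<le>N. real n powr (u - 1)) \<le> real N powr u / u"
 proof (induction N)
  case (Suc N)
  have "real (Suc N) powr (u - 1) \<le> (real (Suc N) powr u - real N powr u) / u"
  proof (cases "N = 0")
   case False
   then obtain \<xi> where x: "real N < \<xi>" "\<xi> < real N + 1" "(real N + 1) powr u - real N powr u = u * \<xi> powr (u - 1)"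
    using powr_mvt[of "real N" u] by auto
   have "(real N + 1) powr (u - 1) \<le> \<xi> powr (u - 1)" using x True by (intro powr_mono2') auto
   also have "... = (real (Suc N) powr u - real N powr u) / u" using x(3) assms by (simp add: add.commute)
   finally show ?thesis by (simp add: add.commute)
  qed (use True assms in auto)
  with Suc.IH show ?case by (simp add: diff_divide_distrib)
 qed auto
 also have "... \<le> 2 * real N powr u / u" using assms by (intro divide_right_mono) auto
 finally show ?thesis .
next
 case False
 have "(\<Sum>n\<le>Suc N. real n powr (u - 1)) \<le> real (Suc N) powr u / u + real (Suc N) powr (u - 1)" for N
 proof (induction N)
  case 0
  show ?case using False by simp
 next
  case (Suc N)
  obtain \<xi> where x: "real (Suc N) < \<xi>" "\<xi> < real (Suc N) + 1"
    "(real (Suc N) + 1) powr u - real (Suc N) powr u = u * \<xi> powr (u - 1)"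
   using powr_mvt[of "real (Suc N)" u] by auto
  have "real (Suc N) powr (u - 1) \<le> \<xi> powr (u - 1)" using x False by (intro powr_mono2) auto
  also have "... = (real (Suc (Suc N)) powr u - real (Suc N) powr u) / u" using x(3) assms by (simp add: add.commute)
  finally have "real (Suc N) powr u / u + real (Suc N) powr (u - 1) \<le> real (Suc (Suc N)) powr u / u"
   by (simp add: diff_divide_distrib)
  with Suc.IH show ?case by simp
 qed
 from this[of "N - 1"] have "(\<Sum>n\<le>N. real n powr (u - 1)) \<le> real N powr u / u + real N powr (u - 1)" using assms by simp
 also have "real N powr (u - 1) = real N powr u / real N" using assms by (simp add: powr_diff)
 also have "... \<le> real N powr u / u" using assms by (intro divide_left_mono) auto
 finally show ?thesis by simp
qed

lemma norm_dirichlet_partial_sum_le: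
 fixes c :: "nat => complex"
 assumes "\<And>n. norm (c n) \<le> C" "Re z < 0" "N > 0" "- Re z \<le> real N"
 shows "norm (\<Sum>n\<le>N. c n * of_nat n powr (- 1 - z)) \<le> 2 * C * real N powr (- Re z) / (- Re z)"
proof -
 have C: "C \<ge> 0" using assms(1)[of 0] norm_ge_zero order_trans by blast
 have "norm (\<Sum>n\<le>N. c n * of_nat n powr (- 1 - z)) \<le> (\<Sum>n\<le>N. C * real n powr (- Re z - 1))"
 proof (rule sum_norm_le)
  fix n
  have "norm (c n * of_nat n powr (- 1 - z)) = norm (c n) * real n powr (- Re z - 1)"
   unfolding norm_mult norm_nat_powr by simp (metis add.commute diff_conv_add_uminus)
  thus "norm (c n * of_nat n powr (- 1 - z)) \<le> C * real n powr (- Re z - 1)"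
   using assms(1)[of n] by (simp add: mult_right_mono)
 qed
 also have "... = C * (\<Sum>n\<le>N. real n powr (- Re z - 1))" by (simp add: sum_distrib_left)
 also have "... \<le> C * (2 * real N powr (- Re z) / (- Re z))"
  using assms C by (intro mult_left_mono sum_powr_le) auto
 finally show ?thesis by (simp add: mult_ac)
qed

text \<open>By the mean value theorem the terms are dominated by the decrements of
  \<open>n powr (- Re z)\<close>, which telescope.\<close>

lemma norm_dirichlet_tail_le:
 fixes c :: "nat => complex"
 assumes "\<And>n. norm (c n) \<le> C" and z: "Re z > 0" and N: "N > 0"
  and sums: "(\<lambda>n. c n * of_nat n powr (- 1 - z)) sums S"
 shows "norm (S - (\<Sum>n\<le>N. c n * of_nat n powr (- 1 - z))) \<le> C * real N powr (- Re z) / Re z"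
proof -
 define x where "x = Re z"
 have x: "x > 0" using z by (simp add: x_def)
 have C: "C \<ge> 0" using assms(1)[of 0] norm_ge_zero order_trans by blast
 let ?f = "\<lambda>n. c (n + Suc N) * of_nat (n + Suc N) powr (- 1 - z)"
 let ?h = "\<lambda>n. real (n + N) powr (- x)"
 have 1: "?f sums (S - (\<Sum>n\<le>N. c n * of_nat n powr (- 1 - z)))"
  using sums_split_initial_segment[OF sums, of "Suc N"] by (simp only: lessThan_Suc_atMost)
 have "?h \<longlonglongrightarrow> 0"
  using x by (intro tendsto_neg_powr filterlim_compose[OF filterlim_real_sequentially] filterlim_add_const_nat_at_top) auto
 from telescope_sums'[OF this] have "(\<lambda>n. ?h n - ?h (Suc n)) sums (real N powr (- x))" by simp
 hence 2: "(\<lambda>n. C / x * (?h n - ?h (Suc n))) sums (C / x * real N powr (- x))" by (rule sums_mult)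
 have b: "norm (?f n) \<le> C / x * (?h n - ?h (Suc n))" for n
 proof -
  obtain \<xi> where xi: "real (n + N) < \<xi>" "\<xi> < real (n + N) + 1"
    "(real (n + N) + 1) powr (- x) - real (n + N) powr (- x) = - x * \<xi> powr (- x - 1)"
   using powr_mvt[of "real (n + N)" "- x"] N by auto
  have "real (n + Suc N) powr (- x - 1) \<le> \<xi> powr (- x - 1)" using xi x N by (intro powr_mono2') auto
  also have "... = (?h n - ?h (Suc n)) / x" using xi(3) x by (simp add: field_simps)
  finally have "real (n + Suc N) powr (- x - 1) \<le> (?h n - ?h (Suc n)) / x" .
  hence "C * real (n + Suc N) powr (- x - 1) \<le> C * ((?h n - ?h (Suc n)) / x)" using C by (rule mult_left_mono)
  moreover have "norm (?f n) \<le> C * real (n + Suc N) powr (- x - 1)"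
  proof -
   have "Re (- 1 - z) = - x - 1" by (simp add: x_def)
   thus ?thesis unfolding norm_mult norm_nat_powr using assms(1)[of "n + Suc N"] by (simp only:) (intro mult_right_mono, auto)
  qed
  ultimately show ?thesis by simp
 qed
 have "norm (suminf ?f) \<le> (\<Sum>n. C / x * (?h n - ?h (Suc n)))"
  using b sums_summable[OF 2] by (rule norm_suminf_le)
 thus ?thesis using sums_unique[OF 1] sums_unique[OF 2] by (simp add: x_def)
qed

text \<open>Newman's kernel \<open>1 / z + z / R^2\<close>, which is small near the points \<open>\<plusminus> i R\<close>.\<close>

lemma norm_kernel_horizontal:
 assumes "R > 0" "\<bar>Im z\<bar> = R"
 shows "norm ((1 + z\<^sup>2 / of_real (R\<^sup>2)) / z) \<le> 2 * \<bar>Re z\<bar> / R\<^sup>2"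
proof -
 have z: "z \<noteq> 0" using assms by auto
 have "Im z * Im z = R * R" using assms by (metis abs_mult_self_eq)
 hence e: "of_real (R\<^sup>2) + z\<^sup>2 = of_real (Re z) * (of_real (Re z) + 2 * \<i> * of_real (Im z))"
  by (simp add: complex_eq_iff power2_eq_square)
 have "norm (z + \<i> * of_real (Im z)) \<le> norm z + norm (\<i> * of_real (Im z))" by (rule norm_triangle_ineq)
 also have "... \<le> 2 * norm z" using abs_Im_le_cmod[of z] by (simp add: norm_mult)
 also have "z + \<i> * of_real (Im z) = of_real (Re z) + 2 * \<i> * of_real (Im z)" by (simp add: complex_eq_iff)
 finally have "norm (of_real (R\<^sup>2) + z\<^sup>2) \<le> \<bar>Re z\<bar> * (2 * norm z)"
  unfolding e norm_mult norm_of_real by (intro mult_left_mono) auto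
 moreover have "(1 + z\<^sup>2 / of_real (R\<^sup>2)) / z = (of_real (R\<^sup>2) + z\<^sup>2) / (of_real (R\<^sup>2) * z)"
  using assms z by (simp add: divide_simps)
 hence "norm ((1 + z\<^sup>2 / of_real (R\<^sup>2)) / z) = norm (of_real (R\<^sup>2) + z\<^sup>2) / (R\<^sup>2 * norm z)"
  by (simp add: norm_divide norm_mult norm_power)
 ultimately have "norm ((1 + z\<^sup>2 / of_real (R\<^sup>2)) / z) \<le> \<bar>Re z\<bar> * (2 * norm z) / (R\<^sup>2 * norm z)"
  by (simp only:) (intro divide_right_mono, auto)
 also have "... = 2 * \<bar>Re z\<bar> / R\<^sup>2" using z by simp
 finally show ?thesis .
qed

lemma norm_kernel_vertical:
 assumes "R > 0" "\<bar>Re z\<bar> \<le> R" "\<bar>Im z\<bar> \<le> R" "0 < a" "a \<le> \<bar>Re z\<bar>"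
 shows "norm ((1 + z\<^sup>2 / of_real (R\<^sup>2)) / z) \<le> 3 / a"
proof -
 have "(Re z)\<^sup>2 \<le> R\<^sup>2" "(Im z)\<^sup>2 \<le> R\<^sup>2" using assms by (auto simp: abs_le_square_iff[symmetric])
 hence "norm (z\<^sup>2) \<le> 2 * R\<^sup>2" by (simp add: norm_power cmod_power2)
 hence "norm (z\<^sup>2 / of_real (R\<^sup>2)) \<le> 2" using assms by (simp add: norm_divide norm_power divide_simps)
 hence "norm (1 + z\<^sup>2 / of_real (R\<^sup>2)) \<le> 3" using norm_triangle_ineq[of 1 "z\<^sup>2 / of_real (R\<^sup>2)"] by simp
 moreover have "a \<le> norm z" using assms abs_Re_le_cmod[of z] by linarith
 ultimately show ?thesis unfolding norm_divide using assms by (intro frac_le) auto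
qed

text \<open>A rectangle takes the place of the customary circle. Its horizontal sides are cut at the
  imaginary axis because the two halves of the contour are treated differently.\<close>

lemma Cauchy_formula_rectangle:
 assumes R: "0 < R" and l: "0 < l" and f: "f holomorphic_on cbox (Complex (- l) (- R)) (Complex R R)"
 defines "\<phi> \<equiv> \<lambda>z. f z / z"
 shows "contour_integral (linepath (Complex 0 (- R)) (Complex R (- R))) \<phi>
  + contour_integral (linepath (Complex R (- R)) (Complex R R)) \<phi>
  + contour_integral (linepath (Complex R R) (Complex 0 R)) \<phi>
  + contour_integral (linepath (Complex 0 R) (Complex (- l) R)) \<phi>
  + contour_integral (linepath (Complex (- l) R) (Complex (- l) (- R))) \<phi>
  + contour_integral (linepath (Complex (- l) (- R)) (Complex 0 (- R))) \<phi> = 2 * of_real pi * \<i> * f 0"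
proof -
 define B where "B = cbox (Complex (- l) (- R)) (Complex R R)"
 let ?a1 = "Complex (- l) (- R)" and ?a2 = "Complex R (- R)" and ?a3 = "Complex R R" and ?a4 = "Complex (- l) R"
 have cont: "continuous_on (B - {0}) \<phi>" unfolding \<phi>_def
  using holomorphic_on_imp_continuous_on[OF f] by (intro continuous_intros) (auto simp: B_def elim: continuous_on_subset)
 have cs: "continuous_on (closed_segment u v) \<phi>" if "closed_segment u v \<subseteq> B - {0}" for u v
  using cont that by (rule continuous_on_subset)
 have s: "closed_segment ?a1 ?a2 \<subseteq> B - {0}" "closed_segment ?a2 ?a3 \<subseteq> B - {0}"
   "closed_segment ?a3 ?a4 \<subseteq> B - {0}" "closed_segment ?a4 ?a1 \<subseteq> B - {0}"
  using R l by (auto simp: B_def closed_segment_same_Re closed_segment_same_Im closed_segment_eq_real_ivl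
    in_cbox_complex_iff split: if_splits)
 have int0: "0 \<in> box ?a1 ?a3" using R l by (simp add: in_box_complex_iff)
 have "((\<lambda>w. f w / (w - 0)) has_contour_integral (2 * pi * \<i> * winding_number (rectpath ?a1 ?a3) 0 * f 0)) (rectpath ?a1 ?a3)"
 proof (rule Cauchy_integral_formula_convex_simple[where S = B])
  show "convex B" unfolding B_def by (rule convex_box)
  show "f holomorphic_on B" using f by (simp add: B_def)
  show "0 \<in> interior B" using int0 by (simp add: B_def)
  show "path_image (rectpath ?a1 ?a3) \<subseteq> B - {0}"
   using path_image_rectpath_cbox_minus_box[of ?a1 ?a3] int0 R l by (auto simp: B_def)
 qed auto
 hence "contour_integral (rectpath ?a1 ?a3) \<phi> = 2 * of_real pi * \<i> * f 0"
  unfolding winding_number_rectpath[OF int0] by (intro contour_integral_unique) (simp add: \<phi>_def)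
 moreover have "contour_integral (rectpath ?a1 ?a3) \<phi> = contour_integral (linepath ?a1 ?a2) \<phi>
   + (contour_integral (linepath ?a2 ?a3) \<phi> + (contour_integral (linepath ?a3 ?a4) \<phi> + contour_integral (linepath ?a4 ?a1) \<phi>))"
  unfolding rectpath_def Let_def
  using s[THEN cs, THEN contour_integrable_continuous_linepath]
  by (simp add: contour_integrable_join)
 moreover have "contour_integral (linepath ?a1 ?a2) \<phi> = contour_integral (linepath ?a1 (Complex 0 (- R))) \<phi>
   + contour_integral (linepath (Complex 0 (- R)) ?a2) \<phi>"
  by (rule contour_integral_split_linepath[OF cs[OF s(1)]])
    (use R l in \<open>auto simp: closed_segment_same_Im closed_segment_eq_real_ivl\<close>)
 moreover have "contour_integral (linepath ?a3 ?a4) \<phi> = contour_integral (linepath ?a3 (Complex 0 R)) \<phi>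
   + contour_integral (linepath (Complex 0 R) ?a4) \<phi>"
  by (rule contour_integral_split_linepath[OF cs[OF s(3)]])
    (use R l in \<open>auto simp: closed_segment_same_Im closed_segment_eq_real_ivl\<close>)
 ultimately show ?thesis by (simp add: add_ac)
qed

text \<open>Three sides of the rectangle with corners \<open>\<plusminus> i s\<close> and \<open>p \<plusminus> i s\<close>, from \<open>- i s\<close> to \<open>i s\<close>;
with negative \<open>p\<close> and \<open>s\<close> this is the left half of a positively oriented contour.\<close>

definition three_sides :: "real => real => complex set" where
 "three_sides p s = {z. Re z \<in> closed_segment 0 p \<and> \<bar>Im z\<bar> \<le> \<bar>s\<bar> \<and> (\<bar>Im z\<bar> = \<bar>s\<bar> \<or> Re z = p)}"

definition three_integral :: "real => real => (complex => complex) => complex" where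
 "three_integral p s f = contour_integral (linepath (Complex 0 (- s)) (Complex p (- s))) f
  + contour_integral (linepath (Complex p (- s)) (Complex p s)) f
  + contour_integral (linepath (Complex p s) (Complex 0 s)) f"

lemma segments_subset_three_sides:
 "closed_segment (Complex 0 (- s)) (Complex p (- s)) \<subseteq> three_sides p s"
 "closed_segment (Complex p (- s)) (Complex p s) \<subseteq> three_sides p s"
 "closed_segment (Complex p s) (Complex 0 s) \<subseteq> three_sides p s"
 by (auto simp: three_sides_def closed_segment_same_Re closed_segment_same_Im closed_segment_eq_real_ivl split: if_splits)

lemma three_sides_integrable:
 assumes "continuous_on (three_sides p s) f"
 shows "f contour_integrable_on linepath (Complex 0 (- s)) (Complex p (- s))"
  "f contour_integrable_on linepath (Complex p (- s)) (Complex p s)"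
  "f contour_integrable_on linepath (Complex p s) (Complex 0 s)"
 using segments_subset_three_sides[where p = p and s = s, THEN continuous_on_subset[OF assms]]
 by (auto intro: contour_integrable_continuous_linepath)

lemma three_integral_diff:
 assumes "continuous_on (three_sides p s) f" "continuous_on (three_sides p s) g"
 shows "three_integral p s (\<lambda>z. f z - g z) = three_integral p s f - three_integral p s g"
 using three_sides_integrable[OF assms(1)] three_sides_integrable[OF assms(2)]
 by (simp add: three_integral_def contour_integral_diff)

lemma norm_three_integral_le:
 assumes f: "continuous_on (three_sides p s) f" and AB: "A \<ge> 0" "B \<ge> 0"
  and A: "\<And>z. Re z \<in> closed_segment 0 p ==> \<bar>Im z\<bar> = \<bar>s\<bar> ==> norm (f z) \<le> A"
  and B: "\<And>z. Re z = p ==> \<bar>Im z\<bar> \<le> \<bar>s\<bar> ==> norm (f z) \<le> B"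
 shows "norm (three_integral p s f) \<le> 2 * A * \<bar>p\<bar> + 2 * B * \<bar>s\<bar>"
proof -
 note int = three_sides_integrable[OF f]
 have n: "norm (Complex p y - Complex 0 y) = \<bar>p\<bar>" "norm (Complex 0 y - Complex p y) = \<bar>p\<bar>" "norm (Complex p s - Complex p (- s)) = 2 * \<bar>s\<bar>" for y
  by (simp_all add: cmod_def real_sqrt_mult)
 have "norm (contour_integral (linepath (Complex 0 (- s)) (Complex p (- s))) f) \<le> A * norm (Complex p (- s) - Complex 0 (- s))"
  by (rule contour_integral_bound_linepath[OF int(1) AB(1)], rule A) (auto simp: closed_segment_same_Im)
 moreover have "norm (contour_integral (linepath (Complex p s) (Complex 0 s)) f) \<le> A * norm (Complex 0 s - Complex p s)"
  by (rule contour_integral_bound_linepath[OF int(3) AB(1)], rule A) (auto simp: closed_segment_same_Im closed_segment_commute)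
 moreover have "norm (contour_integral (linepath (Complex p (- s)) (Complex p s)) f) \<le> B * norm (Complex p s - Complex p (- s))"
  by (rule contour_integral_bound_linepath[OF int(2) AB(2)], rule B)
    (auto simp: closed_segment_same_Re closed_segment_eq_real_ivl split: if_splits)
 ultimately show ?thesis unfolding three_integral_def n
  by (intro order_trans[OF norm_triangle_ineq] order_trans[OF add_mono[OF norm_triangle_ineq order_refl]]) (simp add: algebra_simps)
qed

text \<open>\<open>exp y >= y\<close> at \<open>y = u * ln N\<close>. The bound is uniform in
  \<open>u\<close>, which matters near the imaginary axis, where \<open>N powr (- u)\<close> alone
  does not become small.\<close>

lemma x_powr_le:
 assumes "N \<ge> 2" "u \<ge> 0"
 shows "u * real N powr (- u) \<le> 1 / ln (real N)"
proof -
 have l: "ln (real N) > 0" using assms by simp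
 have "u * ln (real N) \<le> exp (u * ln (real N))" using exp_ge_add_one_self[of "u * ln (real N)"] by linarith
 hence "u * ln (real N) \<le> real N powr u" using assms by (simp add: powr_def mult.commute)
 thus ?thesis using l assms by (simp add: powr_minus field_simps)
qed

definition newman_kernel :: "nat => real => complex => complex" where
 "newman_kernel N R z = of_nat N powr z * ((1 + z\<^sup>2 / of_real (R\<^sup>2)) / z)"

lemma continuous_newman_kernel:
 assumes "N > 0" "R > 0" "p \<noteq> 0" "s \<noteq> 0"
 shows "continuous_on (three_sides p s) (newman_kernel N R)"
 unfolding newman_kernel_def[abs_def]
 using assms by (intro continuous_intros) (auto simp: three_sides_def)

text \<open>On the horizontal sides the kernel supplies \<open>|Re z| / R^2\<close>, which balances
  a growth of the integrand like \<open>1 / |Re z|\<close>; \<open>A\<close> bounds the balanced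
  product, \<open>V\<close> the integrand on the vertical side.\<close>

lemma norm_newman_integral_le:
 assumes N: "N > 0" and p: "p \<noteq> 0" "\<bar>p\<bar> \<le> R" and s: "\<bar>s\<bar> = R" and AV: "A \<ge> 0" "V \<ge> 0"
  and h: "continuous_on (three_sides p s) h"
  and A: "\<And>z. Re z \<in> closed_segment 0 p ==> \<bar>Im z\<bar> \<le> R ==> Re z \<noteq> 0 ==> norm (h z) * (real N powr Re z * \<bar>Re z\<bar>) \<le> A"
  and V: "\<And>z. Re z = p ==> \<bar>Im z\<bar> \<le> R ==> norm (h z) * real N powr p \<le> V"
 shows "norm (three_integral p s (\<lambda>z. h z * newman_kernel N R z)) \<le> 4 * A * \<bar>p\<bar> / R\<^sup>2 + 6 * V * R / \<bar>p\<bar>"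
proof -
 have R: "R > 0" using p by linarith
 have "norm (three_integral p s (\<lambda>z. h z * newman_kernel N R z)) \<le> 2 * (2 * A / R\<^sup>2) * \<bar>p\<bar> + 2 * (3 * V / \<bar>p\<bar>) * \<bar>s\<bar>"
 proof (rule norm_three_integral_le)
  show "continuous_on (three_sides p s) (\<lambda>z. h z * newman_kernel N R z)"
   using N R p s by (intro continuous_on_mult h continuous_newman_kernel) auto
  fix z :: complex
  have e: "norm (h z * newman_kernel N R z) = norm (h z) * real N powr Re z * norm ((1 + z\<^sup>2 / of_real (R\<^sup>2)) / z)"
   by (simp only: newman_kernel_def norm_mult norm_nat_powr mult.assoc)
  {
   assume z: "Re z \<in> closed_segment 0 p" "\<bar>Im z\<bar> = \<bar>s\<bar>"
   have "norm (h z * newman_kernel N R z) \<le> norm (h z) * real N powr Re z * (2 * \<bar>Re z\<bar> / R\<^sup>2)"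
    unfolding e using z R s by (intro mult_left_mono norm_kernel_horizontal) auto
   also have "... = 2 * (norm (h z) * (real N powr Re z * \<bar>Re z\<bar>)) / R\<^sup>2" by simp
   also have "... \<le> 2 * A / R\<^sup>2"
    using A[OF z(1)] z(2) s AV(1) by (cases "Re z = 0") (auto intro!: divide_right_mono)
   finally show "norm (h z * newman_kernel N R z) \<le> 2 * A / R\<^sup>2" .
  next
   assume z: "Re z = p" "\<bar>Im z\<bar> \<le> \<bar>s\<bar>"
   have "norm (h z * newman_kernel N R z) \<le> norm (h z) * real N powr p * (3 / \<bar>p\<bar>)"
    unfolding e z(1) using z R p s by (intro mult_left_mono norm_kernel_vertical[of R]) auto
   also have "... \<le> V * (3 / \<bar>p\<bar>)" using V[OF z(1)] z(2) s by (intro mult_right_mono) auto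
   finally show "norm (h z * newman_kernel N R z) \<le> 3 * V / \<bar>p\<bar>" by (simp add: mult.commute)
  }
 qed (use AV in auto)
 thus ?thesis using s by simp
qed

text \<open>Cauchy's formula for \<open>g\<close> uses a contour reaching only slightly to the left
  of the imaginary axis, whereas for the entire function \<open>F N\<close> the left part can be
  moved out to \<open>- R\<close>. On the right the tail \<open>g - F N\<close> contributes at most
  \<open>10 C / R\<close>, on the left \<open>F N\<close> contributes at most
  \<open>20 C / R\<close>, and the left part of \<open>g\<close> tends to 0 for fixed
  \<open>R\<close> as \<open>N\<close> grows.\<close>

theorem newman_tauberian:
 fixes c :: "nat => complex"
 assumes c: "\<And>n. norm (c n) \<le> C" and U: "open U" "{z. Re z \<ge> 0} \<subseteq> U" and g: "g holomorphic_on U"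
  and sums: "\<And>z. Re z > 0 ==> (\<lambda>n. c n * of_nat n powr (- 1 - z)) sums g z"
 shows "(\<lambda>N. \<Sum>n\<le>N. c n / of_nat n) \<longlonglongrightarrow> g 0"
proof -
 have C: "C \<ge> 0" using c[of 0] norm_ge_zero order_trans by blast
 define F where "F N z = (\<Sum>n\<le>N. c n * of_nat n powr (- 1 - z))" for N z
 have F0: "F N 0 = (\<Sum>n\<le>N. c n / of_nat n)" for N
  unfolding F_def by (intro sum.cong refl) (simp add: powr_minus divide_inverse)
 have F_hol: "F N holomorphic_on A" for N A unfolding F_def[abs_def]
 proof (rule holomorphic_on_sum)
  show "(\<lambda>z. c n * of_nat n powr (- 1 - z)) holomorphic_on A" for n
   by (cases "n = 0") (auto intro!: holomorphic_intros)
 qed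
 define err where "err R \<delta> B N = 4 * (B / ln (real N)) * \<delta> / R\<^sup>2 + 6 * (B * real N powr (- \<delta>)) * R / \<delta>"
  for R \<delta> B :: real and N :: nat
 have main: "\<exists>\<delta>>0. \<exists>B\<ge>0. \<forall>N. N \<ge> 2 \<and> real N \<ge> R \<longrightarrow> 2 * pi * norm (g 0 - F N 0) \<le> 30 * C / R + err R \<delta> B N"
  if R: "R > 0" for R
 proof -
  let ?S = "closed_segment (Complex 0 (- R)) (Complex 0 R)"
  have "?S \<subseteq> U" using U(2) by (auto simp: closed_segment_same_Re)
  then obtain e where e: "e > 0" "(\<Union>x\<in>?S. ball x e) \<subseteq> U"
   using compact_subset_open_imp_ball_epsilon_subset[OF compact_segment U(1)] by metis
  define \<delta> where "\<delta> = min (e / 2) R"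
  have \<delta>: "\<delta> > 0" "\<delta> < e" "\<delta> \<le> R" using e R by (auto simp: \<delta>_def)
  define D where "D = cbox (Complex (- \<delta>) (- R)) (Complex R R)"
  have rect: "D \<subseteq> U"
  proof
   fix z assume z: "z \<in> D"
   show "z \<in> U"
   proof (cases "Re z \<ge> 0")
    case False
    have "Complex 0 (Im z) \<in> ?S"
     using z R by (auto simp: D_def closed_segment_same_Re closed_segment_eq_real_ivl in_cbox_complex_iff)
    moreover have "Complex 0 (Im z) - z = of_real (- Re z)" by (simp add: complex_eq_iff)
    hence "dist (Complex 0 (Im z)) z = \<bar>Re z\<bar>" unfolding dist_norm by (simp only: norm_of_real abs_minus_cancel)
    hence "z \<in> ball (Complex 0 (Im z)) e" using z False \<delta> by (simp add: D_def in_cbox_complex_iff)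
    ultimately show ?thesis using e(2) by blast
   qed (use U(2) in auto)
  qed
  have cont_D: "continuous_on D g" by (rule continuous_on_subset[OF holomorphic_on_imp_continuous_on[OF g] rect])
  hence "compact (g ` D)" by (rule compact_continuous_image) (simp add: D_def)
  then obtain B where B0: "B > 0" "\<forall>x\<in>g ` D. norm x \<le> B"
   by (meson compact_imp_bounded bounded_pos)
  note B = B0(1) B0(2)[rule_format, OF imageI]
  have "2 * pi * norm (g 0 - F N 0) \<le> 30 * C / R + err R \<delta> B N" if N: "N \<ge> 2" "real N \<ge> R" for N
  proof -
   let ?K = "newman_kernel N R"
   have sub: "three_sides R R \<subseteq> D" "three_sides (- \<delta>) (- R) \<subseteq> D"
    using R \<delta> by (auto simp: D_def three_sides_def in_cbox_complex_iff closed_segment_eq_real_ivl)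
   note cont_g = continuous_on_subset[OF cont_D sub(1)] continuous_on_subset[OF cont_D sub(2)]
   have cont_F: "continuous_on A (F N)" for A by (rule holomorphic_on_imp_continuous_on[OF F_hol])
   have cauchy: "three_integral R R (\<lambda>z. h z * ?K z) + three_integral (- l) (- R) (\<lambda>z. h z * ?K z) = 2 * of_real pi * \<i> * h 0"
    if h: "h holomorphic_on cbox (Complex (- l) (- R)) (Complex R R)" and l: "l > 0" for h l
   proof -
    have "(\<lambda>z. h z * (of_nat N powr z * (1 + z\<^sup>2 / of_real (R\<^sup>2)))) holomorphic_on cbox (Complex (- l) (- R)) (Complex R R)"
     using h N R by (intro holomorphic_intros) auto
    from Cauchy_formula_rectangle[OF R l this] show ?thesis
     using N by (simp add: three_integral_def newman_kernel_def mult.assoc add.assoc)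
   qed
   have e1: "three_integral R R (\<lambda>z. g z * ?K z) + three_integral (- \<delta>) (- R) (\<lambda>z. g z * ?K z) = 2 * of_real pi * \<i> * g 0"
    using g rect \<delta> unfolding D_def by (intro cauchy) (auto elim: holomorphic_on_subset)
   have e2: "three_integral R R (\<lambda>z. F N z * ?K z) + three_integral (- R) (- R) (\<lambda>z. F N z * ?K z) = 2 * of_real pi * \<i> * F N 0"
    using R by (intro cauchy F_hol)
   have e3: "three_integral R R (\<lambda>z. (g z - F N z) * ?K z)
     = three_integral R R (\<lambda>z. g z * ?K z) - three_integral R R (\<lambda>z. F N z * ?K z)"
    unfolding left_diff_distrib
    using R N by (intro three_integral_diff continuous_on_mult cont_g cont_F continuous_newman_kernel) auto
   have eq: "2 * of_real pi * \<i> * (g 0 - F N 0) = three_integral R R (\<lambda>z. (g z - F N z) * ?K z)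
     + three_integral (- \<delta>) (- R) (\<lambda>z. g z * ?K z) - three_integral (- R) (- R) (\<lambda>z. F N z * ?K z)"
    unfolding right_diff_distrib e1[symmetric] e2[symmetric] e3 by simp
   have tail: "norm (g z - F N z) * (real N powr Re z * \<bar>Re z\<bar>) \<le> C" if "Re z > 0" for z
   proof -
    have "norm (g z - F N z) \<le> C * real N powr (- Re z) / Re z"
     unfolding F_def using c that N by (intro norm_dirichlet_tail_le sums) auto
    thus ?thesis using that N by (simp add: powr_minus field_simps)
   qed
   have head: "norm (F N z) * (real N powr Re z * \<bar>Re z\<bar>) \<le> 2 * C" if "Re z < 0" "Re z \<ge> - R" for z
   proof -
    have "norm (F N z) \<le> 2 * C * real N powr (- Re z) / (- Re z)"
     unfolding F_def using c that N by (intro norm_dirichlet_partial_sum_le) auto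
    hence "norm (F N z) * (- Re z) \<le> 2 * C * real N powr (- Re z)" using that by (subst (asm) pos_le_divide_eq) auto
    from mult_right_mono[OF this, of "real N powr Re z"] show ?thesis
     using that N by (simp add: powr_minus mult_ac)
   qed
   have b1: "norm (three_integral R R (\<lambda>z. (g z - F N z) * ?K z)) \<le> 4 * C * \<bar>R\<bar> / R\<^sup>2 + 6 * (C / R) * R / \<bar>R\<bar>"
   proof (rule norm_newman_integral_le)
    show "norm (g z - F N z) * real N powr R \<le> C / R" if "Re z = R" for z
     using tail[of z] that R by (simp add: field_simps)
   qed (use R N C tail in \<open>auto intro!: continuous_on_diff cont_g cont_F simp: closed_segment_eq_real_ivl\<close>)
   have b2: "norm (three_integral (- R) (- R) (\<lambda>z. F N z * ?K z)) \<le> 4 * (2 * C) * \<bar>- R\<bar> / R\<^sup>2 + 6 * (2 * C / R) * R / \<bar>- R\<bar>"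
   proof (rule norm_newman_integral_le)
    show "norm (F N z) * real N powr (- R) \<le> 2 * C / R" if "Re z = - R" for z
     using head[of z] that R by (simp add: field_simps)
   qed (use R N C head in \<open>auto intro!: cont_F simp: closed_segment_eq_real_ivl\<close>)
   have gB: "norm (g z) \<le> B" if "- \<delta> \<le> Re z" "Re z \<le> 0" "\<bar>Im z\<bar> \<le> R" for z
    using that R by (intro B(2)) (auto simp: D_def in_cbox_complex_iff)
   have b3: "norm (three_integral (- \<delta>) (- R) (\<lambda>z. g z * ?K z)) \<le> 4 * (B / ln (real N)) * \<bar>- \<delta>\<bar> / R\<^sup>2
     + 6 * (B * real N powr (- \<delta>)) * R / \<bar>- \<delta>\<bar>"
   proof (rule norm_newman_integral_le)
    fix z assume z: "Re z \<in> closed_segment 0 (- \<delta>)" "\<bar>Im z\<bar> \<le> R"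
    hence zd: "Re z \<ge> - \<delta>" "Re z \<le> 0" using \<delta> by (auto simp: closed_segment_eq_real_ivl split: if_splits)
    have "norm (g z) * (- Re z * real N powr (- (- Re z))) \<le> B * (1 / ln (real N))"
     using zd z B N by (intro mult_mono gB x_powr_le mult_nonneg_nonneg) auto
    thus "norm (g z) * (real N powr Re z * \<bar>Re z\<bar>) \<le> B / ln (real N)" using zd by (simp add: mult.commute)
   qed (use R N \<delta> B gB in \<open>auto intro!: cont_g mult_right_mono\<close>)
   have "2 * pi * norm (g 0 - F N 0) = norm (2 * of_real pi * \<i> * (g 0 - F N 0))" by (simp add: norm_mult)
   also have "... \<le> norm (three_integral R R (\<lambda>z. (g z - F N z) * ?K z))
     + norm (three_integral (- \<delta>) (- R) (\<lambda>z. g z * ?K z)) + norm (three_integral (- R) (- R) (\<lambda>z. F N z * ?K z))"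
    unfolding eq by (intro order_trans[OF norm_triangle_ineq4] add_right_mono norm_triangle_ineq)
   also note add_mono[OF add_mono[OF b1 b3] b2]
   also have "4 * C * \<bar>R\<bar> / R\<^sup>2 + 6 * (C / R) * R / \<bar>R\<bar> + (4 * (B / ln (real N)) * \<bar>- \<delta>\<bar> / R\<^sup>2
     + 6 * (B * real N powr (- \<delta>)) * R / \<bar>- \<delta>\<bar>) + (4 * (2 * C) * \<bar>- R\<bar> / R\<^sup>2 + 6 * (2 * C / R) * R / \<bar>- R\<bar>)
     = 30 * C / R + err R \<delta> B N"
    using R \<delta> by (simp add: err_def power2_eq_square)
   finally show ?thesis .
  qed
  thus ?thesis using \<delta>(1) B(1) by (intro exI[of _ \<delta>] exI[of _ B] conjI) auto
 qed
 have "(\<lambda>N. F N 0) \<longlonglongrightarrow> g 0"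
 proof (rule LIMSEQ_I)
  fix e :: real assume e: "e > 0"
  define R where "R = 30 * C / e + 1"
  have R: "R > 0" using C e by (simp add: R_def add_nonneg_pos)
  have CR: "30 * C / R + 0 < e" using C e by (simp add: R_def field_simps)
  obtain \<delta> B where dB: "\<delta> > 0" "B \<ge> 0"
   "\<And>N. N \<ge> 2 ==> real N \<ge> R ==> 2 * pi * norm (g 0 - F N 0) \<le> 30 * C / R + err R \<delta> B N"
   using main[OF R] by blast
  have "(\<lambda>N. 1 / ln (real N)) \<longlonglongrightarrow> 0" "(\<lambda>N. real N powr (- \<delta>)) \<longlonglongrightarrow> 0"
   using dB(1) by real_asymp+
  hence "(\<lambda>N. 4 * B * \<delta> / R\<^sup>2 * (1 / ln (real N)) + 6 * B * R / \<delta> * real N powr (- \<delta>))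
    \<longlonglongrightarrow> 4 * B * \<delta> / R\<^sup>2 * 0 + 6 * B * R / \<delta> * 0"
   by (intro tendsto_add tendsto_mult tendsto_const)
  hence "err R \<delta> B \<longlonglongrightarrow> 0" by (simp add: err_def[abs_def] mult_ac)
  hence "\<forall>\<^sub>F N in sequentially. 30 * C / R + err R \<delta> B N < e"
   by (rule order_tendstoD(2)[OF tendsto_add[OF tendsto_const] CR])
  moreover have "\<forall>\<^sub>F N in sequentially. real N \<ge> R"
   using filterlim_real_sequentially by (simp add: filterlim_at_top)
  ultimately have "\<forall>\<^sub>F N in sequentially. norm (F N 0 - g 0) < e"
   using eventually_ge_at_top[of 2]
  proof eventually_elim
   case (elim N)
   have "2 * pi * norm (g 0 - F N 0) < e" using dB(3)[of N] elim by linarith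
   moreover have "1 * norm (g 0 - F N 0) \<le> 2 * pi * norm (g 0 - F N 0)"
    using pi_gt3 by (intro mult_right_mono) auto
   ultimately show ?case by (simp add: norm_minus_commute)
  qed
  thus "\<exists>n0. \<forall>n\<ge>n0. norm (F n 0 - g 0) < e" by (simp add: eventually_sequentially)
 qed
 thus ?thesis by (simp only: F0)
qed

section \<open>From Newman's theorem to the asymptotics of \<open>psi\<close>\<close>

lemma nat_div_tendsto:
 fixes K :: nat
 assumes "K > 0"
 shows "(\<lambda>N. real (N div K) / real N) \<longlonglongrightarrow> 1 / real K"
proof (rule tendsto_sandwich)
 have "(\<lambda>N. 1 / real K - 1 / real N) \<longlonglongrightarrow> 1 / real K - 0"
  by (intro tendsto_intros lim_1_over_n)
 thus "(\<lambda>N. 1 / real K - 1 / real N) \<longlonglongrightarrow> 1 / real K" by simp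
 show "\<forall>\<^sub>F N in sequentially. 1 / real K - 1 / real N \<le> real (N div K) / real N"
  using eventually_gt_at_top[of 0]
 proof eventually_elim
  case (elim N)
  have "N < K * (N div K) + K" using assms by (metis mod_less_divisor mult_div_mod_eq nat_add_left_cancel_less)
  hence "real N < real K * real (N div K) + real K" by (metis of_nat_add of_nat_less_iff of_nat_mult)
  hence "real N / real K - 1 \<le> real (N div K)" using assms by (simp add: field_simps)
  hence "(real N / real K - 1) / real N \<le> real (N div K) / real N" by (rule divide_right_mono) simp
  thus ?case using elim by (simp add: diff_divide_distrib)
 qed
 show "\<forall>\<^sub>F N in sequentially. real (N div K) / real N \<le> 1 / real K"
  using eventually_gt_at_top[of 0]
 proof eventually_elim
  case (elim N)
  have "real (N div K) * real K \<le> real N" by (metis div_times_less_eq_dividend of_nat_le_iff of_nat_mult)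
  thus ?case using elim assms by (simp add: field_simps)
 qed
qed simp

lemma filterlim_div_nat:
 assumes "(m :: nat) > 0"
 shows "filterlim (\<lambda>n. n div m) at_top sequentially"
 unfolding filterlim_at_top
proof
 fix Z
 show "\<forall>\<^sub>F n in sequentially. Z \<le> n div m"
  using eventually_ge_at_top[of "Z * m"]
  by eventually_elim (use assms in \<open>simp add: less_eq_div_iff_mult_less_eq\<close>)
qed

text \<open>The mean value of \<open>psi n / n - 1\<close> over a short multiplicative interval tends to zero; since \<open>psi\<close>
 is monotone, this pins down \<open>psi\<close> itself.\<close>

theorem psi_asymptotic: "(\<lambda>n. psi n / real n) \<longlonglongrightarrow> 1"
proof -
 obtain g U where gU: "open U" "g holomorphic_on U" "{z. Re z \<ge> 1} \<subseteq> U"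
  "\<And>z. Re z > 1 ==> (\<lambda>n. of_real (psi n / real n - 1) * of_nat n powr (- z)) sums g z"
  by (rule psi_error_continuation) blast
 have "(\<lambda>N. \<Sum>n\<le>N. of_real (psi n / real n - 1) / of_nat n) \<longlonglongrightarrow> g (1 + 0)"
 proof (rule newman_tauberian[where C = 5 and U = "(+) (-1) ` U" and g = "\<lambda>z. g (1 + z)"])
  show "norm (of_real (psi n / real n - 1) :: complex) \<le> 5" for n
  proof (cases "n = 0")
   case False
   hence "psi n / real n \<le> 4" "psi n / real n \<ge> 0" using psi_le[of n] psi_nonneg[of n] by (simp_all add: divide_le_eq)
   thus ?thesis unfolding norm_of_real by linarith
  qed simp
  show "open ((+) (-1) ` U)" using gU(1) by (rule open_translation)
  show "{z. Re z \<ge> 0} \<subseteq> (+) (-1) ` U"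
  proof
   fix z :: complex assume "z \<in> {z. Re z \<ge> 0}"
   hence "1 + z \<in> U" using gU(3) by auto
   thus "z \<in> (+) (-1) ` U" by (rule rev_image_eqI) simp
  qed
  show "(\<lambda>z. g (1 + z)) holomorphic_on (+) (-1) ` U"
   by (rule holomorphic_on_compose_gen[OF _ gU(2), unfolded o_def]) (auto intro!: holomorphic_intros)
  show "(\<lambda>n. of_real (psi n / real n - 1) * of_nat n powr (- 1 - z)) sums g (1 + z)" if "Re z > 0" for z
   using gU(4)[of "1 + z"] that by simp
 qed
 from tendsto_Re[OF this] have L: "(\<lambda>N. \<Sum>n\<le>N. (psi n / real n - 1) / real n) \<longlonglongrightarrow> Re (g 1)"
  by (simp only: Re_sum Re_divide_of_nat Re_complex_of_real add_0_right)
 define S where "S N = (\<Sum>n\<le>N. (psi n / real n - 1) / real n)" for N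
 have SL: "S \<longlonglongrightarrow> Re (g 1)" using L by (simp add: S_def[abs_def])
 have diff: "S (N + d) - S N = (\<Sum>n\<in>{N<..N + d}. (psi n / real n - 1) / real n)" for N d
 proof -
  have e: "{..N + d} = {..N} \<union> {N<..N + d}" by auto
  have "S (N + d) = S N + (\<Sum>n\<in>{N<..N + d}. (psi n / real n - 1) / real n)"
   unfolding S_def e by (rule sum.union_disjoint) auto
  thus ?thesis by simp
 qed
 have f: "(psi n / real n - 1) / real n = psi n / (real n)\<^sup>2 - 1 / real n" for n
  by (simp add: diff_divide_distrib power2_eq_square)
 \<comment> \<open>Applied with \<open>e = 1\<close> to the interval of length
   \<open>N div K\<close> above \<open>N\<close>, and with \<open>e = - 1\<close> to the one below.
   The factor \<open>N / (N div K)\<close> stays bounded, so the differences of the convergent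
   sequence \<open>S\<close> disappear in the limit.\<close>
 have lim: "(\<lambda>N. (1 + e * (real (N div K) / real N))\<^sup>2 * (1 + (S (b N) - S (a N)) * (real N / real (N div K)))) \<longlonglongrightarrow> (1 + e / real K)\<^sup>2"
  if K: "K > 0" and ab: "filterlim a at_top sequentially" "filterlim b at_top sequentially" for K e a b
 proof -
  note d = nat_div_tendsto[OF K]
  have q: "(\<lambda>N. real N / real (N div K)) \<longlonglongrightarrow> real K"
   using tendsto_inverse[OF d] K by (simp add: field_simps inverse_eq_divide)
  have "(\<lambda>N. S (b N) - S (a N)) \<longlonglongrightarrow> 0"
   using tendsto_diff[OF filterlim_compose[OF SL ab(2)] filterlim_compose[OF SL ab(1)]] by simp
  from tendsto_mult[OF tendsto_power[OF tendsto_add[OF tendsto_const tendsto_mult[OF tendsto_const d]]]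
    tendsto_add[OF tendsto_const tendsto_mult[OF this q]], of 1 e 2 1]
  show ?thesis by simp
 qed
 have sq: "(\<lambda>K. (1 + e / real K)\<^sup>2) \<longlonglongrightarrow> 1" for e by real_asymp
 have N_pos: "N > 0" "N div K > 0" if "N \<ge> K" "K \<ge> 2" for N K :: nat using that by (auto simp: div_greater_zero_iff)
 have up: "\<forall>\<^sub>F N in sequentially. psi N / real N < b" if b: "b > 1" for b
 proof -
  have "\<forall>\<^sub>F K in sequentially. K \<ge> 2 \<and> (1 + 1 / real K)\<^sup>2 < b"
   by (intro eventually_conj eventually_ge_at_top order_tendstoD(2)[OF sq b])
  then obtain K where K: "K \<ge> 2" "(1 + 1 / real K)\<^sup>2 < b" by (auto simp: eventually_sequentially)
  hence K_pos: "K > 0" by simp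
  have "filterlim (\<lambda>N. N + N div K) at_top sequentially"
   by (rule filterlim_at_top_mono[OF filterlim_ident]) (simp add: eventuallyI)
  from order_tendstoD(2)[OF lim[OF K_pos filterlim_ident this] K(2)] eventually_ge_at_top[of K] show ?thesis
  proof eventually_elim
   case (elim N)
   define d where "d = N div K"
   note N = N_pos[OF elim(2) K(1), folded d_def] and less = elim(1)[folded d_def]
   have "real (card {N<..N + d}) * (psi N / (real N + real d)\<^sup>2 - 1 / real N) \<le> S (N + d) - S N"
    unfolding diff
   proof (rule sum_bounded_below)
    fix n assume n: "n \<in> {N<..N + d}"
    have "psi N / (real N + real d)\<^sup>2 \<le> psi n / (real n)\<^sup>2"
     using n psi_mono[of N n] psi_nonneg by (intro frac_le power_mono) auto
    moreover have "1 / real n \<le> 1 / real N" using n N by (intro divide_left_mono) auto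
    ultimately show "psi N / (real N + real d)\<^sup>2 - 1 / real N \<le> (psi n / real n - 1) / real n" unfolding f by linarith
   qed
   hence "psi N / (real N + real d)\<^sup>2 \<le> 1 / real N + (S (N + d) - S N) / real d" using N by (simp add: field_simps)
   hence "psi N \<le> (1 / real N + (S (N + d) - S N) / real d) * (real N + real d)\<^sup>2"
    using N by (subst (asm) pos_divide_le_eq) auto
   hence "psi N / real N \<le> (1 / real N + (S (N + d) - S N) / real d) * (real N + real d)\<^sup>2 / real N"
    using N by (intro divide_right_mono) auto
   also have "... = (1 + 1 * (real d / real N))\<^sup>2 * (1 + (S (N + d) - S N) * (real N / real d))"
    using N by (simp add: field_simps power2_eq_square)
   finally show ?case using less by linarith
  qed
 qed
 have low: "\<forall>\<^sub>F N in sequentially. a < psi N / real N" if a: "a < 1" for a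
 proof -
  have "\<forall>\<^sub>F K in sequentially. K \<ge> 2 \<and> a < (1 + - 1 / real K)\<^sup>2"
   by (intro eventually_conj eventually_ge_at_top order_tendstoD(1)[OF sq a])
  then obtain K where K: "K \<ge> 2" "a < (1 + - 1 / real K)\<^sup>2" by (auto simp: eventually_sequentially)
  hence K_pos: "K > 0" by simp
  have half: "2 * (N div K) \<le> N" for N
   using mult_le_mono1[OF K(1), of "N div K"] times_div_less_eq_dividend[of K N] by linarith
  have "filterlim (\<lambda>N. N - N div K) at_top sequentially"
  proof (rule filterlim_at_top_mono[OF filterlim_div_nat[of 2]])
   have "N div 2 \<le> N - N div K" for N using half[of N] by linarith
   thus "\<forall>\<^sub>F N in sequentially. N div 2 \<le> N - N div K" by (intro always_eventually allI)
  qed simp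
  from order_tendstoD(1)[OF lim[OF K_pos this filterlim_ident] K(2)] eventually_ge_at_top[of K] show ?thesis
  proof eventually_elim
   case (elim N)
   define d where "d = N div K"
   note N = N_pos[OF elim(2) K(1), folded d_def] and less = elim(1)[folded d_def]
   have dN: "2 * d \<le> N" using half[of N] by (simp only: d_def)
   have pos: "real N - real d > 0" using dN N by linarith
   have "S N - S (N - d) \<le> real (card {N - d<..N - d + d}) * (psi N / (real N - real d)\<^sup>2 - 1 / real N)"
    using diff[of "N - d" d] dN unfolding le_add_diff_inverse2[OF order_trans[OF le_add1[of d d] dN[unfolded mult_2]]]
   proof (simp only:, intro sum_bounded_above)
    fix n assume n: "n \<in> {N - d<..N}"
    have "psi n / (real n)\<^sup>2 \<le> psi N / (real N - real d)\<^sup>2"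
     using n psi_mono[of n N] psi_nonneg pos by (intro frac_le power_mono) auto
    moreover have "1 / real N \<le> 1 / real n" using n N by (intro divide_left_mono) auto
    ultimately show "(psi n / real n - 1) / real n \<le> psi N / (real N - real d)\<^sup>2 - 1 / real N" unfolding f by linarith
   qed
   hence "(S N - S (N - d)) / real d \<le> psi N / (real N - real d)\<^sup>2 - 1 / real N"
    using N by (subst pos_divide_le_eq) (auto simp: mult.commute)
   hence "1 / real N + (S N - S (N - d)) / real d \<le> psi N / (real N - real d)\<^sup>2" by linarith
   hence "(1 / real N + (S N - S (N - d)) / real d) * (real N - real d)\<^sup>2 \<le> psi N"
    using pos by (subst (asm) pos_le_divide_eq) auto
   hence "(1 / real N + (S N - S (N - d)) / real d) * (real N - real d)\<^sup>2 / real N \<le> psi N / real N"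
    using N by (intro divide_right_mono) auto
   also have "(1 / real N + (S N - S (N - d)) / real d) * (real N - real d)\<^sup>2 / real N
     = (1 + - 1 * (real d / real N))\<^sup>2 * (1 + (S N - S (N - d)) * (real N / real d))"
    using N by (simp add: field_simps power2_eq_square)
   finally show ?case using less by linarith
  qed
 qed
 show ?thesis by (rule order_tendstoI) (use up low in auto)
qed

section \<open>From \<open>psi\<close> to \<open>theta\<close>\<close>

definition theta :: "nat => real" where "theta n = (\<Sum>p | prime p \<and> p \<le> n. ln (real p))"

lemma theta_le_psi: "theta n \<le> psi n"
proof -
 have "theta n = (\<Sum>p | prime p \<and> p \<le> n. mangoldt p)" unfolding theta_def by (intro sum.cong) auto
 also have "... \<le> psi n" unfolding psi_def by (intro sum_mono2 mangoldt_nonneg) auto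
 finally show ?thesis .
qed

text \<open>A proper prime power \<open>p^j <= n\<close> has \<open>p <= sqrt n\<close> and
  \<open>j <= log 2 n\<close>; counting the pairs \<open>(p, j)\<close> this way is crude, but still
  \<open>o(n)\<close> after multiplication by \<open>ln n\<close>.\<close>

lemma psi_minus_theta_le:
 assumes "n > 0"
 shows "psi n - theta n \<le> (sqrt (real n) + 1) * (log 2 (real n) + 1) * ln (real n)"
proof -
 define Q where "Q = {m. m \<le> n \<and> primepow m \<and> \<not> prime m}"
 have fin: "finite Q" unfolding Q_def by (rule finite_subset[of _ "{..n}"]) auto
 have "theta n = (\<Sum>p | prime p \<and> p \<le> n. mangoldt p)" unfolding theta_def by (intro sum.cong) auto
 moreover have "psi n = (\<Sum>m\<in>{p. prime p \<and> p \<le> n} \<union> Q. mangoldt m)" unfolding psi_def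
  by (rule sum.mono_neutral_right) (auto simp: Q_def mangoldt_def)
 moreover have "(\<Sum>m\<in>{p. prime p \<and> p \<le> n} \<union> Q. mangoldt m :: real) = (\<Sum>p | prime p \<and> p \<le> n. mangoldt p) + sum mangoldt Q"
  by (rule sum.union_disjoint) (auto simp: Q_def fin)
 ultimately have "psi n - theta n = sum mangoldt Q" by linarith
 also have "... \<le> (\<Sum>m\<in>Q. ln (real n))"
 proof (rule sum_mono)
  fix m assume "m \<in> Q"
  hence m: "m > 0" "m \<le> n" by (auto simp: Q_def primepow_gt_0_nat)
  have "mangoldt m \<le> ln (real m)" using m by (intro mangoldt_le) auto
  also have "... \<le> ln (real n)" using m by simp
  finally show "mangoldt m \<le> ln (real n)" .
 qed
 also have "... = real (card Q) * ln (real n)" by simp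
 also have "... \<le> (sqrt (real n) + 1) * (log 2 (real n) + 1) * ln (real n)"
 proof (rule mult_right_mono)
  let ?f = "\<lambda>m::nat. (aprimedivisor m, multiplicity (aprimedivisor m) m)"
  let ?T = "{..nat \<lfloor>sqrt (real n)\<rfloor>} \<times> {..nat \<lfloor>log 2 (real n)\<rfloor>}"
  have dec: "m = aprimedivisor m ^ multiplicity (aprimedivisor m) m" if "primepow m" for m :: nat
   using primepow_decompose[OF that] by (rule sym)
  have "card Q \<le> card ?T"
  proof (rule card_inj_on_le)
   show "inj_on ?f Q"
   proof (rule inj_onI)
    fix x y assume "x \<in> Q" "y \<in> Q" "?f x = ?f y"
    thus "x = y" using dec[of x] dec[of y] by (auto simp: Q_def)
   qed
   show "?f ` Q \<subseteq> ?T"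
   proof (rule image_subsetI)
    fix m assume mQ: "m \<in> Q"
    define p where "p = aprimedivisor m"
    define j where "j = multiplicity p m"
    have m: "m \<le> n" "primepow m" "\<not> prime m" using mQ by (auto simp: Q_def)
    have p: "prime p" unfolding p_def using m(2) primepow_gt_Suc_0[OF m(2)] by (intro prime_aprimedivisor') auto
    have mj: "m = p ^ j" using dec[OF m(2)] by (simp add: p_def j_def)
    have j2: "j \<ge> 2"
    proof (rule ccontr)
     assume "\<not> j \<ge> 2"
     hence "j = 0 \<or> j = 1" by auto
     thus False using mj m p primepow_gt_Suc_0[OF m(2)] by auto
    qed
    have p2: "p \<ge> 2" using p by (rule prime_ge_2_nat)
    have "p ^ 2 \<le> p ^ j" using j2 p2 by (intro power_increasing) auto
    hence "p ^ 2 \<le> n" using mj m(1) by linarith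
    hence "real (p ^ 2) \<le> real n" by (simp only: of_nat_le_iff)
    hence "real p ^ 2 \<le> real n" by simp
    hence "real p \<le> sqrt (real n)" by (rule real_le_rsqrt)
    hence a: "p \<le> nat \<lfloor>sqrt (real n)\<rfloor>" by (simp add: le_nat_floor)
    have "2 ^ j \<le> p ^ j" using p2 by (intro power_mono) auto
    hence "2 ^ j \<le> n" using mj m(1) by linarith
    hence "real (2 ^ j) \<le> real n" by (simp only: of_nat_le_iff)
    hence "2 ^ j \<le> real n" by simp
    hence "real j \<le> log 2 (real n)" using assms by (subst le_log_iff) (auto simp: powr_realpow)
    hence "j \<le> nat \<lfloor>log 2 (real n)\<rfloor>" by (simp add: le_nat_floor)
    thus "?f m \<in> ?T" using a by (simp add: p_def j_def)
   qed
  qed auto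
  also have "card ?T = (nat \<lfloor>sqrt (real n)\<rfloor> + 1) * (nat \<lfloor>log 2 (real n)\<rfloor> + 1)" by (simp add: card_cartesian_product)
  finally have "real (card Q) \<le> real ((nat \<lfloor>sqrt (real n)\<rfloor> + 1) * (nat \<lfloor>log 2 (real n)\<rfloor> + 1))" by (simp only: of_nat_le_iff)
  also have "... = (real (nat \<lfloor>sqrt (real n)\<rfloor>) + 1) * (real (nat \<lfloor>log 2 (real n)\<rfloor>) + 1)"
   by (simp only: of_nat_mult of_nat_add of_nat_1)
  also have "... \<le> (sqrt (real n) + 1) * (log 2 (real n) + 1)"
   using assms by (intro mult_mono add_mono) (auto simp: of_nat_floor)
  finally show "real (card Q) \<le> (sqrt (real n) + 1) * (log 2 (real n) + 1)" .
 qed (use assms in auto)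
 finally show ?thesis .
qed

lemma theta_asymptotic: "(\<lambda>n. theta n / real n) \<longlonglongrightarrow> 1"
proof (rule tendsto_sandwich)
 show "\<forall>\<^sub>F n in sequentially. theta n / real n \<le> psi n / real n"
  by (intro always_eventually allI divide_right_mono theta_le_psi) auto
 show "\<forall>\<^sub>F n in sequentially. psi n / real n - (sqrt (real n) + 1) * (log 2 (real n) + 1) * ln (real n) / real n \<le> theta n / real n"
  using eventually_gt_at_top[of 0]
 proof eventually_elim
  case (elim n)
  have "(psi n - (sqrt (real n) + 1) * (log 2 (real n) + 1) * ln (real n)) / real n \<le> theta n / real n"
   using psi_minus_theta_le[OF elim] by (intro divide_right_mono) auto
  thus ?case by (simp add: diff_divide_distrib)
 qed
 have "(\<lambda>n::nat. (sqrt (real n) + 1) * (log 2 (real n) + 1) * ln (real n) / real n) \<longlonglongrightarrow> 0" by real_asymp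
 from tendsto_diff[OF psi_asymptotic this]
 show "(\<lambda>n. psi n / real n - (sqrt (real n) + 1) * (log 2 (real n) + 1) * ln (real n) / real n) \<longlonglongrightarrow> 1" by simp
qed (rule psi_asymptotic)

lemma tendsto_at_multiple:
 fixes f :: "nat => real"
 assumes "(\<lambda>n. f n / real n) \<longlonglongrightarrow> 1" "m > 0" "a > 0"
 shows "(\<lambda>k. f (a * k div m) / real k) \<longlonglongrightarrow> real a / real m"
proof -
 have lim: "filterlim (\<lambda>k. a * k) at_top sequentially"
  using assms(3) by (intro filterlim_subseq) (auto simp: strict_mono_def)
 have "(\<lambda>k. real (a * k div m) / real (a * k)) \<longlonglongrightarrow> 1 / real m"
  by (rule filterlim_compose[OF nat_div_tendsto[OF assms(2)] lim])
 from tendsto_mult[OF tendsto_const[of "real a"] this]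
 have 1: "(\<lambda>k. real (a * k div m) / real k) \<longlonglongrightarrow> real a / real m" using assms(3) by simp
 have "filterlim (\<lambda>n. n div m) at_top sequentially" by (rule filterlim_div_nat) (use assms in auto)
 hence lim2: "filterlim (\<lambda>k. a * k div m) at_top sequentially" by (rule filterlim_compose[OF _ lim])
 have 2: "(\<lambda>k. f (a * k div m) / real (a * k div m)) \<longlonglongrightarrow> 1" by (rule filterlim_compose[OF assms(1) lim2])
 have 3: "\<forall>\<^sub>F k in sequentially. a * k div m > 0"
 proof -
  have "\<forall>\<^sub>F k in sequentially. 1 \<le> a * k div m" using lim2 unfolding filterlim_at_top by blast
  thus ?thesis by eventually_elim (rule less_le_trans[OF zero_less_one])
 qed
 have "(\<lambda>k. f (a * k div m) / real (a * k div m) * (real (a * k div m) / real k)) \<longlonglongrightarrow> 1 * (real a / real m)"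
  by (intro tendsto_mult 1 2)
 moreover have "\<forall>\<^sub>F k in sequentially. f (a * k div m) / real (a * k div m) * (real (a * k div m) / real k) = f (a * k div m) / real k"
  using 3 by eventually_elim simp
 ultimately show ?thesis by (simp add: Lim_transform_eventually)
qed

section \<open>The common denominator\<close>

text \<open>\<open>exp (psi n)\<close> is the product, over all prime powers up to \<open>n\<close>,
  of their underlying primes. A prime power \<open>p^a\<close> dividing some \<open>i <= n\<close>
  is the product of the factors belonging to \<open>p, p^2, ..., p^a\<close>.\<close>

lemma Lcm_le_exp_psi: "real (Lcm {1..n}) \<le> exp (psi n)"
proof -
 define f where "f m = (if primepow m then aprimedivisor m else 1)" for m :: nat
 define P where "P = (\<Prod>m\<in>{1..n}. f m)"
 have f_pos: "f m > 0" for m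
  using primepow_gt_Suc_0[of m] prime_aprimedivisor'[of m] by (auto simp: f_def prime_gt_0_nat)
 have "P > 0" unfolding P_def by (intro prod_pos) (simp add: f_pos)
 have "ln (real P) = (\<Sum>m\<in>{1..n}. ln (real (f m)))"
  unfolding P_def of_nat_prod by (rule ln_prod) (use f_pos in auto)
 also have "... = (\<Sum>m\<in>{1..n}. mangoldt m)" by (intro sum.cong) (auto simp: f_def mangoldt_def)
 also have "... = psi n" unfolding psi_def by (rule sum.mono_neutral_left) (auto simp: not_less_eq_eq)
 finally have lnP: "real P = exp (psi n)" using \<open>P > 0\<close> by (metis exp_ln of_nat_0_less_iff)
 have "i dvd P" if i: "i \<in> {1..n}" for i
 proof (rule multiplicity_le_imp_dvd)
  show "i \<noteq> 0" using i by auto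
  fix p :: nat assume p: "prime p"
  define a where "a = multiplicity p i"
  have pa: "p ^ a dvd i" unfolding a_def by (rule multiplicity_dvd)
  hence "p ^ a \<le> n" using i by (auto dest: dvd_imp_le)
  have inj: "inj_on (\<lambda>j. p ^ j) {1..a}" using prime_gt_1_nat[OF p] by (auto simp: inj_on_def)
  have "p ^ a = (\<Prod>j\<in>{1..a}. f (p ^ j))"
  proof -
   have "f (p ^ j) = p" if "j \<in> {1..a}" for j using that p by (auto simp: f_def aprimedivisor_prime_power)
   thus ?thesis by simp
  qed
  also have "... = (\<Prod>m\<in>(\<lambda>j. p ^ j) ` {1..a}. f m)" using inj by (simp add: prod.reindex)
  also have "... dvd P" unfolding P_def
  proof (rule prod_dvd_prod_subset)
   show "(\<lambda>j. p ^ j) ` {1..a} \<subseteq> {1..n}"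
   proof safe
    fix j assume "j \<in> {1..a}"
    hence "p ^ j \<le> p ^ a" using prime_gt_0_nat[OF p] by (intro power_increasing) auto
    thus "p ^ j \<in> {1..n}" using \<open>p ^ a \<le> n\<close> prime_gt_0_nat[OF p] by auto
   qed
  qed auto
  finally have "p ^ a dvd P" .
  thus "multiplicity p i \<le> multiplicity p P"
   unfolding a_def using p \<open>P > 0\<close> by (intro multiplicity_geI) (auto simp: not_prime_unit)
 qed
 hence "Lcm {1..n} dvd P" by (intro Lcm_least) auto
 hence "Lcm {1..n} \<le> P" using \<open>P > 0\<close> by (rule dvd_imp_le)
 thus ?thesis unfolding lnP[symmetric] by simp
qed

lemma theta_diff:
 assumes "m \<le> n"
 shows "theta n - theta m = (\<Sum>p | prime p \<and> m < p \<and> p \<le> n. ln (real p))"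
proof -
 have e: "{p. prime p \<and> p \<le> n} = {p. prime p \<and> p \<le> m} \<union> {p. prime p \<and> m < p \<and> p \<le> n}" using assms by auto
 have "theta n = theta m + (\<Sum>p | prime p \<and> m < p \<and> p \<le> n. ln (real p))"
  unfolding theta_def e by (rule sum.union_disjoint) auto
 thus ?thesis by simp
qed

text \<open>A prime in \<open>(18 k / m, 20 k / m]\<close> has a multiple in \<open>(18 k, 20 k]\<close>; for \<open>m \<le> 9\<close> these intervals
 are disjoint and lie above \<open>2 k\<close>.\<close>

lemma saving_sum_ge:
 "(\<Sum>q\<in>big_primes k. real (saving k q) * ln (real q)) \<ge>
  (theta (20 * k) - theta (2 * k)) + 4 * (\<Sum>m\<in>{1..9}. theta (20 * k div m) - theta (18 * k div m))"
proof -
 let ?h = "\<lambda>q. \<exists>i\<in>{18 * k<..20 * k}. q dvd i"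
 define I where "I m = {q. prime q \<and> 18 * k div m < q \<and> q \<le> 20 * k div m}" for m
 have fin: "finite (I m)" for m unfolding I_def by (rule finite_subset[of _ "{..20 * k div m}"]) auto
 have ln0: "ln (real q) \<ge> 0" if "q \<in> big_primes k" for q
  using that prime_gt_0_nat[of q] by (auto simp: big_primes_def)
 have sub: "I m \<subseteq> {q\<in>big_primes k. ?h q}" if m: "m \<in> {1..9}" for m
 proof
  fix q assume q: "q \<in> I m"
  have h1: "18 * k < m * q" using q m by (auto simp: I_def div_less_iff_less_mult mult.commute)
  have h2: "m * q \<le> 20 * k" using q m by (auto simp: I_def less_eq_div_iff_mult_less_eq mult.commute)
  have h3: "m * q \<le> 9 * q" using m by (intro mult_right_mono) auto
  have h4: "q \<le> m * q" using m by simp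
  have "2 * k < q" using h1 h3 by linarith
  moreover have "q \<le> 20 * k" using h2 h4 by linarith
  moreover have "m * q \<in> {18 * k<..20 * k}" using h1 h2 by simp
  ultimately
  show "q \<in> {q\<in>big_primes k. ?h q}"
   using q by (auto simp: big_primes_def I_def intro!: bexI[of _ "m * q"])
 qed
 have disj: "I m \<inter> I m' = {}" if m: "m \<in> {1..9}" "m' \<in> {1..9}" "m < m'" for m m'
 proof -
  have "20 * k div m' \<le> 18 * k div m"
  proof -
   \<comment> \<open>With \<open>m' >= m + 1\<close> this follows from
     \<open>10 m <= 9 (m + 1)\<close>, that is \<open>m <= 9\<close>.\<close>
   have "20 * m \<le> 18 * m'" using m by auto
   hence h1: "20 * m * k \<le> 18 * m' * k" by (rule mult_right_mono) simp
   have "20 * k div m' * m' \<le> 20 * k" by simp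
   hence h2: "20 * k div m' * m' * m \<le> 20 * k * m" by (rule mult_right_mono) simp
   have "m' * (20 * k div m' * m) = 20 * k div m' * m' * m" by (simp only: mult_ac)
   also note h2
   also have "20 * k * m = 20 * m * k" by (simp only: mult_ac)
   also note h1
   also have "18 * m' * k = m' * (18 * k)" by (simp only: mult_ac)
   finally have "m' * (20 * k div m' * m) \<le> m' * (18 * k)" .
   hence "20 * k div m' * m \<le> 18 * k" using m by (subst (asm) mult_le_cancel1) auto
   thus ?thesis using m by (subst less_eq_div_iff_mult_less_eq) auto
  qed
  thus ?thesis by (auto simp: I_def)
 qed
 have "(\<Sum>m\<in>{1..9}. theta (20 * k div m) - theta (18 * k div m)) = (\<Sum>m\<in>{1..9}. \<Sum>q\<in>I m. ln (real q))"
  unfolding I_def by (intro sum.cong refl theta_diff div_le_mono) auto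
 also have "... = (\<Sum>q\<in>(\<Union>m\<in>{1..9}. I m). ln (real q))"
 proof (rule sum.UNION_disjoint[symmetric])
  show "\<forall>i\<in>{1..9}. \<forall>j\<in>{1..9}. i \<noteq> j \<longrightarrow> I i \<inter> I j = {}"
   using disj by (metis Int_commute linorder_neqE_nat)
 qed (use fin in auto)
 also have "... \<le> (\<Sum>q | q \<in> big_primes k \<and> (?h q). ln (real q))"
 proof (rule sum_mono2)
  show "(\<Union>m\<in>{1..9}. I m) \<subseteq> {q. q \<in> big_primes k \<and> (?h q)}"
   using sub by (rule UN_least)
 qed (use finite_big_primes[of k] ln0 in auto)
 also have "... = (\<Sum>q\<in>big_primes k. of_bool (?h q) * ln (real q))"
  using finite_big_primes[of k] by (intro sum.mono_neutral_cong_left) auto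
 finally have 1: "(\<Sum>m\<in>{1..9}. theta (20 * k div m) - theta (18 * k div m))
   \<le> (\<Sum>q\<in>big_primes k. of_bool (?h q) * ln (real q))" .
 have 2: "theta (20 * k) - theta (2 * k) = (\<Sum>q\<in>big_primes k. ln (real q))"
  unfolding big_primes_def by (rule theta_diff) simp
 have "(\<Sum>q\<in>big_primes k. real (saving k q) * ln (real q)) = (\<Sum>q\<in>big_primes k. ln (real q))
   + 4 * (\<Sum>q\<in>big_primes k. of_bool (?h q) * ln (real q))"
  unfolding sum_distrib_left sum.distrib[symmetric] by (intro sum.cong) (auto simp: saving_def)
 thus ?thesis using 1 2 by linarith
qed

lemma ln_denom_le:
 "ln (real_of_rat (denom k)) \<le> 6 * psi (20 * k)
  - ((theta (20 * k) - theta (2 * k)) + 4 * (\<Sum>m\<in>{1..9}. theta (20 * k div m) - theta (18 * k div m)))"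
proof -
 have L: "Lcm {1..20 * k} > 0" by (rule Nat.gr0I) (auto simp: Lcm_0_iff)
 have q: "q > 0" if "q \<in> big_primes k" for q using that by (auto simp: big_primes_def prime_gt_0_nat)
 hence P: "(\<Prod>q\<in>big_primes k. q ^ saving k q) > 0" by (intro prod_pos) auto
 have "real_of_rat (denom k) = real (Lcm {1..20 * k}) ^ 6 / real (\<Prod>q\<in>big_primes k. q ^ saving k q)"
  by (simp only: denom_def of_rat_divide of_rat_power of_rat_of_nat_eq)
 hence "ln (real_of_rat (denom k)) = 6 * ln (real (Lcm {1..20 * k})) - ln (real (\<Prod>q\<in>big_primes k. q ^ saving k q))"
  using L P by (simp add: ln_div ln_realpow del: of_nat_prod)
 also have "ln (real (\<Prod>q\<in>big_primes k. q ^ saving k q)) = (\<Sum>q\<in>big_primes k. ln (real q ^ saving k q))"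
  unfolding of_nat_prod of_nat_power by (rule ln_prod) (use q finite_big_primes in auto)
 also have "... = (\<Sum>q\<in>big_primes k. real (saving k q) * ln (real q))"
  using q by (intro sum.cong) (auto simp: ln_realpow)
 finally have e: "ln (real_of_rat (denom k)) = 6 * ln (real (Lcm {1..20 * k})) - (\<Sum>q\<in>big_primes k. real (saving k q) * ln (real q))" .
 have "ln (real (Lcm {1..20 * k})) \<le> ln (exp (psi (20 * k)))"
  using Lcm_le_exp_psi[of "20 * k"] L by (subst ln_le_cancel_iff) auto
 thus ?thesis unfolding e ln_exp using saving_sum_ge[of k] by linarith
qed

text \<open>The limit of \<open>T\<close> is \<open>6 * 20 - 18 - 8 * (1 + 1/2 + ... + 1/9)\<close>,
  about 79.37.\<close>

lemma ln_denom_eventually_le: "\<forall>\<^sub>F k in sequentially. ln (real_of_rat (denom k)) \<le> 79.9 * real k"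
proof -
 define T where "T k = 6 * (psi (20 * k div 1) / real k)
  - ((theta (20 * k div 1) / real k - theta (2 * k div 1) / real k)
   + 4 * (\<Sum>m\<in>{1..9}. theta (20 * k div m) / real k - theta (18 * k div m) / real k))" for k
 have "T \<longlonglongrightarrow> 6 * (real 20 / real 1) - ((real 20 / real 1 - real 2 / real 1) + 4 * (\<Sum>m\<in>{1..9::nat}. real 20 / real m - real 18 / real m))"
  unfolding T_def
  by (intro tendsto_diff tendsto_add tendsto_mult tendsto_const tendsto_sum tendsto_at_multiple psi_asymptotic theta_asymptotic) auto
 moreover have "6 * (real 20 / real 1) - ((real 20 / real 1 - real 2 / real 1) + 4 * (\<Sum>m\<in>{1..9::nat}. real 20 / real m - real 18 / real m)) < 79.9"
  by (simp add: numeral_eq_Suc sum.atLeast_Suc_atMost)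
 ultimately have "\<forall>\<^sub>F k in sequentially. T k < 79.9" by (rule order_tendstoD)
 thus ?thesis using eventually_gt_at_top[of 0]
 proof eventually_elim
  case (elim k)
  have s: "(\<Sum>m\<in>{1..9}. theta (20 * k div m) / real k - theta (18 * k div m) / real k)
    = (\<Sum>m\<in>{1..9}. theta (20 * k div m) - theta (18 * k div m)) / real k"
   unfolding sum_divide_distrib diff_divide_distrib ..
  have "T k = (6 * psi (20 * k)
   - ((theta (20 * k) - theta (2 * k)) + 4 * (\<Sum>m\<in>{1..9}. theta (20 * k div m) - theta (18 * k div m)))) / real k"
   unfolding T_def s by (simp only: diff_divide_distrib add_divide_distrib times_divide_eq_right div_by_1)
  with elim have "6 * psi (20 * k) - ((theta (20 * k) - theta (2 * k)) + 4 * (\<Sum>m\<in>{1..9}. theta (20 * k div m) - theta (18 * k div m)))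
   \<le> 79.9 * real k" by (simp add: field_simps)
  thus ?case using ln_denom_le[of k] by linarith
 qed
qed

section \<open>Rational approximations\<close>

text \<open>The power of 2 in a nonzero integer is at most its absolute value; this is the 2-adic
  substitute for the fact that nonzero integers are at least 1.\<close>

lemma abs2_of_int_ge:
 assumes "k \<noteq> 0"
 shows "abs2 (of_int k) \<ge> 1 / real_of_int \<bar>k\<bar>"
proof -
 define v where "v = multiplicity 2 k"
 have "2 ^ v dvd k" unfolding v_def by (rule multiplicity_dvd)
 hence "2 ^ v \<le> \<bar>k\<bar>" using dvd_imp_le_int[OF assms, of "2 ^ v"] by (simp add: power_abs)
 hence "real_of_int (2 ^ v) \<le> real_of_int \<bar>k\<bar>" by (simp only: of_int_le_iff)
 hence "1 / real_of_int \<bar>k\<bar> \<le> 1 / 2 ^ v" using assms by (intro divide_left_mono) auto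
 also have "1 / 2 ^ v = abs2 (of_int k)"
  using abs2_frac[of k 1] assms by (simp add: v_def power_int_minus divide_inverse)
 finally show ?thesis .
qed

text \<open>With \<open>2^t\<close> the largest power of 2 up to \<open>n\<close>, the product of
  \<open>2^t\<close> and the odd parts of \<open>1, ..., n\<close> is a common multiple.\<close>

lemma abs2_Lcm_ge:
 assumes "n > 0"
 shows "abs2 (of_nat (Lcm {1..n})) \<ge> 1 / real n"
proof -
 obtain t where t: "2 ^ t \<le> n" "n < 2 ^ Suc t" using ex_power_ivl1[of 2 n] assms by auto
 define M where "M = (\<Prod>i\<in>{1..n}. i div 2 ^ multiplicity 2 i)"
 have odd_part: "odd (i div 2 ^ multiplicity 2 i)" if "i \<in> {1..n}" for i
  using that multiplicity_decompose[of i 2] by auto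
 have "odd M" unfolding M_def using odd_part by (simp add: prime_dvd_prod_iff[OF _ two_is_prime_nat])
 have "i dvd 2 ^ t * M" if i: "i \<in> {1..n}" for i
 proof -
  have "2 ^ multiplicity 2 i \<le> i" using i by (intro dvd_imp_le multiplicity_dvd) auto
  hence "(2::nat) ^ multiplicity 2 i < 2 ^ Suc t" using i t by auto
  hence "multiplicity 2 i < Suc t" by (rule power_less_imp_less_exp[rotated]) simp
  hence "2 ^ multiplicity 2 i dvd (2::nat) ^ t" by (intro le_imp_power_dvd) auto
  moreover have "i div 2 ^ multiplicity 2 i dvd M" unfolding M_def using i by (intro dvd_prodI) auto
  ultimately have "2 ^ multiplicity 2 i * (i div 2 ^ multiplicity 2 i) dvd 2 ^ t * M" by (rule mult_dvd_mono)
  thus ?thesis by (simp add: multiplicity_dvd)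
 qed
 hence "Lcm {1..n} dvd 2 ^ t * M" by (intro Lcm_least) auto
 then obtain c where c: "2 ^ t * M = Lcm {1..n} * c" by (elim dvdE)
 have "abs2 (of_nat (2 ^ t * M)) = (1/2) ^ t"
  using abs2_of_int_odd[of "int M"] \<open>odd M\<close> by (simp add: abs2_mult abs2_two_power)
 moreover have "abs2 (of_nat (2 ^ t * M)) = abs2 (of_nat (Lcm {1..n})) * abs2 (of_nat c)"
  unfolding c by (simp add: abs2_mult)
 moreover have "abs2 (of_nat (Lcm {1..n})) * abs2 (of_nat c) \<le> abs2 (of_nat (Lcm {1..n})) * 1"
  using abs2_of_int_le[of "int c"] by (intro mult_left_mono) auto
 ultimately have "(1/2) ^ t \<le> abs2 (of_nat (Lcm {1..n}))" by simp
 moreover have "1 / real n \<le> (1/2) ^ t"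
 proof -
  have "real (2 ^ t) \<le> real n" using t(1) by (simp only: of_nat_le_iff)
  thus ?thesis using assms by (simp add: power_divide field_simps)
 qed
 ultimately show ?thesis by linarith
qed

text \<open>The removed primes are odd, and the power of 2 in the lcm is at most
  \<open>20 k\<close>. Clearing denominators thus changes 2-adic sizes only by a polynomial
  factor.\<close>

lemma abs2_denom:
 assumes "k > 0"
 shows "abs2 (denom k) \<le> 1" "abs2 (denom k) \<ge> 1 / (20 * real k) ^ 6"
proof -
 have "odd (\<Prod>q\<in>big_primes k. q ^ saving k q)"
  using assms prime_odd_nat finite_big_primes[of k]
  by (subst prime_dvd_prod_iff[OF _ two_is_prime_nat]) (auto simp: big_primes_def)
 hence "abs2 (of_nat (\<Prod>q\<in>big_primes k. q ^ saving k q)) = 1"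
  using abs2_of_int_odd[of "int (\<Prod>q\<in>big_primes k. q ^ saving k q)"]
  by (simp only: of_int_of_nat_eq even_of_nat not_False_eq_True)
 hence e: "abs2 (denom k) = abs2 (of_nat (Lcm {1..20 * k})) ^ 6"
  by (simp only: denom_def abs2_divide abs2_power div_by_1)
 show "abs2 (denom k) \<le> 1" unfolding e
  using abs2_of_int_le[of "int (Lcm {1..20 * k})"] by (intro power_le_one) auto
 have "(1 / real (20 * k)) ^ 6 \<le> abs2 (of_nat (Lcm {1..20 * k})) ^ 6"
  using assms by (intro power_mono abs2_Lcm_ge) auto
 thus "abs2 (denom k) \<ge> 1 / (20 * real k) ^ 6" unfolding e by (simp add: power_divide)
qed

lemma power_le_exp_fact:
 assumes "(x::real) \<ge> 0"
 shows "x ^ n \<le> exp x * fact n"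
proof -
 have "(\<Sum>i\<in>{n}. x ^ i /\<^sub>R fact i) \<le> (\<Sum>i. x ^ i /\<^sub>R fact i)"
  using assms by (intro sum_le_suminf summable_exp_generic) auto
 hence "x ^ n / fact n \<le> exp x" by (simp add: exp_def divide_inverse mult.commute)
 thus ?thesis by (simp add: divide_le_eq)
qed

text \<open>\<open>C(20 k, k) <= (20 k)^k / k!\<close> and \<open>k^k <= e^k k!\<close>.\<close>

lemma binomial_le_exp: "real (20 * k choose k) \<le> (20 * exp 1) ^ k"
proof -
 have "real ((20 * k choose k) * fact k) \<le> real ((20 * k) ^ k)" using binomial_fact_pow by (simp only: of_nat_le_iff)
 hence "real (20 * k choose k) * fact k \<le> 20 ^ k * real k ^ k" by (simp add: power_mult_distrib)
 also have "... \<le> 20 ^ k * (exp (real k) * fact k)" using power_le_exp_fact[of "real k" k] by (intro mult_left_mono) auto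
 finally have "real (20 * k choose k) \<le> 20 ^ k * exp (real k)" by simp
 also have "exp (real k) = exp 1 ^ k" by (simp add: exp_of_nat_mult[of k 1, simplified])
 finally show ?thesis by (simp add: power_mult_distrib)
qed

text \<open>The growth rate is \<open>156 ln 2 + 4 ln 5 + 4\<close>, kept below 118.9 by
  \<open>ln 2 <= 25/36\<close> and \<open>5^3 <= 2^7\<close>.\<close>

lemma ln_height_bound_le:
 assumes "k > 0"
 shows "ln (real_of_rat (height_bound k)) \<le> ln 204800 + 6 * ln (20 * real k + 1) + 118.9 * real k"
proof -
 have c: "real (20 * k choose k) > 0" by (simp add: zero_less_binomial)
 have "real_of_rat (height_bound k) = 204800 * real (20 * k + 1) ^ 6 * (4 ^ (18 * k) * 2 ^ k * real (20 * k choose k)) ^ 4"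
  by (simp only: height_bound_def of_rat_mult of_rat_power of_rat_of_nat_eq of_rat_numeral_eq)
 hence "ln (real_of_rat (height_bound k)) = ln 204800 + 6 * ln (20 * real k + 1)
   + 4 * (real (18 * k) * ln 4 + real k * ln 2 + ln (real (20 * k choose k)))"
  using c by (simp add: ln_mult ln_realpow)
 also have "ln (real (20 * k choose k)) \<le> ln ((20 * exp 1) ^ k)"
  using c binomial_le_exp by (subst ln_le_cancel_iff) auto
 also have "ln ((20 * exp 1) ^ k :: real) = real k * (ln 20 + 1)" by (simp add: ln_realpow ln_mult distrib_left)
 also have "ln (20::real) = 2 * ln 2 + ln 5" using ln_mult[of 4 "5::real"] ln_realpow[of "2::real" 2] by simp
 also have "ln (4::real) = 2 * ln 2" using ln_realpow[of "2::real" 2] by simp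
 also have "ln 204800 + 6 * ln (20 * real k + 1) + 4 * (real (18 * k) * (2 * ln 2) + real k * ln 2 + real k * (2 * ln 2 + ln 5 + 1))
   = ln 204800 + 6 * ln (20 * real k + 1) + (156 * ln 2 + 4 * ln 5 + 4) * real k"
  by (simp add: algebra_simps)
 also have "... \<le> ln 204800 + 6 * ln (20 * real k + 1) + 118.9 * real k"
 proof (intro add_left_mono mult_right_mono)
  have "3 * ln (5::real) \<le> 7 * ln 2"
  proof -
   have "ln (5 ^ 3 :: real) \<le> ln (2 ^ 7)" by (subst ln_le_cancel_iff) auto
   moreover have "ln (5 ^ 3 :: real) = 3 * ln 5" "ln (2 ^ 7 :: real) = 7 * ln 2"
    by (subst ln_realpow; simp)+
   ultimately show ?thesis by (simp only:)
  qed
  thus "156 * ln 2 + 4 * ln 5 + 4 \<le> (118.9 :: real)" using ln2_le_25_over_36 by linarith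
 qed auto
 finally show ?thesis by simp
qed

text \<open>\<open>79.9 + 118.9 = 198.8\<close>, and the remaining 0.2 absorbs the polynomial
  factors.\<close>

lemma denom_height_eventually_le:
 "\<forall>\<^sub>F k in sequentially. real_of_rat (denom k * height_bound k) \<le> exp (199 * real k)"
proof -
 have "\<forall>\<^sub>F k in sequentially. ln 204800 + 6 * ln (20 * real k + 1) + 118.9 * real k + 79.9 * real k \<le> 199 * real k"
  by real_asymp
 thus ?thesis using ln_denom_eventually_le eventually_gt_at_top[of 0]
 proof eventually_elim
  case (elim k)
  have d: "real_of_rat (denom k) > 0" using denom_pos[of k] by simp
  have h: "real_of_rat (height_bound k) > 0" by (simp add: height_bound_def zero_less_binomial zero_less_mult_iff)
  have "ln (real_of_rat (denom k * height_bound k)) = ln (real_of_rat (denom k)) + ln (real_of_rat (height_bound k))"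
   unfolding of_rat_mult using d h by (simp add: ln_mult)
  also have "... \<le> 199 * real k" using elim(1,2) ln_height_bound_le[OF elim(3)] by linarith
  finally have "exp (ln (real_of_rat (denom k * height_bound k))) \<le> exp (199 * real k)" by simp
  moreover have "real_of_rat (denom k * height_bound k) > 0" unfolding of_rat_mult using d h by (rule mult_pos_pos)
  ultimately show ?case by (simp only: exp_ln)
 qed
qed

text \<open>The exponent \<open>304 k + 4\<close> is \<open>4 (4 nu + 4 M + 1)\<close> at
  \<open>nu = 10 k\<close>, \<open>M = 9 k\<close>. Since 2 to the digit sum of \<open>n\<close> is
  at most \<open>n + 1\<close>, the 2-adic size is known from both sides up to polynomial
  factors.\<close>

lemma integer_linear_form:
 assumes k: "k \<ge> 10" and h: "real_of_rat (denom k * height_bound k) \<le> exp (199 * real k)"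
 obtains P Q :: int where "\<bar>real_of_int P\<bar> \<le> exp (199 * real k)" "\<bar>real_of_int Q\<bar> \<le> exp (199 * real k)"
  "norm2 (of_int P - of_int Q * zeta_2_5) \<le> (10 * real k + 1) ^ 4 * (9 * real k + 1) / 2 ^ (304 * k + 4)"
  "norm2 (of_int P - of_int Q * zeta_2_5) \<ge> 1 / (20 * real k) ^ 6 / 2 ^ (304 * k + 4)"
proof -
 let ?r0 = "rho0_form (10 * k) (9 * k)" and ?r3 = "rho3_form (10 * k) (9 * k)"
 obtain P :: int where P: "denom k * ?r0 = of_int P" using denom_Ints(1)[OF k] by (auto elim: Ints_cases)
 obtain Q' :: int where Q': "denom k * ?r3 = of_int Q'" using denom_Ints(2)[OF k] by (auto elim: Ints_cases)
 define Q where "Q = 384 * Q'"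
 have Q: "denom k * (384 * ?r3) = of_int Q" using Q' by (simp add: Q_def)
 let ?L = "of_int P - of_int Q * zeta_2_5"
 have bound: "\<bar>real_of_int z\<bar> \<le> exp (199 * real k)" if "denom k * r = of_int z" "\<bar>r\<bar> \<le> height_bound k" for z r
 proof -
  have "of_int \<bar>z\<bar> = denom k * \<bar>r\<bar>" using that(1)[symmetric] denom_pos[of k] by (simp add: abs_mult)
  also have "... \<le> denom k * height_bound k" using that(2) denom_pos[of k] by (intro mult_left_mono) auto
  finally have "real_of_rat (of_int \<bar>z\<bar>) \<le> real_of_rat (denom k * height_bound k)" by (simp only: of_rat_less_eq)
  moreover have "real_of_rat (of_int \<bar>z\<bar>) = \<bar>real_of_int z\<bar>" by (subst of_rat_of_int_eq) simp
  ultimately show ?thesis using h by linarith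
 qed
 have "?L = of_rat (of_int P) - of_rat (of_int Q) * zeta_2_5" by simp
 also have "... = of_rat (denom k) * (of_rat ?r0 - of_rat (384 * ?r3) * zeta_2_5)"
  unfolding P[symmetric] Q[symmetric] of_rat_mult by (simp add: right_diff_distrib mult.assoc)
 finally have eq0: "?L = of_rat (denom k) * (of_rat ?r0 - of_rat (384 * ?r3) * zeta_2_5)" .
 have eq: "norm2 ?L
   = abs2 (denom k) * (2 ^ (4 * digit_sum2 (10 * k) + digit_sum2 (9 * k)) / 2 ^ (304 * k + 4))"
 proof -
  have e: "4 * (4 * (10 * k) + 4 * (9 * k) + 1) = 304 * k + 4" by simp
  have "9 * k \<le> 10 * k" by simp
  from norm2_linear_form[OF this] show ?thesis unfolding eq0 norm2_mult norm2_of_rat e by (simp only:)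
 qed
 have ds: "(2::real) ^ digit_sum2 n \<le> real n + 1" for n
  using power_digit_sum2_le[of n] of_nat_le_iff[of "2 ^ digit_sum2 n" "n + 1", where ?'a = real] by simp
 have "(2::real) ^ (4 * digit_sum2 (10 * k) + digit_sum2 (9 * k)) = (2 ^ digit_sum2 (10 * k)) ^ 4 * 2 ^ digit_sum2 (9 * k)"
  by (simp add: power_add power_mult mult.commute flip: power_mult)
 also have "... \<le> (real (10 * k) + 1) ^ 4 * (real (9 * k) + 1)" by (intro mult_mono power_mono ds) auto
 finally have up: "(2::real) ^ (4 * digit_sum2 (10 * k) + digit_sum2 (9 * k)) \<le> (10 * real k + 1) ^ 4 * (9 * real k + 1)" by simp
 note d = abs2_denom[of k]
 show ?thesis
 proof (rule that[of P Q])
  show "\<bar>real_of_int P\<bar> \<le> exp (199 * real k)" by (rule bound[OF P abs_rho_forms(1)])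
  show "\<bar>real_of_int Q\<bar> \<le> exp (199 * real k)" by (rule bound[OF Q abs_rho_forms(2)])
  have "norm2 ?L \<le> 1 * ((10 * real k + 1) ^ 4 * (9 * real k + 1) / 2 ^ (304 * k + 4))"
   unfolding eq using d(1) k up by (intro mult_mono divide_right_mono) auto
  thus "norm2 ?L \<le> (10 * real k + 1) ^ 4 * (9 * real k + 1) / 2 ^ (304 * k + 4)" by simp
  have "1 / (20 * real k) ^ 6 * (1 / 2 ^ (304 * k + 4)) \<le> norm2 ?L"
   unfolding eq using d(2) k by (intro mult_mono divide_right_mono) auto
  thus "norm2 ?L \<ge> 1 / (20 * real k) ^ 6 / 2 ^ (304 * k + 4)" by simp
 qed
qed

text \<open>With \<open>H\<close> between \<open>exp (11 (k - 1))\<close> and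
  \<open>exp (11 k)\<close> these are the inequalities required at the end: the linear form is
  smaller than the inverse of \<open>2 exp (210 k)\<close>; \<open>19 * 11 = 209\<close> exceeds
  199; and \<open>20 * 11 = 220\<close> exceeds \<open>304 ln 2\<close>. The shift
  \<open>k - 1\<close> allows for rounding in the choice of \<open>k\<close>.\<close>

lemma exp_growth_eventually:
 "\<forall>\<^sub>F k in sequentially. (10 * real k + 1) ^ 4 * (9 * real k + 1) / 2 ^ (304 * k + 4) < 1 / (2 * exp (210 * real k))"
 "\<forall>\<^sub>F k in sequentially. 2 * exp (199 * real k) < exp (209 * (real k - 1))"
 "\<forall>\<^sub>F k in sequentially. (20 * real k) ^ 6 * 2 ^ (304 * k + 4) < exp (220 * (real k - 1))"
proof -
 have "\<forall>\<^sub>F k::nat in sequentially. (10 * real k + 1) ^ 4 * (9 * real k + 1) * (3 / 5) ^ k < 8" by real_asymp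
 thus "\<forall>\<^sub>F k in sequentially. (10 * real k + 1) ^ 4 * (9 * real k + 1) / 2 ^ (304 * k + 4) < 1 / (2 * exp (210 * real k))"
 proof eventually_elim
  case (elim k)
  \<comment> \<open>\<open>304 ln 2\<close> exceeds 210 by about 0.7, which leaves room for a factor
    3/5 per step; its powers beat the polynomial.\<close>
  have "exp (210 :: real) = exp 1 ^ 210" using exp_of_nat_mult[of 210 "1::real"] by simp
  also have "... \<le> (272 / 100) ^ 210" using e_less_272 by (intro power_mono) auto
  also have "... \<le> (3 / 5) * 2 ^ 304" by (simp add: power_divide divide_simps)
  finally have "exp (210 :: real) ^ k \<le> ((3 / 5) * 2 ^ 304) ^ k" by (intro power_mono) auto
  moreover have "exp (210 * real k) = exp 210 ^ k" by (simp add: mult.commute flip: exp_of_nat_mult)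
  ultimately have e: "exp (210 * real k) \<le> (3 / 5) ^ k * 2 ^ (304 * k)"
   by (simp only: power_mult_distrib power_mult)
  define c where "c = (10 * real k + 1) ^ 4 * (9 * real k + 1)"
  have "c * (2 * exp (210 * real k)) \<le> c * (2 * ((3 / 5) ^ k * 2 ^ (304 * k)))"
   using e by (intro mult_left_mono) (auto simp: c_def)
  also have "... = 2 * (c * (3 / 5) ^ k) * 2 ^ (304 * k)" by simp
  also have "... < 2 * 8 * 2 ^ (304 * k)"
   using elim unfolding c_def by (intro mult_strict_right_mono mult_strict_left_mono) auto
  also have "... = 2 ^ (304 * k + 4)" by (simp add: power_add)
  finally show ?case unfolding c_def[symmetric] by (simp add: divide_simps)
 qed
 show "\<forall>\<^sub>F k in sequentially. 2 * exp (199 * real k) < exp (209 * (real k - 1))" by real_asymp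
 have "\<forall>\<^sub>F k in sequentially. (20 * real k) ^ 6 * (16 * exp (212 * real k)) < exp (220 * (real k - 1))" by real_asymp
 thus "\<forall>\<^sub>F k in sequentially. (20 * real k) ^ 6 * 2 ^ (304 * k + 4) < exp (220 * (real k - 1))"
 proof eventually_elim
  case (elim k)
  have "(2::real) ^ (304 * k) = exp (real (304 * k) * ln 2)" by (simp only: exp_of_nat_mult) simp
  also have "... \<le> exp (212 * real k)"
  proof -
   have "304 * ln 2 \<le> (212 :: real)" using ln2_le_25_over_36 by linarith
   from mult_right_mono[OF this, of "real k"] show ?thesis by simp
  qed
  finally have "(2::real) ^ (304 * k + 4) \<le> 16 * exp (212 * real k)" by (simp add: power_add)
  hence "(20 * real k) ^ 6 * 2 ^ (304 * k + 4) \<le> (20 * real k) ^ 6 * (16 * exp (212 * real k))"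
   by (intro mult_left_mono) auto
  with elim show ?case by linarith
 qed
qed

theorem theorem5p2:
 shows "\<exists>M :: real. \<forall>p q :: int. q \<noteq> 0 \<and> real_of_int (max \<bar>p\<bar> \<bar>q\<bar>) > M \<longrightarrow>
  norm2 (zeta_2_5 - of_int p / of_int q) > 1 / real_of_int (max \<bar>p\<bar> \<bar>q\<bar>) ^ 20"
proof -
 obtain K where K: "\<And>k. k \<ge> K ==> k \<ge> 10"
   "\<And>k. k \<ge> K ==> real_of_rat (denom k * height_bound k) \<le> exp (199 * real k)"
   "\<And>k. k \<ge> K ==> (10 * real k + 1) ^ 4 * (9 * real k + 1) / 2 ^ (304 * k + 4) < 1 / (2 * exp (210 * real k))"
   "\<And>k. k \<ge> K ==> 2 * exp (199 * real k) < exp (209 * (real k - 1))"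
   "\<And>k. k \<ge> K ==> (20 * real k) ^ 6 * 2 ^ (304 * k + 4) < exp (220 * (real k - 1))"
  using eventually_conj[OF eventually_ge_at_top[of 10] eventually_conj[OF denom_height_eventually_le
    eventually_conj[OF exp_growth_eventually(1) eventually_conj[OF exp_growth_eventually(2,3)]]]]
  unfolding eventually_sequentially by blast
 show ?thesis
 proof (intro exI[of _ "exp (11 * real K)"] allI impI)
  fix p q :: int
  let ?x = "zeta_2_5 - of_int p / of_int q"
  define H where "H = real_of_int (max \<bar>p\<bar> \<bar>q\<bar>)"
  assume "q \<noteq> 0 \<and> real_of_int (max \<bar>p\<bar> \<bar>q\<bar>) > exp (11 * real K)"
  hence q: "q \<noteq> 0" and HK: "H > exp (11 * real K)" by (auto simp: H_def)
  have H0: "H > 0" using HK exp_gt_zero[of "11 * real K"] by linarith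
  have lnH: "ln H > 11 * real K" using HK H0 by (metis exp_less_cancel_iff exp_ln)
  \<comment> \<open>The least integer above \<open>ln H / 11\<close>, so that \<open>H\<close> lies
    between \<open>exp (11 (k - 1))\<close> and \<open>exp (11 k)\<close>.\<close>
  define k where "k = nat \<lfloor>ln H / 11\<rfloor> + 1"
  have k1: "real k - 1 \<le> ln H / 11" "ln H / 11 < real k" using lnH by (auto simp: k_def) linarith+
  have kK: "k \<ge> K" using lnH k1 by linarith
  have Hlow: "exp (11 * (real k - 1)) \<le> H"
  proof -
   have "exp (11 * (real k - 1)) \<le> exp (ln H)" using k1 by simp
   thus ?thesis using H0 by simp
  qed
  have Hup: "H \<le> exp (11 * real k)"
  proof -
   have "exp (ln H) \<le> exp (11 * real k)" using k1 by simp
   thus ?thesis using H0 by simp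
  qed
  obtain P Q :: int where PQ: "\<bar>real_of_int P\<bar> \<le> exp (199 * real k)" "\<bar>real_of_int Q\<bar> \<le> exp (199 * real k)"
   "norm2 (of_int P - of_int Q * zeta_2_5) \<le> (10 * real k + 1) ^ 4 * (9 * real k + 1) / 2 ^ (304 * k + 4)"
   "norm2 (of_int P - of_int Q * zeta_2_5) \<ge> 1 / (20 * real k) ^ 6 / 2 ^ (304 * k + 4)"
   by (rule integer_linear_form[OF K(1,2)[OF kK]]) blast
  define x where "x = norm2 ?x"
  define L where "L = of_int P - of_int Q * zeta_2_5"
  define N where "N = P * q - Q * p"
  have qz: "(of_int q :: padic2) \<noteq> 0" using q by simp
  \<comment> \<open>\<open>N\<close> is the determinant of the two fractions; the identity
    \<open>N - Q q (zeta_2_5 - p / q) = q L\<close> ties the approximation \<open>p / q\<close> to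
    the linear form.\<close>
  have rel: "of_int N + - (of_int (Q * q) * ?x) = L * of_int q"
   using qz by (simp add: N_def L_def algebra_simps)
  have int_le: "norm2 (of_int z :: padic2) \<le> 1" for z by (simp add: norm2_of_int abs2_of_int_le)
  have x_ge: "norm2 (of_int (Q * q) * ?x) \<le> x"
   using int_le[of "Q * q"] norm2_nonneg[of "?x"]
   unfolding norm2_mult x_def[symmetric] by (intro mult_left_le_one_le) (auto simp: norm2_nonneg x_def)
  have H19: "exp (209 * (real k - 1)) \<le> H ^ 19" "exp (220 * (real k - 1)) \<le> H ^ 20"
  proof -
   have "exp (11 * (real k - 1)) ^ 19 \<le> H ^ 19" "exp (11 * (real k - 1)) ^ 20 \<le> H ^ 20"
    using Hlow by (auto intro: power_mono)
   thus "exp (209 * (real k - 1)) \<le> H ^ 19" "exp (220 * (real k - 1)) \<le> H ^ 20"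
    by (simp_all add: algebra_simps flip: exp_of_nat_mult)
  qed
  have "1 / H ^ 20 < x"
  proof (cases "N = 0")
   case False
   have "\<bar>real_of_int N\<bar> \<le> \<bar>real_of_int P\<bar> * \<bar>real_of_int q\<bar> + \<bar>real_of_int Q\<bar> * \<bar>real_of_int p\<bar>"
    unfolding N_def using abs_triangle_ineq4[of "real_of_int P * real_of_int q" "real_of_int Q * real_of_int p"]
    by (simp add: abs_mult)
   also have "... \<le> exp (199 * real k) * H + exp (199 * real k) * H"
    using PQ(1,2) by (intro add_mono mult_mono) (auto simp: H_def)
   finally have Nle: "real_of_int \<bar>N\<bar> \<le> 2 * exp (199 * real k) * H" unfolding of_int_abs by linarith
   also have "... \<le> 2 * exp (199 * real k) * exp (11 * real k)" using Hup by (intro mult_left_mono) auto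
   also have "... = 2 * exp (210 * real k)" by (simp add: flip: exp_add)
   finally have Nle2: "real_of_int \<bar>N\<bar> \<le> 2 * exp (210 * real k)" .
   have Nabs: "norm2 (of_int N :: padic2) \<ge> 1 / real_of_int \<bar>N\<bar>" unfolding norm2_of_int by (rule abs2_of_int_ge[OF False])
   have "norm2 (L * of_int q) \<le> norm2 L"
    using int_le[of q] norm2_nonneg[of L] norm2_nonneg[of "of_int q"] unfolding norm2_mult by (intro mult_right_le_one_le) auto
   also have "... < 1 / (2 * exp (210 * real k))" using PQ(3) K(3)[OF kK] unfolding L_def by linarith
   also have "... \<le> 1 / real_of_int \<bar>N\<bar>" using Nle2 False by (intro divide_left_mono) auto
   also note Nabs
   finally have "norm2 (of_int (Q * q) * ?x) = norm2 (of_int N :: padic2)"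
    using norm2_eq_of_less[of "of_int N" "- (of_int (Q * q) * ?x)"] unfolding rel by simp
   hence "1 / real_of_int \<bar>N\<bar> \<le> x" using Nabs x_ge by linarith
   moreover have "1 / H ^ 20 < 1 / real_of_int \<bar>N\<bar>"
   proof (rule divide_strict_left_mono)
    have "real_of_int \<bar>N\<bar> \<le> 2 * exp (199 * real k) * H" by (rule Nle)
    also have "... < exp (209 * (real k - 1)) * H" using K(4)[OF kK] H0 by (intro mult_strict_right_mono) auto
    also have "... \<le> H ^ 19 * H" using H19(1) H0 by (intro mult_right_mono) auto
    also have "... = H ^ 20" by (simp add: eval_nat_numeral)
    finally show "real_of_int \<bar>N\<bar> < H ^ 20" .
   qed (use False H0 in auto)
   ultimately show ?thesis by linarith
  next
   case True
   have "norm2 (of_int q :: padic2) * norm2 L = norm2 (of_int q :: padic2) * norm2 (of_int Q * ?x)"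
    using arg_cong[OF rel, of norm2] True by (auto simp: norm2_mult mult_ac)
   hence "norm2 L = norm2 (of_int Q * ?x)" using qz by simp
   also have "... \<le> x" using int_le[of Q] norm2_nonneg
    unfolding norm2_mult x_def by (intro mult_left_le_one_le) auto
   finally have "1 / (20 * real k) ^ 6 / 2 ^ (304 * k + 4) \<le> x" using PQ(4) unfolding L_def by linarith
   moreover have "1 / H ^ 20 < 1 / ((20 * real k) ^ 6 * 2 ^ (304 * k + 4))"
    using K(1)[OF kK] K(5)[OF kK] H19(2) H0 by (intro divide_strict_left_mono mult_pos_pos zero_less_power) auto
   ultimately show ?thesis by simp
  qed
  thus "norm2 ?x > 1 / real_of_int (max \<bar>p\<bar> \<bar>q\<bar>) ^ 20"
   unfolding x_def H_def .
 qed
qed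

end
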